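(* Let $G$ be a finitely generated virtually abelian group. Then there exists an integer $k \geq 0$ such that $\mathrm{RF}_G$ equals $\log^k$.
   Context: A group is virtually abelian if it has an abelian normal subgroup of finite index. Let $G$ be a finitely generated residually finite group with finite generating set $S$. Let $B_G(r)$ be the set of elements of $G$ that are products of at most $r$ elements of $S\cup S^{-1}$, and let $\nu(G)$ be the set of normal subgroups of finite index of $G$. For $g \neq e_G$ put $D_{G,\nu(G)}(g)=\min\{[G:N]\mid N\in\nu(G),\ g\notin N\}$, and for $r\in\mathbb{R}_{\geq 1}$ put $\mathrm{RF}_{G,\nu(G),B_G}(r)=\max\{D_{G,\nu(G)}(g)\mid e_G\neq g\in B_G(r)\}$ (the maximum over the empty set, which only occurs for the trivial group, is taken to be $1$). For increasing functions $f,g$ on $\mathbb{R}_{\geq 1}$, write $f\preceq g$ if there is $C>0$ with $f(r)\leq C\,g(Cr)$ for all $r\geq\max\{1,1/C\}$, and $f\approx g$ if $f\preceq g$ and $g\preceq f$. We say $\mathrm{RF}_G$ equals $f$ if $\mathrm{RF}_{G,\nu(G),B_G}\approx f$ for some (equivalently, every) finite generating set $S$. Here $\log^k$ denotes $r\mapsto(\log r)^k$, with $\log^0$ the constant function $1$; the relations above are applied to $\log^k$ by the same formula. *)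

theory Defs
  imports Complex_Main "HOL-Algebra.Algebra"
begin

definition generates :: "('a, 'b) monoid_scheme \<Rightarrow> 'a set \<Rightarrow> bool" where
  "generates G S \<longleftrightarrow> S \<subseteq> carrier G \<and> generate G S = carrier G"

definition finitely_generated :: "('a, 'b) monoid_scheme \<Rightarrow> bool" where
  "finitely_generated G \<longleftrightarrow> (\<exists>S. finite S \<and> generates G S)"

definition fin_index_normal :: "('a, 'b) monoid_scheme \<Rightarrow> 'a set set" where
  "fin_index_normal G = {N. N \<lhd> G \<and> finite (rcosets\<^bsub>G\<^esub> N)}"

definition virtually_abelian :: "('a, 'b) monoid_scheme \<Rightarrow> bool" where
  "virtually_abelian G \<longleftrightarrow> (\<exists>A \<in> fin_index_normal G. comm_group (G\<lparr>carrier := A\<rparr>))"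

definition word_ball :: "('a, 'b) monoid_scheme \<Rightarrow> 'a set \<Rightarrow> real \<Rightarrow> 'a set" where
  "word_ball G S r =
    {foldr (\<otimes>\<^bsub>G\<^esub>) w \<one>\<^bsub>G\<^esub> | w. set w \<subseteq> S \<union> m_inv G ` S \<and> real (length w) \<le> r}"

text \<open>
  The set below is nonempty for every nontrivial \<open>g\<close> exactly if \<open>G\<close> is residually finite,
  which is the case for every finitely generated virtually abelian group. It is a set of
  natural numbers, so the infimum is then a minimum.
\<close>

definition divisibility :: "('a, 'b) monoid_scheme \<Rightarrow> 'a \<Rightarrow> nat" where
  "divisibility G g = Inf {card (rcosets\<^bsub>G\<^esub> N) | N. N \<in> fin_index_normal G \<and> g \<notin> N}"

text \<open>
  The maximum is over a finite set when \<open>S\<close> is finite. For \<open>r \<ge> 1\<close> and a generating set \<open>S\<close>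
  the first case occurs only for the trivial group.
\<close>

definition RF :: "('a, 'b) monoid_scheme \<Rightarrow> 'a set \<Rightarrow> real \<Rightarrow> real" where
  "RF G S r =
    (if word_ball G S r - {\<one>\<^bsub>G\<^esub>} = {} then 1
     else real (Max (divisibility G ` (word_ball G S r - {\<one>\<^bsub>G\<^esub>}))))"

text \<open>
  Functions on the reals at least 1 are represented by total functions; the two relations
  evaluate them only at arguments that are at least 1.
\<close>

definition growth_le :: "(real \<Rightarrow> real) \<Rightarrow> (real \<Rightarrow> real) \<Rightarrow> bool" where
  "growth_le f g \<longleftrightarrow> (\<exists>C>0. \<forall>r \<ge> max 1 (1 / C). f r \<le> C * g (C * r))"

definition growth_eq :: "(real \<Rightarrow> real) \<Rightarrow> (real \<Rightarrow> real) \<Rightarrow> bool" where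
  "growth_eq f g \<longleftrightarrow> growth_le f g \<and> growth_le g f"

definition RF_equals :: "('a, 'b) monoid_scheme \<Rightarrow> (real \<Rightarrow> real) \<Rightarrow> bool" where
  "RF_equals G f \<longleftrightarrow> (\<exists>S. finite S \<and> generates G S \<and> growth_eq (RF G S) f)"

end

theory Submission
  imports Defs "Jordan_Normal_Form.Char_Poly" "HOL-Library.Function_Algebras"
    "HOL-Computational_Algebra.Fundamental_Theorem_Algebra"
begin

text \<open>
  A finite-index characteristic subgroup of the abelian part is a lattice \<open>V\<close> of rank \<open>m\<close> on which
  \<open>G\<close> acts by conjugation through a finite group \<open>H\<close>. For a vector \<open>w\<close> of elements of a ring finitely
  generated as abelian group, the rank of the matrix with entries \<open>w \<cdot> \<alpha> e\<^sub>c\<close> (\<open>\<alpha> \<in> H\<close>, \<open>c < m\<close>) bounds the index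
  of the invariant subgroup of all \<open>v\<close> with \<open>w \<cdot> \<alpha> v\<close> in a given maximal ideal. The exponent is
  the least \<open>k\<close> such that the vectors \<open>w\<close> of rank at most \<open>k\<close> separate the points of \<open>V\<close>.
  Upper bound: a Chebyshev estimate for the rational primes below a maximal ideal of prime index yields a
  maximal ideal of index \<open>O(log r)\<close> that avoids a given element of size \<open>O(r)\<close>.
  Lower bound: choose \<open>g \<noteq> 0\<close> that is annihilated by all \<open>w\<close> of rank less than \<open>k\<close>. If \<open>lcm(1..n) g\<close> survives in a finite
  quotient, a character of large prime power order lives on that quotient; by a Nullstellensatz for
  \<open>k\<close>-minors its translates under \<open>H\<close> have rank \<open>k\<close> up to a bounded factor, so the quotient has
  at least \<open>(n / N) ^ k\<close> elements.
\<close>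

section \<open>Subgroups of finite index and lattices\<close>

text \<open>Vectors over number rings are allowed because a representation irreducible over the
  rationals may split over a larger ring, into pieces of smaller rank. The price: a maximal ideal of
  index \<open>p ^ f\<close> with \<open>p\<close> of size \<open>log r\<close> would raise the
  exponent by the factor \<open>f\<close>, so ideals of prime index are needed, and enough of them
  below a bound of order \<open>log r\<close>. They come from a Mertens estimate for orders whose
  leading coefficient is 1 both from above and from below; over a multiplicatively long interval the
  leading terms then leave a positive contribution. Elements \<open>1 + D z\<close>, with
  \<open>D\<close> a multiple of the discriminant, avoid all ramified ideals, so the argument stays
  inside one order that need not be integrally closed. The lower bound must treat all finite
  quotients, hence all prime powers, at once; this uniformity is what the Nullstellensatz supplies.
  The number \<open>n\<close> is of order \<open>log r\<close> because the logarithm of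
  \<open>lcm(1..n)\<close> grows linearly, so that the chosen power of a fixed group element still
  has word length \<open>O(r)\<close>.\<close>

definition subgrp :: "'a::ab_group_add set => bool" where
 "subgrp H \<longleftrightarrow> 0 \<in> H \<and> (\<forall>x\<in>H. \<forall>y\<in>H. x - y \<in> H)"

definition cosets :: "'a::ab_group_add set => 'a set => 'a set set" where
 "cosets H K = (%x. (+) x ` K) ` H"

text \<open>An infinite index has the value 0, so finiteness of \<open>cosets H K\<close>
  accompanies the index as a separate statement throughout.\<close>

definition idx :: "'a::ab_group_add set => 'a set => nat" where
 "idx H K = card (cosets H K)"

lemma subgrp_zero: "subgrp H ==> 0 \<in> H"
 and subgrp_diff: "subgrp H ==> x \<in> H ==> y \<in> H ==> x - y \<in> H"
 by (auto simp: subgrp_def)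

lemma subgrp_uminus: "subgrp H ==> x \<in> H ==> - x \<in> H"
 using subgrp_diff[of H 0 x] subgrp_zero by auto

lemma subgrp_add: "subgrp H ==> x \<in> H ==> y \<in> H ==> x + y \<in> H"
 using subgrp_diff[of H x "- y"] subgrp_uminus by auto

lemma subgrp_sum: "subgrp H ==> (\<And>i. i \<in> A ==> f i \<in> H) ==> sum f A \<in> H"
 by (induction A rule: infinite_finite_induct) (auto simp: subgrp_zero subgrp_add)

lemma subgrp_Int: "subgrp H ==> subgrp K ==> subgrp (H \<inter> K)"
 by (auto simp: subgrp_def)

lemma coset_eq_iff:
 assumes "subgrp K"
 shows "(+) x ` K = (+) y ` K \<longleftrightarrow> x - y \<in> K"
proof
 assume "(+) x ` K = (+) y ` K"
 moreover have "x \<in> (+) x ` K" using subgrp_zero[OF assms] by force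
 ultimately obtain k where "x = y + k" "k \<in> K" by auto
 then show "x - y \<in> K" by simp
next
 assume h: "x - y \<in> K"
 have "x + k \<in> (+) y ` K" if "k \<in> K" for k
  using subgrp_add[OF assms h that] by (intro image_eqI[of _ _ "x - y + k"]) auto
 moreover have "y + k \<in> (+) x ` K" if "k \<in> K" for k
  using subgrp_diff[OF assms that h] by (intro image_eqI[of _ _ "k - (x - y)"]) auto
 ultimately show "(+) x ` K = (+) y ` K" by auto
qed

text \<open>A first isomorphism theorem in which only the fibres of \<open>f\<close> are prescribed;
  the target may thus be a set of tuples of residues or of cosets, without any group
  structure.\<close>

lemma cosets_bij_image:
 assumes "subgrp K" and "\<And>x y. x \<in> H ==> y \<in> H ==> f x = f y \<longleftrightarrow> x - y \<in> K"
 shows "\<exists>g. bij_betw g (cosets H K) (f ` H)"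
proof -
 define g where "g C = f (SOME x. x \<in> H \<and> C = (+) x ` K)" for C
 have g: "g ((+) x ` K) = f x" if "x \<in> H" for x
 proof -
  have "\<exists>z. z \<in> H \<and> (+) x ` K = (+) z ` K" using that by auto
  from someI_ex[OF this] have "(SOME z. z \<in> H \<and> (+) x ` K = (+) z ` K) \<in> H"
   "(+) x ` K = (+) (SOME z. z \<in> H \<and> (+) x ` K = (+) z ` K) ` K" by auto
  then show ?thesis using assms(2) that coset_eq_iff[OF assms(1)] unfolding g_def by metis
 qed
 have "inj_on g (cosets H K)"
  by (auto simp: inj_on_def cosets_def g assms(2) coset_eq_iff[OF assms(1)])
 moreover have "g ` cosets H K = f ` H"
  by (auto simp: cosets_def g image_image)
 ultimately show ?thesis by (auto simp: bij_betw_def)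
qed

lemma cosets_image:
 assumes "subgrp K" and "\<And>x y. x \<in> H ==> y \<in> H ==> f x = f y \<longleftrightarrow> x - y \<in> K"
 shows "idx H K = card (f ` H)" and "finite (cosets H K) \<longleftrightarrow> finite (f ` H)"
proof -
 obtain g where "bij_betw g (cosets H K) (f ` H)" using cosets_bij_image[of K H f] assms by blast
 then show "idx H K = card (f ` H)" "finite (cosets H K) \<longleftrightarrow> finite (f ` H)"
  by (auto simp: idx_def dest: bij_betw_same_card bij_betw_finite)
qed

lemma cosets_reps:
 assumes "subgrp K" "finite (cosets H K)"
 obtains R where "R \<subseteq> H" "finite R" "card R = idx H K" "\<And>x. x \<in> H ==> \<exists>r\<in>R. x - r \<in> K"
  "\<And>r s. r \<in> R ==> s \<in> R ==> r - s \<in> K ==> r = s"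
proof -
 define f where "f C = (SOME x. x \<in> H \<and> C = (+) x ` K)" for C
 have f: "f C \<in> H \<and> C = (+) (f C) ` K" if "C \<in> cosets H K" for C
  unfolding f_def by (rule someI_ex) (use that in \<open>auto simp: cosets_def\<close>)
 have inj: "inj_on f (cosets H K)"
  by (rule inj_onI) (metis f)
 show thesis
 proof (rule that[of "f ` cosets H K"])
  show "f ` cosets H K \<subseteq> H" using f by auto
  show "finite (f ` cosets H K)" using assms by auto
  show "card (f ` cosets H K) = idx H K" by (simp add: card_image inj idx_def)
  show "\<exists>r\<in>f ` cosets H K. x - r \<in> K" if "x \<in> H" for x
  proof -
   have m: "(+) x ` K \<in> cosets H K" using that by (auto simp: cosets_def)
   then have "(+) x ` K = (+) (f ((+) x ` K)) ` K" using f by blast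
   then have "x - f ((+) x ` K) \<in> K" using coset_eq_iff[OF assms(1)] by blast
   then show ?thesis using m by blast
  qed
  show "r = s" if "r \<in> f ` cosets H K" "s \<in> f ` cosets H K" "r - s \<in> K" for r s
   using that f coset_eq_iff[OF assms(1)] by (metis imageE)
 qed
qed

lemma card_le_idx:
 assumes "subgrp K" "finite (cosets H K)" "E \<subseteq> H" "\<And>x y. x \<in> E ==> y \<in> E ==> x - y \<in> K ==> x = y"
 shows "finite E" "card E \<le> idx H K"
proof -
 have inj: "inj_on (%x. (+) x ` K) E"
  by (rule inj_onI) (use assms(4) coset_eq_iff[OF assms(1)] in blast)
 have sub: "(%x. (+) x ` K) ` E \<subseteq> cosets H K" using assms(3) by (auto simp: cosets_def)
 show "finite E" using finite_imageD[OF finite_subset[OF sub assms(2)] inj] .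
 show "card E \<le> idx H K" using card_mono[OF assms(2) sub] card_image[OF inj] by (simp add: idx_def)
qed

lemma idx_le_card:
 assumes "subgrp K" "finite E" "\<And>x. x \<in> H ==> \<exists>e\<in>E. x - e \<in> K"
 shows "finite (cosets H K)" "idx H K \<le> card E"
proof -
 have sub: "cosets H K \<subseteq> (%x. (+) x ` K) ` E"
 proof
  fix C assume "C \<in> cosets H K"
  then obtain x where x: "x \<in> H" "C = (+) x ` K" by (auto simp: cosets_def)
  then obtain e where "e \<in> E" "x - e \<in> K" using assms(3) by blast
  then show "C \<in> (%x. (+) x ` K) ` E" using x coset_eq_iff[OF assms(1), of x e] by auto
 qed
 show f: "finite (cosets H K)" using finite_subset[OF sub] assms(2) by auto
 show "idx H K \<le> card E" unfolding idx_def
  using card_mono[OF _ sub] card_image_le[OF assms(2), of "%x. (+) x ` K"] assms(2) by fastforce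
qed

text \<open>Sums of a representative of \<open>H\<close> modulo \<open>J\<close> and one of
  \<open>J\<close> modulo \<open>K\<close> represent \<open>H\<close> modulo \<open>K\<close>
  without repetition.\<close>

lemma idx_tower:
 assumes H: "subgrp H" and J: "subgrp J" and K: "subgrp K" and KJ: "K \<subseteq> J" and JH: "J \<subseteq> H"
  and f1: "finite (cosets H J)" and f2: "finite (cosets J K)"
 shows "finite (cosets H K)" "idx H K = idx H J * idx J K"
proof -
 from cosets_reps[OF J f1] obtain R where R: "R \<subseteq> H" "finite R" "card R = idx H J"
  "\<And>x. x \<in> H ==> \<exists>r\<in>R. x - r \<in> J" "\<And>r s. r \<in> R ==> s \<in> R ==> r - s \<in> J ==> r = s" by metis
 from cosets_reps[OF K f2] obtain S where S: "S \<subseteq> J" "finite S" "card S = idx J K"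
  "\<And>x. x \<in> J ==> \<exists>r\<in>S. x - r \<in> K" "\<And>r s. r \<in> S ==> s \<in> S ==> r - s \<in> K ==> r = s" by metis
 define E where "E = (%(r,s). r + s) ` (R \<times> S)"
 have key: "r = r' \<and> s = s'" if "r \<in> R" "r' \<in> R" "s \<in> S" "s' \<in> S" "(r + s) - (r' + s') \<in> K" for r r' s s'
 proof -
  have "(r + s) - (r' + s') - (s - s') \<in> J"
   by (rule subgrp_diff[OF J]) (use that(5) KJ subgrp_diff[OF J subsetD[OF S(1) that(3)] subsetD[OF S(1) that(4)]] in auto)
  then have rr: "r = r'" using R(5) that by (auto simp: algebra_simps)
  then show ?thesis using that S(5) by auto
 qed
 have injE: "inj_on (%(r,s). r + s) (R \<times> S)"
  by (rule inj_onI) (use key subgrp_zero[OF K] in \<open>auto\<close>)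
 have cE: "card E = idx H J * idx J K"
  unfolding E_def using card_image[OF injE] R S by (simp add: card_cartesian_product)
 have fE: "finite E" unfolding E_def using R S by auto
 have cov: "\<exists>e\<in>E. x - e \<in> K" if x: "x \<in> H" for x
 proof -
  obtain r where r: "r \<in> R" "x - r \<in> J" using R(4) x by blast
  then obtain s where s: "s \<in> S" "x - r - s \<in> K" using S(4) by blast
  show ?thesis by (rule bexI[of _ "r + s"]) (use r s in \<open>auto simp: E_def algebra_simps\<close>)
 qed
 show fin: "finite (cosets H K)" by (rule idx_le_card[OF K fE cov])
 have le: "idx H K \<le> card E" by (rule idx_le_card[OF K fE cov])
 have "E \<subseteq> H" using R(1) S(1) JH subgrp_add[OF H] by (auto simp: E_def subset_iff)
 then have "card E \<le> idx H K"
 proof (rule card_le_idx(2)[OF K fin])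
  fix x y assume "x \<in> E" "y \<in> E" and xy: "x - y \<in> K"
  then obtain r s r' s' where "x = r + s" "y = r' + s'" "r \<in> R" "s \<in> S" "r' \<in> R" "s' \<in> S"
   unfolding E_def by auto
  then show "x = y" using key[of r r' s s'] xy by auto
 qed
 with le cE show "idx H K = idx H J * idx J K" by auto
qed

lemma cosets_finite_mono:
 assumes "subgrp J" "subgrp K" "K \<subseteq> J" "J \<subseteq> H" "finite (cosets H K)"
 shows "finite (cosets H J)" "finite (cosets J K)"
proof -
 obtain R where R: "finite R" "\<And>x. x \<in> H ==> \<exists>r\<in>R. x - r \<in> K"
  using cosets_reps[OF assms(2,5)] by metis
 show "finite (cosets H J)"
  by (rule idx_le_card[OF assms(1) R(1)]) (use R(2) assms(3) in blast)
 have "cosets J K \<subseteq> cosets H K" using assms(4) by (auto simp: cosets_def)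
 then show "finite (cosets J K)" using assms(5) finite_subset by blast
qed

lemma idx_pos: "finite (cosets H K) ==> subgrp H ==> idx H K > 0"
 using subgrp_zero by (auto simp: idx_def card_gt_0_iff cosets_def)

lemma idx_one_iff:
 assumes "subgrp K" "subgrp H" "K \<subseteq> H" "finite (cosets H K)"
 shows "idx H K = 1 \<longleftrightarrow> H = K"
proof
 assume "idx H K = 1"
 then obtain C where C: "cosets H K = {C}" by (auto simp: idx_def card_Suc_eq)
 have "x \<in> K" if "x \<in> H" for x
 proof -
  have "(+) x ` K \<in> cosets H K" "(+) 0 ` K \<in> cosets H K"
   unfolding cosets_def using that subgrp_zero[OF assms(2)] by (intro imageI; simp)+
  then have "(+) x ` K = (+) 0 ` K" using C by (metis singletonD)
  then show ?thesis using coset_eq_iff[OF assms(1), of x 0] by simp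
 qed
 then show "H = K" using assms by auto
next
 assume "H = K"
 then have "(%x. 0::nat) ` H = {0}" "\<And>x y. x \<in> H ==> y \<in> H ==> x - y \<in> K"
  using subgrp_zero[OF assms(2)] subgrp_diff[OF assms(2)] by auto
 then show "idx H K = 1" using cosets_image(1)[OF assms(1), of H "%x. 0::nat"] by simp
qed

text \<open>Second isomorphism theorem: \<open>cov\<close> says that \<open>I\<close> meets every
  coset of \<open>M\<close> that meets \<open>H\<close>.\<close>

lemma idx_Int:
 assumes H: "subgrp H" and I: "subgrp I" and M: "subgrp M" and IH: "I \<subseteq> H"
  and cov: "\<And>x. x \<in> H ==> \<exists>y\<in>I. x - y \<in> M" and f: "finite (cosets H M)"
 shows "idx I (I \<inter> M) = idx H M" "finite (cosets I (I \<inter> M))"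
proof -
 have img: "(%x. (+) x ` M) ` I = cosets H M"
  unfolding cosets_def using IH cov coset_eq_iff[OF M] by (auto simp: image_iff set_eq_iff)
 have e: "(+) x ` M = (+) y ` M \<longleftrightarrow> x - y \<in> I \<inter> M" if "x \<in> I" "y \<in> I" for x y
  using coset_eq_iff[OF M] subgrp_diff[OF I that] by auto
 show "idx I (I \<inter> M) = idx H M"
  using cosets_image(1)[OF subgrp_Int[OF I M], of I "%x. (+) x ` M"] e img by (auto simp: idx_def)
 show "finite (cosets I (I \<inter> M))"
  using cosets_image(2)[OF subgrp_Int[OF I M], of I "%x. (+) x ` M"] e img f by auto
qed

text \<open>A generating family of minimal length modulo a pure subgroup is independent: otherwise
 Euclid's algorithm on a relation would produce a superfluous generator.\<close>

lemma lattice_basis: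
 fixes K :: "(nat => int) => bool" and s :: nat
 assumes K0: "K (%x. 0)" and Kd: "\<And>v w. K v ==> K w ==> K (%x. v x - w x)"
  and pure: "\<And>c v. c \<noteq> 0 ==> K (%x. c * v x) ==> K v"
 shows "\<exists>(n::nat) u. (\<forall>v. (\<forall>x\<ge>s. v x = 0) --> (\<exists>c. K (%x. v x - (\<Sum>j<n. c j * u j x)))) \<and>
  (\<forall>c. K (%x. \<Sum>j<n. c j * u j x) --> (\<forall>j<n. c j = 0)) \<and> (\<forall>j<n. \<forall>x\<ge>s. u j x = 0)"
proof -
 define gen where "gen n u \<longleftrightarrow> (\<forall>v. (\<forall>x\<ge>s. v x = 0) -->
   (\<exists>c. K (%x. v x - (\<Sum>j<n. c j * u j x)))) \<and> (\<forall>j<n. \<forall>x\<ge>s. u j x = 0)" for n and u :: "nat => nat => int"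
 have Ka: "K (%x. v x + w x)" if "K v" "K w" for v w
  using Kd[OF that(1) Kd[OF K0 that(2)]] by simp
 have Km: "K (%x. c * v x)" if "K v" for c v
 proof -
  have nat: "K (%x. int m * v x)" for m
  proof (induction m)
   case (Suc m)
   then show ?case using Ka[OF Suc that] by (simp add: algebra_simps)
  qed (use K0 in simp)
  show ?thesis
  proof (cases "c \<ge> 0")
   case True then show ?thesis using nat[of "nat c"] by simp
  next
   case False then show ?thesis using Kd[OF K0 nat[of "nat (- c)"]] by simp
  qed
 qed
 have ex: "\<exists>n u. gen n u"
 proof (intro exI)
  show "gen s (%j x. if x = j then 1 else 0)"
   unfolding gen_def
  proof (intro conjI allI impI)
   fix v :: "nat => int" assume v: "\<forall>x\<ge>s. v x = 0"
   have "(%x. v x - (\<Sum>j<s. v j * (if x = j then 1 else 0))) = (%x. 0)"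
    using v by (auto simp: fun_eq_iff sum.delta' if_distrib[of "%t. _ * t"] cong: if_cong)
   then show "\<exists>c. K (%x. v x - (\<Sum>j<s. c j * (if x = j then 1 else 0)))" by (intro exI[of _ v]) (simp only: K0)
  qed auto
 qed
 define n where "n = (LEAST n. \<exists>u. gen n u)"
 have n: "\<exists>u. gen n u" unfolding n_def using ex by (rule LeastI_ex)
 have nmin: "\<not> gen k u" if "k < n" for k u using not_less_Least[of k "%n. \<exists>u. gen n u"] that n_def by auto
 have indep: "[|gen n u; K (%x. \<Sum>j<n. c j * u j x); (\<Sum>j<n. nat \<bar>c j\<bar>) = N|] ==> \<forall>j<n. c j = 0" for u c N
 proof (induction N arbitrary: u c rule: less_induct)
  case (less N)
  show ?case
  proof (rule ccontr)
   assume "\<not> (\<forall>j<n. c j = 0)"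
   then obtain j where j: "j < n" "c j \<noteq> 0" by auto
   show False
   proof (cases "\<exists>i<n. i \<noteq> j \<and> c i \<noteq> 0")
    case False
    have "(\<Sum>i<n. c i * u i x) = c j * u j x" for x
     using j False by (subst sum.remove[of _ j]) (auto intro!: sum.neutral)
    then have "K (%x. c j * u j x)" using less.prems by simp
    then have uj: "K (u j)" using pure j by blast
    define u' where "u' i = (if i < j then u i else u (Suc i))" for i
    have reidx: "(\<Sum>i<n. f i) = f j + (\<Sum>i<n - 1. f (if i < j then i else Suc i))" for f :: "nat => int"
    proof -
     have "(\<Sum>i\<in>{..<n} - {j}. f i) = (\<Sum>i<n - 1. f (if i < j then i else Suc i))"
      by (rule sum.reindex_bij_witness[of _ "%i. if i < j then i else Suc i" "%i. if i < j then i else i - 1"])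
       (use j in \<open>auto split: if_splits\<close>)
     then show ?thesis using j by (subst sum.remove[of _ j]) auto
    qed
    have "gen (n - 1) u'"
     unfolding gen_def
    proof (intro conjI allI impI)
     fix v :: "nat => int" assume v: "\<forall>x\<ge>s. v x = 0"
     then obtain d where d: "K (%x. v x - (\<Sum>i<n. d i * u i x))" using less.prems(1) unfolding gen_def by blast
     have "K (%x. (v x - (\<Sum>i<n. d i * u i x)) + d j * u j x)" by (rule Ka[OF d Km[OF uj]])
     also have "(%x. (v x - (\<Sum>i<n. d i * u i x)) + d j * u j x) =
       (%x. v x - (\<Sum>i<n - 1. d (if i < j then i else Suc i) * u' i x))"
      unfolding u'_def by (rule ext, subst reidx) (auto intro!: sum.cong)
     finally show "\<exists>c. K (%x. v x - (\<Sum>j<n - 1. c j * u' j x))"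
      by (rule exI[of _ "%i. d (if i < j then i else Suc i)"])
    next
     fix i x assume "i < n - 1" "s \<le> x"
     then show "u' i x = 0" using less.prems(1) j unfolding gen_def u'_def by auto
    qed
    then show False using nmin[of "n - 1" u'] j by auto
   next
    case True
    then obtain i where i: "i < n" "i \<noteq> j" "c i \<noteq> 0" by auto
    obtain i j where ij: "i < n" "j < n" "i \<noteq> j" "c i \<noteq> 0" "c j \<noteq> 0" "\<bar>c i\<bar> \<ge> \<bar>c j\<bar>"
     by (cases "\<bar>c i\<bar> \<ge> \<bar>c j\<bar>") (use i j in \<open>auto\<close>)
    \<comment> \<open>Adding \<open>\<sigma> * u i\<close> to \<open>u j\<close> and subtracting
      \<open>\<sigma> * c j\<close> from \<open>c i\<close> preserves the relation and the generated
      group. The sign makes the absolute value of \<open>c i\<close> drop by that of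
      \<open>c j\<close>, so the sum of the absolute coefficients decreases.\<close>
    define \<sigma> where "\<sigma> = sgn (c i) * sgn (c j)"
    define u' where "u' = u(j := (%x. u j x + \<sigma> * u i x))"
    define c' where "c' = c(i := c i - \<sigma> * c j)"
    have split2: "(\<Sum>k<n. f k) = f i + f j + (\<Sum>k\<in>{..<n} - {i,j}. f k)" for f :: "nat => int"
    proof -
     have "{..<n} - {i} - {j} = {..<n} - {i,j}" by auto
     then show ?thesis using ij sum.remove[of "{..<n}" i f] sum.remove[of "{..<n} - {i}" j f] by simp
    qed
    have split2n: "(\<Sum>k<n. f k) = f i + f j + (\<Sum>k\<in>{..<n} - {i,j}. f k)" for f :: "nat => nat"
    proof -
     have "{..<n} - {i} - {j} = {..<n} - {i,j}" by auto
     then show ?thesis using ij sum.remove[of "{..<n}" i f] sum.remove[of "{..<n} - {i}" j f] by simp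
    qed
    have same: "(\<Sum>k<n. c' k * u' k x) = (\<Sum>k<n. c k * u k x)" for x
    proof -
     have "(\<Sum>k\<in>{..<n} - {i,j}. c' k * u' k x) = (\<Sum>k\<in>{..<n} - {i,j}. c k * u k x)"
      by (rule sum.cong) (auto simp: u'_def c'_def)
     then show ?thesis unfolding split2 using ij by (simp add: u'_def c'_def algebra_simps)
    qed
    have g': "gen n u'"
     unfolding gen_def
    proof (intro conjI allI impI)
     fix v :: "nat => int" assume v: "\<forall>x\<ge>s. v x = 0"
     then obtain d where d: "K (%x. v x - (\<Sum>i<n. d i * u i x))" using less.prems(1) unfolding gen_def by blast
     define d' where "d' = d(i := d i - \<sigma> * d j)"
     have "(\<Sum>k<n. d' k * u' k x) = (\<Sum>k<n. d k * u k x)" for x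
     proof -
      have "(\<Sum>k\<in>{..<n} - {i,j}. d' k * u' k x) = (\<Sum>k\<in>{..<n} - {i,j}. d k * u k x)"
       by (rule sum.cong) (auto simp: u'_def d'_def)
      then show ?thesis unfolding split2 using ij by (simp add: u'_def d'_def algebra_simps)
     qed
     then show "\<exists>c. K (%x. v x - (\<Sum>j<n. c j * u' j x))" using d by (intro exI[of _ d']) simp
    next
     fix k x assume "k < n" "s \<le> x"
     then show "u' k x = 0" using less.prems(1) ij unfolding gen_def u'_def by auto
    qed
    have sm: "nat \<bar>c' i\<bar> < nat \<bar>c i\<bar>"
     using ij by (auto simp: c'_def \<sigma>_def sgn_if abs_if split: if_splits)
    have "(\<Sum>k<n. nat \<bar>c' k\<bar>) < N"
    proof -
     have "(\<Sum>k\<in>{..<n} - {i,j}. nat \<bar>c' k\<bar>) = (\<Sum>k\<in>{..<n} - {i,j}. nat \<bar>c k\<bar>)"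
      by (rule sum.cong) (auto simp: c'_def)
     moreover have "c' j = c j" using ij by (simp add: c'_def)
     ultimately show ?thesis
      using sm less.prems(3) split2n[of "%k. nat \<bar>c k\<bar>"] split2n[of "%k. nat \<bar>c' k\<bar>"] by linarith
    qed
    from less.IH[OF this g' _ refl] have "\<forall>k<n. c' k = 0" using same less.prems(2) by simp
    then have "c' j = 0" using ij by blast
    then show False using ij by (simp add: c'_def)
   qed
  qed
 qed
 from n obtain u where u: "gen n u" by blast
 have "\<forall>c. K (%x. \<Sum>j<n. c j * u j x) --> (\<forall>j<n. c j = 0)" using indep[OF u _ refl] by simp
 with u show ?thesis unfolding gen_def
  by - (rule exI[of _ n], rule exI[of _ u], simp)
qed

section \<open>Minors\<close>

definition is_subring :: "'a::comm_ring_1 set => bool" where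
 "is_subring S \<longleftrightarrow> 1 \<in> S \<and> (\<forall>x\<in>S. \<forall>y\<in>S. x - y \<in> S \<and> x * y \<in> S)"

lemma subringD:
 assumes "is_subring S"
 shows "1 \<in> S" "0 \<in> S" "x \<in> S ==> y \<in> S ==> x - y \<in> S" "x \<in> S ==> y \<in> S ==> x * y \<in> S"
  "x \<in> S ==> - x \<in> S" "x \<in> S ==> y \<in> S ==> x + y \<in> S"
proof -
 have 1: "1 \<in> S" and d: "\<And>x y. x \<in> S ==> y \<in> S ==> x - y \<in> S" and m: "\<And>x y. x \<in> S ==> y \<in> S ==> x * y \<in> S"
  using assms by (auto simp: is_subring_def)
 have 0: "0 \<in> S" using d[OF 1 1] by simp
 have u: "- x \<in> S" if "x \<in> S" for x using d[OF 0 that] by simp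
 show "1 \<in> S" "0 \<in> S" "x \<in> S ==> y \<in> S ==> x - y \<in> S" "x \<in> S ==> y \<in> S ==> x * y \<in> S"
  "x \<in> S ==> - x \<in> S" "x \<in> S ==> y \<in> S ==> x + y \<in> S"
  using 1 0 d m u d[OF _ u, of x y] by auto
qed

lemma subring_sum: "is_subring S ==> (\<And>i. i \<in> A ==> f i \<in> S) ==> sum f A \<in> S"
 by (induction A rule: infinite_finite_induct) (auto simp: subringD)

lemma subring_prod: "is_subring S ==> (\<And>i. i \<in> A ==> f i \<in> S) ==> prod f A \<in> S"
 by (induction A rule: infinite_finite_induct) (auto simp: subringD)

lemma subring_power: "is_subring S ==> x \<in> S ==> x ^ k \<in> S"
 by (induction k) (auto simp: subringD)

lemma subring_of_int: "is_subring S ==> of_int z \<in> S"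
proof (cases z rule: int_cases2)
 case (nonneg n)
 moreover assume "is_subring S"
 then have "of_nat n \<in> S" by (induction n) (auto simp: subringD)
 ultimately show ?thesis by simp
next
 case (nonpos n)
 moreover assume s: "is_subring S"
 then have "of_nat n \<in> S" by (induction n) (auto simp: subringD)
 ultimately show ?thesis using s by (simp add: subringD)
qed

lemma permutes_lt: "p permutes {0..<n} ==> (i::nat) < n ==> p i < n"
 using permutes_in_image[of p "{0..<n}" i] by auto

lemma det_in_subring:
 assumes "is_subring S" "A \<in> carrier_mat n n" "\<And>i j. i < n ==> j < n ==> A $$ (i,j) \<in> S"
 shows "det A \<in> S"
proof -
 have "signof p \<in> S" for p :: "nat => nat" using subringD[OF assms(1)] by (simp add: sign_def)
 then show ?thesis unfolding det_def'[OF assms(2)]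
  using assms(3) by (auto intro!: subring_sum subring_prod subringD assms(1) simp: permutes_lt)
qed

text \<open>Stated relative to a subring because the specialisation maps constructed later are
  homomorphisms only on a subset of their type.\<close>

lemma hom_on_det:
 assumes S: "is_subring S" and A: "A \<in> carrier_mat n n" "\<And>i j. i < n ==> j < n ==> A $$ (i,j) \<in> S"
  and h: "\<And>x y. x \<in> S ==> y \<in> S ==> h (x + y) = h x + h y"
   "\<And>x y. x \<in> S ==> y \<in> S ==> h (x * y) = h x * h y" "h 1 = (1::'b::comm_ring_1)"
 shows "h (det A) = det (map_mat h A)"
proof -
 have h0: "h 0 = 0" using h(1)[of 0 0] subringD[OF S] by simp
 have hu: "h (- x) = - h x" if "x \<in> S" for x
  using h(1)[OF that subringD(5)[OF S that]] h0 by (simp add: eq_neg_iff_add_eq_0 add.commute)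
 have hs: "h (sum f Z) = (\<Sum>i\<in>Z. h (f i))" if "\<And>i. i \<in> Z ==> f i \<in> S" for f and Z :: "'c set"
  using that by (induction Z rule: infinite_finite_induct) (auto simp: h0 h(1) subring_sum[OF S])
 have hp: "h (prod f Z) = (\<Prod>i\<in>Z. h (f i))" if "\<And>i. i \<in> Z ==> f i \<in> S" for f and Z :: "nat set"
  using that by (induction Z rule: infinite_finite_induct) (auto simp: h(2,3) subring_prod[OF S])
 have sg: "signof p \<in> S" "h (signof p) = signof p" for p :: "nat => nat"
  using subringD[OF S] by (auto simp: sign_def h(3) hu)
 have pr: "(\<Prod>i = 0..<n. A $$ (i, p i)) \<in> S" "h (\<Prod>i = 0..<n. A $$ (i, p i)) = (\<Prod>i = 0..<n. map_mat h A $$ (i, p i))"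
  if p: "p permutes {0..<n}" for p
 proof -
  have in_S: "A $$ (i, p i) \<in> S" if "i \<in> {0..<n}" for i
   using that A(2) permutes_lt[OF p] by auto
  then show "(\<Prod>i = 0..<n. A $$ (i, p i)) \<in> S" by (rule subring_prod[OF S])
  have "h (\<Prod>i = 0..<n. A $$ (i, p i)) = (\<Prod>i = 0..<n. h (A $$ (i, p i)))"
   by (rule hp) (rule in_S)
  also have "... = (\<Prod>i = 0..<n. map_mat h A $$ (i, p i))"
   by (rule prod.cong) (use A(1) permutes_lt[OF p] in auto)
  finally show "h (\<Prod>i = 0..<n. A $$ (i, p i)) = (\<Prod>i = 0..<n. map_mat h A $$ (i, p i))" .
 qed
 have "h (det A) = (\<Sum>p\<in>{p. p permutes {0..<n}}. h (signof p * (\<Prod>i = 0..<n. A $$ (i, p i))))"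
  unfolding det_def'[OF A(1)] by (rule hs) (use sg pr subringD[OF S] in auto)
 also have "... = (\<Sum>p\<in>{p. p permutes {0..<n}}. signof p * (\<Prod>i = 0..<n. map_mat h A $$ (i, p i)))"
  by (rule sum.cong) (auto simp: h(2) sg pr)
 finally show ?thesis using A(1) by (subst det_def'[of "map_mat h A" n]) auto
qed

lemma det_bound:
 fixes A :: "int mat"
 assumes "A \<in> carrier_mat n n" "\<And>i j. i < n ==> j < n ==> real_of_int \<bar>A $$ (i,j)\<bar> \<le> B"
 shows "real_of_int \<bar>det A\<bar> \<le> fact n * B ^ n"
proof -
 have "real_of_int \<bar>det A\<bar> \<le> (\<Sum>p\<in>{p. p permutes {0..<n}}. real_of_int \<bar>signof p * (\<Prod>i = 0..<n. A $$ (i, p i))\<bar>)"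
  unfolding det_def'[OF assms(1)] by (simp flip: of_int_sum of_int_abs add: sum_abs)
 also have "... \<le> (\<Sum>p\<in>{p. p permutes {0..<n}}. B ^ n)"
 proof (rule sum_mono)
  fix p assume "p \<in> {p. p permutes {0..<n}}"
  then have p: "\<And>i. i < n ==> p i < n" by (auto simp: permutes_lt)
  have "real_of_int \<bar>signof p * (\<Prod>i = 0..<n. A $$ (i, p i))\<bar> = (\<Prod>i = 0..<n. real_of_int \<bar>A $$ (i, p i)\<bar>)"
   by (simp add: abs_mult abs_prod sign_def)
  also have "... \<le> (\<Prod>i = 0..<n. B)" by (rule prod_mono) (use p assms(2) in auto)
  finally show "real_of_int \<bar>signof p * (\<Prod>i = 0..<n. A $$ (i, p i))\<bar> \<le> B ^ n" by simp
 qed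
 also have "... = fact n * B ^ n" by (simp add: card_permutations[OF refl])
 finally show ?thesis .
qed

text \<open>Row indices have an arbitrary type, so that maps of a finite group or whole vectors can
  index rows. The selections \<open>f\<close> and \<open>g\<close> may repeat indices, which only
  adds vanishing minors.\<close>

definition minor :: "('r => nat => 'a::comm_ring_1) => nat => (nat => 'r) => (nat => nat) => 'a" where
 "minor Z d f g = det (mat d d (%(i,j). Z (f i) (g j)))"

text \<open>Laplace expansion of a vanishing minor of size \<open>Suc d\<close> along its last
  column. The cofactors do not involve the column \<open>c\<close>, so one family of coefficients
  serves all columns; it stays in \<open>S\<close> because the pivot minor is kept as a factor on
  the left instead of being divided by.\<close>

lemma minor_cramer:
 fixes Z :: "'r => nat => 'a::idom"
 assumes van: "\<And>f g. (\<forall>i\<le>d. f i \<in> R) ==> (\<forall>j\<le>d. g j < m) ==> minor Z (Suc d) f g = 0"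
  and fg: "\<forall>i<d. f i \<in> R" "\<forall>j<d. g j < m" and S: "is_subring S" "\<And>r c. r \<in> R ==> c < m ==> Z r c \<in> S" and r: "r \<in> R"
 shows "\<exists>a. (\<forall>i<d. a i \<in> S) \<and> (\<forall>c<m. minor Z d f g * Z r c = (\<Sum>i<d. a i * Z (f i) c))"
proof -
 define A where "A c = mat (Suc d) (Suc d) (%(i,j). Z (if i < d then f i else r) (if j < d then g j else c))" for c
 have Ac: "A c \<in> carrier_mat (Suc d) (Suc d)" for c by (simp add: A_def)
 have del: "mat_delete (A c) i d = mat d d (%(k,j). Z (if insert_index i k < d then f (insert_index i k) else r) (g j))" for c i
  unfolding mat_delete_def A_def by (rule eq_matI) (auto simp: insert_index_def)
 define a where "a i = - ((-1)^(i+d) * det (mat d d (%(k,j). Z (if insert_index i k < d then f (insert_index i k) else r) (g j))))" for i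
 have aS: "a i \<in> S" if "i < d" for i
  unfolding a_def
  by (intro subringD(5)[OF S(1)] subringD(4)[OF S(1)] subring_power[OF S(1)] det_in_subring[OF S(1), of _ d] subringD(1)[OF S(1)])
   (use fg r S in \<open>auto simp: insert_index_def\<close>)
 have eq: "minor Z d f g * Z r c = (\<Sum>i<d. a i * Z (f i) c)" if c: "c < m" for c
 proof -
  have "det (A c) = minor Z (Suc d) (%i. if i < d then f i else r) (%j. if j < d then g j else c)"
   by (simp add: minor_def A_def)
  also have "... = 0" by (rule van) (use fg r c in auto)
  finally have "0 = (\<Sum>i<Suc d. A c $$ (i,d) * cofactor (A c) i d)"
   using laplace_expansion_column[OF Ac, of d] by simp
  also have "... = Z r c * minor Z d f g + (\<Sum>i<d. Z (f i) c * (- a i))"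
  proof -
   have "cofactor (A c) d d = minor Z d f g"
    unfolding cofactor_def del minor_def
    by (auto intro!: arg_cong[of _ _ det] eq_matI simp: insert_index_def)
   moreover have "cofactor (A c) i d = - a i" if "i < d" for i
    unfolding cofactor_def del a_def by simp
   ultimately show ?thesis by (simp add: A_def)
  qed
  finally show ?thesis by (simp add: sum_negf mult.commute algebra_simps)
 qed
 show ?thesis using aS eq by blast
qed

lemma minor_repeat_col:
 assumes "m < d" "\<And>j. j < d ==> g j < m"
 shows "minor Z d f g = 0"
proof -
 have "\<not> inj_on g {..<d}"
 proof
  assume "inj_on g {..<d}"
  then have "card {..<d} \<le> card {..<m}" by (rule card_inj_on_le) (use assms in auto)
  then show False using assms by simp
 qed
 then obtain i j where ij: "i < d" "j < d" "i \<noteq> j" "g i = g j" by (auto simp: inj_on_def)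
 show ?thesis unfolding minor_def
  by (rule det_identical_columns[of _ d i j]) (use ij in \<open>auto intro!: eq_vecI\<close>)
qed

text \<open>The size \<open>d\<close> is the rank: the empty determinant is 1, so some minor is
  nonzero, and beyond size \<open>m\<close> a column repeats.\<close>

lemma max_minor:
 fixes Z :: "'r => nat => 'a::comm_ring_1"
 obtains d f g where "d \<le> m" "\<forall>i<d. f i \<in> R" "\<forall>j<d. g j < m" "minor Z d f g \<noteq> 0"
  "\<And>f g. (\<forall>i\<le>d. f i \<in> R) ==> (\<forall>j\<le>d. g j < m) ==> minor Z (Suc d) f g = 0"
proof -
 define Q where "Q d \<longleftrightarrow> (\<exists>f g. (\<forall>i<d. f i \<in> R) \<and> (\<forall>j<d. g j < m) \<and> minor Z d f g \<noteq> 0)" for d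
 have Q0: "Q 0" by (simp add: Q_def minor_def)
 have Qm: "d \<le> m" if "Q d" for d using that minor_repeat_col unfolding Q_def by (metis not_le)
 define d where "d = Greatest Q"
 have Qd: "Q d" unfolding d_def using GreatestI_nat[of Q 0 m] Q0 Qm by blast
 have nQ: "\<not> Q (Suc d)" using Greatest_le_nat[of Q "Suc d" m] Qm d_def by fastforce
 show thesis using Qd Qm[OF Qd] nQ that unfolding Q_def by (metis le_imp_less_Suc less_Suc_eq_le)
qed

section \<open>Orders in number rings\<close>

locale nring =
 fixes R :: "complex set" and b :: "nat => complex" and n :: nat
 assumes one: "1 \<in> R" and mult: "x \<in> R ==> y \<in> R ==> x * y \<in> R"
  and span: "R = range (%c::nat => int. \<Sum>i<n. of_int (c i) * b i)"
  and indep: "(\<Sum>i<n. of_int (c i) * b i) = 0 ==> i < n ==> c i = (0::int)"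
begin

text \<open>The coordinates with respect to \<open>b\<close>; only the indices below
  \<open>n\<close> carry a meaning.\<close>

definition co :: "complex => nat => int" where
 "co x = (SOME c. x = (\<Sum>i<n. of_int (c i) * b i))"

lemma co_eq: "x \<in> R ==> x = (\<Sum>i<n. of_int (co x i) * b i)"
proof -
 assume "x \<in> R"
 then have "\<exists>c::nat => int. x = (\<Sum>i<n. of_int (c i) * b i)" using span by auto
 then show ?thesis unfolding co_def by (rule someI_ex)
qed

lemma comb_in: "(\<Sum>i<n. of_int (c i) * b i) \<in> R"
 using span by blast

lemma R_cases:
 assumes "x \<in> R"
 obtains c :: "nat => int" where "x = (\<Sum>i<n. of_int (c i) * b i)"
 using co_eq[OF assms] by blast

lemma subgrp_R: "subgrp R"
 unfolding subgrp_def
proof (intro conjI ballI)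
 show "0 \<in> R" using comb_in[of "%_. 0"] by simp
 fix x y assume "x \<in> R" "y \<in> R"
 then obtain c d :: "nat => int" where "x = (\<Sum>i<n. of_int (c i) * b i)" "y = (\<Sum>i<n. of_int (d i) * b i)"
  using R_cases by metis
 then have "x - y = (\<Sum>i<n. of_int (c i - d i) * b i)"
  by (simp add: algebra_simps sum_subtractf)
 then show "x - y \<in> R" using comb_in[of "%i. c i - d i"] by simp
qed

lemma is_subring_R: "is_subring R"
 using one mult subgrp_diff[OF subgrp_R] by (auto simp: is_subring_def)

lemma of_int_in: "of_int k \<in> R"
 by (rule subring_of_int[OF is_subring_R])

lemma co_unique: "x = (\<Sum>i<n. of_int (c i) * b i) ==> i < n ==> co x i = c i"
proof -
 assume x: "x = (\<Sum>i<n. of_int (c i) * b i)" and i: "i < n"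
 then have "(\<Sum>i<n. of_int (co x i) * b i) = (\<Sum>i<n. of_int (c i) * b i)" using co_eq comb_in by metis
 then have "(\<Sum>i<n. of_int (co x i - c i) * b i) = 0" by (simp add: algebra_simps sum_subtractf)
 from indep[OF this i] show ?thesis by simp
qed

lemma co_comb [simp]: "i < n ==> co (\<Sum>i<n. of_int (c i) * b i) i = c i"
 by (rule co_unique) simp_all

lemma co_lin: "x \<in> R ==> y \<in> R ==> i < n ==> co (of_int k * x + of_int l * y) i = k * co x i + l * co y i"
proof -
 assume x: "x \<in> R" and y: "y \<in> R" and i: "i < n"
 then obtain c d :: "nat => int" where cd: "x = (\<Sum>i<n. of_int (c i) * b i)" "y = (\<Sum>i<n. of_int (d i) * b i)"
  using R_cases by metis
 have "of_int k * x + of_int l * y = (\<Sum>i<n. of_int (k * c i + l * d i) * b i)"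
  unfolding cd by (simp add: algebra_simps sum_distrib_left sum.distrib)
 then show ?thesis using co_unique[OF _ i, of _ "%i. k * c i + l * d i"] cd i by simp
qed

lemma co_add: "x \<in> R ==> y \<in> R ==> i < n ==> co (x + y) i = co x i + co y i"
 using co_lin[of x y i 1 1] by simp

lemma co_diff: "x \<in> R ==> y \<in> R ==> i < n ==> co (x - y) i = co x i - co y i"
 using co_lin[of x y i 1 "-1"] by simp

lemma co_smult: "x \<in> R ==> i < n ==> co (of_int k * x) i = k * co x i"
 using co_lin[of x x i k 0] by simp

lemma zero_in: "0 \<in> R" using subgrp_R by (rule subgrp_zero)

lemma co_zero: "i < n ==> co 0 i = 0"
 using co_unique[of 0 "%_. 0"] by simp

lemma sum_in: "(\<And>i. i \<in> A ==> f i \<in> R) ==> sum f A \<in> R"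
 by (rule subgrp_sum[OF subgrp_R])

lemma co_sum: "(\<And>j. j \<in> A ==> f j \<in> R) ==> i < n ==> co (sum f A) i = (\<Sum>j\<in>A. co (f j) i)"
 by (induction A rule: infinite_finite_induct) (auto simp: co_zero co_add sum_in)

lemma co_lincomb:
 assumes "\<And>i. i \<in> A ==> f i \<in> R" "j < n"
 shows "co (\<Sum>i\<in>A. of_int (k i) * f i) j = (\<Sum>i\<in>A. k i * co (f i) j)"
proof -
 have "co (\<Sum>i\<in>A. of_int (k i) * f i) j = (\<Sum>i\<in>A. co (of_int (k i) * f i) j)"
  by (rule co_sum[OF mult[OF of_int_in assms(1)] assms(2)])
 also have "... = (\<Sum>i\<in>A. k i * co (f i) j)"
  by (rule sum.cong[OF refl], rule co_smult[OF assms])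
 finally show ?thesis .
qed

lemma comb_single: "i < n ==> (\<Sum>j<n. of_int (if i = j then k else 0) * b j) = of_int k * b i"
proof -
 assume "i < n"
 have "(\<Sum>j<n. of_int (if i = j then k else 0) * b j) = (\<Sum>j<n. if i = j then of_int k * b j else 0)"
  by (rule sum.cong) auto
 then show ?thesis using \<open>i < n\<close> by simp
qed

lemma b_in: "i < n ==> b i \<in> R"
 using comb_in[of "%j. if i = j then 1 else 0"] comb_single[of i 1] by simp

lemma co_b: "i < n ==> j < n ==> co (b i) j = (if i = j then 1 else 0)"
 using co_unique[of "b i" "%j. if i = j then 1 else 0" j] comb_single[of i 1] by simp

lemma n_pos: "n > 0"
 using co_eq[OF one] by (cases "n = 0") auto

section \<open>Size of elements, measured by coordinates\<close>

definition bx :: "real => complex => bool" where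
 "bx r x \<longleftrightarrow> x \<in> R \<and> (\<forall>i<n. real_of_int \<bar>co x i\<bar> \<le> r)"

definition kc :: real where
 "kc = 1 + (\<Sum>i<n. \<Sum>j<n. \<Sum>k<n. real_of_int \<bar>co (b i * b j) k\<bar>)"

lemma kc_ge: "kc \<ge> 1"
 unfolding kc_def by (auto intro!: sum_nonneg)

lemma bx_in: "bx r x ==> x \<in> R" by (simp add: bx_def)

lemma bx_mono: "bx r x ==> r \<le> s ==> bx s x" by (force simp: bx_def)

lemma bx_add: "bx r x ==> bx s y ==> bx (r + s) (x + y)"
proof -
 assume h: "bx r x" "bx s y"
 have "real_of_int \<bar>co (x + y) i\<bar> \<le> r + s" if "i < n" for i
 proof -
  have "real_of_int \<bar>co x i\<bar> \<le> r" "real_of_int \<bar>co y i\<bar> \<le> s" "co (x + y) i = co x i + co y i"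
   using h that by (auto simp: bx_def co_add)
  then show ?thesis by linarith
 qed
 then show ?thesis using h subgrp_add[OF subgrp_R] by (simp add: bx_def)
qed

lemma bx_b: "i < n ==> bx 1 (b i)"
 unfolding bx_def using b_in by (auto simp: co_b)

lemma bx_nonneg: "bx r x ==> r \<ge> 0"
proof -
 assume "bx r x"
 then have "real_of_int \<bar>co x 0\<bar> \<le> r" using n_pos by (simp add: bx_def)
 then show ?thesis by linarith
qed

lemma ex_bx: "x \<in> R ==> \<exists>r\<ge>1. bx r x"
proof -
 assume x: "x \<in> R"
 have "real_of_int \<bar>co x i\<bar> \<le> 1 + (\<Sum>i<n. real_of_int \<bar>co x i\<bar>)" if "i < n" for i
  using member_le_sum[of i "{..<n}" "%i. real_of_int \<bar>co x i\<bar>"] that by auto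
 then show ?thesis using x by (intro exI[of _ "1 + (\<Sum>i<n. real_of_int \<bar>co x i\<bar>)"]) (auto simp: bx_def intro: sum_nonneg)
qed

lemma co_mult: "x \<in> R ==> y \<in> R ==> k < n ==> co (x * y) k = (\<Sum>i<n. \<Sum>j<n. co x i * co y j * co (b i * b j) k)"
proof -
 assume x: "x \<in> R" and y: "y \<in> R" and k: "k < n"
 have "x * y = (\<Sum>i<n. of_int (co x i) * b i) * (\<Sum>j<n. of_int (co y j) * b j)"
  using co_eq[OF x] co_eq[OF y] by presburger
 also have "... = (\<Sum>i<n. \<Sum>j<n. of_int (co x i * co y j) * (b i * b j))"
  by (simp add: sum_product algebra_simps)
 finally have "co (x * y) k = co (\<Sum>i<n. \<Sum>j<n. of_int (co x i * co y j) * (b i * b j)) k"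
  by (rule arg_cong[of _ _ "%z. co z k"])
 also have "... = (\<Sum>i<n. \<Sum>j<n. co (of_int (co x i * co y j) * (b i * b j)) k)"
 proof -
  have t: "of_int (co x i * co y j) * (b i * b j) \<in> R" if "i < n" "j < n" for i j
   using that by (intro mult of_int_in b_in)
  have "co (\<Sum>i<n. \<Sum>j<n. of_int (co x i * co y j) * (b i * b j)) k =
   (\<Sum>i<n. co (\<Sum>j<n. of_int (co x i * co y j) * (b i * b j)) k)"
   by (rule co_sum[OF sum_in k]) (rule t; simp)
  also have "... = (\<Sum>i<n. \<Sum>j<n. co (of_int (co x i * co y j) * (b i * b j)) k)"
   by (rule sum.cong[OF refl], rule co_sum[OF _ k]) (rule t; simp)
  finally show ?thesis .
 qed
 also have "... = (\<Sum>i<n. \<Sum>j<n. co x i * co y j * co (b i * b j) k)"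
  by (intro sum.cong refl co_smult mult b_in k) simp_all
 finally show ?thesis .
qed

lemma bx_mult:
 assumes "bx r x" "bx s y"
 shows "bx (kc * r * s) (x * y)"
proof -
 have x: "x \<in> R" and y: "y \<in> R" using assms by (auto simp: bx_def)
 have r: "r \<ge> 0" "s \<ge> 0" using assms bx_nonneg by auto
 have "real_of_int \<bar>co (x * y) k\<bar> \<le> kc * r * s" if k: "k < n" for k
 proof -
  have "real_of_int \<bar>co (x * y) k\<bar> \<le> (\<Sum>i<n. \<Sum>j<n. real_of_int \<bar>co x i * co y j * co (b i * b j) k\<bar>)"
   unfolding co_mult[OF x y k] of_int_abs of_int_sum
   by (rule order_trans[OF sum_abs], rule sum_mono, rule sum_abs)
  also have "... \<le> (\<Sum>i<n. \<Sum>j<n. r * s * (\<Sum>k<n. real_of_int \<bar>co (b i * b j) k\<bar>))"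
  proof (intro sum_mono)
   fix i j assume ij: "i \<in> {..<n}" "j \<in> {..<n}"
   have p1: "real_of_int \<bar>co x i\<bar> * real_of_int \<bar>co y j\<bar> \<le> r * s"
    using assms ij r by (intro mult_mono) (auto simp: bx_def)
   have p2: "real_of_int \<bar>co (b i * b j) k\<bar> \<le> (\<Sum>k<n. real_of_int \<bar>co (b i * b j) k\<bar>)"
    using k by (intro member_le_sum) auto
   show "real_of_int \<bar>co x i * co y j * co (b i * b j) k\<bar> \<le> r * s * (\<Sum>k<n. real_of_int \<bar>co (b i * b j) k\<bar>)"
    unfolding abs_mult of_int_mult by (rule mult_mono[OF p1 p2]) (use r in simp_all)
  qed
  also have "... = (kc - 1) * r * s"
   unfolding kc_def by (simp add: sum_distrib_left mult_ac)
  also have "... \<le> kc * r * s" using r by (intro mult_right_mono) auto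
  finally show ?thesis .
 qed
 then show ?thesis using x y mult by (auto simp: bx_def)
qed

definition ibox :: "int => int => complex set" where
 "ibox l u = {x \<in> R. \<forall>i<n. l \<le> co x i \<and> co x i < u}"

lemma ibox_bij: "bij_betw (%c. \<Sum>i<n. of_int (c i) * b i) ({..<n} \<rightarrow>\<^sub>E {l..<u}) (ibox l u)"
proof (rule bij_betw_byWitness[where f' = "%x. restrict (co x) {..<n}"])
 show "\<forall>c\<in>{..<n} \<rightarrow>\<^sub>E {l..<u}. restrict (co (\<Sum>i<n. of_int (c i) * b i)) {..<n} = c"
 proof
  fix c assume c: "c \<in> {..<n} \<rightarrow>\<^sub>E {l..<u}"
  show "restrict (co (\<Sum>i<n. of_int (c i) * b i)) {..<n} = c"
  proof
   fix i show "restrict (co (\<Sum>i<n. of_int (c i) * b i)) {..<n} i = c i"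
    using PiE_arb[OF c, of i] by (cases "i < n") simp_all
  qed
 qed
 show "\<forall>x\<in>ibox l u. (\<Sum>i<n. of_int (restrict (co x) {..<n} i) * b i) = x"
 proof
  fix x assume "x \<in> ibox l u"
  then have "x \<in> R" by (simp add: ibox_def)
  have "(\<Sum>i<n. of_int (restrict (co x) {..<n} i) * b i) = (\<Sum>i<n. of_int (co x i) * b i)"
   by (rule sum.cong) simp_all
  then show "(\<Sum>i<n. of_int (restrict (co x) {..<n} i) * b i) = x"
   using co_eq[OF \<open>x \<in> R\<close>] by (rule trans[OF _ sym])
 qed
 show "(%c. \<Sum>i<n. of_int (c i) * b i) ` ({..<n} \<rightarrow>\<^sub>E {l..<u}) \<subseteq> ibox l u"
 proof (rule image_subsetI)
  fix c assume c: "c \<in> {..<n} \<rightarrow>\<^sub>E {l..<u}"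
  have "l \<le> c i \<and> c i < u" if "i < n" for i using PiE_mem[OF c, of i] that by simp
  then show "(\<Sum>i<n. of_int (c i) * b i) \<in> ibox l u"
   unfolding ibox_def using comb_in[of c] by simp
 qed
 show "(%x. restrict (co x) {..<n}) ` ibox l u \<subseteq> {..<n} \<rightarrow>\<^sub>E {l..<u}"
  unfolding ibox_def by (rule image_subsetI) (simp add: PiE_iff)
qed

lemma card_ibox: "card (ibox l u) = nat (u - l) ^ n" and finite_ibox: "finite (ibox l u)"
 using bij_betw_same_card[OF ibox_bij[of l u]] bij_betw_finite[OF ibox_bij[of l u]]
 by (auto simp: card_PiE finite_PiE)

lemma bx_ibox: "bx r x ==> x \<in> ibox (- \<lfloor>r\<rfloor>) (\<lfloor>r\<rfloor> + 1)"
proof -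
 assume h: "bx r x"
 have "- \<lfloor>r\<rfloor> \<le> co x i \<and> co x i < \<lfloor>r\<rfloor> + 1" if "i < n" for i
 proof -
  have "\<bar>co x i\<bar> \<le> \<lfloor>r\<rfloor>" using h that unfolding le_floor_iff bx_def by blast
  then show ?thesis by linarith
 qed
 then show ?thesis using h by (simp add: bx_def ibox_def)
qed

section \<open>Multiplication matrices, norm and cofactor\<close>

definition mm :: "complex => int mat" where "mm a = mat n n (%(i,j). co (a * b i) j)"

definition dt :: "complex => int" where "dt a = det (mm a)"

text \<open>With \<open>dt\<close> being the norm, this is the norm of \<open>a\<close> divided by
  \<open>a\<close>, that is, the product of the other conjugates. It is obtained inside the ring
  from the adjugate of the multiplication matrix, applied to the coordinates of 1.\<close>

definition conj :: "complex => complex" where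
 "conj a = (\<Sum>k<n. \<Sum>i<n. of_int (co 1 k * adj_mat (mm a) $$ (k,i)) * b i)"

lemma mm_carrier [simp]: "mm a \<in> carrier_mat n n" by (simp add: mm_def)

lemma mm_dim [simp]: "dim_row (mm a) = n" "dim_col (mm a) = n" by (simp_all add: mm_def)

lemma mult_b: "a \<in> R ==> i < n ==> a * b i = (\<Sum>j<n. of_int (mm a $$ (i,j)) * b j)"
 using co_eq[OF mult[OF _ b_in]] by (simp add: mm_def)

lemma conj_in: "conj a \<in> R"
 unfolding conj_def by (intro sum_in comb_in)

lemma mult_conj:
 assumes a: "a \<in> R"
 shows "a * conj a = of_int (dt a)"
proof -
 have k: "(\<Sum>i<n. of_int (adj_mat (mm a) $$ (k,i)) * (a * b i)) = of_int (dt a) * b k" if k: "k < n" for k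
 proof -
  have c: "adj_mat (mm a) \<in> carrier_mat n n" by (rule adj_mat(1)) simp
  have e: "(\<Sum>i<n. adj_mat (mm a) $$ (k,i) * mm a $$ (i,j)) = (if k = j then dt a else 0)" if j: "j < n" for j
  proof -
   have "(adj_mat (mm a) * mm a) $$ (k,j) = (dt a \<cdot>\<^sub>m 1\<^sub>m n) $$ (k,j)"
    using adj_mat(3)[OF mm_carrier[of a]] by (simp add: dt_def)
   then show ?thesis using c k j mm_carrier[of a] by (simp add: scalar_prod_def atLeast0LessThan)
  qed
  have "(\<Sum>i<n. of_int (adj_mat (mm a) $$ (k,i)) * (a * b i)) =
   (\<Sum>i<n. \<Sum>j<n. of_int (adj_mat (mm a) $$ (k,i) * mm a $$ (i,j)) * b j)"
   by (rule sum.cong) (auto simp: mult_b[OF a] sum_distrib_left mult_ac)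
  also have "... = (\<Sum>j<n. of_int (\<Sum>i<n. adj_mat (mm a) $$ (k,i) * mm a $$ (i,j)) * b j)"
   by (subst sum.swap) (simp add: sum_distrib_right)
  also have "... = (\<Sum>j<n. of_int (if k = j then dt a else 0) * b j)"
   by (rule sum.cong) (simp_all only: e lessThan_iff)
  also have "... = of_int (dt a) * b k"
   by (rule comb_single[OF k])
  finally show ?thesis .
 qed
 have "a * conj a = (\<Sum>k<n. of_int (co 1 k) * (\<Sum>i<n. of_int (adj_mat (mm a) $$ (k,i)) * (a * b i)))"
  unfolding conj_def by (simp add: sum_distrib_left mult_ac)
 also have "... = (\<Sum>k<n. of_int (co 1 k) * (of_int (dt a) * b k))"
  by (rule sum.cong) (simp_all add: k)
 also have "... = of_int (dt a) * (\<Sum>k<n. of_int (co 1 k) * b k)"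
  by (simp add: sum_distrib_left mult_ac)
 also have "(\<Sum>k<n. of_int (co 1 k) * b k) = 1" using co_eq[OF one] by simp
 finally show ?thesis by simp
qed

text \<open>A kernel vector of the transposed multiplication matrix is the coordinate vector of an
  element annihilated by \<open>a\<close>, which must be 0 among the complex numbers.\<close>

lemma dt_nz:
 assumes a: "a \<in> R" "a \<noteq> 0"
 shows "dt a \<noteq> 0"
proof
 assume "dt a = 0"
 then have "det (transpose_mat (mm a)) = 0" using det_transpose[OF mm_carrier[of a]] by (simp add: dt_def)
 then obtain v where v: "v \<in> carrier_vec n" "v \<noteq> 0\<^sub>v n" "transpose_mat (mm a) *\<^sub>v v = 0\<^sub>v n"
  using det_0_iff_vec_prod_zero[of "transpose_mat (mm a)" n] by auto
 have z: "(\<Sum>i<n. mm a $$ (i,j) * v $ i) = 0" if j: "j < n" for j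
 proof -
  have "(transpose_mat (mm a) *\<^sub>v v) $ j = 0" using v j by simp
  then show ?thesis using j v(1) mm_carrier[of a] by (simp add: scalar_prod_def atLeast0LessThan carrier_vecD)
 qed
 have "a * (\<Sum>i<n. of_int (v $ i) * b i) = (\<Sum>i<n. of_int (v $ i) * (a * b i))"
  by (simp add: sum_distrib_left mult_ac)
 also have "... = (\<Sum>i<n. \<Sum>j<n. of_int (mm a $$ (i,j) * v $ i) * b j)"
  by (rule sum.cong) (auto simp: mult_b[OF a(1)] sum_distrib_left mult_ac)
 also have "... = (\<Sum>j<n. of_int (\<Sum>i<n. mm a $$ (i,j) * v $ i) * b j)"
  by (subst sum.swap) (simp add: sum_distrib_right)
 also have "... = 0" by (rule sum.neutral) (simp add: z del: of_int_sum)
 finally have "(\<Sum>i<n. of_int (v $ i) * b i) = 0" using a by simp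
 then have "v $ i = 0" if "i < n" for i using indep[of "%i. v $ i"] that by blast
 then have "v = 0\<^sub>v n" using v(1) by (intro eq_vecI) auto
 then show False using v by simp
qed

lemma mm_bound: "bx r a ==> i < n ==> j < n ==> real_of_int \<bar>mm a $$ (i,j)\<bar> \<le> kc * r"
 using bx_mult[OF _ bx_b, of r a i] by (auto simp: bx_def mm_def)

text \<open>The entries of the adjugate are minors of size \<open>n - 1\<close> of a matrix with
  entries \<open>O(r)\<close>, whence the exponent.\<close>

lemma conj_bound: "\<exists>C\<ge>1. \<forall>r a. r \<ge> 0 --> bx r a --> bx (C * r ^ (n - 1)) (conj a)"
proof -
 define C where "C = 1 + (\<Sum>k<n. real_of_int \<bar>co 1 k\<bar>) * (fact (n - 1) * kc ^ (n - 1))"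
 have "bx (C * r ^ (n - 1)) (conj a)" if r: "r \<ge> 0" "bx r a" for r a
 proof -
  have adj: "real_of_int \<bar>adj_mat (mm a) $$ (k,i)\<bar> \<le> fact (n - 1) * (kc * r) ^ (n - 1)" if ki: "k < n" "i < n" for k i
  proof -
   have "adj_mat (mm a) $$ (k,i) = (-1)^(i+k) * det (mat_delete (mm a) i k)"
    using ki by (simp add: adj_mat_def cofactor_def)
   then have "\<bar>adj_mat (mm a) $$ (k,i)\<bar> = \<bar>det (mat_delete (mm a) i k)\<bar>"
    by (simp add: abs_mult power_abs)
   also have "real_of_int ... \<le> fact (n - 1) * (kc * r) ^ (n - 1)"
    by (rule det_bound[OF mat_delete_carrier[OF mm_carrier]])
     (use ki mm_bound[OF r(2)] in \<open>auto simp: mat_delete_def\<close>)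
   finally show ?thesis .
  qed
  have "real_of_int \<bar>co (conj a) i\<bar> \<le> C * r ^ (n - 1)" if i: "i < n" for i
  proof -
   have "co (conj a) i = (\<Sum>k<n. co 1 k * adj_mat (mm a) $$ (k,i))"
    unfolding conj_def using i by (subst co_sum) (auto intro!: comb_in simp del: of_int_mult)
   then have "real_of_int \<bar>co (conj a) i\<bar> \<le> (\<Sum>k<n. real_of_int \<bar>co 1 k\<bar> * real_of_int \<bar>adj_mat (mm a) $$ (k,i)\<bar>)"
    by (simp flip: of_int_mult of_int_abs of_int_sum abs_mult add: sum_abs)
   also have "... \<le> (\<Sum>k<n. real_of_int \<bar>co 1 k\<bar> * (fact (n - 1) * (kc * r) ^ (n - 1)))"
    using adj i by (intro sum_mono mult_left_mono) auto
   also have "... = (C - 1) * r ^ (n - 1)" by (simp only: sum_distrib_right[symmetric] C_def power_mult_distrib) (simp add: mult_ac)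
   also have "... \<le> C * r ^ (n - 1)" using r by (intro mult_right_mono) auto
   finally show ?thesis .
  qed
  then show ?thesis using conj_in by (auto simp: bx_def)
 qed
 moreover have "C \<ge> 1" unfolding C_def using kc_ge by (auto intro!: mult_nonneg_nonneg sum_nonneg)
 ultimately show ?thesis by blast
qed

definition ideal :: "complex set => bool" where
 "ideal I \<longleftrightarrow> subgrp I \<and> I \<subseteq> R \<and> (\<forall>x\<in>R. \<forall>y\<in>I. x * y \<in> I)"

lemma idealD: "ideal I ==> subgrp I" "ideal I ==> x \<in> I ==> x \<in> R" "ideal I ==> x \<in> R ==> y \<in> I ==> x * y \<in> I"
 "ideal I ==> x \<in> R ==> y \<in> I ==> y * x \<in> I"
 by (auto simp: ideal_def mult.commute)

definition mul :: "complex => complex set" where "mul a = (*) a ` R"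

lemma ideal_mul: "a \<in> R ==> ideal (mul a)"
 unfolding ideal_def subgrp_def mul_def
proof (intro conjI ballI)
 assume a: "a \<in> R"
 show "0 \<in> (*) a ` R" using zero_in by force
 show "x - y \<in> (*) a ` R" if "x \<in> (*) a ` R" "y \<in> (*) a ` R" for x y
  using that subgrp_diff[OF subgrp_R] by (auto simp flip: right_diff_distrib)
 show "(*) a ` R \<subseteq> R" using a mult by auto
 show "x * y \<in> (*) a ` R" if "x \<in> R" "y \<in> (*) a ` R" for x y
  using that mult by (auto simp: image_iff mult.left_commute[of x a])
qed

lemma mul_iff: "x \<in> mul a \<longleftrightarrow> (\<exists>y\<in>R. x = a * y)" by (auto simp: mul_def)

text \<open>Division with remainder: with \<open>d = dt a\<close>, the quotient \<open>z / a\<close>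
  equals \<open>conj a * z / d\<close>. Subtracting the coordinatewise floor leaves \<open>a\<close>
  times an element with rational coordinates in the half-open unit cube.\<close>

lemma small_rep:
 assumes a: "a \<noteq> 0" "bx r a" and z: "z \<in> R"
 shows "\<exists>y. z - y \<in> mul a \<and> bx (n * (kc * r)) y"
proof -
 have aR: "a \<in> R" by (rule bx_in[OF a(2)])
 define d where "d = dt a"
 have d: "d \<noteq> 0" using dt_nz[OF aR a(1)] by (simp add: d_def)
 define c where "c = co (conj a * z)"
 define q where "q = (\<Sum>i<n. of_int (c i div d) * b i)"
 define y where "y = z - a * q"
 have q: "q \<in> R" unfolding q_def by (rule comb_in)
 have yR: "y \<in> R" unfolding y_def using z q aR by (intro subgrp_diff[OF subgrp_R] mult)
 have "of_int d * z = a * (conj a * z)" using mult_conj[OF aR] by (simp add: d_def mult.assoc)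
 also have "conj a * z = (\<Sum>i<n. of_int (c i) * b i)" unfolding c_def by (rule co_eq) (intro mult conj_in z)
 finally have "of_int d * y = a * ((\<Sum>i<n. of_int (c i) * b i) - of_int d * q)"
  by (simp add: y_def algebra_simps)
 also have "(\<Sum>i<n. of_int (c i) * b i) - of_int d * q = (\<Sum>i<n. of_int (c i mod d) * b i)"
  unfolding q_def sum_distrib_left sum_subtractf[symmetric]
  by (rule sum.cong) (simp_all add: minus_div_mult_eq_mod[symmetric] algebra_simps)
 also have "a * ... = (\<Sum>i<n. of_int (c i mod d) * (a * b i))" by (simp add: sum_distrib_left mult_ac)
 finally have dy: "of_int d * y = (\<Sum>i<n. of_int (c i mod d) * (a * b i))" .
 have "real_of_int \<bar>co y j\<bar> \<le> n * (kc * r)" if j: "j < n" for j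
 proof -
  have "co (of_int d * y) j = co (\<Sum>i<n. of_int (c i mod d) * (a * b i)) j" by (simp only: dy)
  then have "d * co y j = (\<Sum>i<n. (c i mod d) * co (a * b i) j)"
   using co_lincomb[of "{..<n}" "%i. a * b i" j "%i. c i mod d"] j co_smult[OF yR j, of d] mult[OF aR b_in] by simp
  then have "\<bar>d\<bar> * \<bar>co y j\<bar> \<le> (\<Sum>i<n. \<bar>c i mod d\<bar> * \<bar>co (a * b i) j\<bar>)"
   by (simp flip: abs_mult add: sum_abs)
  then have "real_of_int \<bar>d\<bar> * real_of_int \<bar>co y j\<bar> \<le> (\<Sum>i<n. real_of_int \<bar>c i mod d\<bar> * real_of_int \<bar>co (a * b i) j\<bar>)"
   by (simp flip: of_int_mult of_int_sum of_int_abs)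
  also have "... \<le> (\<Sum>i<n. real_of_int \<bar>d\<bar> * (kc * r))"
  proof (intro sum_mono mult_mono)
   fix i assume "i \<in> {..<n}"
   then show "real_of_int \<bar>co (a * b i) j\<bar> \<le> kc * r" using mm_bound[OF a(2), of i j] j by (simp add: mm_def)
   show "real_of_int \<bar>c i mod d\<bar> \<le> real_of_int \<bar>d\<bar>" using abs_mod_less[OF d, of "c i"] by linarith
  qed auto
  finally have "real_of_int \<bar>d\<bar> * real_of_int \<bar>co y j\<bar> \<le> real_of_int \<bar>d\<bar> * (n * (kc * r))" by (simp add: mult_ac)
  then show ?thesis using d by (simp add: mult_le_cancel_left)
 qed
 then have "bx (n * (kc * r)) y" using yR by (auto simp: bx_def)
 moreover have "z - y \<in> mul a" using q by (auto simp: y_def mul_def)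
 ultimately show ?thesis by blast
qed

lemma idx_mul_le:
 assumes a: "a \<noteq> 0" "bx r a"
 shows "finite (cosets R (mul a))" "real (idx R (mul a)) \<le> (2 * (n * (kc * r)) + 1) ^ n"
proof -
 have aR: "a \<in> R" using a bx_in by blast
 have s: "subgrp (mul a)" by (rule idealD(1)[OF ideal_mul[OF aR]])
 define s where "s = \<lfloor>n * (kc * r)\<rfloor>"
 have cov: "\<exists>e\<in>ibox (- s) (s + 1). z - e \<in> mul a" if "z \<in> R" for z
 proof -
  obtain y where "z - y \<in> mul a" "bx (n * (kc * r)) y" using small_rep[OF a \<open>z \<in> R\<close>] by (elim exE conjE)
  then show ?thesis using bx_ibox[of "n * (kc * r)" y] unfolding s_def by (intro bexI[of _ y])
 qed
 show "finite (cosets R (mul a))" by (rule idx_le_card(1)[OF s finite_ibox cov])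
 have "s \<ge> 0" unfolding s_def using bx_nonneg[OF a(2)] kc_ge by simp
 then have "real (card (ibox (- s) (s + 1))) = (2 * s + 1) ^ n" by (simp add: card_ibox)
 also have "... \<le> (2 * (n * (kc * r)) + 1) ^ n"
  using \<open>s \<ge> 0\<close> by (simp add: s_def) (intro power_mono, linarith, simp)
 finally show "real (idx R (mul a)) \<le> (2 * (n * (kc * r)) + 1) ^ n"
  using of_nat_mono[OF idx_le_card(2)[where H = R, OF s finite_ibox cov], where 'a = real] by linarith
qed

lemma finite_mul: "a \<in> R ==> a \<noteq> 0 ==> finite (cosets R (mul a))"
 by (meson ex_bx idx_mul_le(1))

lemma idx_mul_int:
 assumes k: "k \<noteq> 0"
 shows "idx R (mul (of_int k)) = nat \<bar>k\<bar> ^ n"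
proof -
 have s: "subgrp (mul (of_int k))" by (rule idealD(1)[OF ideal_mul[OF of_int_in]])
 define f where "f x = restrict (%i. co x i mod \<bar>k\<bar>) {..<n}" for x
 have "f x = f y \<longleftrightarrow> x - y \<in> mul (of_int k)" if "x \<in> R" "y \<in> R" for x y
 proof -
  have "f x = f y \<longleftrightarrow> (\<forall>i<n. co x i mod \<bar>k\<bar> = co y i mod \<bar>k\<bar>)"
   unfolding f_def fun_eq_iff restrict_def by (metis lessThan_iff)
  also have "... \<longleftrightarrow> (\<forall>i<n. k dvd co (x - y) i)"
   using that by (simp add: co_diff mod_eq_dvd_iff)
  also have "... \<longleftrightarrow> x - y \<in> mul (of_int k)"
  proof
   assume d: "\<forall>i<n. k dvd co (x - y) i"
   have "x - y = (\<Sum>i<n. of_int (co (x - y) i) * b i)" by (rule co_eq[OF subgrp_diff[OF subgrp_R that]])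
   also have "... = (\<Sum>i<n. of_int (k * (co (x - y) i div k)) * b i)"
    by (rule sum.cong) (use d in auto)
   also have "... = of_int k * (\<Sum>i<n. of_int (co (x - y) i div k) * b i)"
    by (simp add: sum_distrib_left mult.assoc)
   finally show "x - y \<in> mul (of_int k)" unfolding mul_iff by (rule bexI[OF _ comb_in])
  next
   assume "x - y \<in> mul (of_int k)"
   then show "\<forall>i<n. k dvd co (x - y) i" by (auto simp: mul_iff co_smult)
  qed
  finally show ?thesis .
 qed
 then have "idx R (mul (of_int k)) = card (f ` R)" by (rule cosets_image(1)[OF s])
 also have "f ` R = {..<n} \<rightarrow>\<^sub>E {0..<\<bar>k\<bar>}"
 proof
  show "f ` R \<subseteq> {..<n} \<rightarrow>\<^sub>E {0..<\<bar>k\<bar>}" using k by (auto simp: f_def)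
  show "{..<n} \<rightarrow>\<^sub>E {0..<\<bar>k\<bar>} \<subseteq> f ` R"
  proof
   fix c assume c: "c \<in> {..<n} \<rightarrow>\<^sub>E {0..<\<bar>k\<bar>}"
   have "c = f (\<Sum>i<n. of_int (c i) * b i)"
   proof
    fix i show "c i = f (\<Sum>i<n. of_int (c i) * b i) i"
     using c PiE_mem[OF c, of i] PiE_arb[OF c, of i] by (cases "i < n") (auto simp: f_def)
   qed
   then show "c \<in> f ` R" by (rule image_eqI[OF _ comb_in])
  qed
 qed
 also have "card ... = nat \<bar>k\<bar> ^ n" by (simp add: card_PiE)
 finally show ?thesis .
qed

text \<open>Division by \<open>a\<close> identifies \<open>aR / acR\<close> with
  \<open>R / cR\<close>.\<close>

lemma idx_mul_mult:
 assumes a: "a \<in> R" "a \<noteq> 0" and c: "c \<in> R" "c \<noteq> 0"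
 shows "idx R (mul (a * c)) = idx R (mul a) * idx R (mul c)"
proof -
 have s: "subgrp (mul a)" "subgrp (mul c)" "subgrp (mul (a * c))"
  using ideal_mul idealD(1) a c mult by auto
 have sub: "mul (a * c) \<subseteq> mul a" "mul a \<subseteq> R" using a c mult by (auto simp: mul_def mult.assoc)
 define f where "f x = (+) (x / a) ` mul c" for x
 have ff: "f x = f y \<longleftrightarrow> x - y \<in> mul (a * c)" if "x \<in> mul a" "y \<in> mul a" for x y
  unfolding f_def coset_eq_iff[OF s(2)] using a by (auto simp: mul_iff field_simps)
 have "f ` mul a = cosets R (mul c)"
  unfolding f_def mul_def[of a] cosets_def using a by (auto simp: image_image)
 then have e: "idx (mul a) (mul (a * c)) = idx R (mul c)"
  using cosets_image(1)[OF s(3), of "mul a" f] ff by (auto simp: idx_def)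
 have fin: "finite (cosets R (mul (a * c)))" using finite_mul a c mult by simp
 show ?thesis
  using idx_tower(2)[OF subgrp_R s(1) s(3) sub finite_mul[OF a] cosets_finite_mono(2)[OF s(1) s(3) sub fin]] e by simp
qed

text \<open>Pigeonhole in the role of Minkowski's theorem: a box with \<open>(t + 1) ^ n\<close>
  points contains two distinct points congruent modulo \<open>I\<close>.\<close>

lemma small_element:
 assumes I: "ideal I" and f: "finite (cosets R I)" and t: "idx R I < (t + 1) ^ n"
 shows "\<exists>a\<in>I. a \<noteq> 0 \<and> bx (real t) a"
proof -
 have s: "subgrp I" by (rule idealD(1)[OF I])
 have "\<not> inj_on (%x. (+) x ` I) (ibox 0 (int t + 1))"
 proof
  assume inj: "inj_on (%x. (+) x ` I) (ibox 0 (int t + 1))"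
  have "card (ibox 0 (int t + 1)) \<le> card (cosets R I)"
   by (rule card_inj_on_le[OF inj]) (use f in \<open>auto simp: cosets_def ibox_def\<close>)
  moreover have "nat (int t + 1 - 0) = t + 1" by simp
  ultimately show False using t by (simp add: card_ibox idx_def)
 qed
 then obtain x y where xy: "x \<in> ibox 0 (int t + 1)" "y \<in> ibox 0 (int t + 1)" "x \<noteq> y" "x - y \<in> I"
  using coset_eq_iff[OF s] by (auto simp: inj_on_def)
 have "real_of_int \<bar>co (x - y) i\<bar> \<le> real t" if "i < n" for i
 proof -
  have "0 \<le> co x i" "co x i \<le> int t" "0 \<le> co y i" "co y i \<le> int t"
   using xy that unfolding ibox_def by force+
  then have "\<bar>co x i - co y i\<bar> \<le> int t" by linarith
  then show ?thesis using co_diff[of x y i] xy that unfolding ibox_def by (metis (mono_tags, lifting) mem_Collect_eq of_int_le_iff of_int_of_nat_eq)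
 qed
 then have "bx (real t) (x - y)" using xy subgrp_diff[OF subgrp_R] by (auto simp: bx_def ibox_def)
 then show ?thesis using xy by (intro bexI[of _ "x - y"]) auto
qed

text \<open>A small element of \<open>I\<close> yields representatives of \<open>R\<close> modulo
  \<open>I\<close> of size \<open>O(t)\<close>. The points of \<open>E\<close> are all congruent
  modulo \<open>I\<close>, so the translates of \<open>E\<close> by these representatives are
  disjoint, and they fit into a slightly enlarged box.\<close>

lemma coset_count:
 assumes I: "ideal I" and f: "finite (cosets R I)" and t: "idx R I < (t + 1) ^ n"
  and E: "E \<subseteq> ibox 0 (int L)" "\<And>x y. x \<in> E ==> y \<in> E ==> x - y \<in> I"
 shows "real (card E * idx R I) \<le> (real L + 2 * (n * (kc * t))) ^ n"
proof -
 have sI: "subgrp I" by (rule idealD(1)[OF I])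
 obtain a where a: "a \<in> I" "a \<noteq> 0" "bx (real t) a" using small_element[OF I f t] by blast
 obtain F0 where F0: "F0 \<subseteq> R" "finite F0" "card F0 = idx R I"
  "\<And>r s. r \<in> F0 ==> s \<in> F0 ==> r - s \<in> I ==> r = s" using cosets_reps[OF sI f] by metis
 have "\<exists>y. r - y \<in> I \<and> bx (n * (kc * t)) y" if "r \<in> F0" for r
 proof -
  have "r \<in> R" using that F0(1) by blast
  from small_rep[OF a(2,3) this] obtain y where y: "r - y \<in> mul a" "bx (n * (kc * t)) y" by (elim exE conjE)
  then have "r - y \<in> I" using idealD(4)[OF I _ a(1)] by (auto simp: mul_iff)
  with y show ?thesis by blast
 qed
 then obtain h where h: "\<And>r. r \<in> F0 ==> r - h r \<in> I" "\<And>r. r \<in> F0 ==> bx (n * (kc * t)) (h r)" by metis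
 define s where "s = \<lfloor>n * (kc * t)\<rfloor>"
 have s0: "s \<ge> 0" unfolding s_def using kc_ge by simp
 have inj: "inj_on (%(x,r). x + h r) (E \<times> F0)"
 proof (rule inj_onI, clarify)
  fix x r y q assume A: "x \<in> E" "r \<in> F0" "y \<in> E" "q \<in> F0" "x + h r = y + h q"
  have "(r - h r) - (q - h q) - (x - y) \<in> I" by (rule subgrp_diff[OF sI subgrp_diff[OF sI h(1)[OF A(2)] h(1)[OF A(4)]] E(2)[OF A(1) A(3)]])
  moreover have "(r - h r) - (q - h q) - (x - y) = r - q" using A(5) by (simp add: algebra_simps)
  ultimately have "r = q" using F0(4) A by simp
  then show "x = y \<and> r = q" using A by simp
 qed
 have img: "(%(x,r). x + h r) ` (E \<times> F0) \<subseteq> ibox (- s) (int L + s)"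
 proof clarify
  fix x r assume A: "x \<in> E" "r \<in> F0"
  have "x \<in> ibox 0 (int L)" "h r \<in> ibox (- s) (s + 1)" using A E h(2) bx_ibox s_def by auto
  then show "x + h r \<in> ibox (- s) (int L + s)"
   unfolding ibox_def by (auto simp: co_add subgrp_add[OF subgrp_R]) (smt (verit))+
 qed
 have "card (E \<times> F0) \<le> card (ibox (- s) (int L + s))"
  by (rule card_inj_on_le[OF inj img finite_ibox])
 then have "card E * idx R I \<le> nat (int L + 2 * s) ^ n"
  using F0 by (simp add: card_cartesian_product card_ibox algebra_simps)
 then have "real (card E * idx R I) \<le> real (nat (int L + 2 * s)) ^ n"
  by (metis of_nat_le_iff of_nat_power)
 also have "... \<le> (real L + 2 * (n * (kc * t))) ^ n"
 proof (rule power_mono)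
  have "real (nat (int L + 2 * s)) = real L + 2 * of_int s" using s0 by simp
  also have "of_int s \<le> n * (kc * t)" by (simp add: s_def)
  finally show "real (nat (int L + 2 * s)) \<le> real L + 2 * (n * (kc * t))" by simp
 qed simp
 finally show ?thesis .
qed

end

abbreviation is_prime :: "'a::normalization_semidom => bool" where
 "is_prime \<equiv> normalization_semidom_class.prime"

section \<open>Traces of matrices that are nilpotent modulo a prime\<close>

lemma dvd_prod_diff:
 fixes f g :: "'b => 'a::comm_ring_1"
 assumes "finite A" "\<And>i. i \<in> A ==> d dvd f i - g i"
 shows "d dvd prod f A - prod g A"
 using assms
proof (induction A rule: finite_induct)
 case (insert x A)
 have "prod f (insert x A) - prod g (insert x A) = f x * (prod f A - prod g A) + (f x - g x) * prod g A"
  using insert by (simp add: algebra_simps)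
 moreover have "d dvd f x * (prod f A - prod g A)" using insert by (intro dvd_mult) auto
 moreover have "d dvd (f x - g x) * prod g A" using insert by (intro dvd_mult2) auto
 ultimately show ?case by (simp only: dvd_add)
qed simp

lemma det_cong_dvd:
 fixes A B :: "'a::comm_ring_1 mat"
 assumes A: "A \<in> carrier_mat n n" and B: "B \<in> carrier_mat n n"
  and d: "\<And>i j. i < n ==> j < n ==> d dvd A $$ (i,j) - B $$ (i,j)"
 shows "d dvd det A - det B"
proof -
 have "det A - det B = (\<Sum>p\<in>{p. p permutes {0..<n}}.
   signof p * ((\<Prod>i = 0..<n. A $$ (i, p i)) - (\<Prod>i = 0..<n. B $$ (i, p i))))"
  unfolding det_def'[OF A] det_def'[OF B] by (simp add: sum_subtractf right_diff_distrib)
 also have "d dvd ..."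
 proof (rule dvd_sum)
  fix p assume "p \<in> {p. p permutes {0..<n}}"
  then have "p permutes {0..<n}" by simp
  then show "d dvd signof p * ((\<Prod>i = 0..<n. A $$ (i, p i)) - (\<Prod>i = 0..<n. B $$ (i, p i)))"
   by (intro dvd_mult dvd_prod_diff d) (simp_all add: permutes_lt)
 qed
 finally show ?thesis .
qed

definition trc :: "'a::comm_ring_1 mat => 'a" where
 "trc A = (\<Sum>i<dim_row A. A $$ (i,i))"

text \<open>Induction through the derivative, which is the sum of the characteristic polynomials of
  the principal submatrices of one size less. Each diagonal entry is missing from exactly one of
  their traces.\<close>

lemma coeff_char_poly_trace:
 fixes A :: "int mat"
 assumes "A \<in> carrier_mat n n" "n > 0"
 shows "poly.coeff (char_poly A) (n - 1) = - trc A"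
 using assms
proof (induction n arbitrary: A)
 case (Suc m)
 show ?case
 proof (cases "m = 0")
  case True
  then have A: "A \<in> carrier_mat 1 1" using Suc.prems by simp
  have "char_poly A = [:- A $$ (0,0), 1:]"
   unfolding char_poly_def using A by (subst det_single[of _]) (auto simp: char_poly_matrix_def)
  then show ?thesis using True A by (simp add: trc_def)
 next
  case False
  have del: "mat_delete A i i \<in> carrier_mat m m" for i
   using mat_delete_carrier[OF Suc.prems(1), of i i] by simp
  have tr: "trc (mat_delete A i i) = trc A - A $$ (i,i)" if i: "i < Suc m" for i
  proof -
   have "trc (mat_delete A i i) = (\<Sum>k<m. A $$ (if k < i then k else Suc k, if k < i then k else Suc k))"
    unfolding trc_def using Suc.prems(1) i by (auto simp: mat_delete_def intro!: sum.cong)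
   also have "... = (\<Sum>k\<in>{..<Suc m} - {i}. A $$ (k,k))"
    by (rule sum.reindex_bij_witness[of _ "%k. if k < i then k else k - 1" "%k. if k < i then k else Suc k"])
     (use i in \<open>auto split: if_splits\<close>)
   also have "... = trc A - A $$ (i,i)"
    unfolding trc_def using Suc.prems(1) i by (simp add: sum_diff1)
   finally show ?thesis .
  qed
  have "of_nat m * poly.coeff (char_poly A) m = poly.coeff (pderiv (char_poly A)) (m - 1)"
   using False by (simp add: coeff_pderiv)
  also have "... = (\<Sum>i<Suc m. poly.coeff (char_poly (mat_delete A i i)) (m - 1))"
   unfolding pderiv_char_poly[OF Suc.prems(1)] by (simp add: coeff_sum)
  also have "... = (\<Sum>i<Suc m. - (trc A - A $$ (i,i)))"
  proof (rule sum.cong[OF refl])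
   fix i assume "i \<in> {..<Suc m}"
   then show "poly.coeff (char_poly (mat_delete A i i)) (m - 1) = - (trc A - A $$ (i,i))"
    using Suc.IH[OF del] False tr[of i] by simp
  qed
  also have "... = of_nat m * (- trc A)"
  proof -
   have "(\<Sum>i<Suc m. A $$ (i,i)) = trc A" using Suc.prems(1) by (simp add: trc_def)
   then have "(\<Sum>i<Suc m. - (trc A - A $$ (i,i))) = trc A - of_nat (Suc m) * trc A"
    by (simp only: sum_negf sum_subtractf sum_constant card_lessThan)
   then show ?thesis by (simp add: algebra_simps)
  qed
  finally have "of_nat m * poly.coeff (char_poly A) m = of_nat m * (- trc A)" .
  then have "m = 0 \<or> poly.coeff (char_poly A) m = - trc A"
   by (simp only: mult_cancel_left of_nat_eq_0_iff)
  then show ?thesis using False by simp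
 qed
qed simp

text \<open>The product of the characteristic polynomials of \<open>A\<close> and \<open>- A\<close> is \<open>det (x\<^sup>2 - A\<^sup>2)\<close>,
 which is \<open>x\<close> to the power \<open>2 n\<close> modulo \<open>p\<close>; compare lowest nonvanishing coefficients.\<close>

lemma trace_nilpotent_mod:
 fixes A :: "int mat"
 assumes A: "A \<in> carrier_mat n n" and n: "n > 0" and p: "is_prime p"
  and sq: "\<And>i j. i < n ==> j < n ==> p dvd (A * A) $$ (i,j)"
 shows "p dvd trc A"
proof -
 define P where "P = char_poly_matrix A"
 define Q where "Q = char_poly_matrix (- A)"
 have c: "P \<in> carrier_mat n n" "Q \<in> carrier_mat n n" using A by (auto simp: P_def Q_def)
 define x2 where "x2 = (Polynomial.monom 1 2 :: int poly)"
 have ent: "(P * Q) $$ (i,j) - (x2 \<cdot>\<^sub>m 1\<^sub>m n) $$ (i,j) = [:- (A * A) $$ (i,j):]" if ij: "i < n" "j < n" for i j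
 proof -
  have Pe: "P $$ (i,k) = (if i = k then [:0,1:] else 0) + [:- A $$ (i,k):]" if "k < n" for k
   using A ij that by (auto simp: P_def char_poly_matrix_def)
  have Qe: "Q $$ (k,j) = (if k = j then [:0,1:] else 0) + [:A $$ (k,j):]" if "k < n" for k
   using A ij that by (auto simp: Q_def char_poly_matrix_def)
  have "(P * Q) $$ (i,j) = (\<Sum>k<n. P $$ (i,k) * Q $$ (k,j))"
   using c ij by (simp add: scalar_prod_def atLeast0LessThan)
  also have "... = (\<Sum>k<n. (if i = k then [:0,1:] * Q $$ (k,j) else 0) + ((if k = j then [:- A $$ (i,k):] * [:0,1:] else 0) + [:- A $$ (i,k):] * [:A $$ (k,j):]))"
   by (rule sum.cong) (auto simp: Pe Qe algebra_simps)
  also have "... = [:0,1:] * Q $$ (i,j) + ([:- A $$ (i,j):] * [:0,1:] + (\<Sum>k<n. [:- (A $$ (i,k) * A $$ (k,j)):]))"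
   using ij by (simp add: sum.distrib mult.commute)
  also have "(\<Sum>k<n. [:- (A $$ (i,k) * A $$ (k,j)):]) = [:- (\<Sum>k<n. A $$ (i,k) * A $$ (k,j)):]"
   by (induction n) auto
  also have "(\<Sum>k<n. A $$ (i,k) * A $$ (k,j)) = (A * A) $$ (i,j)"
   using A ij by (simp add: scalar_prod_def atLeast0LessThan)
  finally have "(P * Q) $$ (i,j) = [:0,1:] * Q $$ (i,j) + ([:- A $$ (i,j):] * [:0,1:] + [:- (A * A) $$ (i,j):])" by simp
  moreover have "x2 = [:0,0,1:]" by (simp add: x2_def monom_altdef power2_eq_square)
  ultimately show ?thesis using ij by (simp add: Qe algebra_simps)
 qed
 have "[:p:] dvd det (P * Q) - det (x2 \<cdot>\<^sub>m 1\<^sub>m n)"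
  by (rule det_cong_dvd[of _ n]) (use c ent sq in \<open>auto simp: x2_def\<close>)
 moreover have "det (P * Q) = char_poly A * char_poly (- A)"
  using det_mult[OF c] by (simp add: P_def Q_def char_poly_def)
 moreover have "det (x2 \<cdot>\<^sub>m 1\<^sub>m n) = Polynomial.monom 1 (2 * n)"
  by (simp add: det_smult x2_def monom_power)
 ultimately have dv: "[:p:] dvd char_poly A * char_poly (- A) - Polynomial.monom 1 (2 * n)" by simp
 define a where "a = poly.coeff (char_poly A)"
 define b where "b = poly.coeff (char_poly (- A))"
 have prod: "p dvd (\<Sum>i\<le>k. a i * b (k - i))" if "k < 2 * n" for k
 proof -
  have "p dvd poly.coeff (char_poly A * char_poly (- A) - Polynomial.monom 1 (2 * n)) k"
   using dv by (auto simp: const_poly_dvd_iff)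
  then show ?thesis using that by (simp add: coeff_mult a_def b_def)
 qed
 have np: "\<not> p dvd 1" using p by auto
 have an: "\<not> p dvd a n" "\<not> p dvd b n"
  using degree_monic_char_poly[OF A] degree_monic_char_poly[of "- A" n] A np by (auto simp: a_def b_def)
 define i where "i = (LEAST i. \<not> p dvd a i)"
 define j where "j = (LEAST i. \<not> p dvd b i)"
 have i: "\<not> p dvd a i" "i \<le> n" "\<And>k. k < i ==> p dvd a k"
 proof -
  show "\<not> p dvd a i" unfolding i_def by (rule LeastI) (rule an(1))
  show "i \<le> n" unfolding i_def by (rule Least_le) (rule an(1))
  show "p dvd a k" if "k < i" for k
   using not_less_Least[of k "%i. \<not> p dvd a i"] that unfolding i_def by simp
 qed
 have j: "\<not> p dvd b j" "j \<le> n" "\<And>k. k < j ==> p dvd b k"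
 proof -
  show "\<not> p dvd b j" unfolding j_def by (rule LeastI) (rule an(2))
  show "j \<le> n" unfolding j_def by (rule Least_le) (rule an(2))
  show "p dvd b k" if "k < j" for k
   using not_less_Least[of k "%i. \<not> p dvd b i"] that unfolding j_def by simp
 qed
 \<comment> \<open>\<open>a i\<close> and \<open>b j\<close> are the lowest coefficients not
   divisible by \<open>p\<close>, so \<open>a i * b j\<close> is the only summand of the coefficient
   of degree \<open>i + j\<close> that \<open>p\<close> does not divide. Below degree
   \<open>2 * n\<close> the whole coefficient is divisible by \<open>p\<close>; hence
   \<open>i = j = n\<close>.\<close>
 have "\<not> i + j < 2 * n"
 proof
  assume "i + j < 2 * n"
  then have "p dvd (\<Sum>k\<le>i + j. a k * b (i + j - k))" by (rule prod)
  also have "(\<Sum>k\<le>i + j. a k * b (i + j - k)) = a i * b j + (\<Sum>k\<in>{..i + j} - {i}. a k * b (i + j - k))"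
   by (subst sum.remove[of _ i]) auto
  finally have "p dvd a i * b j + (\<Sum>k\<in>{..i + j} - {i}. a k * b (i + j - k))" .
  moreover have "p dvd (\<Sum>k\<in>{..i + j} - {i}. a k * b (i + j - k))"
  proof (rule dvd_sum)
   fix k assume k: "k \<in> {..i + j} - {i}"
   then have "k < i \<or> i + j - k < j" by auto
   then show "p dvd a k * b (i + j - k)" using i(3) j(3) by (meson dvd_mult dvd_mult2)
  qed
  ultimately have "p dvd a i * b j" by (simp add: dvd_add_left_iff)
  then show False using i(1) j(1) p by (simp add: prime_dvd_mult_iff)
 qed
 then have "i = n" using i(2) j(2) by auto
 then have "p dvd a (n - 1)" using i(3)[of "n - 1"] n by auto
 then show ?thesis using coeff_char_poly_trace[OF A n] by (simp add: a_def)
qed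

context nring
begin

lemma mul_int_iff: "x \<in> R ==> x \<in> mul (of_int k) \<longleftrightarrow> (\<forall>i<n. k dvd co x i)"
proof
 assume x: "x \<in> R" and d: "\<forall>i<n. k dvd co x i"
 have "x = (\<Sum>i<n. of_int (co x i) * b i)" by (rule co_eq[OF x])
 also have "... = (\<Sum>i<n. of_int (k * (co x i div k)) * b i)"
  by (rule sum.cong) (use d in auto)
 also have "... = of_int k * (\<Sum>i<n. of_int (co x i div k) * b i)"
  by (simp add: sum_distrib_left mult.assoc)
 finally show "x \<in> mul (of_int k)" unfolding mul_iff by (rule bexI[OF _ comb_in])
next
 assume "x \<in> mul (of_int k)"
 then show "\<forall>i<n. k dvd co x i" by (auto simp: mul_iff co_smult)
qed

section \<open>Trace form and discriminant of an order\<close>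

definition tr :: "complex => int" where "tr x = (\<Sum>i<n. co (x * b i) i)"

lemma tr_lincomb: "(\<And>j. j \<in> A ==> f j \<in> R) ==> tr (\<Sum>j\<in>A. of_int (k j) * f j) = (\<Sum>j\<in>A. k j * tr (f j))"
proof -
 assume f: "\<And>j. j \<in> A ==> f j \<in> R"
 have "tr (\<Sum>j\<in>A. of_int (k j) * f j) = (\<Sum>i<n. \<Sum>j\<in>A. k j * co (f j * b i) i)"
  unfolding tr_def
 proof (rule sum.cong[OF refl])
  fix i assume i: "i \<in> {..<n}"
  have "(\<Sum>j\<in>A. of_int (k j) * f j) * b i = (\<Sum>j\<in>A. of_int (k j) * (f j * b i))"
   by (simp add: sum_distrib_right mult.assoc)
  then show "co ((\<Sum>j\<in>A. of_int (k j) * f j) * b i) i = (\<Sum>j\<in>A. k j * co (f j * b i) i)"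
   using co_lincomb[of A "%j. f j * b i" i k] i mult[OF f b_in] by simp
 qed
 then show ?thesis by (subst (asm) sum.swap) (simp add: tr_def sum_distrib_left)
qed

lemma tr_of_int: "tr (of_int k) = int n * k"
proof -
 have "co (of_int k * b i) i = k" if "i < n" for i using co_smult[OF b_in[OF that] that, of k] co_b[OF that that] by simp
 then show ?thesis by (simp add: tr_def)
qed

lemma mm_square: "a \<in> R ==> i < n ==> j < n ==> (mm a * mm a) $$ (i,j) = co (a * a * b i) j"
proof -
 assume a: "a \<in> R" and ij: "i < n" "j < n"
 have "a * a * b i = a * (\<Sum>k<n. of_int (mm a $$ (i,k)) * b k)"
  using mult_b[OF a ij(1)] by (simp add: mult.assoc)
 also have "... = (\<Sum>k<n. of_int (mm a $$ (i,k)) * (a * b k))"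
  by (simp add: sum_distrib_left mult.left_commute)
 finally have "co (a * a * b i) j = (\<Sum>k<n. mm a $$ (i,k) * co (a * b k) j)"
  using co_lincomb[of "{..<n}" "%k. a * b k" j "%k. mm a $$ (i,k)"] ij mult[OF a b_in] by simp
 then show ?thesis using ij by (simp add: scalar_prod_def atLeast0LessThan mm_def)
qed

lemma tr_nilpotent:
 assumes "is_prime p" "y \<in> R" "y * y \<in> mul (of_int p)"
 shows "p dvd tr y"
proof -
 have "p dvd (mm y * mm y) $$ (i,j)" if "i < n" "j < n" for i j
 proof -
  have "y * y * b i \<in> mul (of_int p)"
   using idealD(4)[OF ideal_mul[OF of_int_in] b_in[OF that(1)] assms(3)] .
  then show ?thesis using mul_int_iff[of "y * y * b i" p] mm_square[OF assms(2) that] mult[OF mult[OF assms(2,2)] b_in[OF that(1)]] that by simp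
 qed
 then have "p dvd trc (mm y)" by (rule trace_nilpotent_mod[OF mm_carrier n_pos assms(1)])
 then show ?thesis by (simp add: trc_def tr_def mm_def)
qed

definition dsc :: int where "dsc = det (mat n n (%(i,j). tr (b i * b j)))"

text \<open>An element \<open>y\<close> orthogonal to the basis is orthogonal to
  \<open>conj y\<close>, so the trace of the integer \<open>dt y\<close> is 0; but this trace is
  \<open>n * dt y\<close>.\<close>

lemma dsc_nz: "dsc \<noteq> 0"
proof
 define T where "T = mat n n (%(i,j). tr (b i * b j))"
 assume "dsc = 0"
 then obtain v where v: "v \<in> carrier_vec n" "v \<noteq> 0\<^sub>v n" "T *\<^sub>v v = 0\<^sub>v n"
  using det_0_iff_vec_prod_zero[of T n] by (auto simp: dsc_def T_def)
 define y where "y = (\<Sum>j<n. of_int (v $ j) * b j)"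
 have y: "y \<in> R" unfolding y_def by (rule comb_in)
 have z: "tr (b i * y) = 0" if i: "i < n" for i
 proof -
  have "(T *\<^sub>v v) $ i = 0" using v i by simp
  then have "(\<Sum>j<n. v $ j * tr (b i * b j)) = 0"
   using i v(1) by (simp add: T_def scalar_prod_def atLeast0LessThan carrier_vecD mult.commute)
  moreover have "b i * y = (\<Sum>j<n. of_int (v $ j) * (b i * b j))"
   by (simp add: y_def sum_distrib_left mult.left_commute)
  ultimately show ?thesis using tr_lincomb[of "{..<n}" "%j. b i * b j" "%j. v $ j"] mult[OF b_in[OF i] b_in] by simp
 qed
 have "y \<noteq> 0"
 proof
  assume "y = 0"
  then have "v $ i = 0" if "i < n" for i using indep[of "%i. v $ i" i] that by (simp add: y_def)
  then have "v = 0\<^sub>v n" using v(1) by (intro eq_vecI) auto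
  then show False using v by simp
 qed
 then have "dt y \<noteq> 0" using dt_nz[OF y] by simp
 have "of_int (dt y) = (\<Sum>i<n. of_int (co (conj y) i) * b i) * y"
  using mult_conj[OF y] co_eq[OF conj_in[of y]] by (simp add: mult.commute)
 also have "... = (\<Sum>i<n. of_int (co (conj y) i) * (b i * y))" by (simp add: sum_distrib_right mult.assoc)
 finally have "tr (of_int (dt y)) = (\<Sum>i<n. co (conj y) i * tr (b i * y))"
  using tr_lincomb[of "{..<n}" "%i. b i * y" "co (conj y)"] mult[OF b_in y] by simp
 also have "... = 0" by (rule sum.neutral) (simp add: z)
 finally show False using tr_of_int[of "dt y"] n_pos \<open>dt y \<noteq> 0\<close> by simp
qed

text \<open>If \<open>y\<close> squares to 0 modulo \<open>p\<close>, so do all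
  \<open>b i * y\<close>, and their traces are divisible by \<open>p\<close>. Hence the Gram matrix
  of the trace form kills the coordinates of \<open>y\<close> modulo \<open>p\<close>, and
  multiplying by its adjugate shows that \<open>p\<close> divides each
  \<open>dsc * co y j\<close>.\<close>

lemma reduced_mod:
 assumes p: "is_prime p" "\<not> p dvd dsc" and y: "y \<in> R" "y * y \<in> mul (of_int p)"
 shows "y \<in> mul (of_int p)"
proof -
 define T where "T = mat n n (%(i,j). tr (b i * b j))"
 have T: "T \<in> carrier_mat n n" by (simp add: T_def)
 have t: "p dvd (\<Sum>k<n. T $$ (i,k) * co y k)" if i: "i < n" for i
 proof -
  have "y * y * (b i * b i) \<in> mul (of_int p)"
   using idealD(4)[OF ideal_mul[OF of_int_in] mult[OF b_in[OF i] b_in[OF i]] y(2)] .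
  then have "(b i * y) * (b i * y) \<in> mul (of_int p)" by (simp add: mult_ac)
  then have "p dvd tr (b i * y)" using tr_nilpotent[OF p(1) mult[OF b_in[OF i] y(1)]] by simp
  moreover have "b i * y = (\<Sum>k<n. of_int (co y k) * (b i * b k))"
  proof -
   have "b i * y = b i * (\<Sum>k<n. of_int (co y k) * b k)" using co_eq[OF y(1)] by simp
   then show ?thesis by (simp add: sum_distrib_left mult.left_commute)
  qed
  ultimately show ?thesis
   using tr_lincomb[of "{..<n}" "%j. b i * b j" "co y"] mult[OF b_in[OF i] b_in] i by (simp add: T_def mult.commute)
 qed
 have "p dvd co y j" if j: "j < n" for j
 proof -
  have a: "adj_mat T \<in> carrier_mat n n" by (rule adj_mat(1)[OF T])
  have e: "(\<Sum>i<n. adj_mat T $$ (j,i) * T $$ (i,k)) = (if j = k then dsc else 0)" if k: "k < n" for k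
  proof -
   have "(adj_mat T * T) $$ (j,k) = (dsc \<cdot>\<^sub>m 1\<^sub>m n) $$ (j,k)"
    using adj_mat(3)[OF T] by (simp add: dsc_def T_def)
   then show ?thesis using a k j T by (simp add: scalar_prod_def atLeast0LessThan)
  qed
  have "(\<Sum>i<n. adj_mat T $$ (j,i) * (\<Sum>k<n. T $$ (i,k) * co y k)) = (\<Sum>i<n. \<Sum>k<n. adj_mat T $$ (j,i) * T $$ (i,k) * co y k)"
   by (simp add: sum_distrib_left mult.assoc)
  also have "... = (\<Sum>k<n. (\<Sum>i<n. adj_mat T $$ (j,i) * T $$ (i,k)) * co y k)"
   by (subst sum.swap) (simp add: sum_distrib_right)
  also have "... = (\<Sum>k<n. if j = k then dsc * co y k else 0)"
   by (rule sum.cong) (simp_all add: e)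
  also have "... = dsc * co y j" using j by simp
  finally have "dsc * co y j = (\<Sum>i<n. adj_mat T $$ (j,i) * (\<Sum>k<n. T $$ (i,k) * co y k))" by simp
  also have "p dvd ..." by (rule dvd_sum, rule dvd_mult, rule t) simp
  finally show ?thesis using p by (simp add: prime_dvd_mult_iff)
 qed
 then show ?thesis using mul_int_iff[OF y(1)] by simp
qed

end

section \<open>Maximal ideals\<close>

context nring
begin

lemma power_in: "x \<in> R ==> x ^ k \<in> R"
 by (rule subring_power[OF is_subring_R])

text \<open>The square of \<open>y ^ Suc h\<close> is a multiple of \<open>y ^ Suc k\<close> for
  \<open>h\<close> about half of \<open>k\<close>; the exponent is thus halved until the case of
  square zero is reached.\<close>

lemma reduced_mod_power:
 assumes p: "is_prime p" "\<not> p dvd dsc" and y: "y \<in> R"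
 shows "y ^ Suc k \<in> mul (of_int p) ==> y \<in> mul (of_int p)"
proof (induction k rule: less_induct)
 case (less k)
 have id: "ideal (mul (of_int p))" by (rule ideal_mul[OF of_int_in])
 show ?case
 proof (cases "k = 0")
  case False
  define h where "h = (k + 1) div 2"
  have h: "h < k \<or> k = 1" "k \<le> 2 * h" "2 * h \<le> k + 1" using False by (auto simp: h_def)
  show ?thesis
  proof (cases "k = 1")
   case True
   then show ?thesis using reduced_mod[OF p y] less.prems by simp
  next
   case k1: False
   then have hk: "h < k" using h by simp
   have "Suc h + Suc h = (2 * h + 1 - k) + Suc k" using h by simp
   then have e: "y ^ Suc h * y ^ Suc h = y ^ (2 * h + 1 - k) * y ^ Suc k"
    by (metis power_add)
   have "y ^ Suc h * y ^ Suc h \<in> mul (of_int p)"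
    unfolding e by (rule idealD(3)[OF id power_in[OF y] less.prems])
   then have "y ^ Suc h \<in> mul (of_int p)" by (rule reduced_mod[OF p power_in[OF y]])
   then show ?thesis by (rule less.IH[OF hk])
  qed
 qed (use less.prems in simp)
qed

text \<open>Maximality is expressed by inverses modulo \<open>M\<close> of the elements outside
  \<open>M\<close>, the form in which it enters all arguments.\<close>

definition maxid :: "complex set => bool" where
 "maxid M \<longleftrightarrow> ideal M \<and> finite (cosets R M) \<and> 1 \<notin> M \<and> (\<forall>s\<in>R - M. \<exists>r\<in>R. 1 - r * s \<in> M)"

lemma maxidD: "maxid M ==> ideal M" "maxid M ==> subgrp M" "maxid M ==> M \<subseteq> R" "maxid M ==> finite (cosets R M)" "maxid M ==> 1 \<notin> M"
 by (auto simp: maxid_def ideal_def)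

lemma maxid_prime:
 assumes M: "maxid M" and x: "x \<in> R" "x \<notin> M" and y: "y \<in> R" and xy: "x * y \<in> M"
 shows "y \<in> M"
proof -
 obtain r where r: "r \<in> R" "1 - r * x \<in> M" using M x unfolding maxid_def by blast
 have "y * (1 - r * x) + r * (x * y) \<in> M"
  using subgrp_add[OF maxidD(2)[OF M] idealD(3)[OF maxidD(1)[OF M] y r(2)] idealD(3)[OF maxidD(1)[OF M] r(1) xy]] .
 moreover have "y * (1 - r * x) + r * (x * y) = y" by (simp add: algebra_simps)
 ultimately show ?thesis by simp
qed

lemma mult_notin: "maxid M ==> x \<in> R - M ==> y \<in> R - M ==> x * y \<in> R - M"
 using maxid_prime mult by blast

lemma idx_maxid: "maxid M ==> idx R M \<ge> 2"
proof -
 assume M: "maxid M"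
 have "idx R M > 0" using idx_pos[OF maxidD(4)[OF M] subgrp_R] .
 moreover have "idx R M \<noteq> 1" using idx_one_iff[OF maxidD(2)[OF M] subgrp_R maxidD(3)[OF M] maxidD(4)[OF M]] maxidD(5)[OF M] one by blast
 ultimately show ?thesis by simp
qed

lemma ex_int_in:
 assumes M: "ideal M" "finite (cosets R M)"
 shows "\<exists>k>0. of_nat k \<in> M"
proof -
 have "\<not> inj (%k::nat. (+) (of_nat k) ` M)"
 proof
  assume "inj (%k::nat. (+) (of_nat k) ` M)"
  then have "infinite (range (%k::nat. (+) (of_nat k) ` M))" using range_inj_infinite by blast
  moreover have "range (%k::nat. (+) (of_nat k) ` M) \<subseteq> cosets R M"
   unfolding cosets_def using of_int_in[of "int _"] by auto
  ultimately show False using M(2) finite_subset by blast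
 qed
 then obtain i j :: nat where ij: "i \<noteq> j" "(+) (of_nat i) ` M = (+) (of_nat j) ` M"
  unfolding inj_def by blast
 then have d: "of_nat i - of_nat j \<in> M" "of_nat j - of_nat i \<in> M"
  using coset_eq_iff[OF idealD(1)[OF M(1)], of "of_nat i" "of_nat j"] coset_eq_iff[OF idealD(1)[OF M(1)], of "of_nat j" "of_nat i"] by auto
 show ?thesis
 proof (cases "i < j")
  case True
  then show ?thesis using d(2) by (intro exI[of _ "j - i"]) (simp add: of_nat_diff)
 next
  case False
  then show ?thesis using d(1) ij(1) by (intro exI[of _ "i - j"]) (simp add: of_nat_diff)
 qed
qed

text \<open>The residue characteristic.\<close>

definition ch :: "complex set => nat" where "ch M = (LEAST k. k > 0 \<and> of_nat k \<in> M)"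

lemma ch:
 assumes M: "maxid M"
 shows "is_prime (ch M)" "of_nat (ch M) \<in> M"
proof -
 have *: "ch M > 0 \<and> of_nat (ch M) \<in> M"
  unfolding ch_def by (rule LeastI_ex[OF ex_int_in[OF maxidD(1,4)[OF M]]])
 then show "of_nat (ch M) \<in> M" by simp
 have ne1: "ch M \<noteq> 1" using * maxidD(5)[OF M] by auto
 have nat_in: "of_nat k \<in> R" for k using of_int_in[of "int k"] by simp
 show "is_prime (ch M)"
 proof (rule ccontr)
  assume "\<not> is_prime (ch M)"
  then obtain k l where kl: "ch M = k * l" "k \<noteq> 1" "l \<noteq> 1"
   using * ne1 unfolding prime_nat_iff by (metis dvdE less_one linorder_neqE_nat mult.right_neutral nat_dvd_1_iff_1 nat_mult_eq_cancel1 not_less_zero)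
  then have "k > 0" "l > 0" "k < ch M" "l < ch M" using * by auto
  then have "of_nat k \<notin> M" "of_nat l \<notin> M" using not_less_Least unfolding ch_def by blast+
  then show False using mult_notin[OF M, of "of_nat k" "of_nat l"] nat_in * kl by auto
 qed
qed

text \<open>\<open>M\<close> contains the ideal generated by its residue characteristic
  \<open>p\<close>, whose index is \<open>p ^ n\<close>.\<close>

lemma idx_ch:
 assumes M: "maxid M"
 shows "\<exists>f\<ge>1. idx R M = ch M ^ f \<and> f \<le> n"
proof -
 define p where "p = ch M"
 have p: "is_prime p" "of_int (int p) \<in> M" using ch[OF M] by (auto simp: p_def)
 have sub: "mul (of_int (int p)) \<subseteq> M"
  using idealD(4)[OF maxidD(1)[OF M] _ p(2)] by (auto simp: mul_def)
 have s: "subgrp (mul (of_int (int p)))" by (rule idealD(1)[OF ideal_mul[OF of_int_in]])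
 have nz: "of_int (int p) \<noteq> (0::complex)" using prime_gt_0_nat[OF p(1)] by simp
 have f: "finite (cosets R (mul (of_int (int p))))" by (rule finite_mul[OF of_int_in nz])
 have f2: "finite (cosets M (mul (of_int (int p))))"
  by (rule cosets_finite_mono(2)[OF maxidD(2)[OF M] s sub maxidD(3)[OF M] f])
 have "idx R (mul (of_int (int p))) = p ^ n" using idx_mul_int[of "int p"] prime_gt_0_nat[OF p(1)] by simp
 then have "p ^ n = idx R M * idx M (mul (of_int (int p)))"
  using idx_tower(2)[OF subgrp_R maxidD(2)[OF M] s sub maxidD(3)[OF M] maxidD(4)[OF M] f2] by simp
 then have "idx R M dvd p ^ n" by simp
 then obtain f where f: "f \<le> n" "idx R M = p ^ f" using divides_primepow_nat[OF p(1)] by blast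
 moreover have "f \<noteq> 0" using f idx_maxid[OF M] by (cases "f = 0") auto
 ultimately show ?thesis unfolding p_def by (intro exI[of _ f]) auto
qed

text \<open>In the localisation at \<open>M\<close> the maximal ideal is generated by the residue
  characteristic. The localisation is circumvented by clearing a denominator \<open>s\<close>
  outside \<open>M\<close>.\<close>

definition unram :: "complex set => bool" where
 "unram M \<longleftrightarrow> (\<forall>z\<in>M. \<exists>s\<in>R - M. s * z \<in> mul (of_nat (ch M)))"

text \<open>Two powers \<open>z ^ i\<close> and \<open>z ^ j\<close> with \<open>i < j\<close> agree
  modulo \<open>p\<close>. Then \<open>s = 1 - z ^ (j - i)\<close> lies outside \<open>M\<close>
  while \<open>s * z\<close> is nilpotent modulo \<open>p\<close>, hence 0 modulo \<open>p\<close>,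
  because \<open>p\<close> does not divide the discriminant.\<close>

lemma unramI:
 assumes M: "maxid M" and d: "\<not> int (ch M) dvd dsc"
 shows "unram M"
 unfolding unram_def
proof
 fix z assume z: "z \<in> M"
 define p where "p = int (ch M)"
 have p: "is_prime p" "\<not> p dvd dsc" "of_int p \<in> M" using ch[OF M] d by (auto simp: p_def)
 have zR: "z \<in> R" using z maxidD(3)[OF M] by blast
 have id: "ideal (mul (of_int p))" by (rule ideal_mul[OF of_int_in])
 have sub: "mul (of_int p) \<subseteq> M" using idealD(4)[OF maxidD(1)[OF M] _ p(3)] by (auto simp: mul_def)
 have fin: "finite (cosets R (mul (of_int p)))"
  by (rule finite_mul[OF of_int_in]) (use prime_gt_0_int[OF p(1)] in simp)
 have "\<not> inj (%k::nat. (+) (z ^ k) ` mul (of_int p))"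
 proof
  assume "inj (%k::nat. (+) (z ^ k) ` mul (of_int p))"
  then have "infinite (range (%k::nat. (+) (z ^ k) ` mul (of_int p)))" using range_inj_infinite by blast
  moreover have "range (%k::nat. (+) (z ^ k) ` mul (of_int p)) \<subseteq> cosets R (mul (of_int p))"
   unfolding cosets_def using power_in[OF zR] by auto
  ultimately show False using finite_subset[OF _ fin] by blast
 qed
 then obtain i j :: nat where ij: "i < j" "(+) (z ^ i) ` mul (of_int p) = (+) (z ^ j) ` mul (of_int p)"
  unfolding inj_def by (metis linorder_neqE_nat)
 then have d: "z ^ i - z ^ j \<in> mul (of_int p)"
  using coset_eq_iff[OF idealD(1)[OF id]] by blast
 define s where "s = 1 - z ^ (j - i)"
 have zp: "z ^ (j - i) \<in> M"
 proof -
  have "z ^ (j - i) = z ^ (j - i - 1) * z" using ij by (metis Suc_diff_1 power_Suc2 zero_less_diff)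
  then show ?thesis using idealD(3)[OF maxidD(1)[OF M] power_in[OF zR] z] by simp
 qed
 have s: "s \<in> R" unfolding s_def by (intro subgrp_diff[OF subgrp_R] one power_in zR)
 have sM: "s \<notin> M"
 proof
  assume "s \<in> M"
  then have "s + z ^ (j - i) \<in> M" using subgrp_add[OF maxidD(2)[OF M] _ zp] by blast
  then show False using maxidD(5)[OF M] by (simp add: s_def)
 qed
 have zs: "z ^ i * s \<in> mul (of_int p)"
  using d ij by (simp add: s_def right_diff_distrib flip: power_add)
 have "i \<noteq> 0"
 proof
  assume "i = 0"
  then have "s \<in> mul (of_int p)" using zs by simp
  then show False using sub sM by blast
 qed
 then obtain k where k: "i = Suc k" by (cases i) auto
 have e: "(s * z) ^ Suc k = s ^ k * (z ^ i * s)" by (simp add: k power_mult_distrib mult_ac)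
 have "(s * z) ^ Suc k \<in> mul (of_int p)" unfolding e by (rule idealD(3)[OF id power_in[OF s] zs])
 then have "s * z \<in> mul (of_int p)" by (rule reduced_mod_power[OF p(1,2) mult[OF s zR]])
 then show "\<exists>s\<in>R - M. s * z \<in> mul (of_nat (ch M))" using s sM by (auto simp: p_def)
qed

text \<open>The contraction to \<open>R\<close> of the ideal generated by the \<open>j\<close>-th
  power of the residue characteristic in the localisation at \<open>M\<close>. For unramified
  \<open>M\<close> it consists of the elements of valuation at least \<open>j\<close>.\<close>

definition vi :: "complex set => nat => complex set" where
 "vi M j = {z \<in> R. \<exists>s\<in>R - M. s * z \<in> mul (of_nat (ch M) ^ j)}"

lemma chp_in: "of_nat (ch M) ^ j \<in> R"
 using of_int_in[of "int (ch M) ^ j"] by simp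

lemma ideal_vi:
 assumes M: "maxid M"
 shows "ideal (vi M j)"
proof -
 have id: "ideal (mul (of_nat (ch M) ^ j))" by (rule ideal_mul[OF chp_in])
 have d: "x - y \<in> vi M j" if h: "x \<in> vi M j" "y \<in> vi M j" for x y
 proof -
  obtain s where s: "s \<in> R - M" "s * x \<in> mul (of_nat (ch M) ^ j)"
   using h(1) unfolding vi_def by blast
  obtain t where t: "t \<in> R - M" "t * y \<in> mul (of_nat (ch M) ^ j)"
   using h(2) unfolding vi_def by blast
  have "t * (s * x) - s * (t * y) \<in> mul (of_nat (ch M) ^ j)"
   by (rule subgrp_diff[OF idealD(1)[OF id] idealD(3)[OF id _ s(2)] idealD(3)[OF id _ t(2)]]) (use s(1) t(1) in auto)
  then have "(s * t) * (x - y) \<in> mul (of_nat (ch M) ^ j)" by (simp add: algebra_simps)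
  then show ?thesis using mult_notin[OF M s(1) t(1)] subgrp_diff[OF subgrp_R] h unfolding vi_def by blast
 qed
 have m: "x * y \<in> vi M j" if h: "x \<in> R" "y \<in> vi M j" for x y
 proof -
  obtain t where t: "t \<in> R - M" "t * y \<in> mul (of_nat (ch M) ^ j)" "y \<in> R"
   using h unfolding vi_def by blast
  have "x * (t * y) \<in> mul (of_nat (ch M) ^ j)" by (rule idealD(3)[OF id h(1) t(2)])
  then have "t * (x * y) \<in> mul (of_nat (ch M) ^ j)" by (simp add: mult_ac)
  then show ?thesis using t mult[OF h(1) t(3)] unfolding vi_def by blast
 qed
 have o: "1 \<in> R - M" using one maxidD(5)[OF M] by blast
 have "0 \<in> vi M j"
  unfolding vi_def using o zero_in subgrp_zero[OF idealD(1)[OF id]] by auto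
 then show ?thesis unfolding ideal_def subgrp_def using d m by (auto simp: vi_def)
qed

lemma mul_chp_vi: "maxid M ==> mul (of_nat (ch M) ^ j) \<subseteq> vi M j"
proof
 fix z assume M: "maxid M" and z: "z \<in> mul (of_nat (ch M) ^ j)"
 have "1 \<in> R - M" using one maxidD(5)[OF M] by blast
 moreover have "z \<in> R" using idealD(2)[OF ideal_mul[OF chp_in] z] .
 ultimately show "z \<in> vi M j" using z unfolding vi_def by (auto intro!: bexI[of _ 1])
qed

lemma finite_vi:
 assumes M: "maxid M"
 shows "finite (cosets R (vi M j))"
proof -
 have nz: "of_nat (ch M) ^ j \<noteq> (0::complex)" using ch(1)[OF M] by auto
 show ?thesis
  by (rule cosets_finite_mono(1)[OF idealD(1)[OF ideal_vi[OF M]] idealD(1)[OF ideal_mul[OF chp_in]] mul_chp_vi[OF M] _ finite_mul[OF chp_in nz]])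
   (auto simp: vi_def)
qed

lemma vi_Suc: "maxid M ==> vi M (Suc j) \<subseteq> vi M j"
proof
 fix z assume M: "maxid M" and "z \<in> vi M (Suc j)"
 then obtain s where s: "z \<in> R" "s \<in> R - M" "s * z \<in> mul (of_nat (ch M) ^ Suc j)" unfolding vi_def by blast
 then obtain w where "w \<in> R" "s * z = of_nat (ch M) ^ Suc j * w" unfolding mul_def by blast
 then have "s * z \<in> mul (of_nat (ch M) ^ j)"
  unfolding mul_iff using mult[OF chp_in[of M 1]] by (intro bexI[of _ "of_nat (ch M) * w"]) (auto simp: mult_ac)
 then show "z \<in> vi M j" using s unfolding vi_def by blast
qed

lemma vi_antimono: "maxid M ==> i \<le> j ==> vi M j \<subseteq> vi M i"
 using lift_Suc_antimono_le[of "vi M" i j] vi_Suc by blast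

lemma vi_one: "maxid M ==> vi M 1 \<subseteq> M"
proof
 fix z assume M: "maxid M" and "z \<in> vi M 1"
 then obtain s where s: "z \<in> R" "s \<in> R - M" "s * z \<in> mul (of_nat (ch M))" unfolding vi_def by auto
 then have "s * z \<in> M" using idealD(4)[OF maxidD(1)[OF M] _ ch(2)[OF M]] by (auto simp: mul_def)
 then show "z \<in> M" using maxid_prime[OF M] s by blast
qed

lemma vi_zero: "maxid M ==> vi M 0 = R"
proof -
 assume M: "maxid M"
 have "1 \<in> R - M" using one maxidD(5)[OF M] by blast
 then show ?thesis unfolding vi_def by (auto simp: mul_iff intro!: bexI[of _ 1])
qed

text \<open>Multiplication by \<open>ch M ^ j\<close> embeds \<open>R / M\<close> into
  \<open>vi M j / vi M (Suc j)\<close>.\<close>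

lemma idx_vi_ge:
 assumes M: "maxid M"
 shows "idx R M ^ j \<le> idx R (vi M j)"
proof (induction j)
 case 0
 then show ?case using idx_pos[OF finite_vi[OF M] subgrp_R] by (simp add: Suc_leI)
next
 case (Suc j)
 define q where "q = (of_nat (ch M) ^ j :: complex)"
 have q: "q \<noteq> 0" "q \<in> R" using ch(1)[OF M] chp_in by (auto simp: q_def)
 obtain S where S: "S \<subseteq> R" "finite S" "card S = idx R M" "\<And>r s. r \<in> S ==> s \<in> S ==> r - s \<in> M ==> r = s"
  using cosets_reps[OF maxidD(2,4)[OF M]] by metis
 have s1: "subgrp (vi M j)" "subgrp (vi M (Suc j))" by (rule idealD(1)[OF ideal_vi[OF M]])+
 have f: "finite (cosets (vi M j) (vi M (Suc j)))"
  by (rule cosets_finite_mono(2)[OF s1 vi_Suc[OF M] _ finite_vi[OF M]]) (auto simp: vi_def)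
 have "card ((*) q ` S) \<le> idx (vi M j) (vi M (Suc j))"
 proof (rule card_le_idx(2)[OF s1(2) f])
  have "(*) q ` S \<subseteq> mul q" using S(1) by (auto simp: mul_def)
  then show "(*) q ` S \<subseteq> vi M j" using mul_chp_vi[OF M, of j] by (auto simp: q_def)
  fix x y assume "x \<in> (*) q ` S" "y \<in> (*) q ` S" and xy: "x - y \<in> vi M (Suc j)"
  then obtain r t where rt: "x = q * r" "y = q * t" "r \<in> S" "t \<in> S" by blast
  obtain s where s0: "s \<in> R - M" "s * (x - y) \<in> mul (of_nat (ch M) ^ Suc j)"
   using xy unfolding vi_def by blast
  then obtain w where w: "w \<in> R" "s * (x - y) = of_nat (ch M) ^ Suc j * w" unfolding mul_iff by blast
  have "x - y = q * (r - t)" using rt by (simp add: right_diff_distrib)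
  then have s: "s \<in> R - M" "s * (q * (r - t)) = q * of_nat (ch M) * w" "w \<in> R"
   using s0 w by (simp_all add: q_def mult_ac)
  then have "q * (s * (r - t)) = q * (of_nat (ch M) * w)" by (simp add: mult_ac)
  then have "s * (r - t) = of_nat (ch M) * w" using q(1) mult_left_cancel by blast
  then have "s * (r - t) \<in> M" using idealD(4)[OF maxidD(1)[OF M] s(3) ch(2)[OF M]] by simp
  moreover have "r - t \<in> R" using rt S(1) by (intro subgrp_diff[OF subgrp_R]) auto
  ultimately have "r - t \<in> M" using maxid_prime[OF M] s(1) by blast
  then show "x = y" using S(4) rt by simp
 qed
 moreover have "card ((*) q ` S) = idx R M" using q(1) S(3) by (subst card_image) (auto simp: inj_on_def)
 ultimately have "idx R M ^ j * idx R M \<le> idx R (vi M j) * idx (vi M j) (vi M (Suc j))"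
  using Suc by (intro mult_mono) auto
 also have "... = idx R (vi M (Suc j))"
  by (rule idx_tower(2)[symmetric, OF subgrp_R s1 vi_Suc[OF M] _ finite_vi[OF M] f]) (auto simp: vi_def)
 finally show ?case by (simp add: mult.commute)
qed

text \<open>For each \<open>M\<close> the exponents from 1 up to the valuation of \<open>J\<close>:
  a sum over these pairs counts \<open>M\<close> with its multiplicity in \<open>J\<close>.\<close>

definition levels :: "complex set => (complex set \<times> nat) set" where
 "levels J = {(M,j). maxid M \<and> j \<ge> 1 \<and> J \<subseteq> vi M j}"

lemma levels_sub: "(M,j) \<in> levels J ==> J \<subseteq> M"
proof -
 assume "(M,j) \<in> levels J"
 then have "maxid M" "1 \<le> j" "J \<subseteq> vi M j" by (simp_all add: levels_def)
 then show ?thesis using vi_one[of M] vi_antimono[of M 1 j] by blast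
qed

lemma finite_overideals:
 assumes J: "subgrp J" "finite (cosets R J)"
 shows "finite {M. subgrp M \<and> J \<subseteq> M \<and> M \<subseteq> R}"
proof -
 have "inj_on (%M. {C \<in> cosets R J. C \<subseteq> M}) {M. subgrp M \<and> J \<subseteq> M \<and> M \<subseteq> R}"
 proof (rule inj_on_inverseI[of _ "\<Union>"])
  fix M assume M: "M \<in> {M. subgrp M \<and> J \<subseteq> M \<and> M \<subseteq> R}"
  show "\<Union> {C \<in> cosets R J. C \<subseteq> M} = M"
  proof (intro equalityI subsetI)
   fix x assume x: "x \<in> M"
   have "(+) x ` J \<in> cosets R J" "x \<in> (+) x ` J" "(+) x ` J \<subseteq> M"
    using x M subgrp_zero[OF J(1)] subgrp_add[of M x] by (auto simp: cosets_def image_iff)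
   then show "x \<in> \<Union> {C \<in> cosets R J. C \<subseteq> M}" by blast
  qed auto
 qed
 moreover have "finite ((%M. {C \<in> cosets R J. C \<subseteq> M}) ` {M. subgrp M \<and> J \<subseteq> M \<and> M \<subseteq> R})"
  by (rule finite_subset[of _ "Pow (cosets R J)"]) (use J in auto)
 ultimately show ?thesis by (rule finite_imageD[rotated])
qed

text \<open>The index of \<open>vi M j\<close> divides that of \<open>J\<close> and is at least
  \<open>2 ^ j\<close>, which bounds \<open>j\<close>; for \<open>M\<close> there are finitely many
  subgroups above \<open>J\<close> to choose from.\<close>

lemma finite_levels:
 assumes J: "ideal J" "finite (cosets R J)"
 shows "finite (levels J)"
proof (rule finite_subset)
 show "levels J \<subseteq> {M. subgrp M \<and> J \<subseteq> M \<and> M \<subseteq> R} \<times> {..<idx R J}"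
 proof clarify
  fix M j assume L: "(M,j) \<in> levels J"
  then have "maxid M" "J \<subseteq> vi M j" by (simp_all add: levels_def)
  with levels_sub[OF L] have M: "maxid M" "J \<subseteq> vi M j" "J \<subseteq> M" by simp_all
  have sub: "vi M j \<subseteq> R" by (auto simp: vi_def)
  have s: "subgrp (vi M j)" "subgrp J" by (rule idealD(1)[OF ideal_vi[OF M(1)]], rule idealD(1)[OF J(1)])
  have f: "finite (cosets (vi M j) J)" by (rule cosets_finite_mono(2)[OF s M(2) sub J(2)])
  have "idx R J = idx R (vi M j) * idx (vi M j) J"
   by (rule idx_tower(2)[OF subgrp_R s M(2) sub finite_vi[OF M(1)] f])
  moreover have "idx (vi M j) J > 0" by (rule idx_pos[OF f s(1)])
  ultimately have "idx R (vi M j) \<le> idx R J" by simp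
  moreover have "j < 2 ^ j" by simp
  moreover have "2 ^ j \<le> idx R M ^ j" using idx_maxid[OF M(1)] by (rule power_mono) simp
  ultimately have "j < idx R J" using idx_vi_ge[OF M(1), of j] by linarith
  then show "M \<in> {M. subgrp M \<and> J \<subseteq> M \<and> M \<subseteq> R} \<and> j \<in> {..<idx R J}"
   using maxidD(2,3)[OF M(1)] M(3) by simp
 qed
 show "finite ({M. subgrp M \<and> J \<subseteq> M \<and> M \<subseteq> R} \<times> {..<idx R J})"
  using finite_overideals[OF idealD(1)[OF J(1)] J(2)] by simp
qed

text \<open>Climbing from \<open>J\<close> to \<open>R\<close> by simple steps, each step of type \<open>M\<close> lowers the level of \<open>M\<close>.\<close>

lemma ln_idx_le_levels:
 assumes "ideal J" "finite (cosets R J)" "\<And>M. maxid M ==> J \<subseteq> M ==> unram M"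
 shows "ln (real (idx R J)) \<le> (\<Sum>(M,j)\<in>levels J. ln (real (idx R M)))"
 using assms
proof (induction "idx R J" arbitrary: J rule: less_induct)
 case less
 note J = less.prems(1) and fJ = less.prems(2) and unr = less.prems(3)
 have sJ: "subgrp J" and JR: "J \<subseteq> R" using J by (auto simp: ideal_def)
 show ?case
 proof (cases "J = R")
  case True
  then have "idx R J = 1" using idx_one_iff[OF sJ subgrp_R JR fJ] by simp
  then show ?thesis using idx_maxid by (auto intro!: sum_nonneg simp: levels_def split: prod.splits)
   (metis Suc_1 Suc_le_lessD less_imp_le less_numeral_extra(1) ln_ge_zero of_nat_1 of_nat_le_iff order_trans)
 next
  case False
  \<comment> \<open>A candidate of least index over \<open>J\<close> is taken for \<open>K\<close>,
    so that \<open>K / J\<close> is a simple module.\<close>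
  define cand where "cand = {K. ideal K \<and> J \<subset> K}"
  have "R \<in> cand" using False JR subgrp_R mult by (auto simp: cand_def ideal_def)
  then obtain K where K: "K \<in> cand" "\<And>K'. K' \<in> cand ==> idx K J \<le> idx K' J"
   using ex_has_least_nat[of "%K. K \<in> cand" R "%K. idx K J"] by blast
  have iK: "ideal K" "J \<subset> K" using K by (auto simp: cand_def)
  have sK: "subgrp K" and KR: "K \<subseteq> R" using iK by (auto simp: ideal_def)
  have fin: "finite (cosets R K)" "finite (cosets K J)"
   using cosets_finite_mono[OF sK sJ _ KR fJ] iK by auto
  have tower: "idx R J = idx R K * idx K J" using idx_tower(2)[OF subgrp_R sK sJ _ KR fin] iK by auto
  have "idx K J \<noteq> 1" using idx_one_iff[OF sJ sK _ fin(2)] iK by auto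
  then have KJ: "idx K J > 1" using idx_pos[OF fin(2) sK] by linarith
  have Rpos: "idx R K > 0" by (rule idx_pos[OF fin(1) subgrp_R])
  have lt: "idx R K < idx R J" using tower KJ Rpos by simp
  obtain z where z: "z \<in> K" "z \<notin> J" using iK by blast
  have zR: "z \<in> R" using z KR by blast
  define N where "N = (%(j,r). j + r * z) ` (J \<times> R)"
  have NK: "N \<subseteq> K" unfolding N_def using iK z subgrp_add[OF sK] idealD(3)[OF iK(1)] by auto
  have JN: "J \<subseteq> N" unfolding N_def using zero_in by (auto intro!: image_eqI[of _ _ "(_,0)"])
  \<comment> \<open>Simplicity of \<open>K / J\<close>: each element of \<open>K\<close> outside
    \<open>J\<close> generates \<open>K\<close> together with \<open>J\<close>.\<close>
  have gen: "K \<subseteq> (%(j,r). j + r * w) ` (J \<times> R)" if w: "w \<in> K" "w \<notin> J" for w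
  proof -
   define N where "N = (%(j,r). j + r * w) ` (J \<times> R)"
   have NK: "N \<subseteq> K" unfolding N_def using iK w subgrp_add[OF sK] idealD(3)[OF iK(1)] by auto
   have JN: "J \<subseteq> N" unfolding N_def using zero_in by (auto intro!: image_eqI[of _ _ "(_,0)"])
   have wN: "w \<in> N" unfolding N_def using one subgrp_zero[OF sJ] by (auto intro!: image_eqI[of _ _ "(0,1)"])
   have sN: "subgrp N" unfolding subgrp_def
   proof (intro conjI ballI)
    show "0 \<in> N" using JN subgrp_zero[OF sJ] by blast
    fix x y assume "x \<in> N" "y \<in> N"
    then obtain j r j' r' where e: "x = j + r * w" "y = j' + r' * w" "j \<in> J" "r \<in> R" "j' \<in> J" "r' \<in> R" unfolding N_def by auto
    then have "x - y = (j - j') + (r - r') * w" by (simp add: algebra_simps)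
    then show "x - y \<in> N" unfolding N_def using e subgrp_diff[OF sJ] subgrp_diff[OF subgrp_R]
     by (intro image_eqI[of _ _ "(j - j', r - r')"]) auto
   qed
   have "x * y \<in> N" if h: "x \<in> R" "y \<in> N" for x y
   proof -
    obtain j r where e: "y = j + r * w" "j \<in> J" "r \<in> R" using h unfolding N_def by auto
    then have "x * y = x * j + (x * r) * w" by (simp add: algebra_simps)
    then show "x * y \<in> N" unfolding N_def using e h idealD(3)[OF J] mult
     by (intro image_eqI[of _ _ "(x * j, x * r)"]) auto
   qed
   then have "ideal N" unfolding ideal_def using sN NK KR by auto
   then have "N \<in> cand" unfolding cand_def using JN wN w by blast
   then have le: "idx K J \<le> idx N J" by (rule K(2))
   have f1: "finite (cosets K N)" "finite (cosets N J)" using cosets_finite_mono[OF sN sJ JN NK fin(2)] by auto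
   have "idx K J = idx K N * idx N J" by (rule idx_tower(2)[OF sK sN sJ JN NK f1])
   moreover have "idx N J > 0" by (rule idx_pos[OF f1(2) sN])
   moreover have "idx K N > 0" by (rule idx_pos[OF f1(1) sK])
   ultimately have "idx K N = 1" using le by (metis le_antisym mult_le_cancel2 nat_mult_1 Suc_leI One_nat_def)
   then have "K = N" using idx_one_iff[OF sN sK NK f1(1)] by simp
   then show ?thesis unfolding N_def by simp
  qed
  \<comment> \<open>The annihilator of \<open>z\<close> modulo \<open>J\<close>. The map from
    \<open>r\<close> to \<open>r * z\<close> identifies \<open>R / M\<close> with
    \<open>K / J\<close>.\<close>
  define M where "M = {s \<in> R. s * z \<in> J}"
  have sM: "subgrp M" unfolding subgrp_def M_def
   using zero_in subgrp_zero[OF sJ] subgrp_diff[OF sJ] subgrp_diff[OF subgrp_R] by (auto simp: left_diff_distrib)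
  have iM: "ideal M" unfolding ideal_def
   using sM idealD(3)[OF J] mult by (auto simp: M_def mult.assoc)
  have idxM: "idx R M = idx K J" "finite (cosets R M)"
  proof -
   define f where "f r = (+) (r * z) ` J" for r
   have e: "f x = f y \<longleftrightarrow> x - y \<in> M" if "x \<in> R" "y \<in> R" for x y
    unfolding f_def coset_eq_iff[OF sJ] M_def using subgrp_diff[OF subgrp_R that] by (auto simp: left_diff_distrib)
   have "f ` R = cosets K J"
   proof
    show "f ` R \<subseteq> cosets K J" unfolding f_def cosets_def using idealD(3)[OF iK(1) _ z(1)] by auto
    show "cosets K J \<subseteq> f ` R"
    proof
     fix C assume "C \<in> cosets K J"
     then obtain x where x: "x \<in> K" "C = (+) x ` J" unfolding cosets_def by auto
     then obtain j r where "x = j + r * z" "j \<in> J" "r \<in> R" using gen[OF z] by auto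
     then show "C \<in> f ` R" using x(2) coset_eq_iff[OF sJ, of x "r * z"] unfolding f_def by auto
    qed
   qed
   then show "idx R M = idx K J" "finite (cosets R M)"
    using cosets_image[OF sM, of R f] e fin(2) by (auto simp: idx_def)
  qed
  have maxM: "maxid M"
   unfolding maxid_def
  proof (intro conjI ballI)
   show "1 \<notin> M" using z by (simp add: M_def)
   fix s assume s: "s \<in> R - M"
   then have "s * z \<in> K" "s * z \<notin> J" using idealD(3)[OF iK(1) _ z(1)] by (auto simp: M_def)
   then obtain j r where jr: "z = j + r * (s * z)" "j \<in> J" "r \<in> R" using gen[of "s * z"] z(1) by auto
   then have "(1 - r * s) * z = j" by (simp add: algebra_simps)
   then have "1 - r * s \<in> M" unfolding M_def using jr s one mult subgrp_diff[OF subgrp_R] by auto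
   then show "\<exists>r\<in>R. 1 - r * s \<in> M" using jr by blast
  qed (use iM idxM in auto)
  have JM: "J \<subseteq> M" unfolding M_def using JR idealD(4)[OF J zR] by auto
  have un: "unram M" by (rule unr[OF maxM JM])
  have sub: "levels K \<subseteq> levels J" using iK by (auto simp: levels_def)
  have finL: "finite (levels J)" by (rule finite_levels[OF J fJ])
  \<comment> \<open>The exact level \<open>v\<close> of \<open>K\<close> at \<open>M\<close> exists
    because the levels of \<open>K\<close> are among the finitely many levels of
    \<open>J\<close>.\<close>
  have ex: "\<exists>v. K \<subseteq> vi M v \<and> \<not> K \<subseteq> vi M (Suc v)"
  proof (rule ccontr)
   assume "\<not> ?thesis"
   then have "K \<subseteq> vi M v" for v
    by (induction v) (use vi_zero[OF maxM] KR in auto)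
   then have "(%v. (M, Suc v)) ` UNIV \<subseteq> levels K" using maxM by (auto simp: levels_def)
   then have "finite (range (%v. (M, Suc v)))" using finite_subset[OF _ finite_subset[OF sub finL]] by blast
   moreover have "inj (%v. (M, Suc v))" by (auto simp: inj_def)
   ultimately show False using range_inj_infinite by blast
  qed
  then obtain v where v: "K \<subseteq> vi M v" "\<not> K \<subseteq> vi M (Suc v)" by blast
  \<comment> \<open>The level of \<open>J\<close> at \<open>M\<close> exceeds \<open>v\<close>.
    Otherwise some \<open>x\<close> in \<open>J\<close> is, up to a factor outside \<open>M\<close>,
    equal to \<open>ch M ^ v * x'\<close>, and unramifiedness puts \<open>x'\<close> outside
    \<open>M\<close>. Since \<open>z\<close> is a multiple of \<open>ch M ^ v\<close> up to such a
    factor, an element outside \<open>M\<close> would carry \<open>z\<close> into \<open>J\<close>,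
    against the choice of \<open>M\<close>.\<close>
  have JS: "J \<subseteq> vi M (Suc v)"
  proof (rule ccontr)
   assume "\<not> ?thesis"
   then obtain x where x: "x \<in> J" "x \<notin> vi M (Suc v)" by blast
   define q where "q = (of_nat (ch M) ^ v :: complex)"
   have "x \<in> vi M v" using x iK v by blast
   then obtain s x' where s: "s \<in> R - M" "s * x = q * x'" "x' \<in> R" "x \<in> R" unfolding vi_def mul_def q_def by blast
   have x': "x' \<notin> M"
   proof
    assume "x' \<in> M"
    then obtain t where t: "t \<in> R - M" "t * x' \<in> mul (of_nat (ch M))" using un unfolding unram_def by blast
    then obtain u where u: "u \<in> R" "t * x' = of_nat (ch M) * u" unfolding mul_def by blast
    have "(t * s) * x = t * (s * x)" by (simp only: mult.assoc)
    also have "... = q * (t * x')" using s by (simp add: mult_ac)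
    also have "... = of_nat (ch M) ^ Suc v * u" using u by (simp add: q_def mult_ac)
    finally have "(t * s) * x \<in> mul (of_nat (ch M) ^ Suc v)" using u(1) unfolding mul_iff by blast
    then have "x \<in> vi M (Suc v)" unfolding vi_def using mult_notin[OF maxM t(1) s(1)] s(4) by blast
    then show False using x by blast
   qed
   have "z \<in> vi M v" using z v by blast
   then obtain s' z' where s': "s' \<in> R - M" "s' * z = q * z'" "z' \<in> R" unfolding vi_def mul_def q_def by blast
   have "(x' * s') * z = x' * (s' * z)" by (simp only: mult.assoc)
   also have "... = z' * (s * x)" using s s' by (simp add: mult_ac)
   also have "... = (z' * s) * x" by (simp only: mult.assoc)
   also have "... \<in> J" using idealD(3)[OF J mult[OF s'(3)] x(1)] s by blast
   finally have "x' * s' \<in> M" unfolding M_def using mult s s' by blast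
   then show False using mult_notin[OF maxM, of x' s'] x' s s' by blast
  qed
  have new: "(M, Suc v) \<in> levels J" "(M, Suc v) \<notin> levels K" using maxM JS v by (auto simp: levels_def)
  have IH: "ln (real (idx R K)) \<le> (\<Sum>(M,j)\<in>levels K. ln (real (idx R M)))"
   by (rule less.hyps[OF lt iK(1) fin(1)]) (use unr iK in blast)
  have nonneg: "0 \<le> ln (real (idx R M'))" if "(M', j) \<in> levels J" for M' j
   using idx_maxid[of M'] that by (simp add: levels_def)
  have "ln (real (idx R J)) = ln (real (idx R K)) + ln (real (idx R M))"
   using tower idxM Rpos KJ by (simp add: ln_mult)
  also have "... \<le> (\<Sum>(M,j)\<in>insert (M, Suc v) (levels K). ln (real (idx R M)))"
   using IH new finite_subset[OF sub finL] by simp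
  also have "... \<le> (\<Sum>(M,j)\<in>levels J. ln (real (idx R M)))"
   by (rule sum_mono2[OF finL]) (use sub new nonneg in auto)
  finally show ?thesis .
 qed
qed

text \<open>Chinese remainder theorem, one ideal at a time: a product of elements of the old ideals,
  all chosen outside the new \<open>M\<close>, is invertible modulo \<open>M\<close>, so the
  intersection of the old ideals meets every class modulo \<open>M\<close>.\<close>

lemma idx_Inter_maxid:
 assumes "finite \<M>" "\<And>M. M \<in> \<M> ==> maxid M"
 shows "idx R (R \<inter> \<Inter>\<M>) = (\<Prod>M\<in>\<M>. idx R M) \<and> finite (cosets R (R \<inter> \<Inter>\<M>)) \<and> ideal (R \<inter> \<Inter>\<M>)"
 using assms
proof (induction \<M> rule: finite_induct)
 case empty
 have "idx R R = 1 \<and> finite (cosets R R)"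
 proof -
  have "(%_. 0::nat) ` R = {0}" using zero_in by auto
  then show ?thesis using cosets_image[OF subgrp_R, of R "%_. 0::nat"] subgrp_diff[OF subgrp_R] by simp
 qed
 then show ?case using subgrp_R mult by (simp add: ideal_def)
next
 case (insert M \<M>)
 define I where "I = R \<inter> \<Inter>\<M>"
 have IH: "idx R I = (\<Prod>M\<in>\<M>. idx R M)" "finite (cosets R I)" "ideal I"
  using insert by (auto simp: I_def)
 have M: "maxid M" using insert by simp
 have sI: "subgrp I" "I \<subseteq> R" using IH(3) by (auto simp: ideal_def)
 have "\<exists>x\<in>M'. x \<notin> M" if M': "M' \<in> \<M>" for M'
 proof (rule ccontr)
  assume "\<not> ?thesis"
  then have sub: "M' \<subseteq> M" by blast
  have mM': "maxid M'" "M' \<noteq> M" using insert M' by auto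
  then obtain s where s: "s \<in> M" "s \<notin> M'" using sub by blast
  then obtain r where "r \<in> R" "1 - r * s \<in> M'" using mM' maxidD(3)[OF M] unfolding maxid_def by blast
  then have "(1 - r * s) + r * s \<in> M" using sub idealD(3)[OF maxidD(1)[OF M]] s subgrp_add[OF maxidD(2)[OF M]] by blast
  then show False using maxidD(5)[OF M] by simp
 qed
 then obtain g where g: "\<And>M'. M' \<in> \<M> ==> g M' \<in> M' \<and> g M' \<notin> M" by metis
 have gR: "g M' \<in> R" if "M' \<in> \<M>" for M' using g[OF that] insert.prems[of M'] maxidD(3)[of M'] that by blast
 define x where "x = prod g \<M>"
 have xR: "x \<in> R" unfolding x_def by (rule subring_prod[OF is_subring_R gR])
 have "prod g A \<in> R - M" if "finite A" "A \<subseteq> \<M>" for A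
  using that by (induction A rule: finite_induct) (use one maxidD(5)[OF M] mult_notin[OF M] g gR in auto)
 then have xM: "x \<in> R - M" using insert.hyps(1) by (auto simp: x_def)
 have xI: "x \<in> I" unfolding I_def
 proof (intro IntI InterI xR)
  fix M' assume M': "M' \<in> \<M>"
  have "x = prod g (\<M> - {M'}) * g M'" unfolding x_def using prod.remove[OF insert.hyps(1) M', of g] by (simp add: mult.commute)
  moreover have "prod g (\<M> - {M'}) \<in> R" by (rule subring_prod[OF is_subring_R]) (use gR in auto)
  ultimately show "x \<in> M'" using idealD(3)[OF maxidD(1)] insert.prems[of M'] M' g by auto
 qed
 obtain r where r: "r \<in> R" "1 - r * x \<in> M" using M xM unfolding maxid_def by blast
 have cov: "\<exists>y\<in>I. w - y \<in> M" if w: "w \<in> R" for w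
 proof (rule bexI[of _ "(w * r) * x"])
  show "(w * r) * x \<in> I" by (rule idealD(3)[OF IH(3) mult[OF w r(1)] xI])
  have "w * (1 - r * x) \<in> M" by (rule idealD(3)[OF maxidD(1)[OF M] w r(2)])
  then show "w - (w * r) * x \<in> M" by (simp add: algebra_simps)
 qed
 have e: "R \<inter> \<Inter>(insert M \<M>) = I \<inter> M" by (auto simp: I_def)
 have sIM: "subgrp (I \<inter> M)" by (rule subgrp_Int[OF sI(1) maxidD(2)[OF M]])
 note T = idx_Int[OF subgrp_R sI(1) maxidD(2)[OF M] sI(2) cov maxidD(4)[OF M]]
 have t: "finite (cosets R (I \<inter> M))" "idx R (I \<inter> M) = idx R I * idx I (I \<inter> M)"
  using idx_tower[OF subgrp_R sI(1) sIM _ sI(2) IH(2) T(2)] by auto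
 have "ideal (I \<inter> M)" using IH(3) maxidD(1)[OF M] by (auto simp: ideal_def subgrp_def)
 then show ?case unfolding e using t T(1) IH(1) insert.hyps by (simp add: mult.commute)
qed

lemma prod_maxid_le:
 assumes "finite \<M>" "\<And>M. M \<in> \<M> ==> maxid M \<and> J \<subseteq> M" and J: "ideal J" "finite (cosets R J)"
 shows "(\<Prod>M\<in>\<M>. idx R M) \<le> idx R J"
proof -
 define I where "I = R \<inter> \<Inter>\<M>"
 have I: "idx R I = (\<Prod>M\<in>\<M>. idx R M)" "finite (cosets R I)" "ideal I"
  using idx_Inter_maxid[OF assms(1)] assms(2) by (auto simp: I_def)
 have JI: "J \<subseteq> I" using assms(2) J(1) by (auto simp: I_def ideal_def)
 have s: "subgrp I" "subgrp J" "I \<subseteq> R" using I J by (auto simp: ideal_def)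
 have f: "finite (cosets I J)" by (rule cosets_finite_mono(2)[OF s(1,2) JI s(3) J(2)])
 have "idx R J = idx R I * idx I J" by (rule idx_tower(2)[OF subgrp_R s(1,2) JI s(3) I(2) f])
 moreover have "idx I J > 0" by (rule idx_pos[OF f s(1)])
 ultimately show ?thesis using I(1) by simp
qed

definition above :: "nat => complex set set" where "above p = {M. maxid M \<and> ch M = p}"

text \<open>The intersection of \<open>n + 1\<close> ideals above \<open>p\<close> would have index
  at least \<open>p ^ (n + 1)\<close>, although it contains the ideal generated by \<open>p\<close>,
  of index \<open>p ^ n\<close>.\<close>

lemma card_above: "is_prime p ==> finite (above p) \<and> card (above p) \<le> n"
proof (rule ccontr)
 assume p: "is_prime p" and "\<not> (finite (above p) \<and> card (above p) \<le> n)"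
 then obtain A where A: "finite A" "A \<subseteq> above p" "card A = Suc n"
  by (metis Suc_leI infinite_arbitrarily_large not_le obtain_subset_with_card_n)
 have nz: "of_int (int p) \<noteq> (0::complex)" using p prime_gt_0_nat by auto
 have "(\<Prod>M\<in>A. idx R M) \<le> idx R (mul (of_int (int p)))"
 proof (rule prod_maxid_le[OF A(1) _ ideal_mul[OF of_int_in] finite_mul[OF of_int_in nz]])
  fix M assume "M \<in> A"
  then have M: "maxid M" "ch M = p" using A by (auto simp: above_def)
  then show "maxid M \<and> mul (of_int (int p)) \<subseteq> M"
   using idealD(4)[OF maxidD(1)[OF M(1)] _ ch(2)[OF M(1)]] by (auto simp: mul_def)
 qed
 also have "... = p ^ n" using idx_mul_int[of "int p"] nz by simp
 finally have "(\<Prod>M\<in>A. idx R M) \<le> p ^ n" .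
 moreover have "(\<Prod>M\<in>A. p) \<le> (\<Prod>M\<in>A. idx R M)"
 proof (rule prod_mono)
  fix M assume "M \<in> A"
  then have M: "maxid M" "ch M = p" using A by (auto simp: above_def)
  then obtain f where "f \<ge> 1" "idx R M = p ^ f" using idx_ch by blast
  then show "0 \<le> p \<and> p \<le> idx R M" using p prime_gt_0_nat[of p] self_le_power[of p f] by auto
 qed
 moreover have "(\<Prod>M\<in>A. p) = p ^ Suc n" by (simp only: prod_constant A(3))
 ultimately have "p ^ Suc n \<le> p ^ n" by linarith
 then show False using power_strict_increasing[of n "Suc n" p] prime_gt_1_nat[OF p] by simp
qed

end

section \<open>Chebyshev estimates\<close>

lemma binomial_odd_le: "(2 * m + 1) choose m \<le> 4 ^ m"
proof -
 have "2 * ((2 * m + 1) choose m) = ((2 * m + 1) choose m) + ((2 * m + 1) choose (m + 1))"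
  using binomial_symmetric[of m "2 * m + 1"] by simp
 also have "... = (\<Sum>k\<in>{m, m + 1}. (2 * m + 1) choose k)" by simp
 also have "... \<le> (\<Sum>k\<le>2 * m + 1. (2 * m + 1) choose k)" by (rule sum_mono2) auto
 also have "... = 2 ^ (2 * m + 1)" by (rule choose_row_sum)
 also have "... = 2 * 4 ^ m" by (simp add: power_mult)
 finally show ?thesis by simp
qed

lemma prod_primes_dvd:
 fixes k :: nat
 assumes "finite A" "\<And>p. p \<in> A ==> is_prime p \<and> p dvd k"
 shows "\<Prod>A dvd k"
 using assms
proof (induction A rule: finite_induct)
 case (insert p A)
 have "coprime p (\<Prod>A)"
 proof (rule prod_coprime_right)
  fix q assume "q \<in> A"
  then show "coprime p q" using insert by (intro primes_coprime) auto
 qed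
 then show ?case using insert by (simp add: divides_mult)
qed simp

text \<open>Induction of Erdos: for odd \<open>N = 2 * m + 1\<close> the primes above
  \<open>m + 1\<close> all divide the binomial coefficient \<open>N\<close> over \<open>m\<close>,
  which is at most \<open>4 ^ m\<close>.\<close>

lemma primorial_le: "\<Prod>{p. is_prime p \<and> p \<le> N} \<le> (4::nat) ^ N"
proof (induction N rule: less_induct)
 case (less N)
 consider "N \<le> 1" | "N = 2" | "N > 2" "even N" | "N > 2" "odd N" by linarith
 then show ?case
 proof cases
  case 1
  have "\<not> p \<le> N" if "is_prime p" for p :: nat using prime_ge_2_nat[OF that] 1 by linarith
  then have e: "{p::nat. is_prime p \<and> p \<le> N} = {}" by blast
  show ?thesis unfolding e by simp
 next
  case 2
  have "p \<le> N \<longleftrightarrow> p = 2" if "is_prime p" for p :: nat using prime_ge_2_nat[OF that] 2 by linarith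
  then have e: "{p::nat. is_prime p \<and> p \<le> N} = {2}" using two_is_prime_nat by blast
  show ?thesis unfolding e using 2 by simp
 next
  case 3
  have "\<not> is_prime N" using 3 prime_odd_nat by blast
  then have "p \<le> N \<longleftrightarrow> p \<le> N - 1" if "is_prime p" for p using that by (cases "p = N") auto
  then have "{p. is_prime p \<and> p \<le> N} = {p. is_prime p \<and> p \<le> N - 1}" by blast
  also have "\<Prod>... \<le> 4 ^ (N - 1)" using 3 by (intro less.IH) auto
  also have "... \<le> 4 ^ N" by (rule power_increasing) auto
  finally show ?thesis .
 next
  case 4
  then obtain m where m: "N = 2 * m + 1" by (elim oddE)
  define A where "A = {p. is_prime p \<and> p \<le> m + 1}"
  define B where "B = {p. is_prime p \<and> m + 1 < p \<and> p \<le> N}"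
  have e: "{p. is_prime p \<and> p \<le> N} = A \<union> B" using m 4 by (auto simp: A_def B_def)
  have f: "finite A" "finite B" by (auto simp: A_def B_def intro: finite_subset[of _ "{..N}"] finite_subset[of _ "{..m+1}"])
  have "\<Prod>B dvd (2 * m + 1) choose m"
  proof (rule prod_primes_dvd[OF f(2)])
   fix p assume p: "p \<in> B"
   have "fact m * fact (m + 1) * ((2 * m + 1) choose m) = (fact (2 * m + 1) :: nat)"
    using binomial_fact_lemma[of m "2 * m + 1"] by simp
   moreover have "p dvd fact (2 * m + 1)" using p m by (subst prime_dvd_fact_iff) (auto simp: B_def)
   ultimately have "p dvd fact m * fact (m + 1) * ((2 * m + 1) choose m)" by simp
   moreover have "\<not> p dvd fact m" "\<not> p dvd fact (m + 1)" using p by (auto simp: B_def prime_dvd_fact_iff simp del: fact_Suc)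
   ultimately show "is_prime p \<and> p dvd (2 * m + 1) choose m"
    using p by (simp add: B_def prime_dvd_mult_iff del: fact_Suc)
  qed
  then have "\<Prod>B \<le> (2 * m + 1) choose m" by (rule dvd_imp_le) simp
  also have "... \<le> 4 ^ m" by (rule binomial_odd_le)
  finally have "\<Prod>B \<le> 4 ^ m" .
  moreover have "\<Prod>A \<le> 4 ^ (m + 1)" unfolding A_def by (rule less.IH) (use m 4 in auto)
  ultimately have "\<Prod>A * \<Prod>B \<le> 4 ^ (m + 1) * 4 ^ m" by (rule mult_le_mono[rotated])
  also have "... = 4 ^ N" by (simp add: m flip: power_add)
  finally have le: "\<Prod>A * \<Prod>B \<le> 4 ^ N" .
  have "A \<inter> B = {}" by (auto simp: A_def B_def)
  then show ?thesis unfolding e using prod.union_disjoint[OF f, of "%x. x"] le by simp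
 qed
qed

text \<open>The weight of Chebyshev's theta function.\<close>

definition lp :: "nat => real" where "lp p = (if is_prime p then ln (real p) else 0)"

lemma lp_nonneg: "lp p \<ge> 0"
 using prime_ge_1_nat[of p] by (simp add: lp_def)

lemma theta_le: "(\<Sum>p\<le>N. lp p) \<le> 2 * real N"
proof -
 have f: "finite {p. is_prime p \<and> p \<le> N}" by (rule finite_subset[of _ "{..N}"]) auto
 have "(\<Sum>p\<le>N. lp p) = (\<Sum>p\<in>{p. is_prime p \<and> p \<le> N}. ln (real p))"
  by (rule sum.mono_neutral_cong_right) (auto simp: lp_def)
 also have "... = ln (\<Prod>p\<in>{p. is_prime p \<and> p \<le> N}. real p)"
  by (rule ln_prod[symmetric]) (use f prime_gt_0_nat in auto)
 also have "(\<Prod>p\<in>{p. is_prime p \<and> p \<le> N}. real p) = real (\<Prod>{p. is_prime p \<and> p \<le> N})" by simp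
 also have "ln ... \<le> ln (real (4 ^ N))"
 proof (rule ln_mono)
  show "real (\<Prod>{p. is_prime p \<and> p \<le> N}) \<le> real (4 ^ N)"
   using primorial_le[of N] by (simp only: of_nat_le_iff)
  have "\<Prod>{p. is_prime p \<and> p \<le> N} > 0" by (rule prod_pos) (use prime_gt_0_nat in auto)
  then show "0 < real (\<Prod>{p. is_prime p \<and> p \<le> N})" by (simp only: of_nat_0_less_iff)
 qed
 also have "ln (real (4 ^ N)) = N * (2 * ln 2)"
  using ln_realpow[of 2 2] by (simp add: ln_realpow)
 also have "... \<le> real N * 2" using mult_left_mono[of "2 * ln 2" 2 "real N"] ln_2_less_1 by simp
 finally show ?thesis by simp
qed

text \<open>Partial summation, by induction. It transfers information on the partial sums of
  \<open>t\<close> to sums against a decreasing weight \<open>g\<close>.\<close>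

lemma abel_majorize:
 fixes t g :: "nat => real"
 assumes T: "\<And>N. N \<ge> 1 ==> (\<Sum>m=1..N. t m) \<ge> 0" and g: "\<And>m. m \<ge> 1 ==> g (Suc m) \<le> g m"
  and N: "N \<ge> 1"
 shows "(\<Sum>m=1..N. t m * g m) \<ge> (\<Sum>m=1..N. t m) * g N"
 using N
proof (induction N rule: nat_induct_at_least)
 case (Suc N)
 have "(\<Sum>m=1..N. t m) * g (Suc N) \<le> (\<Sum>m=1..N. t m) * g N"
  using T[of N] g[of N] Suc by (intro mult_left_mono) auto
 then show ?case using Suc by (simp add: algebra_simps)
qed simp

text \<open>Bernoulli's inequality for the quotient of the two roots; the right side is made to
  telescope.\<close>

lemma root_weight:
 fixes m n :: nat
 assumes n: "n > 0" and m: "m \<ge> 1"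
 shows "root n m / m \<le> n * (root n m - root n (real m - 1))"
proof -
 define u where "u = root n (real m)"
 define v where "v = root n (real m - 1)"
 have u: "u > 0" "u ^ n = m" using n m by (auto simp: u_def)
 have v: "v \<ge> 0" "v ^ n = real m - 1" using n m by (auto simp: v_def)
 have "1 + n * (v / u - 1) \<le> (1 + (v / u - 1)) ^ n" by (rule Bernoulli_inequality) (use u v in simp)
 also have "... = (real m - 1) / m" using u v by (simp add: power_divide)
 finally have "1 + n * (v / u - 1) \<le> 1 - 1 / m" using m by (simp add: diff_divide_distrib)
 then have "1 / m \<le> n * ((u - v) / u)" using u by (simp add: field_simps)
 then have "u * (1 / m) \<le> u * (n * ((u - v) / u))" using u by (intro mult_left_mono) auto
 then show ?thesis using u by (simp add: u_def v_def)
qed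

lemma sum_root_weight:
 fixes n :: nat
 assumes n: "n > 0"
 shows "(\<Sum>m=1..N. root n (real m) / real m) \<le> n * root n N"
proof (induction N)
 case (Suc N)
 have "root n (real (Suc N)) / real (Suc N) \<le> n * (root n (Suc N) - root n N)"
  using root_weight[OF n, of "Suc N"] by simp
 then show ?case using Suc by (simp add: algebra_simps)
qed simp

lemma root_div_antimono:
 fixes m n :: nat
 assumes n: "n > 0" and m: "m \<ge> 1"
 shows "root n (Suc m) / Suc m \<le> root n m / m"
proof -
 define u where "u = root n (real m)"
 define v where "v = root n (real (Suc m))"
 obtain k where k: "n = Suc k" using n by (cases n) auto
 have u: "u > 0" "u ^ n = m" using n m by (auto simp: u_def)
 have v: "v > 0" "v ^ n = Suc m" using n m by (auto simp: v_def)
 have uv: "u \<le> v" unfolding u_def v_def using n by simp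
 have "v / Suc m = v / v ^ n" by (simp only: v(2))
 also have "... = 1 / v ^ k" using v(1) k by simp
 also have "... \<le> 1 / u ^ k" using u uv by (intro divide_left_mono power_mono) auto
 also have "... = u / u ^ n" using u(1) k by simp
 also have "... = u / m" by (simp only: u(2))
 finally show ?thesis by (simp add: u_def v_def)
qed

text \<open>The numbers \<open>2 - lp m\<close> have nonnegative partial sums by the bound on theta,
  so against a decreasing weight the primes may be replaced by twice all integers. The estimate
  later sums up the boundary terms of lattice point counts.\<close>

lemma sum_lp_root:
 fixes n :: nat
 assumes n: "n > 0"
 shows "(\<Sum>p=1..N. lp p * (root n p / p)) \<le> 2 * n * root n N"
proof (cases "N \<ge> 1")
 case True
 define g where "g m = root n (real m) / real m" for m
 have e: "(\<Sum>p=1..N. lp p) \<le> 2 * real N" for N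
 proof -
  have "(\<Sum>p=1..N. lp p) \<le> (\<Sum>p\<le>N. lp p)" by (rule sum_mono2) (auto simp: lp_nonneg)
  then show ?thesis using theta_le[of N] by simp
 qed
 have T: "0 \<le> (\<Sum>m=1..N. (2 - lp m))" for N
  using e[of N] by (simp add: sum_subtractf mult.commute)
 have "0 \<le> (\<Sum>m=1..N. (2 - lp m)) * g N"
  using n by (intro mult_nonneg_nonneg T) (auto simp: g_def)
 also have "... \<le> (\<Sum>m=1..N. (2 - lp m) * g m)"
  unfolding g_def by (rule abel_majorize[where t = "%m. 2 - lp m" and g = "%m. root n (real m) / real m", OF T root_div_antimono[OF n] True])
 finally have "(\<Sum>m=1..N. lp m * g m) \<le> 2 * (\<Sum>m=1..N. g m)"
  by (simp add: left_diff_distrib sum_subtractf sum_distrib_left)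
 then show ?thesis using sum_root_weight[OF n, of N] by (simp add: g_def)
next
 case False
 then have "N = 0" by simp
 then show ?thesis by simp
qed

text \<open>The logarithm is at most twice the square root, and the terms of exponent
  \<open>3/2\<close> that result telescope against \<open>1 / sqrt m\<close>. This convergent sum
  later absorbs prime powers and ideals of higher degree.\<close>

lemma sum_lp_square: "(\<Sum>p=1..N. lp p / real p ^ 2) \<le> 10"
proof -
 have step: "1 / (real m * sqrt m) \<le> 2 * (1 / sqrt (m - 1) - 1 / sqrt m)" if "m \<ge> 2" for m :: nat
 proof -
  define u where "u = sqrt (real m)"
  define v where "v = sqrt (real m - 1)"
  have u: "u > 0" "u\<^sup>2 = m" using that by (auto simp: u_def)
  have v: "v > 0" "v\<^sup>2 = real m - 1" using that by (auto simp: v_def)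
  have uv: "v \<le> u" by (simp add: u_def v_def)
  have "(u - v) * (u + v) = 1" using u v by (simp add: algebra_simps power2_eq_square)
  then have d: "u - v = 1 / (u + v)" using u v by (simp add: field_simps)
  have "1 / v - 1 / u = (u - v) / (u * v)" using u v by (simp add: field_simps)
  also have "... = 1 / ((u + v) * (u * v))" using u v d by simp
  also have "... \<ge> 1 / ((u + u) * (u * u))" using u v uv
   by (intro divide_left_mono mult_mono add_mono mult_pos_pos add_pos_pos) auto
  finally have "1 / (2 * u * u\<^sup>2) \<le> 1 / v - 1 / u" by (simp add: power2_eq_square mult_ac)
  moreover have "real (m - 1) = real m - 1" using that by simp
  ultimately show ?thesis using u by (simp add: u_def v_def field_simps)
 qed
 have lnb: "ln x \<le> 2 * sqrt x" if "x > 0" for x :: real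
 proof -
  have "ln (sqrt x) \<le> sqrt x - 1" by (rule ln_le_minus_one) (use that in simp)
  then show ?thesis using that by (simp add: ln_sqrt)
 qed
 have trm: "lp m / real m ^ 2 \<le> 2 * (1 / (real m * sqrt m))" if "m \<ge> 1" for m :: nat
 proof -
  have "lp m \<le> 2 * sqrt m" using lnb[of "real m"] that by (simp add: lp_def)
  then have "lp m / real m ^ 2 \<le> 2 * sqrt m / real m ^ 2" by (intro divide_right_mono) auto
  also have "... = 2 * (1 / (real m * sqrt m))"
   using that by (simp add: power2_eq_square field_simps)
  finally show ?thesis .
 qed
 have tel: "(\<Sum>m=2..M. 1 / (real m * sqrt m)) \<le> 2 * (1 - 1 / sqrt M)" if "M \<ge> 1" for M :: nat
  using that
 proof (induction M rule: nat_induct_at_least)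
  case (Suc M)
  have "(\<Sum>m=2..Suc M. 1 / (real m * sqrt m)) = (\<Sum>m=2..M. 1 / (real m * sqrt m)) + 1 / (real (Suc M) * sqrt (Suc M))"
   using Suc by simp
  then show ?case using Suc step[of "Suc M"] by (simp add: right_diff_distrib)
 qed simp
 show ?thesis
 proof (cases "N \<ge> 1")
  case True
  have "(\<Sum>p=1..N. lp p / real p ^ 2) \<le> (\<Sum>p=1..N. 2 * (1 / (real p * sqrt p)))"
   by (rule sum_mono) (use trm in auto)
  also have "... = 2 + 2 * (\<Sum>p=2..N. 1 / (real p * sqrt p))"
   using True by (simp add: sum.atLeast_Suc_atMost sum_distrib_left numeral_2_eq_2)
  also have "... \<le> 2 + 2 * (2 * (1 - 1 / sqrt N))" using tel[OF True] by (intro add_mono mult_left_mono) auto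
  also have "... \<le> 10"
  proof -
   define t where "t = 1 / sqrt (real N)"
   have "t \<ge> 0" by (simp add: t_def)
   then show ?thesis unfolding t_def[symmetric] by simp
  qed
  finally show ?thesis .
 qed simp
qed

text \<open>For points at mutual distance at least one, the integer part of the distance
 to a fixed point is attained at most twice, so the sum of logarithms is at least that of a factorial.\<close>

lemma sum_ln_line:
 fixes c :: int and \<mu> :: complex and L :: nat
 assumes c: "c \<noteq> 0" and G: "G \<subseteq> {..<L}" "\<And>x. x \<in> G ==> norm (of_int c * of_nat x + \<mu>) \<ge> 1/2"
 shows "(\<Sum>x\<in>G. ln (norm (of_int c * of_nat x + \<mu>))) \<ge> real (card G) * ln L - 4 * L"
proof -
 define u where "u x = norm (of_int c * of_nat x + \<mu>)" for x :: nat
 define \<rho> where "\<rho> = - Re \<mu> / of_int c"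
 define j where "j x = nat \<lfloor>\<bar>real x - \<rho>\<bar>\<rfloor>" for x :: nat
 have fG: "finite G" using G(1) finite_subset by blast
 have uj: "u x \<ge> (real (j x) + 1) / 2" if x: "x \<in> G" for x
 proof -
  have "\<bar>of_int c * (real x - \<rho>)\<bar> \<le> u x"
   using abs_Re_le_cmod[of "of_int c * of_nat x + \<mu>"] c by (simp add: u_def \<rho>_def algebra_simps)
  moreover have "\<bar>real x - \<rho>\<bar> \<le> \<bar>of_int c * (real x - \<rho>)\<bar>"
  proof -
   have "1 \<le> \<bar>real_of_int c\<bar>" using c by linarith
   then show ?thesis unfolding abs_mult using mult_right_mono[of 1 "\<bar>real_of_int c\<bar>" "\<bar>real x - \<rho>\<bar>"] by simp
  qed
  ultimately have "u x \<ge> \<bar>real x - \<rho>\<bar>" by linarith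
  moreover have "real (j x) \<le> \<bar>real x - \<rho>\<bar>" unfolding j_def by simp
  moreover have "u x \<ge> 1/2" using G(2)[OF x] by (simp add: u_def)
  moreover have "j x = 0 \<or> real (j x) \<ge> 1" by linarith
  ultimately show ?thesis by auto
 qed
 have fib: "card {x \<in> G. j x = k} \<le> 2" for k
 proof -
  have "{x \<in> G. j x = k} \<subseteq> {nat \<lceil>\<rho> + k\<rceil>, nat \<lfloor>\<rho> - k\<rfloor>}"
  proof
   fix x assume "x \<in> {x \<in> G. j x = k}"
   then have "nat \<lfloor>\<bar>real x - \<rho>\<bar>\<rfloor> = k" by (simp add: j_def)
   then have fl: "real k \<le> \<bar>real x - \<rho>\<bar>" "\<bar>real x - \<rho>\<bar> < real k + 1" by linarith+
   show "x \<in> {nat \<lceil>\<rho> + k\<rceil>, nat \<lfloor>\<rho> - k\<rfloor>}"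
   proof (cases "real x \<ge> \<rho>")
    case True
    then have "\<lceil>\<rho> + k\<rceil> = int x" using fl by (intro ceiling_unique) auto
    then show ?thesis by simp
   next
    case False
    then have "\<lfloor>\<rho> - k\<rfloor> = int x" using fl by (intro floor_unique) auto
    then show ?thesis by simp
   qed
  qed
  then have "card {x \<in> G. j x = k} \<le> card {nat \<lceil>\<rho> + k\<rceil>, nat \<lfloor>\<rho> - k\<rfloor>}" by (intro card_mono) auto
  also have "... \<le> 2" by (simp add: card_insert_if)
  finally show ?thesis .
 qed
 show ?thesis
 proof (cases "L = 0")
  case True
  then show ?thesis using G(1) by simp
 next
  case False
  \<comment> \<open>The deficit of a point at rounded distance \<open>k\<close>: a logarithm of at
    least \<open>ln ((k + 1) / 2)\<close> falls short of \<open>ln L\<close> by at most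
    \<open>h k\<close>.\<close>
  define h where "h k = (if k < L then ln (2 * real L / (real k + 1)) else 0)" for k
  have h0: "h k \<ge> 0" for k unfolding h_def by (auto intro!: ln_ge_zero simp: field_simps)
  have t: "ln (u x) \<ge> ln L - h (j x)" if x: "x \<in> G" for x
  proof (cases "j x < L")
   case True
   have "ln L - h (j x) = ln ((real (j x) + 1) / 2)"
    using True False by (simp add: h_def ln_div ln_mult)
   also have "... \<le> ln (u x)" using uj[OF x] by (intro ln_mono) (auto intro: less_le_trans[rotated])
   finally show ?thesis .
  next
   case False2: False
   have "ln (real L) \<le> ln (u x)"
   proof (rule ln_mono)
    have "\<bar>of_int c * (real x - \<rho>)\<bar> \<le> u x"
     using abs_Re_le_cmod[of "of_int c * of_nat x + \<mu>"] c by (simp add: u_def \<rho>_def algebra_simps)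
    moreover have "\<bar>real x - \<rho>\<bar> \<le> \<bar>of_int c * (real x - \<rho>)\<bar>"
    proof -
     have "1 \<le> \<bar>real_of_int c\<bar>" using c by linarith
     then show ?thesis unfolding abs_mult using mult_right_mono[of 1 "\<bar>real_of_int c\<bar>" "\<bar>real x - \<rho>\<bar>"] by simp
    qed
    moreover have "real (j x) \<le> \<bar>real x - \<rho>\<bar>" unfolding j_def by simp
    ultimately show "real L \<le> u x" using False2 by linarith
    then show "0 < real L" using False by simp
   qed
   then show ?thesis using False2 by (simp add: h_def)
  qed
  have "(\<Sum>x\<in>G. h (j x)) = (\<Sum>k<L. real (card {x \<in> G. j x = k}) * h k)"
  proof -
   have "(\<Sum>x\<in>G. h (j x)) = (\<Sum>x\<in>G. \<Sum>k<L. if j x = k then h k else 0)"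
    by (rule sum.cong) (auto simp: h_def)
   also have "... = (\<Sum>k<L. \<Sum>x\<in>G. if j x = k then h k else 0)" by (rule sum.swap)
   also have "... = (\<Sum>k<L. real (card {x \<in> G. j x = k}) * h k)"
    by (rule sum.cong) (auto simp: sum.If_cases[OF fG] Int_def)
   finally show ?thesis .
  qed
  also have "... \<le> (\<Sum>k<L. 2 * h k)"
   by (intro sum_mono mult_right_mono h0) (use fib in \<open>simp add: of_nat_le_iff[of _ 2, where 'a = real, simplified]\<close>)
  also have "... = 2 * (\<Sum>k<L. ln 2 + ln L - ln (real k + 1))"
   unfolding sum_distrib_left using False by (intro sum.cong) (auto simp: h_def ln_div ln_mult)
  also have "... = 2 * (L * ln 2 + (L * ln L - ln (fact L)))"
  proof -
   have "ln (fact L) = (\<Sum>k<L. ln (real k + 1))"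
    by (induction L) (auto simp: ln_mult add.commute)
   then show ?thesis by (simp add: sum.distrib sum_subtractf algebra_simps)
  qed
  also have "... \<le> 2 * (real L * 1 + real L * 1)"
  proof -
   \<comment> \<open>Stirling's bound, read off from the single term \<open>L ^ L / fact L\<close>
     of the exponential series at \<open>L\<close>.\<close>
   have "L * ln L - ln (fact L) \<le> L"
   proof -
    have "real L ^ L / fact L \<le> exp (real L)"
    proof -
     have "(\<Sum>i\<le>L. real L ^ i /\<^sub>R fact i) \<le> suminf (%i. real L ^ i /\<^sub>R fact i)"
      by (rule sum_le_suminf) (use summable_exp[of "real L"] in auto)
     moreover have "real L ^ L /\<^sub>R fact L \<le> (\<Sum>i\<le>L. real L ^ i /\<^sub>R fact i)"
      by (rule member_le_sum) auto
     ultimately show ?thesis by (simp add: exp_def divide_inverse mult.commute)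
    qed
    then have "ln (real L ^ L / fact L) \<le> ln (exp (real L))" using False by (intro ln_mono) auto
    then show ?thesis using False by (simp add: ln_div ln_realpow)
   qed
   then show ?thesis using mult_left_mono[of "ln 2" 1 "real L"] ln_2_less_1 by simp
  qed
  finally have "(\<Sum>x\<in>G. h (j x)) \<le> 4 * L" by simp
  moreover have "(\<Sum>x\<in>G. ln (u x)) \<ge> (\<Sum>x\<in>G. ln L - h (j x))" by (rule sum_mono) (rule t)
  ultimately show ?thesis by (simp add: u_def sum_subtractf)
 qed
qed

section \<open>Norms along lines and averages over boxes\<close>

context nring
begin

text \<open>The order is reversed because the images of the basis stand in the rows of
  \<open>mm\<close>.\<close>

lemma mm_mult: "u \<in> R ==> v \<in> R ==> mm (u * v) = mm v * mm u"
proof (rule eq_matI)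
 assume u: "u \<in> R" and v: "v \<in> R"
 fix i j assume "i < dim_row (mm v * mm u)" "j < dim_col (mm v * mm u)"
 then have ij: "i < n" "j < n" by simp_all
 have "u * v * b i = u * (\<Sum>k<n. of_int (mm v $$ (i,k)) * b k)"
  using mult_b[OF v ij(1)] by (simp add: mult.assoc)
 also have "... = (\<Sum>k<n. of_int (mm v $$ (i,k)) * (u * b k))"
  by (simp add: sum_distrib_left mult.left_commute)
 finally have "co (u * v * b i) j = (\<Sum>k<n. mm v $$ (i,k) * co (u * b k) j)"
  using co_lincomb[of "{..<n}" "%k. u * b k" j "%k. mm v $$ (i,k)"] ij mult[OF u b_in] by simp
 then show "mm (u * v) $$ (i,j) = (mm v * mm u) $$ (i,j)"
  using ij by (simp add: scalar_prod_def atLeast0LessThan mm_def)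
qed simp_all

lemma dt_mult: "u \<in> R ==> v \<in> R ==> dt (u * v) = dt u * dt v"
 unfolding dt_def using mm_mult det_mult[OF mm_carrier mm_carrier] by (simp add: mult.commute)

text \<open>As a function of \<open>k\<close> the norm of \<open>z + k\<close> is the characteristic
  polynomial of the negative of the multiplication matrix of \<open>z\<close>, which splits over the
  complex numbers.\<close>

lemma dt_shift:
 assumes z: "z \<in> R"
 shows "\<exists>\<mu>::nat => complex. \<forall>k::int. of_int (dt (z + of_int k)) = (\<Prod>i<n. of_int k + \<mu> i)"
proof -
 define A where "A = - map_mat complex_of_int (mm z)"
 have A: "A \<in> carrier_mat n n" by (simp add: A_def)
 obtain as where as: "char_poly A = (\<Prod>a\<leftarrow>as. [:- a, 1:])" "length as = n"
  using char_poly_factorized[OF A] by (elim exE conjE)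
 have "of_int (dt (z + of_int k)) = (\<Prod>i<n. of_int k + - (as ! i))" for k :: int
 proof -
  have m: "- (char_matrix A (of_int k)) = map_mat complex_of_int (mm (z + of_int k))"
  proof (rule eq_matI)
   fix i j assume "i < dim_row (map_mat complex_of_int (mm (z + of_int k)))" "j < dim_col (map_mat complex_of_int (mm (z + of_int k)))"
   then have ij: "i < n" "j < n" by simp_all
   have "(z + of_int k) * b i = z * b i + of_int k * b i" by (simp add: distrib_right)
   then have "co ((z + of_int k) * b i) j = co (z * b i) j + (if i = j then k else 0)"
    using ij co_add[OF mult[OF z b_in] mult[OF of_int_in b_in], of i i j k] co_smult[OF b_in, of i j k] co_b[of i j] by simp
   then show "(- char_matrix A (of_int k)) $$ (i,j) = map_mat complex_of_int (mm (z + of_int k)) $$ (i,j)"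
    using ij by (simp add: char_matrix_def A_def mm_def)
  qed (simp_all add: char_matrix_def A_def)
  have "of_int (dt (z + of_int k)) = det (map_mat complex_of_int (mm (z + of_int k)))"
   by (simp add: dt_def)
  also have "... = poly (char_poly A) (of_int k)" unfolding char_poly_matrix[OF A] m ..
  also have "... = (\<Prod>a\<leftarrow>as. of_int k - a)" unfolding as(1) by (induction as) (simp_all add: left_diff_distrib)
  also have "... = (\<Prod>i<n. of_int k + - (as ! i))"
   using as(2) by (simp add: prod.list_conv_set_nth atLeast0LessThan)
  finally show ?thesis .
 qed
 then show ?thesis by (intro exI[of _ "%i. - (as ! i)"] allI)
qed

text \<open>Multiplication by \<open>conj \<beta>\<close> turns the step of the line into the
  integer \<open>dt \<beta>\<close>. The norms then become products of \<open>n\<close> factors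
  \<open>c * x + \<mu> i\<close>, and for each \<open>i\<close> the estimate for points on a line
  applies.\<close>

lemma line_bound:
 assumes \<beta>: "\<beta> \<in> R" "\<beta> \<noteq> 0"
 shows "\<exists>C. \<forall>y\<in>R. \<forall>L\<ge>1. (\<forall>x<L. y + of_nat x * \<beta> \<noteq> 0) -->
  (\<Sum>x<L. ln (real_of_int \<bar>dt (y + of_nat x * \<beta>)\<bar>)) \<ge> n * (L * ln (real L)) - C * real L"
proof -
 define c where "c = dt \<beta>"
 define \<beta>' where "\<beta>' = conj \<beta>"
 have c: "c \<noteq> 0" using dt_nz[OF \<beta>] by (simp add: c_def)
 have \<beta>': "\<beta>' \<in> R" "\<beta> * \<beta>' = of_int c" using conj_in mult_conj[OF \<beta>(1)] by (auto simp: \<beta>'_def c_def)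
 have "\<beta>' \<noteq> 0" using \<beta>'(2) c by auto
 then have d: "dt \<beta>' \<noteq> 0" by (rule dt_nz[OF \<beta>'(1)])
 define l where "l = ln (real_of_int \<bar>dt \<beta>'\<bar>)"
 \<comment> \<open>The three summands pay for at most \<open>n\<close> discarded points in each of
   the \<open>n\<close> factors, for the error of the \<open>n\<close> line estimates, and for the
   factor \<open>dt \<beta>'\<close>.\<close>
 define C where "C = real n * real n + 4 * real n + l"
 have "(\<Sum>x<L. ln (real_of_int \<bar>dt (y + of_nat x * \<beta>)\<bar>)) \<ge> n * (L * ln (real L)) - C * real L"
  if y: "y \<in> R" and L: "L \<ge> 1" and nz: "\<forall>x<L. y + of_nat x * \<beta> \<noteq> 0" for y and L :: nat
 proof -
  define a where "a x = y + of_nat x * \<beta>" for x :: nat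
  have nat_in: "of_nat x \<in> R" for x using of_int_in[of "int x"] by simp
  have aR: "a x \<in> R" for x unfolding a_def by (intro subgrp_add[OF subgrp_R] y mult nat_in \<beta>)
  have dtnz: "dt (a x) \<noteq> 0" if "x < L" for x using dt_nz[OF aR] nz that by (simp add: a_def)
  obtain \<mu> :: "nat => complex" where \<mu>: "\<And>k::int. of_int (dt (\<beta>' * y + of_int k)) = (\<Prod>i<n. of_int k + \<mu> i)"
   using dt_shift[OF mult[OF \<beta>'(1) y]] by blast
  define u where "u i x = norm (of_int c * of_nat x + \<mu> i)" for i and x :: nat
  have eq: "real_of_int \<bar>dt \<beta>'\<bar> * real_of_int \<bar>dt (a x)\<bar> = (\<Prod>i<n. u i x)" for x
  proof -
   have "\<beta>' * a x = \<beta>' * y + of_int (c * int x)"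
    using \<beta>'(2) by (simp add: a_def distrib_left mult_ac)
   then have "dt \<beta>' * dt (a x) = dt (\<beta>' * y + of_int (c * int x))" using dt_mult[OF \<beta>'(1) aR] by metis
   then have "complex_of_int (dt \<beta>' * dt (a x)) = (\<Prod>i<n. of_int (c * int x) + \<mu> i)" using \<mu> by metis
   then have "norm (complex_of_int (dt \<beta>' * dt (a x))) = (\<Prod>i<n. u i x)"
    by (simp add: u_def prod_norm[symmetric])
   then show ?thesis by (simp add: norm_mult)
  qed
  \<comment> \<open>Factors below 1/2 have uncontrolled logarithms. For each \<open>i\<close> this
    happens for at most one \<open>x\<close>, the points \<open>c * x\<close> being at mutual
    distance at least 1. At a discarded point the integer \<open>dt (a x)\<close> is nonzero, so
    omitting its logarithm loses nothing.\<close>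
  define G where "G = {x. x < L \<and> (\<forall>i<n. u i x \<ge> 1/2)}"
  have fG: "finite G" "G \<subseteq> {..<L}" by (auto simp: G_def)
  have one: "card {x. x < L \<and> u i x < 1/2} \<le> 1" for i
  proof -
   have "x = x'" if x: "u i x < 1/2" "u i x' < 1/2" for x x'
   proof (rule ccontr)
    assume ne: "x \<noteq> x'"
    have "norm (of_int c * (of_nat x - of_nat x') :: complex) \<le> u i x + u i x'"
     using norm_triangle_ineq4[of "of_int c * of_nat x + \<mu> i" "of_int c * of_nat x' + \<mu> i"]
     by (simp add: u_def right_diff_distrib)
    also have "... < 1" using x by simp
    finally have "norm (complex_of_int (c * (int x - int x'))) < 1" by simp
    then have "\<bar>c * (int x - int x')\<bar> < 1" by (simp only: norm_of_int)
    then show False using c ne by simp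
   qed
   moreover have "finite {x. x < L \<and> u i x < 1/2}" by simp
   ultimately show ?thesis unfolding One_nat_def by (subst card_le_Suc0_iff_eq) simp_all
  qed
  have cG: "real L - real n \<le> real (card G)"
  proof -
   have "{..<L} = G \<union> (\<Union>i<n. {x. x < L \<and> u i x < 1/2})" by (auto simp: G_def not_less)
   then have "L = card (G \<union> (\<Union>i<n. {x. x < L \<and> u i x < 1/2}))" by (metis card_lessThan)
   also have "... \<le> card G + card (\<Union>i<n. {x. x < L \<and> u i x < 1/2})" by (rule card_Un_le)
   also have "card (\<Union>i<n. {x. x < L \<and> u i x < 1/2}) \<le> (\<Sum>i<n. card {x. x < L \<and> u i x < 1/2})"
    by (rule card_UN_le) simp
   also have "... \<le> (\<Sum>i<n. 1)" by (rule sum_mono) (rule one)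
   finally show ?thesis by simp
  qed
  have lnd: "ln (real_of_int \<bar>dt (a x)\<bar>) = (\<Sum>i<n. ln (u i x)) - l" if x: "x \<in> G" for x
  proof -
   have up: "u i x > 0" if "i < n" for i using x that by (force simp: G_def)
   have "ln (\<Prod>i<n. u i x) = (\<Sum>i<n. ln (u i x))" by (rule ln_prod) (auto dest: up)
   moreover have "ln (real_of_int \<bar>dt \<beta>'\<bar> * real_of_int \<bar>dt (a x)\<bar>) = l + ln (real_of_int \<bar>dt (a x)\<bar>)"
    unfolding l_def using d dtnz[of x] x by (simp add: ln_mult G_def)
   ultimately show ?thesis using eq[of x] by simp
  qed
  have "n * (L * ln (real L)) - C * real L \<le> n * (real (card G) * ln L - 4 * L) - real (card G) * l"
  proof -
   have l0: "l \<ge> 0" unfolding l_def using d by (auto intro!: ln_ge_zero)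
   have lnL: "0 \<le> ln (real L)" "ln (real L) \<le> real L" using L ln_le_minus_one[of "real L"] by auto
   have "(real L - real n) * ln L \<le> real (card G) * ln L" by (rule mult_right_mono[OF cG lnL(1)])
   moreover have "real n * ln L \<le> real n * real L" by (rule mult_left_mono[OF lnL(2)]) simp
   ultimately have "real L * ln L - real n * L \<le> real (card G) * ln L" by (simp add: left_diff_distrib)
   then have "real n * (real L * ln L - real n * L - 4 * L) \<le> real n * (real (card G) * ln L - 4 * L)"
    by (intro mult_left_mono) auto
   moreover have "real (card G) * l \<le> real L * l"
    using card_mono[OF _ fG(2)] l0 by (intro mult_right_mono) auto
   ultimately show ?thesis by (simp add: C_def algebra_simps)
  qed
  also have "... \<le> (\<Sum>i<n. \<Sum>x\<in>G. ln (u i x)) - (\<Sum>x\<in>G. l)"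
  proof -
   have "(\<Sum>i<n. real (card G) * ln L - 4 * L) \<le> (\<Sum>i<n. \<Sum>x\<in>G. ln (u i x))"
    unfolding u_def by (rule sum_mono, rule sum_ln_line[OF c fG(2)]) (auto simp: G_def u_def)
   then show ?thesis by simp
  qed
  also have "... = (\<Sum>x\<in>G. (\<Sum>i<n. ln (u i x)) - l)"
   by (subst sum.swap) (simp add: sum_subtractf)
  also have "... = (\<Sum>x\<in>G. ln (real_of_int \<bar>dt (a x)\<bar>))" by (rule sum.cong[OF refl], rule lnd[symmetric])
  also have "... \<le> (\<Sum>x<L. ln (real_of_int \<bar>dt (a x)\<bar>))"
  proof (rule sum_mono2[OF _ fG(2)])
   fix x assume "x \<in> {..<L} - G"
   then have "dt (a x) \<noteq> 0" using dtnz by auto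
   then have "1 \<le> \<bar>dt (a x)\<bar>" by linarith
   then have "1 \<le> real_of_int \<bar>dt (a x)\<bar>" by linarith
   then show "0 \<le> ln (real_of_int \<bar>dt (a x)\<bar>)" by (rule ln_ge_zero)
  qed simp
  finally show ?thesis by (simp add: a_def)
 qed
 then show ?thesis by blast
qed

text \<open>The product of \<open>a\<close> with its cofactor \<open>conj a\<close> is the integer \<open>dt a\<close>, so the index of
 \<open>conj a\<close> bounds the index of \<open>a\<close> from below; the loss is harmless on average.\<close>

lemma ln_idx_lower:
 "\<exists>C. \<forall>r a. r \<ge> 1 --> bx r a --> a \<noteq> 0 -->
  ln (real (idx R (mul a))) \<ge> n * ln (real_of_int \<bar>dt a\<bar>) - n * ((n - 1) * ln r) - C"
proof -
 obtain C0 where C0: "C0 \<ge> 1" "\<And>r a. r \<ge> 0 ==> bx r a ==> bx (C0 * r ^ (n - 1)) (conj a)"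
  using conj_bound by blast
 define C1 where "C1 = 2 * (n * (kc * C0)) + 1"
 have C1: "C1 > 0" unfolding C1_def using kc_ge C0(1) by (simp add: add_nonneg_pos)
 have "ln (real (idx R (mul a))) \<ge> n * ln (real_of_int \<bar>dt a\<bar>) - n * ((n - 1) * ln r) - n * ln C1"
  if r: "r \<ge> 1" "bx r a" "a \<noteq> 0" for r a
 proof -
  have aR: "a \<in> R" by (rule bx_in[OF r(2)])
  have d: "dt a \<noteq> 0" by (rule dt_nz[OF aR r(3)])
  have cn: "conj a \<noteq> 0" using mult_conj[OF aR] d by auto
  have bc: "bx (C0 * r ^ (n - 1)) (conj a)" by (rule C0(2)) (use r in auto)
  have "idx R (mul a) * idx R (mul (conj a)) = nat \<bar>dt a\<bar> ^ n"
   using idx_mul_mult[OF aR r(3) conj_in cn] mult_conj[OF aR] idx_mul_int[OF d] by simp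
  then have e: "real (idx R (mul a)) * real (idx R (mul (conj a))) = real_of_int \<bar>dt a\<bar> ^ n"
   by (metis abs_ge_zero of_nat_mult of_nat_nat of_nat_power)
  have p: "real (idx R (mul a)) > 0" "real (idx R (mul (conj a))) > 0"
   using idx_pos[OF finite_mul[OF aR r(3)] subgrp_R] idx_pos[OF finite_mul[OF conj_in cn] subgrp_R] by simp_all
  have "real (idx R (mul (conj a))) \<le> (2 * (n * (kc * (C0 * r ^ (n - 1)))) + 1) ^ n"
   by (rule idx_mul_le(2)[OF cn bc])
  also have "... \<le> (C1 * r ^ (n - 1)) ^ n"
  proof (rule power_mono)
   have "1 \<le> r ^ (n - 1)" using r(1) by simp
   then show "2 * (n * (kc * (C0 * r ^ (n - 1)))) + 1 \<le> C1 * r ^ (n - 1)"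
    by (simp add: C1_def algebra_simps)
   show "0 \<le> 2 * (n * (kc * (C0 * r ^ (n - 1)))) + 1" using kc_ge C0(1) r(1) by (intro add_nonneg_nonneg mult_nonneg_nonneg) auto
  qed
  finally have "ln (real (idx R (mul (conj a)))) \<le> ln ((C1 * r ^ (n - 1)) ^ n)"
   by (rule ln_mono[rotated, rotated]) (use p in auto)
  also have "... = n * (ln C1 + (n - 1) * ln r)"
   using C1 r(1) by (simp add: ln_realpow ln_mult)
  finally have "ln (real (idx R (mul (conj a)))) \<le> n * (ln C1 + (n - 1) * ln r)" .
  moreover have "ln (real (idx R (mul a))) + ln (real (idx R (mul (conj a)))) = n * ln (real_of_int \<bar>dt a\<bar>)"
   using arg_cong[OF e, of ln] p d by (simp add: ln_mult ln_realpow)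
  ultimately show ?thesis by (simp add: algebra_simps)
 qed
 then show ?thesis by blast
qed

lemma ibox_lines:
 "(\<Sum>z\<in>ibox 0 (int L). f z) = (\<Sum>z\<in>{z \<in> ibox 0 (int L). co z 0 = 0}. \<Sum>x<L. f (z + of_nat x * b 0))"
proof -
 define Z where "Z = {z \<in> ibox 0 (int L). co z 0 = 0}"
 have co': "co (of_nat x * b 0) i = (if i = 0 then int x else 0)" "of_nat x * b 0 \<in> R" if "i < n" for x i
  using co_smult[OF b_in[OF n_pos] that, of "int x"] co_b[OF n_pos that] mult[OF of_int_in[of "int x"] b_in[OF n_pos]] by simp_all
 have "(\<Sum>z\<in>Z. \<Sum>x<L. f (z + of_nat x * b 0)) = (\<Sum>(z,x)\<in>Z \<times> {..<L}. f (z + of_nat x * b 0))"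
  by (rule sum.cartesian_product)
 also have "... = (\<Sum>z\<in>ibox 0 (int L). f z)"
 proof (rule sum.reindex_bij_witness[of _ "%z. (z - of_nat (nat (co z 0)) * b 0, nat (co z 0))" "%(z,x). z + of_nat x * b 0"])
  fix a assume "a \<in> Z \<times> {..<L}"
  then obtain z x where a: "a = (z,x)" "z \<in> Z" "x < L" by auto
  then have zR: "z \<in> R" "co z 0 = 0" "\<And>i. i < n ==> 0 \<le> co z i \<and> co z i < int L" by (auto simp: Z_def ibox_def)
  have c: "co (z + of_nat x * b 0) i = co z i + (if i = 0 then int x else 0)" if "i < n" for i
   using co_add[OF zR(1) co'(2)[OF that] that] co'(1)[OF that] by simp
  show "(case a of (z,x) => z + of_nat x * b 0) \<in> ibox 0 (int L)"
   unfolding ibox_def using a zR c subgrp_add[OF subgrp_R zR(1) co'(2)[OF n_pos]] by simp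
  show "((case a of (z,x) => z + of_nat x * b 0) - of_nat (nat (co (case a of (z,x) => z + of_nat x * b 0) 0)) * b 0,
    nat (co (case a of (z,x) => z + of_nat x * b 0) 0)) = a"
   using a zR c[OF n_pos] by simp
  show "f (case a of (z,x) => z + of_nat x * b 0) = (case a of (z,x) => f (z + of_nat x * b 0))"
   by (simp add: a)
 next
  fix z assume z: "z \<in> ibox 0 (int L)"
  then have zR: "z \<in> R" "\<And>i. i < n ==> 0 \<le> co z i \<and> co z i < int L" by (auto simp: ibox_def)
  show "(case (z - of_nat (nat (co z 0)) * b 0, nat (co z 0)) of (z,x) => z + of_nat x * b 0) = z" by simp
  define x where "x = nat (co z 0)"
  have x: "int x = co z 0" using zR(2)[OF n_pos] by (simp add: x_def)
  define w where "w = z - of_nat x * b 0"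
  have "co w i = co z i - (if i = 0 then co z 0 else 0)" if "i < n" for i
   unfolding w_def co_diff[OF zR(1) co'(2)[OF that] that] co'(1)[OF that] x ..
  moreover have "w \<in> R" unfolding w_def by (rule subgrp_diff[OF subgrp_R zR(1) co'(2)[OF n_pos]])
  moreover have "0 < L" using zR(2)[OF n_pos] by linarith
  ultimately have "w \<in> Z" unfolding Z_def ibox_def using zR n_pos by auto
  moreover have "nat (co z 0) < L" using zR(2)[OF n_pos] by linarith
  ultimately show "(z - of_nat (nat (co z 0)) * b 0, nat (co z 0)) \<in> Z \<times> {..<L}" by (simp add: w_def x_def)
 qed
 finally show ?thesis by (simp add: Z_def)
qed

text \<open>Otherwise \<open>D\<close> would be a unit, although the ideal generated by it has index
  \<open>D ^ n > 1\<close>.\<close>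

lemma one_plus_mult_nz:
 assumes D: "D \<ge> (2::int)" and z: "z \<in> R"
 shows "1 + of_int D * z \<noteq> 0"
proof
 assume "1 + of_int D * z = 0"
 then have e: "of_int D * z = - 1" by (simp add: eq_neg_iff_add_eq_0 add.commute)
 then have "z \<noteq> 0" by auto
 moreover have "of_int D \<noteq> (0::complex)" using D by simp
 ultimately have "idx R (mul (- 1)) = idx R (mul (of_int D)) * idx R (mul z)"
  using idx_mul_mult[OF of_int_in _ z, of D] e by simp
 moreover have "idx R (mul (- 1)) = 1" using idx_mul_int[of "-1"] by simp
 ultimately have "nat \<bar>D\<bar> ^ n = 1" using idx_mul_int[of D] D by simp
 then show False using D n_pos by simp
qed

text \<open>Per point, the norms contribute \<open>n * n * ln L\<close> and the cofactors cost
  \<open>n * (n - 1) * ln L\<close>. The difference \<open>n * ln L\<close> is the logarithm of the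
  number of points of the box; this sharp leading term is what the Mertens estimate from below rests
  on.\<close>

lemma avg_lower:
 assumes D: "D \<ge> (2::int)"
 shows "\<exists>C. \<forall>L\<ge>1. (\<Sum>z\<in>ibox 0 (int L). ln (real (idx R (mul (1 + of_int D * z))))) \<ge> real L ^ n * (n * ln L - C)"
proof -
 define \<beta> where "\<beta> = of_int D * b 0"
 have bnz: "b 0 \<noteq> 0" using co_b[OF n_pos n_pos] co_zero[OF n_pos] by auto
 have \<beta>: "\<beta> \<in> R" "\<beta> \<noteq> 0" using mult[OF of_int_in b_in[OF n_pos]] bnz D by (auto simp: \<beta>_def)
 obtain C1 where C1: "\<And>y L. y \<in> R ==> L \<ge> 1 ==> (\<forall>x<L. y + of_nat x * \<beta> \<noteq> 0) ==>
  (\<Sum>x<L. ln (real_of_int \<bar>dt (y + of_nat x * \<beta>)\<bar>)) \<ge> n * (L * ln (real L)) - C1 * real L"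
  using line_bound[OF \<beta>] by blast
 obtain C2 where C2: "\<And>r a. r \<ge> 1 ==> bx r a ==> a \<noteq> 0 ==>
  ln (real (idx R (mul a))) \<ge> n * ln (real_of_int \<bar>dt a\<bar>) - n * ((n - 1) * ln r) - C2"
  using ln_idx_lower by blast
 obtain r1 where r1: "r1 \<ge> 1" "bx r1 1" using ex_bx[OF one] by blast
 define \<kappa> where "\<kappa> = r1 + real_of_int D"
 have \<kappa>: "\<kappa> \<ge> 1" using r1 D by (simp add: \<kappa>_def)
 define C where "C = n * C1 + n * ((n - 1) * ln \<kappa>) + C2"
 have "(\<Sum>z\<in>ibox 0 (int L). ln (real (idx R (mul (1 + of_int D * z))))) \<ge> real L ^ n * (n * ln L - C)" if L: "L \<ge> 1" for L :: nat
 proof -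
  define Z where "Z = {z \<in> ibox 0 (int L). co z 0 = 0}"
  have fZ: "finite Z" unfolding Z_def using finite_ibox by simp
  have ibx: "bx (\<kappa> * L) (1 + of_int D * z)" if "z \<in> ibox 0 (int L)" for z
  proof -
   have zR: "z \<in> R" "\<And>i. i < n ==> 0 \<le> co z i \<and> co z i < int L" using that by (auto simp: ibox_def)
   have "real_of_int \<bar>co (of_int D * z) i\<bar> \<le> real_of_int D * L" if i: "i < n" for i
   proof -
    have "\<bar>co (of_int D * z) i\<bar> = D * co z i" using co_smult[OF zR(1) i, of D] zR(2)[OF i] D by (simp add: abs_mult)
    also have "... \<le> D * int L" using zR(2)[OF i] D by (intro mult_left_mono) auto
    finally have "real_of_int \<bar>co (of_int D * z) i\<bar> \<le> real_of_int (D * int L)" by (simp only: of_int_le_iff)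
    then show ?thesis by simp
   qed
   then have "bx (real_of_int D * L) (of_int D * z)" unfolding bx_def using mult[OF of_int_in zR(1)] by simp
   from bx_add[OF r1(2) this] show ?thesis
    by (rule bx_mono) (use r1 L in \<open>simp add: \<kappa>_def distrib_right mult_le_cancel_left1\<close>)
  qed
  have cZ: "real (card Z) * L = real L ^ n"
   using ibox_lines[of "%_. 1::real" L] card_ibox[of 0 "int L"] by (simp add: Z_def mult.commute)
  have line: "(\<Sum>x<L. ln (real (idx R (mul (1 + of_int D * (z + of_nat x * b 0)))))) \<ge> L * (n * ln L - C)" if z: "z \<in> Z" for z
  proof -
   have zR: "z \<in> R" using z by (simp add: Z_def ibox_def)
   define y where "y = 1 + of_int D * z"
   have y: "y \<in> R" unfolding y_def by (intro subgrp_add[OF subgrp_R] one mult of_int_in zR)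
   have e: "1 + of_int D * (z + of_nat x * b 0) = y + of_nat x * \<beta>" for x :: nat
    by (simp add: y_def \<beta>_def algebra_simps)
   have inb: "z + of_nat x * b 0 \<in> ibox 0 (int L)" if "x < L" for x
   proof -
    have xR: "of_nat x * b 0 \<in> R" using mult[OF of_int_in[of "int x"] b_in[OF n_pos]] by simp
    have "co (z + of_nat x * b 0) i = co z i + (if i = 0 then int x else 0)" if "i < n" for i
     using co_add[OF zR xR that] co_smult[OF b_in[OF n_pos] that, of "int x"] co_b[OF n_pos that] by simp
    then show ?thesis using z that subgrp_add[OF subgrp_R zR xR] by (simp add: Z_def ibox_def)
   qed
   have nz: "y + of_nat x * \<beta> \<noteq> 0" if "x < L" for x
    using one_plus_mult_nz[OF D, of "z + of_nat x * b 0"] inb[OF that] e[of x] by (simp add: ibox_def)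
   have "L * (n * ln L - C) \<le> n * (n * (L * ln (real L)) - C1 * real L) - L * (n * ((n - 1) * ln (\<kappa> * L))) - L * C2"
   proof -
    have "ln (\<kappa> * L) = ln \<kappa> + ln L" using \<kappa> L by (simp add: ln_mult)
    moreover have "real (n - 1) = real n - 1" using n_pos by simp
    ultimately show ?thesis by (simp add: C_def algebra_simps)
   qed
   also have "... \<le> n * (\<Sum>x<L. ln (real_of_int \<bar>dt (y + of_nat x * \<beta>)\<bar>)) - L * (n * ((n - 1) * ln (\<kappa> * L))) - L * C2"
    using C1[OF y L] nz by (intro diff_right_mono mult_left_mono) auto
   also have "... = (\<Sum>x<L. n * ln (real_of_int \<bar>dt (y + of_nat x * \<beta>)\<bar>) - n * ((n - 1) * ln (\<kappa> * L)) - C2)"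
    by (simp add: sum_subtractf sum_distrib_left)
   also have "... \<le> (\<Sum>x<L. ln (real (idx R (mul (y + of_nat x * \<beta>)))))"
   proof (rule sum_mono)
    fix x assume "x \<in> {..<L}"
    then have x: "x < L" by simp
    have "1 \<le> \<kappa> * L" using \<kappa> L mult_mono[of 1 \<kappa> 1 "real L"] by simp
    then show "n * ln (real_of_int \<bar>dt (y + of_nat x * \<beta>)\<bar>) - n * ((n - 1) * ln (\<kappa> * L)) - C2
     \<le> ln (real (idx R (mul (y + of_nat x * \<beta>))))"
     using C2[OF _ _ nz[OF x]] ibx[OF inb[OF x]] e[of x] by simp
   qed
   finally show ?thesis unfolding e .
  qed
  have "real L ^ n * (n * ln L - C) = (\<Sum>z\<in>Z. L * (n * ln L - C))" unfolding cZ[symmetric] by simp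
  also have "... \<le> (\<Sum>z\<in>Z. \<Sum>x<L. ln (real (idx R (mul (1 + of_int D * (z + of_nat x * b 0))))))"
   by (rule sum_mono) (rule line)
  also have "... = (\<Sum>z\<in>ibox 0 (int L). ln (real (idx R (mul (1 + of_int D * z)))))"
   unfolding Z_def by (rule ibox_lines[symmetric])
  finally show ?thesis .
 qed
 then show ?thesis by blast
qed

end

section \<open>Mertens estimate for ideals of prime index, from above\<close>

context nring
begin

definition degone :: "nat => complex set set" where
 "degone N = {M. maxid M \<and> idx R M = ch M \<and> ch M \<le> N}"

lemma finite_max_le: "finite {M. maxid M \<and> ch M \<le> N}"
proof (rule finite_subset)
 show "{M. maxid M \<and> ch M \<le> N} \<subseteq> (\<Union>p\<in>{p. is_prime p \<and> p \<le> N}. above p)"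
  using ch(1) by (auto simp: above_def)
 have "finite {p. is_prime p \<and> p \<le> N}" by (rule finite_subset[of _ "{..N}"]) auto
 then show "finite (\<Union>p\<in>{p. is_prime p \<and> p \<le> N}. above p)" using card_above by (intro finite_UN_I) auto
qed

lemma finite_degone: "finite (degone N)"
 by (rule finite_subset[OF _ finite_max_le[of N]]) (auto simp: degone_def)

lemma sum_max_le:
 assumes A: "A \<subseteq> {M. maxid M \<and> ch M \<le> N}" and g: "\<And>p. g p \<ge> (0::real)"
 shows "(\<Sum>M\<in>A. ln (real (ch M)) * g (ch M)) \<le> n * (\<Sum>p=1..N. lp p * g p)"
proof -
 have fA: "finite A" by (rule finite_subset[OF A finite_max_le])
 have "(\<Sum>M\<in>A. ln (real (ch M)) * g (ch M)) = (\<Sum>p\<in>{1..N}. \<Sum>M\<in>{M\<in>A. ch M = p}. ln (real (ch M)) * g (ch M))"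
  by (rule sum.group[symmetric, OF fA]) (use A ch(1) prime_ge_1_nat in auto)
 also have "... = (\<Sum>p\<in>{1..N}. real (card {M\<in>A. ch M = p}) * (ln (real p) * g p))"
  by (rule sum.cong) auto
 also have "... \<le> (\<Sum>p\<in>{1..N}. n * (lp p * g p))"
 proof (rule sum_mono)
  fix p assume p: "p \<in> {1..N}"
  show "real (card {M\<in>A. ch M = p}) * (ln (real p) * g p) \<le> n * (lp p * g p)"
  proof (cases "is_prime p")
   case True
   have "card {M\<in>A. ch M = p} \<le> card (above p)"
    using card_above[OF True] A by (intro card_mono) (auto simp: above_def)
   then have "card {M\<in>A. ch M = p} \<le> n" using card_above[OF True] by linarith
   then show ?thesis using p g[of p] True by (intro mult_mono) (auto simp: lp_def)
  next
   case False
   then have e: "{M\<in>A. ch M = p} = {}" using A ch(1) by auto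
   show ?thesis unfolding e using False by (simp add: lp_def)
  qed
 qed
 finally show ?thesis by (simp add: sum_distrib_left)
qed

definition mert :: "nat => real" where
 "mert N = (\<Sum>M\<in>degone N. ln (real (ch M)) / real (ch M))"

text \<open>Cauchy-Schwarz for the numbers of points of \<open>B\<close> in the cosets of
  \<open>M\<close>, in the form that a sum of squares is nonnegative.\<close>

lemma pairs_ge:
 assumes M: "maxid M" and B: "finite B" "B \<subseteq> R"
 shows "(card B)\<^sup>2 \<le> idx R M * card {(x,y) \<in> B \<times> B. x - y \<in> M}"
proof -
 define T where "T = cosets R M"
 have fT: "finite T" "card T = idx R M" using maxidD(4)[OF M] by (simp_all add: T_def idx_def)
 define m where "m C = card {x \<in> B. (+) x ` M = C}" for C
 have sum_m: "(\<Sum>C\<in>T. m C) = card B"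
 proof -
  have "card B = (\<Sum>x\<in>B. 1)" by simp
  also have "... = (\<Sum>C\<in>T. \<Sum>x\<in>{x\<in>B. (+) x ` M = C}. 1)"
   by (rule sum.group[symmetric, OF B(1) fT(1)]) (use B in \<open>auto simp: T_def cosets_def\<close>)
  finally show ?thesis by (simp add: m_def)
 qed
 have "{(x,y) \<in> B \<times> B. x - y \<in> M} = {(x,y) \<in> B \<times> B. (+) x ` M = (+) y ` M}"
  using coset_eq_iff[OF maxidD(2)[OF M]] by simp
 also have "... = (\<Union>C\<in>T. {x \<in> B. (+) x ` M = C} \<times> {x \<in> B. (+) x ` M = C})"
  using B(2) unfolding T_def cosets_def by blast
 finally have "card {(x,y) \<in> B \<times> B. x - y \<in> M} = (\<Sum>C\<in>T. card ({x \<in> B. (+) x ` M = C} \<times> {x \<in> B. (+) x ` M = C}))"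
  using B(1) fT(1) by (simp only:) (rule card_UN_disjoint, auto)
 also have "... = (\<Sum>C\<in>T. (m C)\<^sup>2)" by (simp add: m_def card_cartesian_product power2_eq_square)
 finally have pc: "card {(x,y) \<in> B \<times> B. x - y \<in> M} = (\<Sum>C\<in>T. (m C)\<^sup>2)" .
 define q where "q = real (idx R M)"
 have qp: "q > 0" using idx_maxid[OF M] by (simp add: q_def)
 have "0 \<le> (\<Sum>C\<in>T. (q * real (m C) - real (card B))\<^sup>2)" by (intro sum_nonneg) simp
 also have "... = (\<Sum>C\<in>T. q * q * (real (m C))\<^sup>2 - 2 * q * real (card B) * real (m C) + (real (card B))\<^sup>2)"
  by (rule sum.cong) (simp_all add: power2_eq_square algebra_simps)
 also have "... = q * q * (\<Sum>C\<in>T. (real (m C))\<^sup>2) - 2 * q * real (card B) * (\<Sum>C\<in>T. real (m C)) + q * (real (card B))\<^sup>2"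
  using fT by (simp add: sum.distrib sum_subtractf sum_distrib_left q_def)
 also have "(\<Sum>C\<in>T. real (m C)) = real (card B)" using sum_m by (metis of_nat_sum)
 finally have "q * (real (card B))\<^sup>2 \<le> q * (q * (\<Sum>C\<in>T. (real (m C))\<^sup>2))"
  by (simp add: power2_eq_square algebra_simps)
 then have "(real (card B))\<^sup>2 \<le> q * (\<Sum>C\<in>T. (real (m C))\<^sup>2)" using qp by (simp only: mult_le_cancel_left_pos)
 then have "real ((card B)\<^sup>2) \<le> real (idx R M * (\<Sum>C\<in>T. (m C)\<^sup>2))" by (simp add: q_def)
 then show ?thesis unfolding pc by (simp only: of_nat_le_iff)
qed

lemma ln_degone_le:
 assumes c: "c \<in> R" "c \<noteq> 0"
 shows "(\<Sum>M\<in>degone N. if c \<in> M then ln (real (ch M)) else 0) \<le> ln (real (idx R (mul c)))"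
proof -
 define A where "A = {M \<in> degone N. c \<in> M}"
 have fA: "finite A" using finite_degone by (simp add: A_def)
 have A: "maxid M \<and> mul c \<subseteq> M" if "M \<in> A" for M
  using that idealD(4)[OF maxidD(1)] by (auto simp: A_def degone_def mul_def)
 have pos: "real (idx R M) > 0" if "M \<in> A" for M using idx_maxid[of M] A[OF that] by simp
 have "(\<Sum>M\<in>degone N. if c \<in> M then ln (real (ch M)) else 0) = (\<Sum>M\<in>A. ln (real (idx R M)))"
  unfolding A_def using finite_degone by (intro sum.mono_neutral_cong_right) (auto simp: degone_def)
 also have "... = ln (\<Prod>M\<in>A. real (idx R M))" by (rule ln_prod[symmetric]) (auto simp: fA dest: pos)
 also have "... = ln (real (\<Prod>M\<in>A. idx R M))" by simp
 also have "... \<le> ln (real (idx R (mul c)))"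
 proof (rule ln_mono)
  show "real (\<Prod>M\<in>A. idx R M) \<le> real (idx R (mul c))"
   using prod_maxid_le[OF fA A ideal_mul[OF c(1)] finite_mul[OF c]] by (simp only: of_nat_le_iff)
  show "0 < real (\<Prod>M\<in>A. idx R M)" using pos by (simp add: prod_pos)
 qed
 finally show ?thesis .
qed

text \<open>Double counting as in Gallagher's larger sieve: pairs of distinct points in a box of
  \<open>N = L ^ n\<close> points, with weight \<open>ln (ch M)\<close> for each \<open>M\<close> in
  \<open>degone N\<close> that contains the difference. Each \<open>M\<close> contains at least
  \<open>N * N / ch M - N\<close> differences, whereas the weights of the ideals containing one
  difference add up to at most the logarithm of its index, which is
  \<open>n * ln L + O(1)\<close>.\<close>

lemma mert_power_le: "\<exists>C. \<forall>L\<ge>1. mert (L ^ n) \<le> n * ln (real L) + C"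
proof -
 define \<kappa> where "\<kappa> = 2 * (n * kc) + 1"
 have \<kappa>: "\<kappa> \<ge> 1" using kc_ge by (simp add: \<kappa>_def)
 have "mert (L ^ n) \<le> n * ln (real L) + (n * ln \<kappa> + 2 * real n)" if L: "L \<ge> 1" for L :: nat
 proof -
  define B where "B = ibox 0 (int L)"
  have B: "finite B" "B \<subseteq> R" "card B = L ^ n"
   using finite_ibox card_ibox[of 0 "int L"] by (auto simp: B_def ibox_def)
  define N where "N = L ^ n"
  have Np: "real N > 0" using L by (simp add: N_def)
  define \<Delta> where "\<Delta> = {(x,y) \<in> B \<times> B. x \<noteq> y}"
  have f\<Delta>: "finite \<Delta>" by (rule finite_subset[of _ "B \<times> B"]) (use B in \<open>auto simp: \<Delta>_def\<close>)
  have pair: "(\<Sum>M\<in>degone N. if x - y \<in> M then ln (real (ch M)) else 0) \<le> n * ln (\<kappa> * L)" if "(x,y) \<in> \<Delta>" for x y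
  proof -
   have xy: "x \<in> R" "y \<in> R" "x - y \<noteq> 0" "x - y \<in> R" using that B(2) subgrp_diff[OF subgrp_R] by (auto simp: \<Delta>_def)
   have "real_of_int \<bar>co (x - y) i\<bar> \<le> real L" if i: "i < n" for i
   proof -
    have "0 \<le> co x i" "co x i < int L" "0 \<le> co y i" "co y i < int L"
     using \<open>(x,y) \<in> \<Delta>\<close> i unfolding \<Delta>_def B_def ibox_def by auto
    then have "\<bar>co (x - y) i\<bar> \<le> int L" using co_diff[OF xy(1,2) i] by linarith
    then have "real_of_int \<bar>co (x - y) i\<bar> \<le> real_of_int (int L)" by (simp only: of_int_le_iff)
    then show ?thesis by simp
   qed
   then have bxy: "bx (real L) (x - y)" using xy by (simp add: bx_def)
   have "(\<Sum>M\<in>degone N. if x - y \<in> M then ln (real (ch M)) else 0) \<le> ln (real (idx R (mul (x - y))))"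
    by (rule ln_degone_le[OF xy(4,3)])
   also have "... \<le> ln ((\<kappa> * L) ^ n)"
   proof (rule ln_mono)
    have "real (idx R (mul (x - y))) \<le> (2 * (n * (kc * L)) + 1) ^ n" by (rule idx_mul_le(2)[OF xy(3) bxy])
    also have "... \<le> (\<kappa> * L) ^ n"
     using L kc_ge by (intro power_mono) (auto simp: \<kappa>_def distrib_right)
    finally show "real (idx R (mul (x - y))) \<le> (\<kappa> * L) ^ n" .
    show "0 < real (idx R (mul (x - y)))" using idx_pos[OF finite_mul[OF xy(4,3)] subgrp_R] by simp
   qed
   also have "... = n * ln (\<kappa> * L)" using \<kappa> L by (simp add: ln_realpow)
   finally show ?thesis .
  qed
  have cnt: "real N * real N / real (ch M) - real N \<le> (\<Sum>(x,y)\<in>\<Delta>. if x - y \<in> M then 1 else 0)" if M: "M \<in> degone N" for M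
  proof -
   have m: "maxid M" "idx R M = ch M" using M by (auto simp: degone_def)
   have cp: "real (ch M) > 0" using prime_gt_0_nat[OF ch(1)[OF m(1)]] by simp
   have d: "{(x,y) \<in> B \<times> B. x - y \<in> M} = {(x,y) \<in> \<Delta>. x - y \<in> M} \<union> (%x. (x,x)) ` B"
    using subgrp_zero[OF maxidD(2)[OF m(1)]] by (auto simp: \<Delta>_def)
   have "card {(x,y) \<in> B \<times> B. x - y \<in> M} \<le> card {(x,y) \<in> \<Delta>. x - y \<in> M} + card ((%x. (x,x)) ` B)"
    unfolding d by (rule card_Un_le)
   also have "card ((%x. (x,x)) ` B) = N" using B by (simp add: card_image inj_on_def N_def)
   finally have "real (card {(x,y) \<in> B \<times> B. x - y \<in> M}) \<le> real (card {(x,y) \<in> \<Delta>. x - y \<in> M}) + real N" by linarith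
   moreover have "N * N \<le> ch M * card {(x,y) \<in> B \<times> B. x - y \<in> M}"
    using pairs_ge[OF m(1) B(1,2)] unfolding m(2) B(3) N_def[symmetric] power2_eq_square .
   then have "real (N * N) \<le> real (ch M * card {(x,y) \<in> B \<times> B. x - y \<in> M})"
    by (simp only: of_nat_le_iff)
   then have "real N * real N / real (ch M) \<le> real (card {(x,y) \<in> B \<times> B. x - y \<in> M})"
    using cp by (simp add: divide_le_eq mult.commute)
   moreover have "(\<Sum>(x,y)\<in>\<Delta>. if x - y \<in> M then 1 else 0) = real (card {(x,y) \<in> \<Delta>. x - y \<in> M})"
   proof -
    have "(\<Sum>(x,y)\<in>\<Delta>. if x - y \<in> M then 1 else (0::real)) = (\<Sum>w\<in>{w\<in>\<Delta>. fst w - snd w \<in> M}. 1)"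
     by (rule sum.mono_neutral_cong_right) (use f\<Delta> in \<open>auto split: prod.splits if_splits\<close>)
    moreover have "{w\<in>\<Delta>. fst w - snd w \<in> M} = {(x,y) \<in> \<Delta>. x - y \<in> M}" by auto
    ultimately show ?thesis by simp
   qed
   ultimately show ?thesis by linarith
  qed
  have "real N * real N * mert N - real N * (\<Sum>M\<in>degone N. ln (real (ch M)))
   = (\<Sum>M\<in>degone N. ln (real (ch M)) * (real N * real N / real (ch M) - real N))"
   by (simp add: mert_def right_diff_distrib sum_subtractf sum_distrib_left mult_ac)
  also have "... \<le> (\<Sum>M\<in>degone N. ln (real (ch M)) * (\<Sum>(x,y)\<in>\<Delta>. if x - y \<in> M then 1 else 0))"
  proof (rule sum_mono, rule mult_left_mono[OF cnt])
   fix M assume "M \<in> degone N"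
   then have "ch M \<ge> 1" using prime_ge_1_nat[OF ch(1)] by (auto simp: degone_def)
   then show "0 \<le> ln (real (ch M))" by simp
  qed
  also have "... = (\<Sum>(x,y)\<in>\<Delta>. \<Sum>M\<in>degone N. if x - y \<in> M then ln (real (ch M)) else 0)"
   unfolding sum_distrib_left by (subst sum.swap) (auto intro!: sum.cong)
  also have "... \<le> (\<Sum>(x,y)\<in>\<Delta>. n * ln (\<kappa> * L))" by (rule sum_mono) (use pair in auto)
  also have "... = real (card \<Delta>) * (n * ln (\<kappa> * L))" by (simp add: case_prod_unfold)
  also have "... \<le> (real N * real N) * (n * ln (\<kappa> * L))"
  proof (rule mult_right_mono)
   have "card \<Delta> \<le> card (B \<times> B)" by (rule card_mono) (use B in \<open>auto simp: \<Delta>_def\<close>)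
   also have "... = N * N" using B by (simp add: card_cartesian_product N_def)
   finally have "real (card \<Delta>) \<le> real (N * N)" by (simp only: of_nat_le_iff)
   then show "real (card \<Delta>) \<le> real N * real N" by simp
   have "1 \<le> \<kappa> * L" using \<kappa> L mult_mono[of 1 \<kappa> 1 "real L"] by simp
   then show "0 \<le> n * ln (\<kappa> * L)" by simp
  qed
  finally have "real N * real N * mert N \<le> real N * real N * (n * ln (\<kappa> * L)) + real N * (\<Sum>M\<in>degone N. ln (real (ch M)))" by simp
  also have "... \<le> real N * real N * (n * ln (\<kappa> * L)) + real N * (n * (2 * real N))"
  proof -
   have "(\<Sum>M\<in>degone N. ln (real (ch M))) \<le> n * (\<Sum>p=1..N. lp p)"
    using sum_max_le[of "degone N" N "%_. 1"] by (auto simp: degone_def)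
   also have "(\<Sum>p=1..N. lp p) \<le> (\<Sum>p\<le>N. lp p)" by (rule sum_mono2) (auto simp: lp_nonneg)
   also have "... \<le> 2 * real N" by (rule theta_le)
   finally have "(\<Sum>M\<in>degone N. ln (real (ch M))) \<le> n * (2 * real N)" by (simp add: mult_left_mono)
   then show ?thesis by (intro add_left_mono mult_left_mono) auto
  qed
  also have "... = real N * real N * (n * ln (\<kappa> * L) + 2 * real n)" by (simp add: algebra_simps)
  finally have "mert N \<le> n * ln (\<kappa> * L) + 2 * real n" using Np by simp
  then show ?thesis using \<kappa> L by (simp add: N_def ln_mult algebra_simps)
 qed
 then show ?thesis by blast
qed

lemma mert_mono: "N \<le> N' ==> mert N \<le> mert N'"
 unfolding mert_def
proof (rule sum_mono2[OF finite_degone])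
 assume "N \<le> N'"
 then show "degone N \<subseteq> degone N'" by (auto simp: degone_def)
 fix M assume "M \<in> degone N' - degone N"
 then have "ch M \<ge> 1" using prime_ge_1_nat[OF ch(1)] by (auto simp: degone_def)
 then show "0 \<le> ln (real (ch M)) / real (ch M)" by simp
qed

lemma mert_upper: "\<exists>C. \<forall>N\<ge>1. mert N \<le> ln (real N) + C"
proof -
 obtain C where C: "\<And>L. L \<ge> 1 ==> mert (L ^ n) \<le> n * ln (real L) + C" using mert_power_le by blast
 have "mert N \<le> ln (real N) + (n * ln 2 + C)" if N: "N \<ge> 1" for N :: nat
 proof -
  define r where "r = root n (real N)"
  have r: "r \<ge> 1" "r ^ n = real N" using N n_pos by (auto simp: r_def)
  define L where "L = nat \<lceil>r\<rceil>"
  have L: "real L \<ge> r" "real L \<le> 2 * r" "L \<ge> 1" using r by (auto simp: L_def) linarith+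
  have "real N \<le> real (L ^ n)" using power_mono[OF L(1), of n] r by simp
  then have "mert N \<le> mert (L ^ n)" by (intro mert_mono) (simp only: of_nat_le_iff)
  also have "... \<le> n * ln (real L) + C" by (rule C[OF L(3)])
  also have "... \<le> n * ln (2 * r) + C" using L by (intro add_right_mono mult_left_mono ln_mono) auto
  also have "... = n * ln 2 + n * ln r + C" using r by (simp add: ln_mult algebra_simps)
  also have "n * ln r = ln (real N)" using r ln_realpow[of r n] by simp
  finally show ?thesis by simp
 qed
 then show ?thesis by blast
qed

end

section \<open>Primes of degree one\<close>

text \<open>Bernoulli's inequality for the quotient \<open>u / (u + \<kappa>)\<close>. It separates
  the main term of a box count from a boundary term with one power of \<open>u\<close> less,
  uniformly for \<open>u \<ge> u0\<close>.\<close>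

lemma power_add_le:
 fixes u u0 \<kappa> :: real
 assumes "u0 > 0" "u \<ge> u0" "\<kappa> \<ge> 0"
 shows "(u + \<kappa>) ^ n \<le> u ^ n + (n * \<kappa> * (1 + \<kappa> / u0) ^ (n - 1)) * u ^ (n - 1)"
proof (cases n)
 case (Suc m)
 define w where "w = u + \<kappa>"
 have w: "w > 0" "u > 0" using assms by (auto simp: w_def)
 have "1 + n * (u / w - 1) \<le> (1 + (u / w - 1)) ^ n" by (rule Bernoulli_inequality) (use w in simp)
 then have "1 - n * (\<kappa> / w) \<le> (u / w) ^ n" using w by (simp add: w_def field_simps)
 then have "w ^ n * (1 - n * (\<kappa> / w)) \<le> w ^ n * (u / w) ^ n" using w by (intro mult_left_mono) auto
 moreover have "w ^ n * (u / w) ^ n = u ^ n" using w by (simp add: power_divide)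
 moreover have "w ^ n * (1 - n * (\<kappa> / w)) = w ^ n - n * \<kappa> * w ^ m" using w by (simp add: Suc field_simps)
 ultimately have "w ^ n - n * \<kappa> * w ^ m \<le> u ^ n" by simp
 moreover have "w ^ m \<le> ((1 + \<kappa> / u0) * u) ^ m"
 proof (rule power_mono)
  have "\<kappa> * 1 \<le> \<kappa> * (u / u0)" using assms by (intro mult_left_mono) auto
  then show "w \<le> (1 + \<kappa> / u0) * u" by (simp add: w_def distrib_right)
 qed (use w in simp)
 then have "n * \<kappa> * w ^ m \<le> n * \<kappa> * ((1 + \<kappa> / u0) * u) ^ m" using assms by (intro mult_left_mono) auto
 ultimately show ?thesis using Suc by (simp add: w_def power_mult_distrib mult_ac)
qed simp

context nring
begin

lemma bx_one_plus:
 assumes D: "D \<ge> (2::int)"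
 shows "\<exists>\<kappa>\<ge>1. \<forall>L\<ge>1. \<forall>z\<in>ibox 0 (int L). bx (\<kappa> * real L) (1 + of_int D * z)"
proof -
 obtain r1 where r1: "r1 \<ge> 1" "bx r1 1" using ex_bx[OF one] by blast
 define \<kappa> where "\<kappa> = r1 + real_of_int D"
 have \<kappa>: "\<kappa> \<ge> 1" using r1 D by (simp add: \<kappa>_def)
 have "bx (\<kappa> * real L) (1 + of_int D * z)" if L: "L \<ge> 1" and z: "z \<in> ibox 0 (int L)" for L z
 proof -
  have zR: "z \<in> R" "\<And>i. i < n ==> 0 \<le> co z i \<and> co z i < int L" using z by (auto simp: ibox_def)
  have "real_of_int \<bar>co (of_int D * z) i\<bar> \<le> real_of_int D * L" if i: "i < n" for i
  proof -
   have "\<bar>co (of_int D * z) i\<bar> = D * co z i" using co_smult[OF zR(1) i, of D] zR(2)[OF i] D by (simp add: abs_mult)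
   also have "... \<le> D * int L" using zR(2)[OF i] D by (intro mult_left_mono) auto
   finally have "real_of_int \<bar>co (of_int D * z) i\<bar> \<le> real_of_int (D * int L)" by (simp only: of_int_le_iff)
   then show ?thesis by simp
  qed
  then have "bx (real_of_int D * L) (of_int D * z)" unfolding bx_def using mult[OF of_int_in zR(1)] by simp
  from bx_add[OF r1(2) this] show ?thesis
   by (rule bx_mono) (use r1 L in \<open>simp add: \<kappa>_def distrib_right mult_le_cancel_left1\<close>)
 qed
 then show ?thesis using \<kappa> by blast
qed

lemma int_notin:
 assumes M: "maxid M" and D: "\<not> int (ch M) dvd D"
 shows "of_int D \<in> R - M"
proof -
 have "coprime (int (ch M)) D" using ch(1)[OF M] D by (intro prime_imp_coprime) auto
 then obtain u v where uv: "u * int (ch M) + v * D = 1" using bezout_int[of "int (ch M)" D] by (auto simp: coprime_iff_gcd_eq_1)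
 have "of_int D \<notin> M"
 proof
  assume "of_int D \<in> M"
  then have "of_int u * of_nat (ch M) + of_int v * of_int D \<in> M"
   using idealD(3)[OF maxidD(1)[OF M] of_int_in] ch(2)[OF M] by (intro subgrp_add[OF maxidD(2)[OF M]]) auto
  moreover have "of_int u * of_nat (ch M) + of_int v * of_int D = (1::complex)"
   using arg_cong[OF uv, of "of_int :: int => complex"] by simp
  ultimately show False using maxidD(5)[OF M] by simp
 qed
 then show ?thesis using of_int_in by blast
qed

text \<open>\<open>D\<close> is invertible modulo \<open>M\<close>, so all solutions
  \<open>z\<close> are congruent modulo \<open>vi M j\<close>, and the count of the points of one
  coset in a box applies. The index of \<open>vi M j\<close> is then replaced by its lower bound
  \<open>idx R M ^ j\<close>.\<close>

lemma level_count:
 assumes M: "maxid M" and D: "\<not> int (ch M) dvd D"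
 shows "real (card {z \<in> ibox 0 (int L). 1 + of_int D * z \<in> vi M j}) \<le>
  (L / root n (real (idx R M ^ j)) + 2 * (n * kc)) ^ n"
proof -
 define E where "E = {z \<in> ibox 0 (int L). 1 + of_int D * z \<in> vi M j}"
 define Q where "Q = idx R (vi M j)"
 have qQ: "idx R M ^ j \<le> Q" unfolding Q_def by (rule idx_vi_ge[OF M])
 have q1: "1 \<le> idx R M ^ j" using idx_maxid[OF M] by (simp add: Suc_leI)
 define rQ where "rQ = root n (real Q)"
 define rq where "rq = root n (real (idx R M ^ j))"
 have r: "rq \<le> rQ" "1 \<le> rq" using qQ q1 n_pos by (auto simp: rQ_def rq_def simp del: of_nat_power)
 have rQn: "rQ ^ n = real Q" using n_pos by (simp add: rQ_def)
 define t where "t = nat \<lfloor>rQ\<rfloor>"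
 have t: "real t \<le> rQ" "rQ < real t + 1" using r by (auto simp: t_def)
 have "rQ ^ n < (real t + 1) ^ n" using t r n_pos by (intro power_strict_mono) auto
 then have "real Q < real ((t + 1) ^ n)" by (simp add: rQn add.commute)
 then have tQ: "idx R (vi M j) < (t + 1) ^ n" unfolding Q_def by (simp only: of_nat_less_iff)
 have diff: "x - y \<in> vi M j" if xy: "x \<in> E" "y \<in> E" for x y
 proof -
  have R: "x \<in> R" "y \<in> R" using xy by (auto simp: E_def ibox_def)
  have "(1 + of_int D * x) - (1 + of_int D * y) \<in> vi M j"
   using xy by (intro subgrp_diff[OF idealD(1)[OF ideal_vi[OF M]]]) (auto simp: E_def)
  then have "of_int D * (x - y) \<in> vi M j" by (simp add: right_diff_distrib)
  then obtain s where s: "s \<in> R - M" "s * (of_int D * (x - y)) \<in> mul (of_nat (ch M) ^ j)" unfolding vi_def by blast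
  then have "(s * of_int D) * (x - y) \<in> mul (of_nat (ch M) ^ j)" by (simp only: mult.assoc)
  then show ?thesis unfolding vi_def using mult_notin[OF M s(1) int_notin[OF M D]] subgrp_diff[OF subgrp_R R] by blast
 qed
 have "real (card E * idx R (vi M j)) \<le> (real L + 2 * (n * (kc * t))) ^ n"
  by (rule coset_count[OF ideal_vi[OF M] finite_vi[OF M] tQ _ diff]) (auto simp: E_def)
 then have "real (card E) * rQ ^ n \<le> (real L + 2 * (n * (kc * t))) ^ n" by (simp add: rQn Q_def)
 then have "real (card E) \<le> (real L + 2 * (n * (kc * t))) ^ n / rQ ^ n" using r by (simp add: pos_le_divide_eq)
 also have "... = ((real L + 2 * (n * (kc * t))) / rQ) ^ n" by (simp add: power_divide)
 also have "... \<le> (L / rq + 2 * (n * kc)) ^ n"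
 proof (rule power_mono)
  have "real L / rQ \<le> L / rq" using r by (intro divide_left_mono) auto
  moreover have "2 * (n * (kc * t)) / rQ \<le> 2 * (n * kc)"
  proof -
   have "2 * (n * kc) * t \<le> 2 * (n * kc) * rQ" using t kc_ge by (intro mult_left_mono) auto
   then show ?thesis using r by (simp add: pos_divide_le_eq mult_ac)
  qed
  ultimately show "(real L + 2 * (n * (kc * t))) / rQ \<le> L / rq + 2 * (n * kc)" by (simp add: add_divide_distrib)
  show "0 \<le> (real L + 2 * (n * (kc * t))) / rQ" using r kc_ge by (intro divide_nonneg_nonneg add_nonneg_nonneg mult_nonneg_nonneg) auto
 qed
 finally show ?thesis by (simp add: E_def rq_def)
qed

text \<open>An index set independent of \<open>z\<close> that contains the levels of every
  \<open>1 + D z\<close> of index at most \<open>Y\<close>, so that the summation over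
  \<open>z\<close> can be moved inside.\<close>

definition lev :: "int => nat => (complex set \<times> nat) set" where
 "lev D Y = {(M,j). maxid M \<and> 1 \<le> j \<and> idx R M ^ j \<le> Y \<and> \<not> int (ch M) dvd D}"

lemma ch_le_idx: "maxid M ==> ch M \<le> idx R M"
proof -
 assume M: "maxid M"
 obtain f where f: "f \<ge> 1" "idx R M = ch M ^ f" using idx_ch[OF M] by blast
 have "ch M ^ 1 \<le> ch M ^ f" using f(1) prime_gt_0_nat[OF ch(1)[OF M]] by (intro power_increasing) auto
 then show ?thesis using f(2) by simp
qed

lemma lev_sub: "lev D Y \<subseteq> {M. maxid M \<and> ch M \<le> Y} \<times> {1..Y}"
proof clarify
 fix M j assume "(M,j) \<in> lev D Y"
 then have M: "maxid M" "1 \<le> j" "idx R M ^ j \<le> Y" by (auto simp: lev_def)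
 have "idx R M ^ 1 \<le> idx R M ^ j" using M(2) idx_maxid[OF M(1)] by (intro power_increasing) auto
 then have 1: "ch M \<le> Y" using ch_le_idx[OF M(1)] M(3) by simp
 have "2 ^ j \<le> idx R M ^ j" using idx_maxid[OF M(1)] by (rule power_mono) simp
 moreover have "j < 2 ^ j" by simp
 ultimately have "j \<le> Y" using M(3) by linarith
 then show "M \<in> {M. maxid M \<and> ch M \<le> Y} \<and> j \<in> {1..Y}" using M 1 by simp
qed

lemma finite_lev: "finite (lev D Y)"
 by (rule finite_subset[OF lev_sub]) (simp add: finite_max_le)

text \<open>An ideal containing \<open>1 + D z\<close> and a prime divisor of \<open>D\<close> would
  contain 1. The residue characteristics above \<open>1 + D z\<close> are therefore prime to the
  discriminant, and all these ideals are unramified.\<close>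

lemma ln_idx_le_lev:
 assumes D: "D \<ge> 2" "dsc dvd D" and z: "z \<in> R" and Y: "idx R (mul (1 + of_int D * z)) \<le> Y"
 shows "ln (real (idx R (mul (1 + of_int D * z)))) \<le>
  (\<Sum>(M,j)\<in>lev D Y. if 1 + of_int D * z \<in> vi M j then ln (real (idx R M)) else 0)"
proof -
 define a where "a = 1 + of_int D * z"
 have aR: "a \<in> R" unfolding a_def by (intro subgrp_add[OF subgrp_R] one mult of_int_in z)
 have anz: "a \<noteq> 0" unfolding a_def by (rule one_plus_mult_nz[OF D(1) z])
 have aa: "a \<in> mul a" unfolding mul_iff using one by (intro bexI[of _ 1]) auto
 have fin: "finite (cosets R (mul a))" by (rule finite_mul[OF aR anz])
 have nd: "\<not> int (ch M) dvd D" if M: "maxid M" "mul a \<subseteq> M" for M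
 proof
  assume "int (ch M) dvd D"
  then obtain k where "D = int (ch M) * k" by (elim dvdE)
  then have e: "of_int D * z = of_nat (ch M) * (of_int k * z)" by (simp add: mult.assoc)
  have "of_int D * z \<in> M" unfolding e by (rule idealD(4)[OF maxidD(1)[OF M(1)] mult[OF of_int_in z] ch(2)[OF M(1)]])
  then have "a - of_int D * z \<in> M" using M(2) aa subgrp_diff[OF maxidD(2)[OF M(1)]] by blast
  then show False using maxidD(5)[OF M(1)] by (simp add: a_def)
 qed
 have "ln (real (idx R (mul a))) \<le> (\<Sum>(M,j)\<in>levels (mul a). ln (real (idx R M)))"
 proof (rule ln_idx_le_levels[OF ideal_mul[OF aR] fin])
  fix M assume M: "maxid M" "mul a \<subseteq> M"
  show "unram M" by (rule unramI[OF M(1)]) (use nd[OF M] D(2) dvd_trans in blast)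
 qed
 also have "... = (\<Sum>(M,j)\<in>levels (mul a). if a \<in> vi M j then ln (real (idx R M)) else 0)"
  by (rule sum.cong) (use aa in \<open>auto simp: levels_def\<close>)
 also have "... \<le> (\<Sum>(M,j)\<in>lev D Y. if a \<in> vi M j then ln (real (idx R M)) else 0)"
 proof (rule sum_mono2[OF finite_lev])
  show "levels (mul a) \<subseteq> lev D Y"
  proof clarify
   fix M j assume L: "(M,j) \<in> levels (mul a)"
   then have M: "maxid M" "1 \<le> j" "mul a \<subseteq> vi M j" by (auto simp: levels_def)
   have s: "subgrp (vi M j)" "subgrp (mul a)" "vi M j \<subseteq> R"
    using idealD(1)[OF ideal_vi[OF M(1)]] idealD(1)[OF ideal_mul[OF aR]] by (auto simp: vi_def)
   have f: "finite (cosets (vi M j) (mul a))" by (rule cosets_finite_mono(2)[OF s(1,2) M(3) s(3) fin])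
   have "idx R (mul a) = idx R (vi M j) * idx (vi M j) (mul a)"
    by (rule idx_tower(2)[OF subgrp_R s(1,2) M(3) s(3) finite_vi[OF M(1)] f])
   moreover have "idx (vi M j) (mul a) > 0" by (rule idx_pos[OF f s(1)])
   ultimately have "idx R (vi M j) \<le> idx R (mul a)" by simp
   then have "idx R M ^ j \<le> Y" using idx_vi_ge[OF M(1), of j] Y by (simp add: a_def)
   then show "(M,j) \<in> lev D Y" using M nd[OF M(1) levels_sub[OF L]] by (simp add: lev_def)
  qed
  fix w assume "w \<in> lev D Y - levels (mul a)"
  then have "maxid (fst w)" by (auto simp: lev_def)
  then have "1 \<le> real (idx R (fst w))" using idx_maxid[of "fst w"] by simp
  then have "0 \<le> ln (real (idx R (fst w)))" by simp
  then show "0 \<le> (case w of (M,j) => if a \<in> vi M j then ln (real (idx R M)) else 0)" by (auto split: prod.splits)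
 qed
 finally show ?thesis by (simp add: a_def)
qed

text \<open>The levels with \<open>j = 1\<close> and prime index reproduce the Mertens sum. The
  summand with \<open>K\<close> is the boundary error of the counts; summed over primes up to
  \<open>c * L ^ n\<close> it is of order \<open>L\<close>, which the division by \<open>L\<close>
  makes bounded.\<close>

lemma sum_lev_main:
 assumes K: "K \<ge> 0" and L: "L \<ge> (1::nat)" and c: "c \<ge> (1::nat)"
 shows "(\<Sum>(M,j)\<in>{(M,j) \<in> lev D (c * L ^ n). j = 1 \<and> idx R M = ch M}.
   ln (real (idx R M)) * (1 / real (idx R M ^ j) + K * root n (real (idx R M ^ j)) / (real (idx R M ^ j) * L)))
  \<le> mert (c * L ^ n) + K * (n * (2 * n * root n c))"
proof -
 define Y where "Y = c * L ^ n"
 define A where "A = {M \<in> degone Y. \<not> int (ch M) dvd D}"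
 have fA: "finite A" "A \<subseteq> degone Y" using finite_degone by (auto simp: A_def)
 have lnn: "0 \<le> ln (real (ch M))" if "M \<in> degone Y" for M
 proof -
  have "ch M \<ge> 1" using prime_ge_1_nat[OF ch(1)] that by (auto simp: degone_def)
  then show ?thesis by simp
 qed
 have "(\<Sum>(M,j)\<in>{(M,j) \<in> lev D Y. j = 1 \<and> idx R M = ch M}.
   ln (real (idx R M)) * (1 / real (idx R M ^ j) + K * root n (real (idx R M ^ j)) / (real (idx R M ^ j) * L)))
  = (\<Sum>M\<in>A. ln (real (ch M)) / real (ch M) + K / L * (ln (real (ch M)) * (root n (real (ch M)) / real (ch M))))"
  by (rule sum.reindex_bij_witness[of _ "%M. (M,1)" fst])
   (auto simp: A_def lev_def degone_def algebra_simps)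
 also have "... = (\<Sum>M\<in>A. ln (real (ch M)) / real (ch M)) + K / L * (\<Sum>M\<in>A. ln (real (ch M)) * (root n (real (ch M)) / real (ch M)))"
  by (simp add: sum.distrib sum_distrib_left)
 also have "... \<le> mert Y + K / L * (n * (2 * n * root n Y))"
 proof (rule add_mono)
  show "(\<Sum>M\<in>A. ln (real (ch M)) / real (ch M)) \<le> mert Y"
   unfolding mert_def by (rule sum_mono2[OF finite_degone fA(2)]) (use lnn in auto)
  have "(\<Sum>M\<in>A. ln (real (ch M)) * (root n (real (ch M)) / real (ch M))) \<le> n * (\<Sum>p=1..Y. lp p * (root n p / p))"
   by (rule sum_max_le) (use fA(2) n_pos in \<open>auto simp: degone_def\<close>)
  also have "... \<le> n * (2 * n * root n Y)" using sum_lp_root[OF n_pos, of Y] by (intro mult_left_mono) auto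
  finally show "K / L * (\<Sum>M\<in>A. ln (real (ch M)) * (root n (real (ch M)) / real (ch M))) \<le> K / L * (n * (2 * n * root n Y))"
   using K by (intro mult_left_mono) auto
 qed
 also have "root n Y = root n c * L"
  using n_pos by (simp add: Y_def real_root_mult real_root_power_cancel)
 also have "K / L * (n * (2 * n * (root n c * L))) = K * (n * (2 * n * root n c))" using L by simp
 finally show ?thesis by (simp add: Y_def)
qed

text \<open>Here \<open>idx R M ^ j\<close> is \<open>p ^ (f * j)\<close> with
  \<open>f * j \<ge> 2\<close>. Splitting off \<open>p ^ 2\<close> leaves at least
  \<open>2 ^ j / 4\<close>, so the sum is dominated by a convergent sum over primes times a
  geometric series; the constant is \<open>4 * n\<close> times \<open>10 * n\<close>.\<close>

lemma sum_lev_other: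
 "(\<Sum>(M,j)\<in>{(M,j) \<in> lev D Y. \<not> (j = 1 \<and> idx R M = ch M)}. ln (real (idx R M)) / real (idx R M ^ j)) \<le> 40 * real n ^ 2"
proof -
 define A where "A = {M. maxid M \<and> ch M \<le> Y}"
 have fA: "finite A" unfolding A_def by (rule finite_max_le)
 have trm: "ln (real (idx R M)) / real (idx R M ^ j) \<le> 4 * n * (ln (real (ch M)) * (1 / real (ch M) ^ 2)) * (1/2) ^ j"
  if "(M,j) \<in> lev D Y" "\<not> (j = 1 \<and> idx R M = ch M)" for M j
 proof -
  have M: "maxid M" "1 \<le> j" using that by (auto simp: lev_def)
  obtain f where f: "f \<ge> 1" "idx R M = ch M ^ f" "f \<le> n" using idx_ch[OF M(1)] by blast
  define p where "p = ch M"
  have p: "p \<ge> 2" using prime_ge_2_nat[OF ch(1)[OF M(1)]] by (simp add: p_def)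
  have fj: "f * j \<ge> 2" "f * j \<ge> j"
  proof -
   have "\<not> (j = 1 \<and> f = 1)" using that(2) f(2) by auto
   then have "f \<ge> 2 \<or> j \<ge> 2" using f(1) M(2) by linarith
   then show "f * j \<ge> 2" using f(1) M(2) mult_le_mono[of 2 f 1 j] mult_le_mono[of 1 f 2 j] by auto
   show "f * j \<ge> j" using f(1) by simp
  qed
  have e: "idx R M ^ j = p ^ (f * j)" by (simp add: f(2) p_def power_mult)
  have "f * j = 2 + (f * j - 2)" using fj(1) by simp
  then have e2: "real p ^ (f * j) = real p ^ 2 * real p ^ (f * j - 2)" by (metis power_add)
  have "(2::real) ^ (f * j - 2) \<le> real p ^ (f * j - 2)" using p by (intro power_mono) auto
  then have "real p ^ 2 * 2 ^ (f * j - 2) \<le> real p ^ (f * j)" unfolding e2 by (rule mult_left_mono) simp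
  moreover have "(2::real) ^ j \<le> 2 ^ (f * j - 2) * 4"
  proof -
   have "j \<le> f * j - 2 + 2" using fj by linarith
   then have "(2::real) ^ j \<le> 2 ^ (f * j - 2 + 2)" by (rule power_increasing) simp
   then show ?thesis by (simp add: power_add)
  qed
  then have "real p ^ 2 * 2 ^ j \<le> real p ^ 2 * (2 ^ (f * j - 2) * 4)" by (intro mult_left_mono) auto
  ultimately have key: "real p ^ 2 * 2 ^ j \<le> 4 * real p ^ (f * j)" by linarith
  have pp: "real p ^ 2 * 2 ^ j > 0" "real p ^ (f * j) > 0" using p by auto
  have "1 / real p ^ (f * j) \<le> 4 / (real p ^ 2 * 2 ^ j)" using key pp by (simp add: field_simps)
  moreover have lq: "ln (real (idx R M)) = f * ln (real p)" using p by (simp add: f(2) p_def[symmetric] ln_realpow)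
  moreover have lnp: "0 \<le> ln (real p)" using p by simp
  moreover have "f * ln (real p) \<le> n * ln (real p)" using f(3) lnp by (intro mult_right_mono) auto
  ultimately have "ln (real (idx R M)) * (1 / real p ^ (f * j)) \<le> (n * ln (real p)) * (4 / (real p ^ 2 * 2 ^ j))"
   using pp by (intro mult_mono) auto
  then show ?thesis by (simp add: e p_def power_divide mult_ac)
 qed
 have pos: "0 \<le> 4 * n * (ln (real (ch M)) * (1 / real (ch M) ^ 2)) * (1/2) ^ j" if "M \<in> A" for M j
 proof -
  have "ch M \<ge> 1" using prime_ge_1_nat[OF ch(1)] that by (auto simp: A_def)
  then show ?thesis by simp
 qed
 have "(\<Sum>(M,j)\<in>{(M,j) \<in> lev D Y. \<not> (j = 1 \<and> idx R M = ch M)}. ln (real (idx R M)) / real (idx R M ^ j))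
  \<le> (\<Sum>(M,j)\<in>{(M,j) \<in> lev D Y. \<not> (j = 1 \<and> idx R M = ch M)}. 4 * n * (ln (real (ch M)) * (1 / real (ch M) ^ 2)) * (1/2) ^ j)"
  by (rule sum_mono) (use trm in auto)
 also have "... \<le> (\<Sum>(M,j)\<in>A \<times> {1..Y}. 4 * n * (ln (real (ch M)) * (1 / real (ch M) ^ 2)) * (1/2) ^ j)"
  by (rule sum_mono2) (use fA lev_sub[of D Y] pos in \<open>auto simp: A_def\<close>)
 also have "... = 4 * n * (\<Sum>M\<in>A. ln (real (ch M)) * (1 / real (ch M) ^ 2)) * (\<Sum>j=1..Y. (1/2) ^ j)"
  by (simp add: sum.cartesian_product[symmetric] sum_distrib_left sum_distrib_right sum_divide_distrib mult_ac)
 also have "... \<le> real (4 * n) * (real n * 10) * 1"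
 proof (rule mult_mono)
  have "(\<Sum>M\<in>A. ln (real (ch M)) * (1 / real (ch M) ^ 2)) \<le> n * (\<Sum>p=1..Y. lp p * (1 / real p ^ 2))"
   by (rule sum_max_le) (auto simp: A_def)
  also have "... \<le> real n * 10" using sum_lp_square[of Y] by (intro mult_left_mono) auto
  finally show "real (4 * n) * (\<Sum>M\<in>A. ln (real (ch M)) * (1 / real (ch M) ^ 2)) \<le> real (4 * n) * (real n * 10)"
   by (intro mult_left_mono) auto
  have "(\<Sum>j=1..Y. (1/2::real) ^ j) = 1 - (1/2) ^ Y" by (induction Y) auto
  then show "(\<Sum>j=1..Y. (1/2::real) ^ j) \<le> 1" by simp
 qed (auto intro!: sum_nonneg)
 also have "... = 40 * real n ^ 2" by (simp add: power2_eq_square)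
 finally show ?thesis .
qed

text \<open>The average over the box of the logarithm of the index of \<open>1 + D z\<close> is at
  least \<open>n * ln L - O(1)\<close>. Expanded over levels, and with the points counted for each
  level, the same average is at most \<open>mert (c * L ^ n) + O(1)\<close>.\<close>

lemma mert_power_ge: "\<exists>C. \<exists>c\<ge>1. \<forall>L\<ge>1. mert (c * L ^ n) \<ge> n * ln (real L) - C"
proof -
 \<comment> \<open>A multiple of the discriminant, doubled to reach the value 2 from which on
   \<open>1 + D z\<close> cannot vanish.\<close>
 define D where "D = 2 * \<bar>dsc\<bar>"
 have D: "D \<ge> 2" "dsc dvd D" using dsc_nz by (auto simp: D_def)
 obtain C1 where C1: "\<And>L. L \<ge> 1 ==>
  (\<Sum>z\<in>ibox 0 (int L). ln (real (idx R (mul (1 + of_int D * z))))) \<ge> real L ^ n * (n * ln L - C1)"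
  using avg_lower[OF D(1)] by blast
 obtain \<kappa> where \<kappa>: "\<kappa> \<ge> 1" "\<And>L z. L \<ge> 1 ==> z \<in> ibox 0 (int L) ==> bx (\<kappa> * real L) (1 + of_int D * z)"
  using bx_one_plus[OF D(1)] by blast
 define c where "c = nat \<lceil>(2 * (n * (kc * \<kappa>)) + 1) ^ n\<rceil>"
 have base: "2 * (n * (kc * \<kappa>)) + 1 \<ge> 1" using kc_ge \<kappa> by simp
 have "(2 * (n * (kc * \<kappa>)) + 1) ^ n \<ge> 1" using base by simp
 then have c: "c \<ge> 1" "(2 * (n * (kc * \<kappa>)) + 1) ^ n \<le> real c" unfolding c_def by linarith+
 \<comment> \<open>All levels in question satisfy \<open>idx R M ^ j \<le> c * L ^ n\<close>, so
   \<open>L\<close> divided by the \<open>n\<close>-th root of \<open>idx R M ^ j\<close> is at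
   least \<open>u0\<close>. This keeps the boundary error bounded relative to the main term.\<close>
 define u0 where "u0 = 1 / root n (real c)"
 have u0: "u0 > 0" using c n_pos by (simp add: u0_def)
 define k2 where "k2 = 2 * (n * kc)"
 have k2: "k2 \<ge> 0" using kc_ge by (simp add: k2_def)
 define K where "K = n * k2 * (1 + k2 / u0) ^ (n - 1)"
 have K: "K \<ge> 0" unfolding K_def using k2 u0 by simp
 define C where "C = C1 + K * (n * (2 * n * root n c)) + (1 + K / u0) * (40 * real n ^ 2)"
 have "mert (c * L ^ n) \<ge> n * ln (real L) - C" if L: "L \<ge> 1" for L
 proof -
  define Y where "Y = c * L ^ n"
  define h where "h = (%(M,j). ln (real (idx R M)) * (1 / real (idx R M ^ j) + K * root n (real (idx R M ^ j)) / (real (idx R M ^ j) * L)))"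
  have idxY: "idx R (mul (1 + of_int D * z)) \<le> Y" if z: "z \<in> ibox 0 (int L)" for z
  proof -
   have zR: "z \<in> R" using z by (simp add: ibox_def)
   have "real (idx R (mul (1 + of_int D * z))) \<le> (2 * (n * (kc * (\<kappa> * L))) + 1) ^ n"
    by (rule idx_mul_le(2)[OF one_plus_mult_nz[OF D(1) zR] \<kappa>(2)[OF L z]])
   also have "... \<le> ((2 * (n * (kc * \<kappa>)) + 1) * L) ^ n"
    using L kc_ge \<kappa>(1) by (intro power_mono) (auto simp: algebra_simps)
   also have "... \<le> real c * real L ^ n" unfolding power_mult_distrib using c(2) by (intro mult_right_mono) auto
   finally have "real (idx R (mul (1 + of_int D * z))) \<le> real Y" by (simp add: Y_def)
   then show ?thesis by (simp only: of_nat_le_iff)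
  qed
  have lq: "0 \<le> ln (real (idx R M))" if "(M,j) \<in> lev D Y" for M j
   using idx_maxid[of M] that by (auto simp: lev_def)
  have rootL: "root n (real (idx R M ^ j)) / L \<le> 1 / u0" "root n (real (idx R M ^ j)) \<ge> 1" if "(M,j) \<in> lev D Y" for M j
  proof -
   have M: "maxid M" "idx R M ^ j \<le> Y" using that by (auto simp: lev_def)
   have "root n (real (idx R M ^ j)) \<le> root n (real Y)" using M(2) n_pos by (simp only: real_root_le_iff of_nat_le_iff)
   also have "root n (real Y) = root n (real c) * L" using n_pos by (simp add: Y_def real_root_mult real_root_power_cancel)
   finally show "root n (real (idx R M ^ j)) / L \<le> 1 / u0" using L by (simp add: u0_def pos_divide_le_eq)
   have "1 \<le> idx R M ^ j" using idx_maxid[OF M(1)] by (simp add: Suc_leI)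
   then show "root n (real (idx R M ^ j)) \<ge> 1" using n_pos by (simp del: of_nat_power)
  qed
  have "real L ^ n * (n * ln L - C1) \<le> (\<Sum>z\<in>ibox 0 (int L). ln (real (idx R (mul (1 + of_int D * z)))))"
   by (rule C1[OF L])
  also have "... \<le> (\<Sum>z\<in>ibox 0 (int L). \<Sum>(M,j)\<in>lev D Y. if 1 + of_int D * z \<in> vi M j then ln (real (idx R M)) else 0)"
  proof (rule sum_mono)
   fix z assume z: "z \<in> ibox 0 (int L)"
   then have "z \<in> R" by (simp add: ibox_def)
   then show "ln (real (idx R (mul (1 + of_int D * z)))) \<le> (\<Sum>(M,j)\<in>lev D Y. if 1 + of_int D * z \<in> vi M j then ln (real (idx R M)) else 0)"
    by (rule ln_idx_le_lev[OF D _ idxY[OF z]])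
  qed
  also have "... = (\<Sum>(M,j)\<in>lev D Y. \<Sum>z\<in>ibox 0 (int L). if 1 + of_int D * z \<in> vi M j then ln (real (idx R M)) else 0)"
   unfolding case_prod_unfold by (rule sum.swap)
  also have "... = (\<Sum>(M,j)\<in>lev D Y. ln (real (idx R M)) * real (card {z \<in> ibox 0 (int L). 1 + of_int D * z \<in> vi M j}))"
   by (rule sum.cong) (auto simp: sum.If_cases[OF finite_ibox] Int_def mult.commute)
  also have "... \<le> (\<Sum>w\<in>lev D Y. real L ^ n * h w)"
  proof (rule sum_mono, clarify)
   fix M j assume Mj: "(M,j) \<in> lev D Y"
   then have M: "maxid M" "\<not> int (ch M) dvd D" by (auto simp: lev_def)
   define q where "q = real (idx R M ^ j)"
   define r where "r = root n q"
   have r: "r \<ge> 1" "r / L \<le> 1 / u0" using rootL[OF Mj] by (auto simp: r_def q_def)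
   have rn: "r ^ n = q" "q > 0" using n_pos idx_maxid[OF M(1)] by (auto simp: r_def q_def)
   define u where "u = L / r"
   have u: "u \<ge> u0" "u > 0" using r u0 L by (auto simp: u_def field_simps)
   have "real (card {z \<in> ibox 0 (int L). 1 + of_int D * z \<in> vi M j}) \<le> (u + k2) ^ n"
    using level_count[OF M, of L j] by (simp only: u_def k2_def r_def q_def)
   also have "... \<le> u ^ n + K * u ^ (n - 1)" unfolding K_def by (rule power_add_le[OF u0 u(1) k2])
   also have "u ^ (n - 1) = u ^ n / u" using n_pos u by (cases n) auto
   also have "u ^ n + K * (u ^ n / u) = real L ^ n * (1 / q + K * r / (q * L))"
    using rn r L by (simp add: u_def power_divide field_simps)
   finally have "real (card {z \<in> ibox 0 (int L). 1 + of_int D * z \<in> vi M j}) \<le> real L ^ n * (1 / q + K * r / (q * L))" .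
   then have "ln (real (idx R M)) * real (card {z \<in> ibox 0 (int L). 1 + of_int D * z \<in> vi M j})
    \<le> ln (real (idx R M)) * (real L ^ n * (1 / q + K * r / (q * L)))" using lq[OF Mj] by (rule mult_left_mono)
   then show "ln (real (idx R M)) * real (card {z \<in> ibox 0 (int L). 1 + of_int D * z \<in> vi M j}) \<le> real L ^ n * h (M,j)"
    by (simp add: h_def q_def r_def mult_ac)
  qed
  also have "... = real L ^ n * (\<Sum>w\<in>lev D Y. h w)" by (simp add: sum_distrib_left)
  finally have "n * ln L - C1 \<le> (\<Sum>w\<in>lev D Y. h w)" using L by simp
  also have "... = (\<Sum>w\<in>{(M,j) \<in> lev D Y. j = 1 \<and> idx R M = ch M}. h w) + (\<Sum>w\<in>{(M,j) \<in> lev D Y. \<not> (j = 1 \<and> idx R M = ch M)}. h w)"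
   by (subst sum.union_disjoint[symmetric]) (auto intro!: sum.cong finite_subset[OF _ finite_lev[of D Y]])
  also have "(\<Sum>w\<in>{(M,j) \<in> lev D Y. j = 1 \<and> idx R M = ch M}. h w) \<le> mert Y + K * (n * (2 * n * root n c))"
   unfolding h_def Y_def by (rule sum_lev_main[OF K L c(1)])
  also have "(\<Sum>w\<in>{(M,j) \<in> lev D Y. \<not> (j = 1 \<and> idx R M = ch M)}. h w) \<le>
   (\<Sum>w\<in>{(M,j) \<in> lev D Y. \<not> (j = 1 \<and> idx R M = ch M)}. (1 + K / u0) * (case w of (M,j) => ln (real (idx R M)) / real (idx R M ^ j)))"
  proof (rule sum_mono, clarify)
   fix M j assume Mj: "(M,j) \<in> lev D Y"
   define q where "q = real (idx R M ^ j)"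
   have q: "q > 0" using idx_maxid[of M] Mj by (auto simp: lev_def q_def)
   have "K * (root n q / L) \<le> K * (1 / u0)" using rootL(1)[OF Mj] K by (intro mult_left_mono) (auto simp: q_def)
   then have "1 + K * (root n q / L) \<le> 1 + K / u0" by simp
   then have "(ln (real (idx R M)) / q) * (1 + K * (root n q / L)) \<le> (ln (real (idx R M)) / q) * (1 + K / u0)"
    using lq[OF Mj] q by (intro mult_left_mono) auto
   moreover have "h (M,j) = (ln (real (idx R M)) / q) * (1 + K * (root n q / L))"
    unfolding h_def prod.case q_def[symmetric] using q L by (simp add: field_simps)
   ultimately show "h (M,j) \<le> (1 + K / u0) * (ln (real (idx R M)) / real (idx R M ^ j))"
    unfolding q_def[symmetric] by (simp add: mult.commute)
  qed
  also have "... = (1 + K / u0) * (\<Sum>(M,j)\<in>{(M,j) \<in> lev D Y. \<not> (j = 1 \<and> idx R M = ch M)}. ln (real (idx R M)) / real (idx R M ^ j))"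
   by (rule sum_distrib_left[symmetric])
  also have "... \<le> (1 + K / u0) * (40 * real n ^ 2)"
   by (rule mult_left_mono[OF sum_lev_other]) (use K u0 in simp)
  finally show ?thesis by (simp add: C_def Y_def)
 qed
 then show ?thesis using c(1) by blast
qed

lemma mert_nonneg: "mert N \<ge> 0"
proof -
 have "degone 0 = {}" using ch(1) prime_gt_0_nat by (auto simp: degone_def)
 then have "mert 0 = 0" by (simp add: mert_def)
 then show ?thesis using mert_mono[of 0 N] by simp
qed

lemma mert_lower: "\<exists>C. \<forall>N\<ge>1. mert N \<ge> ln (real N) - C"
proof -
 obtain C c where C: "c \<ge> 1" "\<And>L. L \<ge> 1 ==> mert (c * L ^ n) \<ge> n * ln (real L) - C"
  using mert_power_ge by blast
 have "mert N \<ge> ln (real N) - (\<bar>C\<bar> + ln c + n * ln 2)" if N: "N \<ge> 1" for N :: nat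
 proof (cases "N \<ge> c")
  case True
  define r where "r = root n (real N / real c)"
  have r: "r \<ge> 1" "r ^ n = real N / real c" using True C(1) n_pos by (auto simp: r_def)
  define L where "L = nat \<lfloor>r\<rfloor>"
  have "1 \<le> \<lfloor>r\<rfloor>" using r(1) by (simp add: le_floor_iff)
  then have "real L = of_int \<lfloor>r\<rfloor>" "L \<ge> 1" unfolding L_def by (simp, linarith)
  then have L: "real L \<le> r" "r \<le> 2 * real L" "L \<ge> 1" by linarith+
  have "real L ^ n \<le> real N / real c" using power_mono[OF L(1), of n] r by simp
  then have "real (c * L ^ n) \<le> real N" using C(1) by (simp add: pos_le_divide_eq mult.commute)
  then have "mert (c * L ^ n) \<le> mert N" by (intro mert_mono) (simp only: of_nat_le_iff)
  moreover have "mert (c * L ^ n) \<ge> n * ln (real L) - C" by (rule C(2)[OF L(3)])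
  moreover have "ln r \<le> ln (2 * real L)" using L r by (intro ln_mono) auto
  then have "n * ln r \<le> n * (ln 2 + ln (real L))" using L(3) by (intro mult_left_mono) (auto simp: ln_mult)
  moreover have "n * ln r = ln (real N) - ln c" using r ln_realpow[of r n] N C(1) by (simp add: ln_div)
  ultimately show ?thesis by (simp add: distrib_left)
 next
  case False
  have "ln (real N) \<le> ln (real c)" using False N by (intro ln_mono) auto
  moreover have "0 \<le> n * ln 2" by simp
  ultimately show ?thesis using mert_nonneg[of N] by linarith
 qed
 then show ?thesis by blast
qed

definition deg_one_prime :: "nat => bool" where
 "deg_one_prime p \<longleftrightarrow> is_prime p \<and> (\<exists>M. maxid M \<and> ch M = p \<and> idx R M = p)"

text \<open>The Mertens estimates from above and below share their leading term, so for a large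
  constant \<open>K\<close> the ideals with characteristic between \<open>N / K\<close> and
  \<open>N\<close> contribute at least 1. There the weight \<open>1 / ch M\<close> is at most about
  \<open>K / N\<close>, and a prime is counted at most \<open>n\<close> times.\<close>

theorem chebyshev_deg_one:
 "\<exists>c>0. \<exists>N0. \<forall>N\<ge>N0. (\<Sum>p\<in>{p. p \<le> N \<and> deg_one_prime p}. ln (real p)) \<ge> c * real N"
proof -
 obtain C1 where C1: "\<And>N. N \<ge> 1 ==> mert N \<le> ln (real N) + C1" using mert_upper by blast
 obtain C2 where C2: "\<And>N. N \<ge> 1 ==> mert N \<ge> ln (real N) - C2" using mert_lower by blast
 define K where "K = nat \<lceil>exp (C1 + C2 + 1)\<rceil> + 1"
 have K: "K \<ge> 1" "exp (C1 + C2 + 1) \<le> real K" unfolding K_def by (simp, linarith)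
 have lnK: "C1 + C2 + 1 \<le> ln (real K)" using K by (subst ln_ge_iff) auto
 have "(\<Sum>p\<in>{p. p \<le> N \<and> deg_one_prime p}. ln (real p)) \<ge> (1 / (real K * real n)) * real N" if N: "N \<ge> K" for N :: nat
 proof -
  define N' where "N' = N div K"
  have N': "N' \<ge> 1" "real N' * real K \<le> real N" "real N < (real N' + 1) * real K"
  proof -
   show "N' \<ge> 1" using N K by (simp add: N'_def div_greater_zero_iff Suc_leI)
   have "N' * K \<le> N" by (simp add: N'_def)
   then show "real N' * real K \<le> real N" by (metis of_nat_le_iff of_nat_mult)
   have "N < (N' + 1) * K" using dividend_less_div_times[of K N] K by (simp add: N'_def)
   then have "real N < real ((N' + 1) * K)" by (simp only: of_nat_less_iff)
   then show "real N < (real N' + 1) * real K" by (simp add: algebra_simps)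
  qed
  have "ln (real N') + ln (real K) \<le> ln (real N)"
   using N' K N ln_mono[of "real N' * real K" "real N"] by (simp add: ln_mult)
  then have "1 \<le> mert N - mert N'" using C1[OF N'(1)] C2[of N] lnK N K by simp
  also have "... = (\<Sum>M\<in>degone N - degone N'. ln (real (ch M)) / real (ch M))"
  proof -
   have "N' \<le> N" by (simp add: N'_def)
   then have "degone N' \<subseteq> degone N" by (auto simp: degone_def)
   then show ?thesis unfolding mert_def by (simp add: sum_diff finite_degone)
  qed
  also have "... \<le> (\<Sum>M\<in>degone N - degone N'. ln (real (ch M)) * (1 / (real N' + 1)))"
  proof (rule sum_mono)
   fix M assume M: "M \<in> degone N - degone N'"
   then have "real N' + 1 \<le> real (ch M)" "ch M \<ge> 1" using prime_ge_1_nat[OF ch(1)] by (auto simp: degone_def)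
   then have "1 / real (ch M) \<le> 1 / (real N' + 1)" "0 \<le> ln (real (ch M))" by (auto intro!: divide_left_mono)
   then show "ln (real (ch M)) / real (ch M) \<le> ln (real (ch M)) * (1 / (real N' + 1))"
    using mult_left_mono by fastforce
  qed
  also have "... = (1 / (real N' + 1)) * (\<Sum>M\<in>degone N - degone N'. ln (real (ch M)))"
   by (simp add: sum_divide_distrib)
  also have "... \<le> (1 / (real N' + 1)) * (n * (\<Sum>p\<in>{p. p \<le> N \<and> deg_one_prime p}. ln (real p)))"
  proof (rule mult_left_mono)
   define g where "g p = (if deg_one_prime p then 1 else 0::real)" for p
   have "(\<Sum>M\<in>degone N - degone N'. ln (real (ch M))) = (\<Sum>M\<in>degone N - degone N'. ln (real (ch M)) * g (ch M))"
   proof (rule sum.cong[OF refl])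
    fix M assume "M \<in> degone N - degone N'"
    then have "deg_one_prime (ch M)" unfolding deg_one_prime_def degone_def using ch(1) by auto
    then show "ln (real (ch M)) = ln (real (ch M)) * g (ch M)" by (simp add: g_def)
   qed
   also have "... \<le> n * (\<Sum>p=1..N. lp p * g p)"
    by (rule sum_max_le) (auto simp: degone_def g_def)
   also have "(\<Sum>p=1..N. lp p * g p) = (\<Sum>p\<in>{p. p \<le> N \<and> deg_one_prime p}. ln (real p))"
   proof (rule sum.mono_neutral_cong_right)
    show "{p. p \<le> N \<and> deg_one_prime p} \<subseteq> {1..N}"
     using prime_ge_1_nat by (auto simp: deg_one_prime_def)
   qed (auto simp: g_def lp_def deg_one_prime_def)
   finally show "(\<Sum>M\<in>degone N - degone N'. ln (real (ch M))) \<le> n * (\<Sum>p\<in>{p. p \<le> N \<and> deg_one_prime p}. ln (real p))" .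
  qed simp
  finally have "real N' + 1 \<le> n * (\<Sum>p\<in>{p. p \<le> N \<and> deg_one_prime p}. ln (real p))" by (simp add: field_simps)
  then have "(real N' + 1) * real K \<le> n * (\<Sum>p\<in>{p. p \<le> N \<and> deg_one_prime p}. ln (real p)) * real K" by (intro mult_right_mono) auto
  then have "real N \<le> (real K * real n) * (\<Sum>p\<in>{p. p \<le> N \<and> deg_one_prime p}. ln (real p))" using N'(3) by (simp add: mult_ac)
  then show ?thesis using K n_pos by (simp add: field_simps)
 qed
 moreover have "1 / (real K * real n) > 0" using K n_pos by simp
 ultimately show ?thesis by blast
qed

end

section \<open>Rings finitely generated as abelian groups, and their fraction fields\<close>

definition zspan :: "complex set => complex set" where
 "zspan B = range (%c::complex => int. \<Sum>b\<in>B. of_int (c b) * b)"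

definition fgring :: "complex set => bool" where
 "fgring R \<longleftrightarrow> is_subring R \<and> (\<exists>B. finite B \<and> R = zspan B)"

lemma subgrp_scale: "subgrp S ==> x \<in> S ==> of_int k * (x::'u::comm_ring_1) \<in> S"
proof -
 assume S: "subgrp S" and x: "x \<in> S"
 have nat: "of_nat j * x \<in> S" for j
  by (induction j) (auto simp: subgrp_zero[OF S] distrib_right intro: subgrp_add[OF S] x)
 show ?thesis
 proof (cases k rule: int_cases2)
  case (nonneg j) then show ?thesis using nat by simp
 next
  case (nonpos j) then show ?thesis using subgrp_uminus[OF S nat[of j]] by simp
 qed
qed

lemma zspan_least: "subgrp S ==> B \<subseteq> S ==> zspan B \<subseteq> S"
 by (auto simp: zspan_def intro!: subgrp_sum subgrp_scale)

lemma subgrp_zspan: "subgrp (zspan B)"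
 unfolding subgrp_def
proof (intro conjI ballI)
 show "0 \<in> zspan B" unfolding zspan_def by (rule image_eqI[of _ _ "%_. 0"]) simp_all
 fix x y assume "x \<in> zspan B" "y \<in> zspan B"
 then obtain c d :: "complex => int" where "x = (\<Sum>b\<in>B. of_int (c b) * b)" "y = (\<Sum>b\<in>B. of_int (d b) * b)"
  unfolding zspan_def by blast
 then have *: "x - y = (\<Sum>b\<in>B. of_int (c b - d b) * b)" by (simp add: left_diff_distrib sum_subtractf)
 show "x - y \<in> zspan B" unfolding zspan_def by (rule range_eqI[where x = "%b. c b - d b"], rule *)
qed

lemma zspan_base: "finite B ==> b \<in> B ==> b \<in> zspan B"
proof -
 assume B: "finite B" and b: "b \<in> B"
 have "(\<Sum>x\<in>B. of_int (if x = b then 1 else 0) * x) = (\<Sum>x\<in>B. if x = b then x else 0)"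
  by (rule sum.cong) auto
 also have "... = b" using B b by simp
 finally show ?thesis unfolding zspan_def by (intro image_eqI[of _ _ "%x. if x = b then 1 else 0"]) simp_all
qed

lemma subgrp_of_subring: "is_subring R ==> subgrp R"
 unfolding subgrp_def by (intro conjI ballI) (simp_all only: subringD(2,3))

text \<open>The generators define a homomorphism from integer vectors onto \<open>R\<close>. Its
  kernel is pure since \<open>R\<close> is torsion-free, and a lattice basis modulo the kernel
  becomes a basis of \<open>R\<close>.\<close>

lemma fgring_basis:
 assumes "fgring R"
 obtains b n where "nring R b n"
proof -
 obtain B where B: "finite B" "R = zspan B" and S: "is_subring R" using assms unfolding fgring_def by blast
 obtain bs where bs: "set bs = B" "distinct bs" using finite_distinct_list[OF B(1)] by blast
 define s where "s = length bs"
 define \<Phi> where "\<Phi> v = (\<Sum>x<s. of_int (v x) * bs ! x)" for v :: "nat => int"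
 have \<Phi>d: "\<Phi> (%x. v x - w x) = \<Phi> v - \<Phi> w" for v w by (simp add: \<Phi>_def left_diff_distrib sum_subtractf)
 have \<Phi>m: "\<Phi> (%x. c * v x) = of_int c * \<Phi> v" for c v by (simp add: \<Phi>_def sum_distrib_left mult.assoc)
 define K where "K v \<longleftrightarrow> \<Phi> v = 0" for v
 have K0: "K (%x. 0)" by (simp add: K_def \<Phi>_def)
 obtain n :: nat and u where u: "\<And>v. (\<forall>x\<ge>s. v x = 0) ==> \<exists>c. K (%x. v x - (\<Sum>j<n. c j * u j x))"
  "\<And>c. K (%x. \<Sum>j<n. c j * u j x) ==> \<forall>j<n. c j = 0"
  using lattice_basis[of K s, OF K0] by (auto simp: K_def \<Phi>d \<Phi>m)
 define b where "b j = \<Phi> (u j)" for j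
 have \<Phi>s: "\<Phi> (%x. \<Sum>j<n. c j * u j x) = (\<Sum>j<n. of_int (c j) * b j)" for c
 proof -
  have "\<Phi> (%x. \<Sum>j<n. c j * u j x) = (\<Sum>x<s. \<Sum>j<n. of_int (c j) * (of_int (u j x) * bs ! x))"
   by (simp add: \<Phi>_def sum_distrib_right mult.assoc)
  also have "... = (\<Sum>j<n. of_int (c j) * b j)" by (subst sum.swap) (simp add: b_def \<Phi>_def sum_distrib_left)
  finally show ?thesis .
 qed
 have \<Phi>R: "\<Phi> v \<in> R" for v
  unfolding \<Phi>_def
  by (intro subgrp_sum subgrp_of_subring[OF S] subgrp_scale)
   (use B bs zspan_base in \<open>auto simp: s_def\<close>)
 have "nring R b n"
 proof
  show "1 \<in> R" "\<And>x y. x \<in> R ==> y \<in> R ==> x * y \<in> R" using subringD[OF S] by auto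
  show "R = range (%c::nat => int. \<Sum>i<n. of_int (c i) * b i)"
  proof (intro equalityI subsetI)
   fix z assume "z \<in> R"
   then obtain c :: "complex => int" where c: "z = (\<Sum>b\<in>B. of_int (c b) * b)" unfolding B(2) zspan_def by blast
   define v where "v x = (if x < s then c (bs ! x) else 0)" for x
   have "z = (\<Sum>x<s. of_int (c (bs ! x)) * bs ! x)"
    unfolding c bs(1)[symmetric] s_def
    by (rule sum.reindex_bij_betw[symmetric]) (use bs(2) in \<open>simp add: bij_betw_nth\<close>)
   also have "... = \<Phi> v" unfolding \<Phi>_def v_def by (rule sum.cong) auto
   finally have z: "z = \<Phi> v" .
   obtain d where "K (%x. v x - (\<Sum>j<n. d j * u j x))" using u(1)[of v] by (auto simp: v_def)
   then have *: "z = (\<Sum>j<n. of_int (d j) * b j)" by (simp add: K_def \<Phi>d \<Phi>s z)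
   show "z \<in> range (%c::nat => int. \<Sum>i<n. of_int (c i) * b i)" by (rule range_eqI[where x = d], rule *)
  next
   fix z assume "z \<in> range (%c::nat => int. \<Sum>i<n. of_int (c i) * b i)"
   then obtain c :: "nat => int" where "z = (\<Sum>i<n. of_int (c i) * b i)" by (elim imageE)
   then show "z \<in> R" using \<Phi>R[of "%x. \<Sum>j<n. c j * u j x"] by (simp only: \<Phi>s)
  qed
  fix c :: "nat => int" and i assume *: "(\<Sum>i<n. of_int (c i) * b i) = 0" and i: "i < n"
  have "K (%x. \<Sum>j<n. c j * u j x)" unfolding K_def \<Phi>s by (rule *)
  from u(2)[OF this] i show "c i = 0" by blast
 qed
 then show thesis by (rule that)
qed

text \<open>For finitely generated \<open>R\<close> this is the fraction field: integers suffice as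
  denominators, since a nonzero \<open>a\<close> divides the nonzero integer
  \<open>dt a\<close>.\<close>

definition fr :: "complex set => complex set" where
 "fr R = {x. \<exists>N::int. N \<noteq> 0 \<and> of_int N * x \<in> R}"

lemma frI: "N \<noteq> 0 ==> of_int N * x \<in> R ==> x \<in> fr R" by (auto simp: fr_def)

lemma subring_fr:
 assumes R: "is_subring R"
 shows "is_subring (fr R)"
 unfolding is_subring_def
proof (intro conjI ballI)
 show "1 \<in> fr R" by (rule frI[of 1]) (use subringD[OF R] in auto)
 fix x y assume "x \<in> fr R" "y \<in> fr R"
 then obtain N M :: int where N: "N \<noteq> 0" "of_int N * x \<in> R" and M: "M \<noteq> 0" "of_int M * y \<in> R" by (auto simp: fr_def)
 have NM: "N * M \<noteq> 0" using N M by simp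
 have "of_int M * (of_int N * x) - of_int N * (of_int M * y) \<in> R"
  by (intro subringD(3)[OF R] subringD(4)[OF R] subring_of_int[OF R] N M)
 then show "x - y \<in> fr R" by (intro frI[OF NM]) (simp add: algebra_simps)
 have "(of_int N * x) * (of_int M * y) \<in> R" by (intro subringD(4)[OF R] N M)
 then show "x * y \<in> fr R" by (intro frI[OF NM]) (simp add: algebra_simps)
qed

lemma sub_fr: "R \<subseteq> fr R" using frI[of 1] by auto

lemma fr_mono: "R \<subseteq> R' ==> fr R \<subseteq> fr R'" by (auto simp: fr_def)

lemma fr_inverse:
 assumes R: "fgring R" and x: "x \<in> fr R" "x \<noteq> 0"
 shows "inverse x \<in> fr R"
proof -
 obtain b n where "nring R b n" by (rule fgring_basis[OF R])
 then interpret nring R b n .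
 obtain N :: int where N: "N \<noteq> 0" "of_int N * x \<in> R" using x by (auto simp: fr_def)
 define a where "a = of_int N * x"
 have a: "a \<in> R" "a \<noteq> 0" using N x by (auto simp: a_def)
 have d: "dt a \<noteq> 0" by (rule dt_nz[OF a])
 have "of_int (dt a) * inverse x = of_int N * conj a"
  using mult_conj[OF a(1)] x by (simp add: a_def field_simps)
 also have "... \<in> R" by (intro mult of_int_in conj_in)
 finally show ?thesis by (rule frI[OF d])
qed

lemma fr_common_denominator:
 assumes R: "is_subring R" and "finite A" "\<And>i. i \<in> A ==> f i \<in> fr R"
 shows "\<exists>N::int. N \<noteq> 0 \<and> (\<forall>i\<in>A. of_int N * f i \<in> R)"
 using assms(2,3)
proof (induction A rule: finite_induct)
 case (insert a A)
 then obtain N :: int where N: "N \<noteq> 0" "\<forall>i\<in>A. of_int N * f i \<in> R" by auto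
 obtain M :: int where M: "M \<noteq> 0" "of_int M * f a \<in> R" using insert.prems[of a] by (auto simp: fr_def)
 have "of_int (N * M) * f i \<in> R" if "i \<in> insert a A" for i
 proof (cases "i = a")
  case True
  have "of_int N * (of_int M * f a) \<in> R" by (intro subringD(4)[OF R subring_of_int[OF R]] M)
  then show ?thesis using True by (simp add: mult.assoc)
 next
  case False
  have "of_int M * (of_int N * f i) \<in> R" by (rule subringD(4)[OF R subring_of_int[OF R]]) (use N False that in auto)
  then show ?thesis by (simp add: mult_ac)
 qed
 then show ?case using N M by (intro exI[of _ "N * M"]) auto
qed (auto intro: exI[of _ 1])

text \<open>After normalising the leading coefficient to 1, a common denominator \<open>N\<close> of
  the other coefficients makes \<open>\<beta> = N * \<xi>\<close> integral over \<open>R\<close>.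
  The powers of \<open>\<beta>\<close> below the degree then generate a ring \<open>R'\<close> as a
  module over \<open>R\<close>.\<close>

lemma fgring_extend:
 assumes R: "fgring R" and p: "p \<noteq> 0" "\<And>i. poly.coeff p i \<in> fr R" and root: "poly p \<xi> = 0"
 shows "\<exists>R'. fgring R' \<and> R \<subseteq> R' \<and> \<xi> \<in> fr R'"
proof -
 have sR: "is_subring R" using R by (simp add: fgring_def)
 define d where "d = Polynomial.degree p"
 define l where "l = poly.coeff p d"
 have l: "l \<noteq> 0" using p(1) by (simp add: l_def d_def)
 have d0: "d > 0"
 proof (rule ccontr)
  assume "\<not> d > 0"
  then have "p = [:l:]" using degree_eq_zeroE[of p] by (metis d_def l_def neq0_conv pCons_0_0 coeff_pCons_0)
  then show False using root l by simp
 qed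
 define q where "q i = poly.coeff p i * inverse l" for i
 have q: "q i \<in> fr R" for i
  unfolding q_def by (intro subringD(4)[OF subring_fr[OF sR]] p fr_inverse[OF R]) (use p l in \<open>auto simp: l_def\<close>)
 obtain N :: int where N: "N \<noteq> 0" "\<forall>i\<in>{..<d}. of_int N * q i \<in> R"
  using fr_common_denominator[OF sR, of "{..<d}" q] q by blast
 define \<beta> where "\<beta> = of_int N * \<xi>"
 define e where "e i = - (of_int N ^ (d - i - 1) * (of_int N * q i))" for i
 have eR: "e i \<in> R" if "i < d" for i
  unfolding e_def
  by (rule subringD(5)[OF sR], rule subringD(4)[OF sR subring_power[OF sR subring_of_int[OF sR]]]) (use N that in auto)
 have \<beta>d: "\<beta> ^ d = (\<Sum>i<d. e i * \<beta> ^ i)"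
 proof -
  have "0 = poly p \<xi> * inverse l" using root by simp
  also have "... = (\<Sum>i\<le>d. q i * \<xi> ^ i)" by (simp add: poly_altdef d_def q_def sum_distrib_left sum_distrib_right mult_ac)
  also have "... = (\<Sum>i<d. q i * \<xi> ^ i) + \<xi> ^ d"
   using l by (simp add: lessThan_Suc_atMost[symmetric] q_def l_def)
  finally have "\<xi> ^ d = - (\<Sum>i<d. q i * \<xi> ^ i)" by (simp add: eq_neg_iff_add_eq_0 add.commute)
  then have "\<beta> ^ d = of_int N ^ d * - (\<Sum>i<d. q i * \<xi> ^ i)" by (simp add: \<beta>_def power_mult_distrib)
  also have "... = (\<Sum>i<d. e i * \<beta> ^ i)"
   unfolding sum_distrib_left mult_minus_right sum_negf[symmetric]
  proof (rule sum.cong[OF refl])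
   fix i assume "i \<in> {..<d}"
   then obtain j where "d = Suc (i + j)" using less_iff_Suc_add[of i d] by auto
   then have "of_int N ^ d = (of_int N :: complex) ^ (d - i - 1) * of_int N * of_int N ^ i"
    by (simp add: power_add)
   then show "- (of_int N ^ d * (q i * \<xi> ^ i)) = e i * \<beta> ^ i"
    by (simp add: e_def \<beta>_def power_mult_distrib mult_ac)
  qed
  finally show ?thesis .
 qed
 define R' where "R' = {\<Sum>i<d. a i * \<beta> ^ i | a. \<forall>i. a i \<in> R}"
 have R'I: "(\<Sum>i<d. a i * \<beta> ^ i) \<in> R'" if "\<And>i. i < d ==> a i \<in> R" for a
 proof -
  have "(\<Sum>i<d. a i * \<beta> ^ i) = (\<Sum>i<d. (if i < d then a i else 0) * \<beta> ^ i)" by (rule sum.cong) auto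
  then show ?thesis unfolding R'_def using that subringD(2)[OF sR]
   by (intro CollectI exI[of _ "%i. if i < d then a i else 0"]) auto
 qed
 have R'E: "\<exists>a. (\<forall>i. a i \<in> R) \<and> x = (\<Sum>i<d. a i * \<beta> ^ i)" if "x \<in> R'" for x
  using that unfolding R'_def by blast
 have sub: "subgrp R'"
  unfolding subgrp_def
 proof (intro conjI ballI)
  show "0 \<in> R'" using R'I[of "%_. 0"] subringD(2)[OF sR] by simp
  fix x y assume xy: "x \<in> R'" "y \<in> R'"
  obtain a where a: "\<forall>i. a i \<in> R" "x = (\<Sum>i<d. a i * \<beta> ^ i)" using R'E[OF xy(1)] by blast
  obtain c where c: "\<forall>i. c i \<in> R" "y = (\<Sum>i<d. c i * \<beta> ^ i)" using R'E[OF xy(2)] by blast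
  have "x - y = (\<Sum>i<d. (a i - c i) * \<beta> ^ i)" by (simp add: a c left_diff_distrib sum_subtractf)
  then show "x - y \<in> R'" using R'I[of "%i. a i - c i"] a c subringD(3)[OF sR] by simp
 qed
 have multR: "r * x \<in> R'" if r: "r \<in> R" and x: "x \<in> R'" for r x
 proof -
  obtain a where a: "\<forall>i. a i \<in> R" "x = (\<Sum>i<d. a i * \<beta> ^ i)" using R'E[OF x] by blast
  have "r * x = (\<Sum>i<d. (r * a i) * \<beta> ^ i)" by (simp add: a sum_distrib_left mult.assoc)
  then show ?thesis using R'I[of "%i. r * a i"] a r subringD(4)[OF sR] by simp
 qed
 have mult\<beta>: "\<beta> * x \<in> R'" if x: "x \<in> R'" for x
 proof -
  obtain a where a: "\<forall>i. a i \<in> R" "x = (\<Sum>i<d. a i * \<beta> ^ i)" using R'E[OF x] by blast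
  obtain d' where d': "d = Suc d'" using d0 by (cases d) auto
  have "\<beta> * x = (\<Sum>i<d'. a i * \<beta> ^ Suc i) + a d' * \<beta> ^ d"
   by (simp add: a d' sum_distrib_left mult_ac distrib_left)
  also have "(\<Sum>i<d'. a i * \<beta> ^ Suc i) = (\<Sum>i<d. (if i = 0 then 0 else a (i - 1)) * \<beta> ^ i)"
   unfolding d' sum.lessThan_Suc_shift[of _ d'] by simp
  also have "a d' * \<beta> ^ d = (\<Sum>i<d. (a d' * e i) * \<beta> ^ i)" by (simp add: \<beta>d sum_distrib_left mult.assoc)
  also have "(\<Sum>i<d. (if i = 0 then 0 else a (i - 1)) * \<beta> ^ i) + ... \<in> R'"
   by (intro subgrp_add[OF sub] R'I) (use a eR subringD[OF sR] in auto)
  finally show ?thesis .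
 qed
 have mult\<beta>p: "\<beta> ^ k * x \<in> R'" if x: "x \<in> R'" for x k
  by (induction k) (use x mult\<beta> in \<open>auto simp: mult.assoc\<close>)
 have RR': "R \<subseteq> R'"
 proof
  fix r assume "r \<in> R"
  then have "(\<Sum>i<d. (if i = 0 then r else 0) * \<beta> ^ i) \<in> R'" using subringD(2)[OF sR] by (intro R'I) auto
  also have "(\<Sum>i<d. (if i = 0 then r else 0) * \<beta> ^ i) = r"
   using d0 by (subst sum.remove[of _ 0]) (auto intro!: sum.neutral)
  finally show "r \<in> R'" .
 qed
 have ring: "is_subring R'"
  unfolding is_subring_def
 proof (intro conjI ballI)
  show "1 \<in> R'" using RR' subringD(1)[OF sR] by blast
  fix x y assume xy: "x \<in> R'" "y \<in> R'"
  then show "x - y \<in> R'" by (rule subgrp_diff[OF sub])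
  obtain a where a: "\<forall>i. a i \<in> R" "x = (\<Sum>i<d. a i * \<beta> ^ i)" using R'E[OF xy(1)] by blast
  have "x * y = (\<Sum>i<d. a i * (\<beta> ^ i * y))" by (simp add: a sum_distrib_right mult.assoc)
  also have "... \<in> R'" using a by (intro subgrp_sum[OF sub] multR mult\<beta>p xy) auto
  finally show "x * y \<in> R'" .
 qed
 obtain B where B: "finite B" "R = zspan B" using R unfolding fgring_def by blast
 define B' where "B' = (%(b,i). b * \<beta> ^ i) ` (B \<times> {..<d})"
 have fB': "finite B'" using B by (simp add: B'_def)
 have "R' = zspan B'"
 proof
  show "zspan B' \<subseteq> R'"
  proof (rule zspan_least[OF sub], clarsimp simp: B'_def)
   fix b i assume "b \<in> B" "i < d"
   then have "b \<in> R" using zspan_base B by auto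
   then have "\<beta> ^ i * b \<in> R'" using RR' mult\<beta>p by blast
   then show "b * \<beta> ^ i \<in> R'" by (simp add: mult.commute)
  qed
  show "R' \<subseteq> zspan B'"
  proof
   fix x assume "x \<in> R'"
   then obtain a where a: "\<forall>i. a i \<in> R" "x = (\<Sum>i<d. a i * \<beta> ^ i)" using R'E by blast
   have "a i * \<beta> ^ i \<in> zspan B'" if i: "i < d" for i
   proof -
    define S where "S = {x. x * \<beta> ^ i \<in> zspan B'}"
    have "subgrp S" unfolding subgrp_def S_def
     using subgrp_zero[OF subgrp_zspan] subgrp_diff[OF subgrp_zspan] by (auto simp: left_diff_distrib)
    moreover have "B \<subseteq> S" unfolding S_def using zspan_base[OF fB'] i by (auto simp: B'_def)
    ultimately have "R \<subseteq> S" unfolding B(2) by (rule zspan_least)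
    then show ?thesis using a(1) by (auto simp: S_def)
   qed
   then show "x \<in> zspan B'" unfolding a(2) by (intro subgrp_sum[OF subgrp_zspan]) auto
  qed
 qed
 then have "fgring R'" unfolding fgring_def using ring fB' by blast
 moreover have "\<xi> \<in> fr R'"
 proof (rule frI[OF N(1)])
  have "\<beta> * 1 \<in> R'" by (rule mult\<beta>) (use subringD(1)[OF ring] in simp)
  then show "of_int N * \<xi> \<in> R'" by (simp add: \<beta>_def)
 qed
 ultimately show ?thesis using RR' by blast
qed

lemma is_subring_ints: "is_subring (range of_int :: 'u::comm_ring_1 set)"
 unfolding is_subring_def
proof (intro conjI ballI)
 show "(1::'u) \<in> range of_int" by (rule image_eqI[of _ _ 1]) auto
 fix x y :: 'u assume "x \<in> range of_int" "y \<in> range of_int"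
 then obtain i j :: int where "x = of_int i" "y = of_int j" by blast
 then have "x - y = of_int (i - j)" "x * y = of_int (i * j)" by simp_all
 then show "x - y \<in> range of_int" "x * y \<in> range of_int" by (simp_all only: rangeI)
qed

lemma fgring_int: "fgring (range of_int)"
proof -
 have "is_subring (range of_int :: complex set)" by (rule is_subring_ints)
 moreover have "range of_int = zspan {1}"
 proof (intro equalityI subsetI)
  fix z :: complex assume "z \<in> range of_int"
  then obtain i :: int where z: "z = of_int i" by blast
  show "z \<in> zspan {1}" unfolding zspan_def by (rule range_eqI[where x = "%_. i"]) (simp add: z)
 qed (auto simp: zspan_def)
 ultimately show ?thesis unfolding fgring_def by blast
qed

section \<open>Specialisation of prime ideals and a Nullstellensatz\<close>

text \<open>Prime ideals that contain no nonzero integer, so that the quotient is a domain of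
  characteristic 0.\<close>

definition pideal :: "'u::comm_ring_1 set => bool" where
 "pideal P \<longleftrightarrow> subgrp P \<and> (\<forall>x\<in>P. \<forall>y. y * x \<in> P) \<and> (\<forall>x y. x * y \<in> P --> x \<in> P \<or> y \<in> P)
  \<and> (\<forall>k::int. of_int k \<in> P --> k = 0)"

lemma pidealD:
 assumes "pideal P"
 shows "subgrp P" "x \<in> P ==> y * x \<in> P" "x \<in> P ==> x * y \<in> P" "x * y \<in> P ==> x \<in> P \<or> y \<in> P"
  "of_int k \<in> P ==> k = 0" "0 \<in> P" "x \<in> P ==> y \<in> P ==> x - y \<in> P" "x \<in> P ==> y \<in> P ==> x + y \<in> P"
  "1 \<notin> P" "x ^ e \<in> P ==> x \<in> P"
proof -
 have 1: "subgrp P" and 2: "\<And>x y. x \<in> P ==> y * x \<in> P" and 3: "\<And>x y. x * y \<in> P ==> x \<in> P \<or> y \<in> P"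
  and 4: "\<And>k. of_int k \<in> P ==> k = 0"
  using assms by (auto simp: pideal_def)
 show "subgrp P" "x \<in> P ==> y * x \<in> P" "x * y \<in> P ==> x \<in> P \<or> y \<in> P" "of_int k \<in> P ==> k = 0"
  by (fact 1 2 3 4)+
 show "x \<in> P ==> x * y \<in> P" using 2[of x y] by (simp add: mult.commute)
 show "0 \<in> P" "x \<in> P ==> y \<in> P ==> x - y \<in> P" "x \<in> P ==> y \<in> P ==> x + y \<in> P"
  using 1 by (simp_all add: subgrp_zero subgrp_diff subgrp_add)
 show n1: "1 \<notin> P" using 4[of 1] by auto
 show "x ^ e \<in> P ==> x \<in> P" using n1 3 by (induction e) auto
qed

text \<open>Zorn's lemma: the nonzero integers form a multiplicative set, and an ideal maximal among
  those disjoint from it is prime.\<close>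

lemma maximal_pideal:
 fixes J :: "'u::comm_ring_1 set"
 assumes J: "subgrp J" "\<And>x y. x \<in> J ==> y * x \<in> J" "\<And>k::int. of_int k \<in> J ==> k = 0"
 shows "\<exists>P. pideal P \<and> J \<subseteq> P"
proof -
 define I where "I = {Q. J \<subseteq> Q \<and> subgrp Q \<and> (\<forall>x\<in>Q. \<forall>y. y * x \<in> Q) \<and> (\<forall>k::int. of_int k \<in> Q --> k = 0)}"
 have ne: "I \<noteq> {}" using J by (auto simp: I_def)
 have "\<Union>C \<in> I" if C: "C \<noteq> {}" "subset.chain I C" for C
 proof -
  have CI: "Q \<in> I" if "Q \<in> C" for Q using C that by (auto simp: subset.chain_def)
  have tot: "Q \<subseteq> Q' \<or> Q' \<subseteq> Q" if "Q \<in> C" "Q' \<in> C" for Q Q' using C that by (auto simp: subset.chain_def)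
  obtain Q0 where Q0: "Q0 \<in> C" using C by blast
  have "x - y \<in> \<Union>C" if xy: "x \<in> \<Union>C" "y \<in> \<Union>C" for x y
  proof -
   obtain Q Q' where Q: "Q \<in> C" "x \<in> Q" "Q' \<in> C" "y \<in> Q'" using xy by blast
   then obtain Q2 where "Q2 \<in> C" "x \<in> Q2" "y \<in> Q2" using tot[of Q Q'] by blast
   moreover from this have "x - y \<in> Q2" using CI[of Q2] by (auto simp: I_def intro: subgrp_diff)
   ultimately show ?thesis by blast
  qed
  moreover have "0 \<in> \<Union>C" using Q0 CI[OF Q0] by (auto simp: I_def subgrp_def)
  ultimately have "subgrp (\<Union>C)" by (simp add: subgrp_def)
  moreover have "J \<subseteq> \<Union>C" using Q0 CI[OF Q0] by (auto simp: I_def)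
  moreover have "y * x \<in> Q" if "Q \<in> C" "x \<in> Q" for Q x y using CI[OF that(1)] that(2) by (simp add: I_def)
  then have "\<forall>x\<in>\<Union>C. \<forall>y. y * x \<in> \<Union>C" by (meson UnionE UnionI)
  moreover have "k = 0" if "Q \<in> C" "of_int k \<in> Q" for Q and k :: int using CI[OF that(1)] that(2) by (simp add: I_def)
  then have "\<forall>k::int. of_int k \<in> \<Union>C --> k = 0" by (meson UnionE)
  ultimately show ?thesis by (simp add: I_def)
 qed
 from subset_Zorn_nonempty[OF ne this] obtain P where P: "P \<in> I" and max: "\<And>Q. Q \<in> I ==> P \<subseteq> Q ==> Q = P"
  by blast
 have sub: "subgrp P" and absorb: "\<And>x y. x \<in> P ==> y * x \<in> P" and JP: "J \<subseteq> P"
  and av: "\<And>k::int. of_int k \<in> P ==> k = 0"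
  using P by (auto simp: I_def)
 have ext: "\<exists>k p a. k \<noteq> 0 \<and> p \<in> P \<and> of_int k = p + a * x" if x: "x \<notin> P" for x
 proof (rule ccontr)
  assume no: "\<nexists>k p a. k \<noteq> 0 \<and> p \<in> P \<and> of_int k = p + a * x"
  define Q where "Q = {p + a * x | p a. p \<in> P}"
  have "P \<subseteq> Q" unfolding Q_def by (force intro: exI[of _ 0])
  have "subgrp Q" unfolding subgrp_def
  proof (intro conjI ballI)
   show "0 \<in> Q" using \<open>P \<subseteq> Q\<close> subgrp_zero[OF sub] by blast
   fix u v assume "u \<in> Q" "v \<in> Q"
   then obtain p a q b where "p \<in> P" "q \<in> P" "u = p + a * x" "v = q + b * x" by (auto simp: Q_def)
   then have "u - v = (p - q) + (a - b) * x" "p - q \<in> P" using subgrp_diff[OF sub] by (auto simp: algebra_simps)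
   then show "u - v \<in> Q" unfolding Q_def by blast
  qed
  moreover have "\<forall>z\<in>Q. \<forall>y. y * z \<in> Q"
  proof (intro ballI allI)
   fix z y assume "z \<in> Q"
   then obtain p a where "p \<in> P" "z = p + a * x" by (auto simp: Q_def)
   then have "y * z = y * p + (y * a) * x" "y * p \<in> P" using absorb by (auto simp: algebra_simps)
   then show "y * z \<in> Q" unfolding Q_def by blast
  qed
  moreover have "\<forall>k::int. of_int k \<in> Q --> k = 0" using no by (auto simp: Q_def)
  ultimately have "Q \<in> I" using \<open>P \<subseteq> Q\<close> JP by (auto simp: I_def)
  then have "Q = P" using max \<open>P \<subseteq> Q\<close> by blast
  moreover have "0 + 1 * x \<in> Q" unfolding Q_def using subgrp_zero[OF sub] by blast
  ultimately show False using x by simp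
 qed
 have "x \<in> P \<or> y \<in> P" if xy: "x * y \<in> P" for x y
 proof (rule ccontr)
  assume "\<not> (x \<in> P \<or> y \<in> P)"
  then obtain k p a l q b where *: "k \<noteq> 0" "p \<in> P" "of_int k = p + a * x" "l \<noteq> 0" "q \<in> P" "of_int l = q + b * y"
   using ext[of x] ext[of y] by blast
  have "of_int (k * l) = q * p + (b * y) * p + (a * x) * q + (a * b) * (x * y)"
   by (simp add: * algebra_simps)
  also have "... \<in> P" by (intro subgrp_add[OF sub] absorb * xy)
  finally show False using av[of "k * l"] * by simp
 qed
 then have "pideal P" unfolding pideal_def using sub absorb av by blast
 then show ?thesis using JP by blast
qed

definition rhom :: "'u::comm_ring_1 set => complex set => ('u => complex) => bool" where
 "rhom S T \<psi> \<longleftrightarrow> \<psi> 1 = 1 \<and> (\<forall>x\<in>S. \<psi> x \<in> T \<and> (\<forall>y\<in>S. \<psi> (x + y) = \<psi> x + \<psi> y \<and> \<psi> (x * y) = \<psi> x * \<psi> y))"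

lemma rhomD:
 assumes "rhom S T \<psi>"
 shows "\<psi> 1 = 1" "x \<in> S ==> \<psi> x \<in> T" "x \<in> S ==> y \<in> S ==> \<psi> (x + y) = \<psi> x + \<psi> y"
  "x \<in> S ==> y \<in> S ==> \<psi> (x * y) = \<psi> x * \<psi> y"
 using assms by (auto simp: rhom_def)

lemma rhom_simps:
 assumes h: "rhom S T \<psi>" and S: "is_subring S"
 shows "\<psi> 0 = 0" "x \<in> S ==> \<psi> (- x) = - \<psi> x" "x \<in> S ==> y \<in> S ==> \<psi> (x - y) = \<psi> x - \<psi> y"
  "(\<And>i. i \<in> A ==> f i \<in> S) ==> \<psi> (sum f A) = (\<Sum>i\<in>A. \<psi> (f i))"
  "x \<in> S ==> \<psi> (x ^ e) = \<psi> x ^ e" "\<psi> (of_int k) = of_int k"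
proof -
 show 0: "\<psi> 0 = 0" using rhomD(3)[OF h, of 0 0] subringD[OF S] by simp
 have u: "\<psi> (- x) = - \<psi> x" if "x \<in> S" for x
  using rhomD(3)[OF h that subringD(5)[OF S that]] 0 by (simp add: eq_neg_iff_add_eq_0 add.commute)
 then show "x \<in> S ==> \<psi> (- x) = - \<psi> x" .
 show "x \<in> S ==> y \<in> S ==> \<psi> (x - y) = \<psi> x - \<psi> y"
  using rhomD(3)[OF h, of x "- y"] u[of y] subringD(5)[OF S, of y] by simp
 show "(\<And>i. i \<in> A ==> f i \<in> S) ==> \<psi> (sum f A) = (\<Sum>i\<in>A. \<psi> (f i))"
  by (induction A rule: infinite_finite_induct) (auto simp: 0 rhomD(3)[OF h] subring_sum[OF S])
 show "x \<in> S ==> \<psi> (x ^ e) = \<psi> x ^ e"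
  by (induction e) (auto simp: rhomD(1,4)[OF h] subring_power[OF S])
 have n: "\<psi> (of_nat j) = of_nat j" for j
 proof (induction j)
  case (Suc j)
  have "of_nat j \<in> S" using subring_of_int[OF S, of "int j"] by simp
  then show ?case using Suc rhomD(3)[OF h subringD(1)[OF S], of "of_nat j"] rhomD(1)[OF h] by simp
 qed (simp add: 0)
 show "\<psi> (of_int k) = of_int k"
 proof (cases k rule: int_cases2)
  case (nonpos j)
  have "of_nat j \<in> S" using subring_of_int[OF S, of "int j"] by simp
  then show ?thesis using u[of "of_nat j"] n nonpos by simp
 qed (simp add: n)
qed

section \<open>Polynomials over a subring, considered modulo a prime ideal\<close>

definition cin :: "'u::comm_ring_1 set => 'u poly => bool" where
 "cin S f \<longleftrightarrow> (\<forall>i. poly.coeff f i \<in> S)"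

definition pev :: "('u::comm_ring_1 => complex) => complex => 'u poly => complex" where
 "pev \<psi> \<xi> f = poly (map_poly \<psi> f) \<xi>"

context
 fixes S :: "'u::comm_ring_1 set"
 assumes S: "is_subring S"
begin

lemma cin_simps: "cin S f ==> poly.coeff f i \<in> S" "cin S 0" "cin S 1" "c \<in> S ==> cin S [:c:]"
  "cin S f ==> cin S g ==> cin S (f + g)" "cin S f ==> cin S g ==> cin S (f - g)"
  "cin S f ==> cin S g ==> cin S (f * g)" "c \<in> S ==> cin S f ==> cin S (smult c f)"
  "c \<in> S ==> cin S (Polynomial.monom c e)"
proof -
 note D = subringD[OF S]
 show "cin S f ==> poly.coeff f i \<in> S" by (simp add: cin_def)
 show "cin S 0" "c \<in> S ==> cin S (Polynomial.monom c e)" using D by (auto simp: cin_def coeff_monom)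
 show "cin S 1" using D by (auto simp: cin_def coeff_1)
 show "c \<in> S ==> cin S [:c:]" using D by (auto simp: cin_def coeff_pCons split: nat.split)
 show "cin S f ==> cin S g ==> cin S (f + g)" "cin S f ==> cin S g ==> cin S (f - g)"
  "c \<in> S ==> cin S f ==> cin S (smult c f)"
  by (simp_all add: cin_def D)
 show "cin S f ==> cin S g ==> cin S (f * g)"
  unfolding cin_def coeff_mult by (intro allI subring_sum[OF S] D(4)) auto
qed

text \<open>Leading coefficients need not be invertible, so the dividend is first multiplied by a
  power of that of \<open>\<mu>\<close>. The bound on the degree of the quotient is recorded
  explicitly, since the ambient ring may have zero divisors.\<close>

lemma pseudo_div:
 assumes \<mu>: "cin S \<mu>" "Polynomial.degree \<mu> \<ge> 1" and h: "cin S h"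
 shows "\<exists>k q r. cin S q \<and> cin S r \<and> smult (lead_coeff \<mu> ^ k) h = q * \<mu> + r \<and>
  Polynomial.degree r < Polynomial.degree \<mu> \<and> Polynomial.degree q \<le> Polynomial.degree h - Polynomial.degree \<mu>"
 using h
proof (induction "Polynomial.degree h" arbitrary: h rule: less_induct)
 case less
 define e where "e = Polynomial.degree \<mu>"
 define n where "n = Polynomial.degree h"
 define l where "l = lead_coeff \<mu>"
 show ?case
 proof (cases "n < e")
  case True
  then show ?thesis using less.prems cin_simps(2)
   by (intro exI[of _ 0] exI[of _ "0::'u poly"] exI[of _ h]) (simp add: e_def n_def)
 next
  case False
  define t where "t = Polynomial.monom (lead_coeff h) (n - e)"
  define h' where "h' = smult l h - t * \<mu>"
  have lS: "l \<in> S" using cin_simps(1)[OF \<mu>(1)] by (simp add: l_def)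
  have tS: "cin S t" unfolding t_def by (intro cin_simps less.prems)
  have h': "cin S h'" unfolding h'_def by (intro cin_simps lS tS \<mu> less.prems)
  have "Polynomial.degree (t * \<mu>) \<le> n"
   using degree_mult_le[of t \<mu>] degree_monom_le[of "lead_coeff h" "n - e"] False by (simp add: t_def e_def)
  then have "Polynomial.degree h' \<le> n"
   unfolding h'_def using degree_smult_le[of l h] by (intro degree_diff_le) (auto simp: n_def)
  moreover have "poly.coeff (t * \<mu>) n = lead_coeff h * l"
   using False by (simp add: t_def coeff_monom_mult l_def n_def e_def)
  then have "poly.coeff h' n = 0" by (simp add: h'_def n_def mult.commute)
  ultimately have d: "Polynomial.degree h' < n"
   using eq_zero_or_degree_less[of h' n] False \<mu>(2) by (auto simp: e_def)
  then obtain k q r where IH: "cin S q" "cin S r" "smult (l ^ k) h' = q * \<mu> + r" "Polynomial.degree r < e"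
   "Polynomial.degree q \<le> Polynomial.degree h' - e"
   using less.hyps[OF _ h'] unfolding n_def e_def l_def by blast
  have "smult (l ^ Suc k) h = smult (l ^ k) (h' + t * \<mu>)" by (simp add: h'_def mult.commute)
  also have "... = (q + smult (l ^ k) t) * \<mu> + r" by (simp only: smult_add_right IH) (simp add: algebra_simps)
  finally have "smult (l ^ Suc k) h = (q + smult (l ^ k) t) * \<mu> + r" .
  moreover have "cin S (q + smult (l ^ k) t)" by (intro cin_simps IH tS subring_power[OF S] lS)
  moreover have "Polynomial.degree (smult (l ^ k) t) \<le> n - e"
   using degree_smult_le[of "l ^ k" t] degree_monom_le[of "lead_coeff h" "n - e"] by (simp add: t_def)
  then have "Polynomial.degree (q + smult (l ^ k) t) \<le> n - e"
   using IH(5) d by (intro degree_add_le) auto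
  ultimately have *: "cin S (q + smult (l ^ k) t) \<and> cin S r \<and> smult (l ^ Suc k) h = (q + smult (l ^ k) t) * \<mu> + r \<and>
    Polynomial.degree r < e \<and> Polynomial.degree (q + smult (l ^ k) t) \<le> n - e"
   using IH(2,4) by (intro conjI)
  show ?thesis by (rule exI[of _ "Suc k"], rule exI[of _ "q + smult (l ^ k) t"], rule exI[of _ r])
   (use * in \<open>simp only: l_def e_def n_def\<close>)
 qed
qed

lemma trim:
 assumes f: "cin S f" "Polynomial.degree f \<ge> 1" and P: "pideal P" "lead_coeff f \<in> P"
 shows "\<exists>f'. cin S f' \<and> Polynomial.degree f' < Polynomial.degree f \<and> (\<forall>x. poly f x - poly f' x \<in> P) \<and>
  (\<forall>i. poly.coeff f i - poly.coeff f' i \<in> P)"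
proof -
 define n where "n = Polynomial.degree f"
 define f' where "f' = f - Polynomial.monom (lead_coeff f) n"
 have "Polynomial.degree f' \<le> n"
  unfolding f'_def using degree_monom_le[of "lead_coeff f" n] by (intro degree_diff_le) (auto simp: n_def)
 moreover have "poly.coeff f' n = 0" by (simp add: f'_def n_def)
 ultimately have "Polynomial.degree f' < n" using eq_zero_or_degree_less[of f' n] f(2) by (auto simp: n_def)
 moreover have "cin S f'" unfolding f'_def by (intro cin_simps f)
 moreover have "poly f x - poly f' x \<in> P" for x
  using pidealD(3)[OF P] by (simp add: f'_def poly_monom)
 moreover have "poly.coeff f i - poly.coeff f' i \<in> P" for i
  using P pidealD(6)[OF P(1)] by (simp add: f'_def coeff_monom)
 ultimately show ?thesis unfolding n_def by (intro exI[of _ f'] conjI allI)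
qed

context
 fixes T \<psi> \<xi>
 assumes h: "rhom S T \<psi>" and T: "is_subring T" and \<xi>: "\<xi> \<in> T"
begin

lemma coeff_map: "poly.coeff (map_poly \<psi> f) i = \<psi> (poly.coeff f i)"
 by (rule coeff_map_poly) (rule rhom_simps(1)[OF h S])

lemma ev_in: "cin S f ==> pev \<psi> \<xi> f \<in> T"
 unfolding pev_def poly_altdef coeff_map
 by (intro subring_sum[OF T] subringD(4)[OF T] subring_power[OF T] \<xi> rhomD(2)[OF h] cin_simps)

lemma ev_add: assumes "cin S f" "cin S g" shows "pev \<psi> \<xi> (f + g) = pev \<psi> \<xi> f + pev \<psi> \<xi> g"
proof -
 have "map_poly \<psi> (f + g) = map_poly \<psi> f + map_poly \<psi> g"
  by (rule poly_eqI) (simp add: coeff_map rhomD(3)[OF h] cin_simps(1) assms)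
 then show ?thesis by (simp add: pev_def)
qed

lemma ev_diff: assumes "cin S f" "cin S g" shows "pev \<psi> \<xi> (f - g) = pev \<psi> \<xi> f - pev \<psi> \<xi> g"
 using ev_add[of "f - g" g] assms by (simp add: cin_simps)

lemma ev_mult: assumes "cin S f" "cin S g" shows "pev \<psi> \<xi> (f * g) = pev \<psi> \<xi> f * pev \<psi> \<xi> g"
proof -
 have "map_poly \<psi> (f * g) = map_poly \<psi> f * map_poly \<psi> g"
 proof (rule poly_eqI)
  fix n
  have "\<psi> (\<Sum>i\<le>n. poly.coeff f i * poly.coeff g (n - i)) = (\<Sum>i\<le>n. \<psi> (poly.coeff f i * poly.coeff g (n - i)))"
   by (rule rhom_simps(4)[OF h S]) (intro subringD(4)[OF S] cin_simps assms)
  then show "poly.coeff (map_poly \<psi> (f * g)) n = poly.coeff (map_poly \<psi> f * map_poly \<psi> g) n"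
   by (simp add: coeff_map coeff_mult rhomD(4)[OF h] cin_simps(1) assms)
 qed
 then show ?thesis by (simp add: pev_def)
qed

lemma ev_const: "pev \<psi> \<xi> [:c:] = \<psi> c"
proof -
 have "map_poly \<psi> [:c:] = [:\<psi> c:]"
  using rhom_simps(1)[OF h S] by (intro poly_eqI) (simp add: coeff_map coeff_pCons split: nat.split)
 then show ?thesis by (simp add: pev_def)
qed

lemma ev_one: "pev \<psi> \<xi> 1 = 1"
 using ev_const[of 1] rhomD(1)[OF h] by (simp add: one_pCons)

lemma ev_killed: "(\<And>i. \<psi> (poly.coeff f i) = 0) ==> pev \<psi> \<xi> f = 0"
 by (simp add: pev_def poly_altdef coeff_map)

lemma ev_smult: "c \<in> S ==> cin S f ==> pev \<psi> \<xi> (smult c f) = \<psi> c * pev \<psi> \<xi> f"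
 using ev_mult[of "[:c:]" f] cin_simps(4)[of c] by (simp add: ev_const)

text \<open>The value at \<open>poly f x\<close> must not depend on \<open>f\<close>. The difference
  of two choices vanishes at \<open>x\<close>, hence lies in \<open>P\<close> there, and
  \<open>key\<close> lets it evaluate to 0.\<close>

lemma extend_hom:
 assumes P: "pideal P" and key: "\<And>f. cin S f ==> poly f x \<in> P ==> pev \<psi> \<xi> f = 0"
 shows "\<exists>\<psi>'. rhom {poly f x |f. cin S f} T \<psi>' \<and> (\<forall>y\<in>{poly f x |f. cin S f} \<inter> P. \<psi>' y = 0) \<and>
  (\<forall>f. cin S f --> \<psi>' (poly f x) = pev \<psi> \<xi> f)"
proof -
 define \<psi>' where "\<psi>' y = pev \<psi> \<xi> (SOME f. cin S f \<and> y = poly f x)" for y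
 have \<psi>': "\<psi>' (poly f x) = pev \<psi> \<xi> f" if f: "cin S f" for f
 proof -
  define g where "g = (SOME g. cin S g \<and> poly f x = poly g x)"
  have g: "cin S g \<and> poly f x = poly g x" unfolding g_def by (rule someI[of _ f]) (use f in simp)
  have "pev \<psi> \<xi> (f - g) = 0" by (rule key) (use f g pidealD(6)[OF P] in \<open>simp_all add: cin_simps\<close>)
  then show ?thesis using ev_diff[OF f conjunct1[OF g]] unfolding \<psi>'_def g_def[symmetric] by simp
 qed
 have "\<psi>' 1 = 1" using \<psi>'[of 1] ev_one cin_simps(3) by simp
 moreover have "\<psi>' y \<in> T" if "y \<in> {poly f x |f. cin S f}" for y using that \<psi>' ev_in by auto
 moreover have "\<psi>' (y + z) = \<psi>' y + \<psi>' z \<and> \<psi>' (y * z) = \<psi>' y * \<psi>' z"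
  if yz: "y \<in> {poly f x |f. cin S f}" "z \<in> {poly f x |f. cin S f}" for y z
 proof -
  obtain f g where "cin S f" "y = poly f x" "cin S g" "z = poly g x" using yz by blast
  then show ?thesis using \<psi>'[of "f + g"] \<psi>'[of "f * g"] \<psi>' ev_add ev_mult by (simp add: cin_simps)
 qed
 ultimately have "rhom {poly f x |f. cin S f} T \<psi>'" by (simp only: rhom_def) blast
 moreover have "\<forall>y\<in>{poly f x |f. cin S f} \<inter> P. \<psi>' y = 0" using \<psi>' key by auto
 ultimately show ?thesis using \<psi>' by blast
qed

end

end

text \<open>Every element of \<open>S\<close> outside \<open>P\<close> survives under some
  homomorphism to a number field that kills \<open>S \<inter> P\<close>: the domain
  \<open>S / (S \<inter> P)\<close> has enough specialisations.\<close>

definition spec :: "'u::comm_ring_1 set => 'u set => bool" where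
 "spec P S \<longleftrightarrow> (\<forall>u\<in>S - P. \<exists>\<psi> Q. fgring Q \<and> rhom S (fr Q) \<psi> \<and> (\<forall>y\<in>S \<inter> P. \<psi> y = 0) \<and> \<psi> u \<noteq> 0)"

lemma spec_base:
 fixes P :: "'a::comm_ring_1 set"
 assumes P: "pideal P"
 shows "is_subring (range of_int :: 'a set) \<and> spec P (range of_int)"
proof
 show "is_subring (range of_int :: 'a set)" by (rule is_subring_ints)
 define \<psi> :: "'a => complex" where "\<psi> y = of_int (SOME k. y = of_int k)" for y
 have inj: "i = j" if "of_int i = (of_int j :: 'a)" for i j
 proof -
  have "of_int (i - j) = (0::'a)" using that by simp
  then show ?thesis using pidealD(5)[OF P, of "i - j"] pidealD(6)[OF P] by simp
 qed
 have \<psi>: "\<psi> (of_int k) = of_int k" for k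
 proof -
  have "of_int k = (of_int (SOME j. of_int k = (of_int j :: 'a)) :: 'a)" by (rule someI) (rule refl)
  then show ?thesis using inj unfolding \<psi>_def by metis
 qed
 have "rhom (range of_int) (fr (range of_int)) \<psi>"
  unfolding rhom_def
 proof (intro conjI ballI)
  show "\<psi> 1 = 1" using \<psi>[of 1] by simp
  fix x :: 'a assume "x \<in> range of_int"
  then obtain i where i: "x = of_int i" by blast
  show "\<psi> x \<in> fr (range of_int)" unfolding i \<psi> by (rule subsetD[OF sub_fr rangeI])
  fix y :: 'a assume "y \<in> range of_int"
  then obtain j where j: "y = of_int j" by blast
  show "\<psi> (x + y) = \<psi> x + \<psi> y" "\<psi> (x * y) = \<psi> x * \<psi> y"
   using \<psi>[of "i + j"] \<psi>[of "i * j"] \<psi> i j by simp_all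
 qed
 moreover have "\<forall>y\<in>range of_int \<inter> P. \<psi> y = 0" using \<psi> pidealD(5)[OF P] by auto
 moreover have "\<psi> u \<noteq> 0" if "u \<in> range of_int - P" for u
  using that \<psi> pidealD(6)[OF P] by auto
 ultimately show "spec P (range of_int)" unfolding spec_def using fgring_int by blast
qed

lemma rhom_mono: "rhom S T \<psi> ==> T \<subseteq> T' ==> rhom S T' \<psi>"
 by (auto simp: rhom_def)

text \<open>One element \<open>x\<close> is adjoined. If \<open>x\<close> is transcendental modulo
  \<open>P\<close>, its image may be any integer outside a finite set. Otherwise \<open>x\<close> is
  sent to a root of the image of a relation \<open>\<mu>\<close> of least degree, and
  \<open>u\<close> survives because a multiple of it is congruent modulo \<open>P\<close> to an
  element \<open>\<rho>\<close> of \<open>S\<close> outside \<open>P\<close>.\<close>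

lemma spec_step:
 fixes x :: "'u::comm_ring_1"
 assumes P: "pideal P" and S: "is_subring S" and sp: "spec P S"
 shows "spec P {poly f x |f. cin S f}"
 unfolding spec_def
proof
 fix u assume "u \<in> {poly f x |f. cin S f} - P"
 then obtain f0 where f0: "cin S f0" "u = poly f0 x" "u \<notin> P" by blast
 note PD = pidealD[OF P] and cs = cin_simps[OF S]
 define rel where "rel f \<longleftrightarrow> cin S f \<and> poly f x \<in> P" for f
 \<comment> \<open>Polynomials that are 0 modulo \<open>P\<close> coefficient by coefficient; as
   relations they say nothing about \<open>x\<close>.\<close>
 define triv where "triv f \<longleftrightarrow> (\<forall>i. poly.coeff f i \<in> P)" for f :: "'u poly"
 have trivP: "poly f y \<in> P" if "triv f" for f y
  unfolding poly_altdef by (intro subgrp_sum[OF PD(1)] PD(3)) (use that in \<open>simp add: triv_def\<close>)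
 show "\<exists>\<psi> Q. fgring Q \<and> rhom {poly f x |f. cin S f} (fr Q) \<psi> \<and>
   (\<forall>y\<in>{poly f x |f. cin S f} \<inter> P. \<psi> y = 0) \<and> \<psi> u \<noteq> 0"
 proof (cases "\<forall>f. rel f --> triv f")
  case True
  obtain i where i: "poly.coeff f0 i \<notin> P" using trivP[of f0 x] f0 by (auto simp: triv_def)
  then have "poly.coeff f0 i \<in> S - P" using cs(1)[OF f0(1)] by blast
  then obtain \<psi> Q where \<psi>: "fgring Q" "rhom S (fr Q) \<psi>" "\<forall>y\<in>S \<inter> P. \<psi> y = 0" "\<psi> (poly.coeff f0 i) \<noteq> 0"
   using sp unfolding spec_def by blast
  have T: "is_subring (fr Q)" using subring_fr \<psi>(1) by (simp add: fgring_def)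
  have "map_poly \<psi> f0 \<noteq> 0" using \<psi>(4) coeff_map_poly[of \<psi> f0 i, OF rhom_simps(1)[OF \<psi>(2) S]] by auto
  then have "finite {z. poly (map_poly \<psi> f0) z = 0}" by (rule poly_roots_finite)
  moreover have "infinite (range (of_int :: int => complex))"
   by (simp add: finite_image_iff inj_on_def infinite_UNIV_int)
  ultimately obtain \<xi> where \<xi>: "\<xi> \<in> range of_int" "poly (map_poly \<psi> f0) \<xi> \<noteq> 0"
   by (metis (mono_tags, lifting) finite_subset mem_Collect_eq subsetI)
  have \<xi>T: "\<xi> \<in> fr Q" using \<xi>(1) subring_of_int[OF T] by auto
  have key: "pev \<psi> \<xi> f = 0" if "cin S f" "poly f x \<in> P" for f
  proof (rule ev_killed[OF S \<psi>(2) T \<xi>T])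
   fix i
   have "triv f" using True that by (simp add: rel_def)
   then show "\<psi> (poly.coeff f i) = 0" using \<psi>(3) cs(1)[OF that(1)] by (simp add: triv_def)
  qed
  obtain \<psi>' where \<psi>': "rhom {poly f x |f. cin S f} (fr Q) \<psi>'" "\<forall>y\<in>{poly f x |f. cin S f} \<inter> P. \<psi>' y = 0"
   "\<forall>f. cin S f --> \<psi>' (poly f x) = pev \<psi> \<xi> f"
   using extend_hom[OF S \<psi>(2) T \<xi>T P key] by blast
  have "\<psi>' u \<noteq> 0" using \<psi>'(3) f0 \<xi>(2) by (simp add: pev_def)
  then show ?thesis using \<psi>' \<psi>(1) by blast
 next
  case False
  define Dm where "Dm d \<longleftrightarrow> (\<exists>f. rel f \<and> \<not> triv f \<and> Polynomial.degree f = d)" for d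
  define d where "d = Least Dm"
  have "\<exists>d. Dm d" using False by (auto simp: Dm_def)
  then have "Dm d" unfolding d_def by (rule LeastI_ex)
  then obtain \<mu> where \<mu>: "rel \<mu>" "\<not> triv \<mu>" "Polynomial.degree \<mu> = d" by (auto simp: Dm_def)
  have min: "triv f" if "rel f" "Polynomial.degree f < d" for f
  proof -
   have "\<not> Dm (Polynomial.degree f)" by (rule not_less_Least) (use that(2) in \<open>simp only: d_def\<close>)
   then show ?thesis using that(1) unfolding Dm_def by blast
  qed
  have \<mu>S: "cin S \<mu>" "poly \<mu> x \<in> P" using \<mu> by (auto simp: rel_def)
  have d1: "d \<ge> 1"
  proof (rule ccontr)
   assume "\<not> d \<ge> 1"
   then obtain a where a: "\<mu> = [:a:]" using \<mu>(3) by (metis degree_eq_zeroE less_one not_le)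
   then have "triv \<mu>" using \<mu>S PD(6) by (auto simp: triv_def coeff_pCons split: nat.split)
   then show False using \<mu> by blast
  qed
  define l where "l = lead_coeff \<mu>"
  have lS: "l \<in> S" using cs(1)[OF \<mu>S(1)] by (simp add: l_def)
  have lP: "l \<notin> P"
  proof
   assume "l \<in> P"
   then obtain f' where f': "cin S f'" "Polynomial.degree f' < d" "poly \<mu> x - poly f' x \<in> P"
    "\<And>i. poly.coeff \<mu> i - poly.coeff f' i \<in> P"
    using trim[OF S \<mu>S(1) _ P] d1 unfolding \<mu>(3) l_def by blast
   have "poly f' x \<in> P" using PD(7)[OF \<mu>S(2) f'(3)] by simp
   then have "triv f'" using f' min by (simp add: rel_def)
   then have "triv \<mu>" unfolding triv_def using PD(8)[OF f'(4)] by (metis diff_add_cancel)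
   then show False using \<mu> by blast
  qed
  \<comment> \<open>Polynomials whose value at \<open>x\<close> is outside \<open>P\<close> and
    agrees modulo \<open>P\<close> with that of a multiple of \<open>f0\<close>. The least degree
    among them will be shown to be 0; the constant obtained plays the part of a resultant of
    \<open>f0\<close> and \<open>\<mu>\<close>.\<close>
  define good where "good g \<longleftrightarrow> cin S g \<and> poly g x \<notin> P \<and> (\<exists>B. cin S B \<and> poly g x - poly (B * f0) x \<in> P)" for g
  define Dg where "Dg e \<longleftrightarrow> (\<exists>g. good g \<and> Polynomial.degree g = e)" for e
  define e where "e = Least Dg"
  have "good f0" unfolding good_def using f0 cs(3) PD(6) by (intro conjI exI[of _ 1]) auto
  then have "Dg (Polynomial.degree f0)" by (auto simp: Dg_def)
  then have "Dg e" unfolding e_def by (rule LeastI)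
  then obtain g where g: "good g" "Polynomial.degree g = e" by (auto simp: Dg_def)
  have ming: "\<not> good r" if "Polynomial.degree r < e" for r
  proof -
   have "\<not> Dg (Polynomial.degree r)" by (rule not_less_Least) (use that in \<open>simp only: e_def\<close>)
   then show ?thesis unfolding Dg_def by blast
  qed
  obtain B where B: "cin S B" "poly g x - poly (B * f0) x \<in> P" and gS: "cin S g" "poly g x \<notin> P"
   using g by (auto simp: good_def)
  have good_cong: "good r" if r: "cin S r" "cin S q" "poly r x - poly q x * poly g x \<in> P" "poly q x \<notin> P" for r q
  proof -
   have "poly r x \<notin> P"
   proof
    assume "poly r x \<in> P"
    then have "poly q x * poly g x \<in> P" using PD(7)[OF _ r(3), of "poly r x"] by simp
    then show False using PD(4) r(4) gS(2) by blast
   qed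
   moreover have "poly r x - poly ((q * B) * f0) x = (poly r x - poly q x * poly g x) + poly q x * (poly g x - poly (B * f0) x)"
    by (simp add: algebra_simps)
   then have "poly r x - poly ((q * B) * f0) x \<in> P" by (simp only: PD(8)[OF r(3) PD(2)[OF B(2)]])
   ultimately show ?thesis unfolding good_def using r(1) cs(7)[OF r(2) B(1)] by blast
  qed
  have e0: "e = 0"
  proof (rule ccontr)
   assume "e \<noteq> 0"
   then have e1: "Polynomial.degree g \<ge> 1" using g by simp
   define lg where "lg = lead_coeff g"
   have lgS: "lg \<in> S" using cs(1)[OF gS(1)] by (simp add: lg_def)
   have lgP: "lg \<notin> P"
   proof
    assume "lg \<in> P"
    then obtain g' where g': "cin S g'" "Polynomial.degree g' < e" "poly g x - poly g' x \<in> P"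
     using trim[OF S gS(1) e1 P] unfolding g(2) lg_def by blast
    have "poly g' x - poly 1 x * poly g x = - (poly g x - poly g' x)" by simp
    then have "poly g' x - poly 1 x * poly g x \<in> P" using subgrp_uminus[OF PD(1) g'(3)] by simp
    then have "good g'" using good_cong[of g' 1] g'(1) cs(3) subringD(1)[OF S] PD(9) by simp
    then show False using ming g' by blast
   qed
   \<comment> \<open>Otherwise the remainder of \<open>g\<close> under pseudo-division by
     \<open>\<mu>\<close> is a good polynomial of smaller degree.\<close>
   have ed: "e < d"
   proof (rule ccontr)
    assume "\<not> e < d"
    obtain k q r where qr: "cin S q" "cin S r" "smult (l ^ k) g = q * \<mu> + r" "Polynomial.degree r < d"
     using pseudo_div[OF S \<mu>S(1) _ gS(1)] d1 unfolding \<mu>(3) l_def by blast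
    have "poly (smult (l ^ k) g) x = poly (q * \<mu> + r) x" by (simp only: qr(3))
    then have "poly r x - poly [:l ^ k:] x * poly g x = - (poly q x * poly \<mu> x)" by (simp add: algebra_simps)
    then have "poly r x - poly [:l ^ k:] x * poly g x \<in> P"
     using subgrp_uminus[OF PD(1) PD(2)[OF \<mu>S(2)]] by simp
    moreover have "poly [:l ^ k:] x \<notin> P" using PD(10) lP by auto
    ultimately have "good r" using good_cong[of r "[:l ^ k:]"] qr(2) subringD(1)[OF S] cs(4) subring_power[OF S lS] by simp
    then show False using ming[of r] qr(4) \<open>\<not> e < d\<close> by simp
   qed
   \<comment> \<open>Now \<open>\<mu>\<close> is divided by \<open>g\<close>. If the value of
     \<open>q\<close> at \<open>x\<close> is outside \<open>P\<close>, the remainder is good and of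
     too small a degree. If it is in \<open>P\<close>, the minimality of \<open>\<mu>\<close> makes
     \<open>q\<close> trivial, and the leading coefficient of the multiple of \<open>\<mu>\<close>
     falls into \<open>P\<close>.\<close>
   obtain k q r where qr: "cin S q" "cin S r" "smult (lg ^ k) \<mu> = q * g + r" "Polynomial.degree r < e"
    "Polynomial.degree q \<le> d - e"
    using pseudo_div[OF S gS(1) e1 \<mu>S(1)] unfolding \<mu>(3) lg_def g(2) by blast
   have E: "poly (smult (lg ^ k) \<mu>) x = poly (q * g + r) x" by (simp only: qr(3))
   have "poly q x \<in> P"
   proof (rule ccontr)
    assume q: "poly q x \<notin> P"
    have "poly r x - poly (- q) x * poly g x = lg ^ k * poly \<mu> x" using E by (simp add: algebra_simps)
    then have "poly r x - poly (- q) x * poly g x \<in> P" using PD(2)[OF \<mu>S(2)] by simp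
    moreover have "poly (- q) x \<notin> P" using q subgrp_uminus[OF PD(1), of "poly (- q) x"] by auto
    moreover have "cin S (- q)" using cs(6)[OF cs(2) qr(1)] by simp
    ultimately have "good r" using good_cong[of r "- q"] qr(2) subringD(1)[OF S] by simp
    then show False using ming qr(4) by blast
   qed
   then have "triv q" using min[of q] qr(1,5) ed e1 g(2) by (simp add: rel_def)
   then have "poly.coeff (q * g) d \<in> P"
    unfolding coeff_mult by (intro subgrp_sum[OF PD(1)] PD(3)) (simp add: triv_def)
   moreover have "poly.coeff (smult (lg ^ k) \<mu>) d = poly.coeff (q * g) d"
    unfolding qr(3) using qr(4) ed by (simp add: coeff_eq_0)
   ultimately have "lg ^ k * l \<in> P" using \<mu>(3) by (simp add: l_def)
   then show False using PD(4,10) lP lgP by blast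
  qed
  then obtain \<rho> where \<rho>: "g = [:\<rho>:]" using g(2) by (metis degree_eq_zeroE)
  have \<rho>S: "\<rho> \<in> S" "\<rho> \<notin> P" using gS cs(1)[OF gS(1), of 0] by (auto simp: \<rho>)
  \<comment> \<open>Both factors have to survive: \<open>l\<close> keeps the image of
    \<open>\<mu>\<close> nonconstant and can be cancelled after pseudo-division, and
    \<open>\<rho>\<close> certifies that \<open>u\<close> is not killed.\<close>
  have "l * \<rho> \<in> S - P" using subringD(4)[OF S lS \<rho>S(1)] PD(4) lP \<rho>S(2) by blast
  then obtain \<psi> Q where \<psi>: "fgring Q" "rhom S (fr Q) \<psi>" "\<forall>y\<in>S \<inter> P. \<psi> y = 0" "\<psi> (l * \<rho>) \<noteq> 0"
   using sp unfolding spec_def by blast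
  have nz: "\<psi> l \<noteq> 0" "\<psi> \<rho> \<noteq> 0" using \<psi>(4) rhomD(4)[OF \<psi>(2) lS \<rho>S(1)] by auto
  have deg: "poly.coeff (map_poly \<psi> \<mu>) d \<noteq> 0" using nz(1) coeff_map_poly[of \<psi> \<mu> d, OF rhom_simps(1)[OF \<psi>(2) S]] \<mu>(3) by (simp add: l_def)
  then have nz\<mu>: "map_poly \<psi> \<mu> \<noteq> 0" by auto
  have "Polynomial.degree (map_poly \<psi> \<mu>) \<noteq> 0" using le_degree[OF deg] d1 by simp
  then obtain \<xi> where \<xi>: "poly (map_poly \<psi> \<mu>) \<xi> = 0"
   using fundamental_theorem_of_algebra[of "map_poly \<psi> \<mu>"] by (auto simp: constant_degree)
  have "poly.coeff (map_poly \<psi> \<mu>) i \<in> fr Q" for i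
   using coeff_map_poly[of \<psi> \<mu> i, OF rhom_simps(1)[OF \<psi>(2) S]] rhomD(2)[OF \<psi>(2) cs(1)[OF \<mu>S(1)]] by simp
  then obtain Q' where Q': "fgring Q'" "Q \<subseteq> Q'" "\<xi> \<in> fr Q'"
   using fgring_extend[OF \<psi>(1) nz\<mu> _ \<xi>] by blast
  have hom: "rhom S (fr Q') \<psi>" by (rule rhom_mono[OF \<psi>(2) fr_mono[OF Q'(2)]])
  have T: "is_subring (fr Q')" using subring_fr Q'(1) by (simp add: fgring_def)
  note ev = ev_add[OF S hom T Q'(3)] ev_mult[OF S hom T Q'(3)] ev_smult[OF S hom T Q'(3)] ev_diff[OF S hom T Q'(3)] ev_const[OF S hom T Q'(3)]
  have ev\<mu>: "pev \<psi> \<xi> \<mu> = 0" using \<xi> by (simp add: pev_def)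
  have key: "pev \<psi> \<xi> f = 0" if f: "cin S f" "poly f x \<in> P" for f
  proof -
   obtain k q r where qr: "cin S q" "cin S r" "smult (l ^ k) f = q * \<mu> + r" "Polynomial.degree r < d"
    using pseudo_div[OF S \<mu>S(1) _ f(1)] d1 unfolding \<mu>(3) l_def by blast
   have "poly (smult (l ^ k) f) x = poly (q * \<mu> + r) x" by (simp only: qr(3))
   then have "poly r x = l ^ k * poly f x - poly q x * poly \<mu> x" by (simp add: algebra_simps)
   then have "poly r x \<in> P" using PD(7)[OF PD(2)[OF f(2)] PD(2)[OF \<mu>S(2)]] by simp
   then have "triv r" using min qr by (simp add: rel_def)
   then have "pev \<psi> \<xi> r = 0" using \<psi>(3) cs(1)[OF qr(2)] by (intro ev_killed[OF S hom T Q'(3)]) (simp add: triv_def)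
   moreover have "pev \<psi> \<xi> (smult (l ^ k) f) = pev \<psi> \<xi> (q * \<mu> + r)" by (simp only: qr(3))
   ultimately have "\<psi> (l ^ k) * pev \<psi> \<xi> f = 0"
    using ev\<mu> f qr(1,2) \<mu>S subring_power[OF S lS] by (simp add: ev cs)
   then show ?thesis using nz(1) rhom_simps(5)[OF hom S lS] by simp
  qed
  obtain \<psi>' where \<psi>': "rhom {poly f x |f. cin S f} (fr Q') \<psi>'" "\<forall>y\<in>{poly f x |f. cin S f} \<inter> P. \<psi>' y = 0"
   "\<forall>f. cin S f --> \<psi>' (poly f x) = pev \<psi> \<xi> f"
   using extend_hom[OF S hom T Q'(3) P key] by blast
  have "pev \<psi> \<xi> (g - B * f0) = 0" using B gS f0 by (intro key) (simp_all add: cs)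
  then have "pev \<psi> \<xi> B * pev \<psi> \<xi> f0 = \<psi> \<rho>" using B gS f0 by (simp add: ev cs \<rho>)
  then have "\<psi>' u \<noteq> 0" using \<psi>'(3) f0 nz(2) by auto
  then show ?thesis using \<psi>' Q'(1) by blast
 qed
qed

lemma spec_finite:
 assumes P: "pideal P" and "finite Y"
 shows "\<exists>S. is_subring S \<and> Y \<subseteq> S \<and> spec P S"
 using assms(2)
proof (induction Y rule: finite_induct)
 case empty then show ?case using spec_base[OF P] by blast
next
 case (insert x Y)
 then obtain S where S: "is_subring S" "Y \<subseteq> S" "spec P S" by blast
 note cs = cin_simps[OF S(1)]
 let ?S = "{poly f x |f. cin S f}"
 have "is_subring ?S"
  unfolding is_subring_def
 proof (intro conjI ballI)
  show "1 \<in> ?S" by (intro CollectI exI[of _ 1]) (simp add: cs)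
  fix y z assume "y \<in> ?S" "z \<in> ?S"
  then obtain f g where "cin S f" "y = poly f x" "cin S g" "z = poly g x" by blast
  then show "y - z \<in> ?S" "y * z \<in> ?S"
   by (force intro!: exI[of _ "f - g"] simp: cs, force intro!: exI[of _ "f * g"] simp: cs)
 qed
 moreover have "y \<in> ?S" if "y \<in> S" for y by (intro CollectI exI[of _ "[:y:]"]) (simp add: cs that)
 moreover have "x \<in> ?S"
  using cs(9)[OF subringD(1)[OF S(1)], of 1] by (intro CollectI exI[of _ "Polynomial.monom 1 1"]) (simp add: poly_monom)
 ultimately show ?case using spec_step[OF P S(1,3), of x] S(2) by blast
qed


section \<open>The pointwise ring of integer functions, and minors modulo prime powers\<close>

lemma of_int_fun_apply: "(of_int k :: 'a => 'b::comm_ring_1) x = of_int k"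
proof -
 have n: "(of_nat j :: 'a => 'b) x = of_nat j" for j by (induction j) (simp_all add: zero_fun_def one_fun_def plus_fun_def)
 show ?thesis by (cases k rule: int_cases2) (simp_all add: n fun_Compl_def uminus_apply)
qed

lemma sum_fun_apply: "(\<Sum>i\<in>A. f i) x = (\<Sum>i\<in>A. (f i x :: 'b::comm_monoid_add))"
 by (induction A rule: infinite_finite_induct) (simp_all add: zero_fun_def plus_fun_def)

lemma is_subring_UNIV: "is_subring UNIV" by (simp add: is_subring_def)

lemma map_mat_mat: "map_mat h (mat a b f) = mat a b (%ij. h (f ij))"
 by (rule eq_matI) auto

lemma minor_hom:
 assumes "is_subring S" "\<And>i j. i < d ==> j < d ==> Z (f i) (g j) \<in> S"
  and "\<And>x y. x \<in> S ==> y \<in> S ==> h (x + y) = h x + h y" "\<And>x y. x \<in> S ==> y \<in> S ==> h (x * y) = h x * h y" "h 1 = 1"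
 shows "h (minor Z d f g) = minor (%r c. h (Z r c)) d f g"
proof -
 have "h (det (mat d d (%(i,j). Z (f i) (g j)))) = det (map_mat h (mat d d (%(i,j). Z (f i) (g j))))"
  by (rule hom_on_det[OF assms(1)]) (use assms in auto)
 also have "map_mat h (mat d d (%(i,j). Z (f i) (g j))) = mat d d (%(i,j). h (Z (f i) (g j)))"
  unfolding map_mat_mat by (rule cong_mat) auto
 finally show ?thesis by (simp add: minor_def)
qed

lemma minor_scale: "minor (%r c. a * Z r c) d f g = a ^ d * minor Z d f g"
proof -
 have "mat d d (%(i,j). a * Z (f i) (g j)) = a \<cdot>\<^sub>m mat d d (%(i,j). Z (f i) (g j))"
  by (rule eq_matI) auto
 then show ?thesis by (simp add: minor_def)
qed

text \<open>The gcd is a power of \<open>p\<close>; since it does not divide \<open>F\<close>, its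
  exponent exceeds the multiplicity of \<open>p\<close> in \<open>F\<close>.\<close>

lemma prime_power_excess:
 fixes p :: int
 assumes p: "is_prime p" and F: "F \<noteq> 0" and g: "\<not> gcd \<delta> (p ^ e) dvd F"
 shows "p ^ Suc (multiplicity p F) dvd gcd \<delta> (p ^ e)"
proof -
 have "gcd \<delta> (p ^ e) dvd p ^ e" by simp
 then obtain a where a: "gcd \<delta> (p ^ e) = p ^ a"
  using divides_primepow[OF p, of "gcd \<delta> (p ^ e)" e] p by (auto simp: normalize_power prime_imp_prime_elem)
 have "\<not> a \<le> multiplicity p F" using g unfolding a using multiplicity_dvd'[of a p F] by blast
 then show ?thesis unfolding a by (intro le_imp_power_dvd) simp
qed

text \<open>If no bound existed, a counterexample for each \<open>i!\<close> would give a point over the ring of integer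
 sequences modulo a prime ideal, which specialises to a complex counterexample.\<close>

lemma nullstellensatz:
 fixes A :: "'h => nat => nat => int"
 assumes Hs: "Hs \<noteq> {}" and m: "m > 0" and t: "t \<noteq> 0"
  and van: "\<And>Q w. fgring Q ==> (\<forall>i<m. w i \<in> Q) ==>
   (\<And>f c. \<forall>i<k. f i \<in> Hs ==> \<forall>j<k. c j < m ==> minor (%h c. \<Sum>i<m. w i * of_int (A h i c)) k f c = 0) ==>
   (\<Sum>i<m. w i * of_int (g i)) = 0"
 shows "\<exists>N>0. \<forall>(p::int) e W. is_prime p --> p ^ e dvd (\<Sum>i<m. W i * g i) - t -->
  (\<exists>f c. (\<forall>i<k. f i \<in> Hs) \<and> (\<forall>j<k. c j < m) \<and> gcd (minor (%h c. \<Sum>i<m. W i * A h i c) k f c) (p ^ e) dvd N)"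
proof (rule ccontr)
 let ?G = ?thesis
 assume neg: "\<not> ?G"
 define bad where "bad x p e W \<longleftrightarrow> is_prime p \<and> p ^ e dvd (\<Sum>i<m. W i * g i) - t \<and>
  (\<forall>f c. (\<forall>i<k. f i \<in> Hs) --> (\<forall>j<k. c j < m) --> \<not> gcd (minor (%h c. \<Sum>i<m. W i * A h i c) k f c) (p ^ e) dvd fact x)"
  for x :: nat and p :: int and e and W
 have "\<forall>x. \<exists>p e W. bad x p e W"
 proof
  fix x :: nat
  show "\<exists>p e W. bad x p e W"
  proof (rule ccontr)
   assume *: "\<nexists>p e W. bad x p e W"
   have ?G
   proof (rule exI[of _ "fact x"], intro conjI allI impI)
    fix p :: int and e W assume "is_prime p" "p ^ e dvd (\<Sum>i<m. W i * g i) - t"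
    moreover have "\<not> bad x p e W" using * by blast
    ultimately show "\<exists>f c. (\<forall>i<k. f i \<in> Hs) \<and> (\<forall>j<k. c j < m) \<and>
      gcd (minor (%h c. \<Sum>i<m. W i * A h i c) k f c) (p ^ e) dvd fact x"
     unfolding bad_def by blast
   qed simp
   then show False using neg by (rule notE[rotated])
  qed
 qed
 then obtain p e W where bad: "\<And>x. bad x (p x) (e x) (W x)" by metis
 have p: "\<And>x. is_prime (p x)" "\<And>x. p x ^ e x dvd (\<Sum>i<m. W x i * g i) - t"
  using bad unfolding bad_def by blast+
 have ndvd: "\<not> gcd (minor (%h c. \<Sum>i<m. W x i * A h i c) k f c) (p x ^ e x) dvd fact x"
  if "\<forall>i<k. f i \<in> Hs" "\<forall>j<k. c j < m" for x f c
  using bad[of x] that unfolding bad_def by blast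
 \<comment> \<open>One modulus per counterexample that divides all its minors: the least power of
   \<open>p x\<close> that does not divide \<open>x!\<close>.\<close>
 define q where "q x = p x ^ Suc (multiplicity (p x) (fact x :: int))" for x
 have q: "q x dvd gcd (minor (%h c. \<Sum>i<m. W x i * A h i c) k f c) (p x ^ e x)"
  if "\<forall>i<k. f i \<in> Hs" "\<forall>j<k. c j < m" for x f c
  unfolding q_def by (rule prime_power_excess[OF p(1) _ ndvd[OF that]]) simp
 obtain h0 where h0: "h0 \<in> Hs" using Hs by blast
 \<comment> \<open>Applied to one minor, with a row from the nonempty \<open>Hs\<close> and column
   0, which exists by \<open>m > 0\<close>.\<close>
 have qe: "q x dvd p x ^ e x" for x using q[of "%_. h0" "%_. 0" x] h0 m by auto
 \<comment> \<open>The sequences divisible by \<open>q x\<close> in every place. A nonzero constant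
   \<open>z\<close> among them is impossible: at the place \<open>x = \<bar>z\<bar>\<close> the
   integer \<open>z\<close> divides \<open>x!\<close>, but \<open>q x\<close> does not.\<close>
 define J where "J = {y :: nat => int. \<forall>x. q x dvd y x}"
 have "subgrp J" by (auto simp: J_def subgrp_def)
 moreover have "y * x \<in> J" if "x \<in> J" for x y using that by (auto simp: J_def)
 moreover have "z = 0" if "of_int z \<in> J" for z
 proof (rule ccontr)
  assume z: "z \<noteq> 0"
  define x where "x = nat \<bar>z\<bar>"
  have xf: "x dvd fact x" using z by (intro dvd_fact) (auto simp: x_def)
  have "q x dvd z" using that by (auto simp: J_def of_int_fun_apply)
  also have "z dvd int x" by (simp add: x_def)
  also have "int x dvd int (fact x)" using xf by (simp only: of_nat_dvd_iff)
  finally have "q x dvd fact x" by simp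
  then have "Suc (multiplicity (p x) (fact x :: int)) \<le> multiplicity (p x) (fact x :: int)"
   unfolding q_def using p(1)[of x] by (intro multiplicity_geI) (auto simp: prime_elem_not_unit)
  then show False by simp
 qed
 ultimately obtain P where P: "pideal P" "J \<subseteq> P" using maximal_pideal[of J] by blast
 define w where "w i = (%x. W x i)" for i
 obtain S where S: "is_subring S" "w ` {..<m} \<subseteq> S" "spec P S"
  using spec_finite[OF P(1), of "w ` {..<m}"] by auto
 have wS: "w i \<in> S" if "i < m" for i using S(2) that by auto
 define y where "y = (\<Sum>i<m. w i * of_int (g i))"
 define Z where "Z h c = (\<Sum>i<m. w i * of_int (A h i c))" for h c
 have ZS: "Z h c \<in> S" for h c
  unfolding Z_def by (intro subring_sum[OF S(1)] subringD(4)[OF S(1)] subring_of_int[OF S(1)] wS) simp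
 have yS: "y \<in> S" unfolding y_def by (intro subring_sum[OF S(1)] subringD(4)[OF S(1)] subring_of_int[OF S(1)] wS) simp
 have "y - of_int t \<in> J"
 proof -
  have "q x dvd (\<Sum>i<m. W x i * g i) - t" for x using qe p(2) dvd_trans by blast
  then show ?thesis by (simp add: J_def y_def w_def sum_fun_apply of_int_fun_apply)
 qed
 then have "y - of_int t \<in> P" using P by blast
 moreover have "(of_int t :: nat => int) \<notin> P" using t pidealD(5)[OF P(1)] by blast
 ultimately have "y \<notin> P" using pidealD(7)[OF P(1), of y "y - of_int t"] by auto
 then obtain \<psi> Q where \<psi>: "fgring Q" "rhom S (fr Q) \<psi>" "\<forall>y\<in>S \<inter> P. \<psi> y = 0" "\<psi> y \<noteq> 0"
  using S(3) yS unfolding spec_def by blast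
 have sQ: "is_subring Q" using \<psi>(1) by (simp add: fgring_def)
 \<comment> \<open>The values of the specialisation lie in the fraction field of \<open>Q\<close>,
   whereas \<open>van\<close> speaks of vectors over \<open>Q\<close> itself.\<close>
 obtain N :: int where N: "N \<noteq> 0" "\<forall>i\<in>{..<m}. of_int N * \<psi> (w i) \<in> Q"
  using fr_common_denominator[OF sQ, of "{..<m}" "%i. \<psi> (w i)"] rhomD(2)[OF \<psi>(2)] wS by auto
 have lin: "\<psi> (\<Sum>i<m. w i * of_int (a i)) = (\<Sum>i<m. \<psi> (w i) * of_int (a i))" for a
 proof -
  have "\<psi> (\<Sum>i<m. w i * of_int (a i)) = (\<Sum>i<m. \<psi> (w i * of_int (a i)))"
   by (rule rhom_simps(4)[OF \<psi>(2) S(1)]) (auto intro: subringD(4)[OF S(1)] wS subring_of_int[OF S(1)])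
  also have "... = (\<Sum>i<m. \<psi> (w i) * of_int (a i))"
   by (rule sum.cong) (auto simp: rhomD(4)[OF \<psi>(2)] wS subring_of_int[OF S(1)] rhom_simps(6)[OF \<psi>(2) S(1)])
  finally show ?thesis .
 qed
 have "(\<Sum>i<m. (of_int N * \<psi> (w i)) * of_int (g i)) = 0"
 proof (rule van[OF \<psi>(1)])
  show "\<forall>i<m. of_int N * \<psi> (w i) \<in> Q" using N by auto
  fix f :: "nat => 'h" and c assume fc: "\<forall>i<k. f i \<in> Hs" "\<forall>j<k. c j < m"
  have "minor Z k f c x = minor (%h c. \<Sum>i<m. W x i * A h i c) k f c" for x
  proof -
   have "minor Z k f c x = minor (%h c. Z h c x) k f c"
    by (rule minor_hom[OF is_subring_UNIV, where h = "%y. y x"]) (simp_all add: one_fun_def)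
   also have "(%h c. Z h c x) = (%h c. \<Sum>i<m. W x i * A h i c)"
    by (intro ext) (simp add: Z_def w_def sum_fun_apply of_int_fun_apply)
   finally show ?thesis .
  qed
  then have "minor Z k f c \<in> J" using q[OF fc] by (auto simp: J_def)
  moreover have "minor Z k f c \<in> S"
   unfolding minor_def by (rule det_in_subring[OF S(1)]) (auto simp: ZS)
  ultimately have "\<psi> (minor Z k f c) = 0" using \<psi>(3) P(2) by blast
  also have "\<psi> (minor Z k f c) = minor (%h c. \<psi> (Z h c)) k f c"
   by (rule minor_hom[OF S(1)]) (simp_all only: ZS rhomD[OF \<psi>(2)])
  finally have "minor (%h c. of_int N * \<psi> (Z h c)) k f c = 0" by (simp only: minor_scale mult_zero_right)
  moreover have "(%h c. of_int N * \<psi> (Z h c)) = (%h c. \<Sum>i<m. of_int N * \<psi> (w i) * of_int (A h i c))"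
   by (intro ext) (simp add: Z_def lin sum_distrib_left mult.assoc)
  ultimately show "minor (%h c. \<Sum>i<m. of_int N * \<psi> (w i) * of_int (A h i c)) k f c = 0" by simp
 qed
 also have "(\<Sum>i<m. (of_int N * \<psi> (w i)) * of_int (g i)) = of_int N * \<psi> y"
  by (simp add: y_def lin sum_distrib_left mult.assoc)
 finally show False using N(1) \<psi>(4) by simp
qed

section \<open>Lattices with a finite group action\<close>

lemma adjugate:
 fixes D :: "nat => nat => 'a::comm_ring_1"
 shows "\<exists>B. \<forall>l<k. \<forall>i<k. (\<Sum>j<k. D l j * B j i) = (if l = i then det (mat k k (%(i,j). D i j)) else 0)"
proof -
 define A where "A = mat k k (%(i,j). D i j)"
 have A: "A \<in> carrier_mat k k" by (simp add: A_def)
 have aA: "adj_mat A \<in> carrier_mat k k" "A * adj_mat A = det A \<cdot>\<^sub>m 1\<^sub>m k" using adj_mat[OF A] by blast+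
 have "(\<Sum>j<k. D l j * adj_mat A $$ (j,i)) = (if l = i then det A else 0)" if li: "l < k" "i < k" for l i
 proof -
  have "(\<Sum>j<k. D l j * adj_mat A $$ (j,i)) = (A * adj_mat A) $$ (l,i)"
   using A aA(1) li by (simp add: scalar_prod_def A_def atLeast0LessThan)
  also have "... = (if l = i then det A else 0)" unfolding aA(2) using li by simp
  finally show ?thesis .
 qed
 then show ?thesis unfolding A_def by (intro exI[of _ "%j i. adj_mat (mat k k (%(i,j). D i j)) $$ (j,i)"]) blast
qed

section \<open>Characters with values modulo \<open>m\<close>\<close>

lemma dvd_diff_trans:
 fixes m :: int
 shows "m dvd a - b ==> m dvd b - c ==> m dvd a - c"
 using dvd_add[of m "a - b" "b - c"] by simp

text \<open>A homomorphism from \<open>U / M\<close> to the integers modulo \<open>m\<close>,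
  represented by an integer-valued function that is additive on \<open>U\<close> and zero on
  \<open>M\<close> only up to multiples of \<open>m\<close>.\<close>

definition charac :: "int => 'u::comm_ring_1 set => 'u set => ('u => int) => bool" where
 "charac m M U W \<longleftrightarrow> subgrp U \<and> M \<subseteq> U \<and> (\<forall>x\<in>U. \<forall>y\<in>U. m dvd W (x + y) - (W x + W y)) \<and> (\<forall>x\<in>M. m dvd W x)"

lemma characD:
 assumes "charac m M U W"
 shows "subgrp U" "M \<subseteq> U" "x \<in> U ==> y \<in> U ==> m dvd W (x + y) - (W x + W y)" "x \<in> M ==> m dvd W x"
 using assms by (auto simp: charac_def)

lemma charac_sum:
 assumes c: "charac m M U W" and a: "\<And>i. i \<in> A ==> x i \<in> U"
 shows "m dvd W (\<Sum>i\<in>A. of_int (a i) * x i) - (\<Sum>i\<in>A. a i * W (x i))"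
proof -
 note D = characD[OF c]
 have z: "m dvd W 0" using D(3)[of 0 0] subgrp_zero[OF D(1)] by simp
 have nat: "m dvd W (of_nat j * y) - int j * W y" if y: "y \<in> U" for j y
 proof (induction j)
  case (Suc j)
  have "m dvd W (y + of_nat j * y) - (W y + W (of_nat j * y))"
   using subgrp_scale[OF D(1) y, of "int j"] by (intro D(3) y) simp
  from dvd_add[OF this Suc] show ?case by (simp add: algebra_simps)
 qed (simp add: z)
 have sc: "m dvd W (of_int k * y) - k * W y" if y: "y \<in> U" for k y
 proof (cases k rule: int_cases2)
  case (nonneg j) then show ?thesis using nat[OF y, of j] by simp
 next
  case (nonpos j)
  have "of_nat j * y \<in> U" using subgrp_scale[OF D(1) y, of "int j"] by simp
  then have "m dvd W (of_nat j * y + - (of_nat j * y)) - (W (of_nat j * y) + W (- (of_nat j * y)))"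
   by (intro D(3) subgrp_uminus[OF D(1)])
  then have "m dvd W 0 - (W (of_nat j * y) + W (- (of_nat j * y)))" by simp
  from dvd_diff[OF dvd_diff[OF z this] nat[OF y, of j]] show ?thesis using nonpos by (simp add: algebra_simps)
 qed
 show ?thesis using a
 proof (induction A rule: infinite_finite_induct)
  case (insert i A)
  have xi: "of_int (a i) * x i \<in> U" "(\<Sum>i\<in>A. of_int (a i) * x i) \<in> U"
   using insert.prems by (auto intro!: subgrp_scale[OF D(1)] subgrp_sum[OF D(1)])
  have "m dvd W (of_int (a i) * x i) - a i * W (x i)" using insert.prems by (intro sc) simp
  moreover have "m dvd W (\<Sum>i\<in>A. of_int (a i) * x i) - (\<Sum>i\<in>A. a i * W (x i))"
   by (rule insert.IH) (rule insert.prems, simp)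
  ultimately have "m dvd (W (of_int (a i) * x i + (\<Sum>i\<in>A. of_int (a i) * x i)) - (W (of_int (a i) * x i) + W (\<Sum>i\<in>A. of_int (a i) * x i)))
    + ((W (of_int (a i) * x i) - a i * W (x i)) + (W (\<Sum>i\<in>A. of_int (a i) * x i) - (\<Sum>i\<in>A. a i * W (x i))))"
   by (intro dvd_add D(3) xi)
  then show ?case using insert.hyps by (simp add: algebra_simps)
 qed (simp_all add: z)
qed

lemma charac_scale:
 assumes c: "charac m M U W" and x: "x \<in> U"
 shows "m dvd W (of_int k * x) - k * W x"
 using charac_sum[OF c, of "{0::nat}" "%_. x" "%_. k"] x by simp

text \<open>The integers modulo \<open>m\<close> are injective among groups of exponent
  \<open>m\<close>. If \<open>d\<close> is the order of \<open>e\<close> modulo \<open>U\<close>,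
  then \<open>d\<close> divides \<open>m\<close>, and it also divides the value \<open>u\<close> at
  \<open>d * e\<close>, because \<open>m / d\<close> times \<open>u\<close> is 0 modulo
  \<open>m\<close>. So \<open>e\<close> may be sent to \<open>u / d\<close>.\<close>

lemma charac_extend:
 fixes e :: "'u::comm_ring_1"
 assumes c: "charac m M U W" and m: "m > 0" and e: "of_int m * e \<in> M"
 shows "\<exists>U' W'. charac m M U' W' \<and> U \<subseteq> U' \<and> e \<in> U' \<and> (\<forall>x\<in>U. m dvd W' x - W x)"
proof -
 note D = characD[OF c]
 define I where "I j \<longleftrightarrow> j > 0 \<and> of_nat j * e \<in> U" for j
 have "I (nat m)" using m e D(2) by (auto simp: I_def)
 then have L: "I (Least I)" by (rule LeastI)
 define d where "d = int (Least I)"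
 have d: "d > 0" "of_int d * e \<in> U" using L by (auto simp: I_def d_def)
 have dI: "d dvd j" if j: "of_int j * e \<in> U" for j
 proof (rule ccontr)
  assume nd: "\<not> d dvd j"
  have "of_int (j mod d) * e = of_int j * e - of_int (j div d) * (of_int d * e)"
   by (simp only: minus_mult_div_eq_mod[symmetric] of_int_diff of_int_mult) (simp add: algebra_simps)
  then have "of_int (j mod d) * e \<in> U" using subgrp_diff[OF D(1) j subgrp_scale[OF D(1) d(2)]] by simp
  moreover have "j mod d > 0" using nd d(1) pos_mod_sign[OF d(1), of j] by (auto simp: dvd_eq_mod_eq_0)
  ultimately have "I (nat (j mod d))" by (simp add: I_def)
  then have "d \<le> j mod d" using Least_le[of I "nat (j mod d)"] \<open>j mod d > 0\<close> by (simp add: d_def)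
  then show False using pos_mod_bound[OF d(1), of j] by simp
 qed
 have "d dvd m" using dI[of m] e D(2) by blast
 then obtain m' where m': "m = d * m'" by blast
 define u where "u = W (of_int d * e)"
 have "m dvd W (of_int m' * (of_int d * e)) - m' * u" unfolding u_def by (rule charac_scale[OF c d(2)])
 moreover have "of_int m' * (of_int d * e) = of_int m * e" by (simp add: m' mult_ac)
 ultimately have "m dvd W (of_int m * e) - m' * u" by simp
 from dvd_diff[OF D(4)[OF e] this] have "m dvd m' * u" by simp
 then have "m' * d dvd m' * u" by (simp add: m' mult.commute)
 moreover have "m' \<noteq> 0" using m m' by auto
 ultimately have "d dvd u" by simp
 then obtain r where r: "u = d * r" by blast
 define U' where "U' = {y. \<exists>j. y - of_int j * e \<in> U}"
 define J where "J y = (SOME j. y - of_int j * e \<in> U)" for y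
 define W' where "W' y = W (y - of_int (J y) * e) + J y * r" for y
 have J: "y - of_int (J y) * e \<in> U" if "y \<in> U'" for y
  unfolding J_def by (rule someI_ex) (use that in \<open>simp add: U'_def\<close>)
 \<comment> \<open>Up to multiples of \<open>m\<close> the value does not depend on the choice made
   by \<open>J\<close>.\<close>
 have W': "m dvd W' y - (W (y - of_int j * e) + j * r)" if y: "y - of_int j * e \<in> U" for y j
 proof -
  have Jy: "y - of_int (J y) * e \<in> U" by (rule J) (use y in \<open>auto simp: U'_def\<close>)
  have "of_int (j - J y) * e = (y - of_int (J y) * e) - (y - of_int j * e)" by (simp add: algebra_simps)
  then have jU: "of_int (j - J y) * e \<in> U" using subgrp_diff[OF D(1) Jy y] by simp
  then obtain s where s: "j - J y = d * s" using dI by blast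
  have 1: "m dvd W ((y - of_int j * e) + of_int (j - J y) * e) - (W (y - of_int j * e) + W (of_int (j - J y) * e))"
   by (rule D(3)[OF y jU])
  have "m dvd W (of_int s * (of_int d * e)) - s * u" unfolding u_def by (rule charac_scale[OF c d(2)])
  then have 2: "m dvd W (of_int (j - J y) * e) - (j - J y) * r" by (simp add: s r mult_ac)
  have eq: "(y - of_int j * e) + of_int (j - J y) * e = y - of_int (J y) * e" by (simp add: algebra_simps)
  from dvd_add[OF 1 2] show ?thesis unfolding W'_def eq by (simp add: algebra_simps)
 qed
 have UU': "U \<subseteq> U'" unfolding U'_def by (auto intro: exI[of _ 0])
 have W'U: "m dvd W' x - W x" if "x \<in> U" for x using W'[of x 0] that by simp
 have "subgrp U'" unfolding subgrp_def
 proof (intro conjI ballI)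
  show "0 \<in> U'" using UU' subgrp_zero[OF D(1)] by blast
  fix x y assume "x \<in> U'" "y \<in> U'"
  then obtain i j where "x - of_int i * e \<in> U" "y - of_int j * e \<in> U" by (auto simp: U'_def)
  then have "(x - of_int i * e) - (y - of_int j * e) \<in> U" by (rule subgrp_diff[OF D(1)])
  then have "(x - y) - of_int (i - j) * e \<in> U" by (simp add: algebra_simps)
  then show "x - y \<in> U'" unfolding U'_def by blast
 qed
 moreover have "M \<subseteq> U'" using D(2) UU' by blast
 moreover have "m dvd W' (x + y) - (W' x + W' y)" if xy: "x \<in> U'" "y \<in> U'" for x y
 proof -
  have x: "x - of_int (J x) * e \<in> U" and y: "y - of_int (J y) * e \<in> U" using J xy by auto
  have eq: "(x + y) - of_int (J x + J y) * e = (x - of_int (J x) * e) + (y - of_int (J y) * e)"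
   by (simp add: algebra_simps)
  have "(x + y) - of_int (J x + J y) * e \<in> U" unfolding eq by (rule subgrp_add[OF D(1) x y])
  from dvd_add[OF W'[OF this] D(3)[OF x y]] show ?thesis
   unfolding eq unfolding W'_def[of x] W'_def[of y] by (simp add: algebra_simps)
 qed
 moreover have "m dvd W' x" if x: "x \<in> M" for x
  using dvd_add[OF W'U[of x] D(4)[OF x]] D(2) x by auto
 ultimately have "charac m M U' W'" unfolding charac_def by blast
 moreover have "e \<in> U'" unfolding U'_def using subgrp_zero[OF D(1)] by (auto intro!: exI[of _ 1])
 ultimately show ?thesis using UU' W'U by blast
qed

text \<open>Starts on the sum of \<open>M\<close> and the multiples of \<open>g\<close>, where
  \<open>g\<close> goes to 1 and \<open>m\<close> is its exact order modulo \<open>M\<close>, and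
  extends over the elements of \<open>E\<close> one at a time.\<close>

lemma character_exists:
 fixes M :: "'u::comm_ring_1 set"
 assumes M: "subgrp M" and ord: "\<And>j::int. of_int j * g \<in> M \<longleftrightarrow> m dvd j" and m: "m > 0"
  and E: "finite E" "\<And>e. e \<in> E ==> of_int m * e \<in> M"
 shows "\<exists>U W. charac m M U W \<and> g \<in> U \<and> E \<subseteq> U \<and> m dvd W g - 1"
 using E
proof (induction E rule: finite_induct)
 case empty
 define U where "U = {x. \<exists>j. x - of_int j * g \<in> M}"
 define W where "W x = (SOME j. x - of_int j * g \<in> M)" for x
 have W: "x - of_int (W x) * g \<in> M" if "x \<in> U" for x
  unfolding W_def by (rule someI_ex) (use that in \<open>simp add: U_def\<close>)
 have W1: "m dvd W x - j" if x: "x - of_int j * g \<in> M" for x j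
 proof -
  have "x - of_int (W x) * g \<in> M" by (rule W) (use x in \<open>auto simp: U_def\<close>)
  from subgrp_diff[OF M x this] have "of_int (W x - j) * g \<in> M" by (simp add: algebra_simps)
  then show ?thesis using ord by blast
 qed
 have "subgrp U" unfolding subgrp_def
 proof (intro conjI ballI)
  show "0 \<in> U" unfolding U_def using subgrp_zero[OF M] by (auto intro!: exI[of _ 0])
  fix x y assume "x \<in> U" "y \<in> U"
  then obtain i j where "x - of_int i * g \<in> M" "y - of_int j * g \<in> M" by (auto simp: U_def)
  from subgrp_diff[OF M this] have "(x - y) - of_int (i - j) * g \<in> M" by (simp add: algebra_simps)
  then show "x - y \<in> U" unfolding U_def by blast
 qed
 moreover have "M \<subseteq> U" unfolding U_def by (auto intro: exI[of _ 0])
 moreover have "m dvd W (x + y) - (W x + W y)" if "x \<in> U" "y \<in> U" for x y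
 proof (rule W1)
  from subgrp_add[OF M W[OF that(1)] W[OF that(2)]]
  show "(x + y) - of_int (W x + W y) * g \<in> M" by (simp add: algebra_simps)
 qed
 moreover have "m dvd W x" if "x \<in> M" for x using W1[of x 0] that by simp
 ultimately have "charac m M U W" unfolding charac_def by blast
 moreover have "g \<in> U" unfolding U_def using subgrp_zero[OF M] by (auto intro!: exI[of _ 1])
 moreover have "m dvd W g - 1" by (rule W1) (simp add: subgrp_zero[OF M])
 ultimately show ?case by blast
next
 case (insert e E)
 obtain U W where UW: "charac m M U W" "g \<in> U" "E \<subseteq> U" "m dvd W g - 1"
  using insert.IH insert.prems by blast
 obtain U' W' where U': "charac m M U' W'" "U \<subseteq> U'" "e \<in> U'" "\<forall>x\<in>U. m dvd W' x - W x"
  using charac_extend[OF UW(1) m, of e] insert.prems by blast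
 have "m dvd W' g - 1" using dvd_diff_trans[of m "W' g" "W g" 1] U'(4) UW(2,4) by blast
 then show ?case using U' UW by blast
qed

text \<open>Vectors are functions on all naturals that vanish from \<open>m\<close> on. Inside the
  pointwise ring, scalars are the constants \<open>of_int k\<close>, so the facts on subgroups of
  commutative rings apply to them.\<close>

definition vecs :: "nat => (nat => int) set" where
 "vecs m = {v. \<forall>i\<ge>m. v i = 0}"

definition unitv :: "nat => nat => int" where
 "unitv c = (%i. if i = c then 1 else 0)"

lemma subgrp_vecs: "subgrp (vecs m)"
 by (auto simp: vecs_def subgrp_def)

lemma unitv_in: "c < m ==> unitv c \<in> vecs m"
 by (auto simp: vecs_def unitv_def)

lemma vec_expand: "v \<in> vecs m ==> v = (\<Sum>c<m. of_int (v c) * unitv c)"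
proof (rule ext)
 fix i assume v: "v \<in> vecs m"
 have "(\<Sum>c<m. of_int (v c) * unitv c) i = (\<Sum>c<m. v c * unitv c i)"
  by (simp add: sum_fun_apply of_int_fun_apply)
 also have "... = (\<Sum>c<m. if i = c then v c else 0)" by (rule sum.cong) (auto simp: unitv_def)
 also have "... = v i" using v by (simp add: vecs_def)
 finally show "v i = (\<Sum>c<m. of_int (v c) * unitv c) i" by simp
qed

locale additive_on =
 fixes m :: nat and f :: "(nat => int) => (nat => int)"
 assumes add: "v \<in> vecs m ==> w \<in> vecs m ==> f (v + w) = f v + f w"
begin

lemma zero: "f 0 = 0"
 using add[of 0 0] subgrp_zero[OF subgrp_vecs] by simp

lemma diff: "v \<in> vecs m ==> w \<in> vecs m ==> f (v - w) = f v - f w"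
 using add[of "v - w" w] subgrp_diff[OF subgrp_vecs, of v m w] by simp

lemma scale: assumes v: "v \<in> vecs m" shows "f (of_int k * v) = of_int k * f v"
proof -
 have sv: "of_nat j * v \<in> vecs m" for j using subgrp_scale[OF subgrp_vecs v, of "int j"] by simp
 have nat: "f (of_nat j * v) = of_nat j * f v" for j
 proof (induction j)
  case 0 show ?case by (simp only: of_nat_0 mult_zero_left zero)
 next
  case (Suc j) show ?case by (simp only: of_nat_Suc distrib_right mult_1_left add[OF v sv] Suc)
 qed
 show ?thesis
 proof (cases k rule: int_cases2)
  case (nonneg j) then show ?thesis using nat by simp
 next
  case (nonpos j)
  have "f (0 - of_nat j * v) = f 0 - f (of_nat j * v)" by (rule diff[OF subgrp_zero[OF subgrp_vecs] sv])
  then show ?thesis using nonpos nat[of j] by (simp add: zero)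
 qed
qed

lemma lincomb: "(\<And>i. i \<in> A ==> x i \<in> vecs m) ==> f (\<Sum>i\<in>A. of_int (a i) * x i) = (\<Sum>i\<in>A. of_int (a i) * f (x i))"
proof (induction A rule: infinite_finite_induct)
 case (insert i A)
 have xi: "x i \<in> vecs m" "\<And>i. i \<in> A ==> x i \<in> vecs m" using insert.prems by auto
 have "of_int (a i) * x i \<in> vecs m" "(\<Sum>i\<in>A. of_int (a i) * x i) \<in> vecs m"
  using xi by (auto intro!: subgrp_scale[OF subgrp_vecs] subgrp_sum[OF subgrp_vecs])
 from add[OF this] show ?case by (simp only: sum.insert[OF insert.hyps] scale[OF xi(1)] insert.IH[OF xi(2)])
qed (simp_all add: zero)

lemma sum: "(\<And>i. i \<in> A ==> x i \<in> vecs m) ==> f (\<Sum>i\<in>A. x i) = (\<Sum>i\<in>A. f (x i))"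
 using lincomb[of A x "%_. 1"] by (simp only: of_int_1 mult_1_left)

lemma expand: "v \<in> vecs m ==> f v = (\<Sum>c<m. of_int (v c) * f (unitv c))"
 using lincomb[of "{..<m}" unitv v] vec_expand[of v m] unitv_in[of _ m] by auto

lemma expand_apply: "v \<in> vecs m ==> f v i = (\<Sum>c<m. v c * f (unitv c) i)"
 by (subst expand) (simp_all add: sum_fun_apply of_int_fun_apply)

end

text \<open>The acting group is a set of maps on all integer functions. Since they send everything
  outside the lattice to 0, two of them that agree on the lattice are equal; this makes right
  translations of \<open>H\<close> injective.\<close>

locale latt =
 fixes m :: nat and H :: "((nat => int) => (nat => int)) set"
 assumes finH: "finite H"
  and comp: "\<alpha> \<in> H ==> \<beta> \<in> H ==> \<alpha> \<circ> \<beta> \<in> H"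
  and one: "\<exists>\<epsilon>\<in>H. \<forall>v\<in>vecs m. \<epsilon> v = v"
  and invs: "\<alpha> \<in> H ==> \<exists>\<beta>\<in>H. \<forall>v\<in>vecs m. \<beta> (\<alpha> v) = v \<and> \<alpha> (\<beta> v) = v"
  and outside: "\<alpha> \<in> H ==> v \<notin> vecs m ==> \<alpha> v = 0"
  and clos: "\<alpha> \<in> H ==> v \<in> vecs m ==> \<alpha> v \<in> vecs m"
  and addH: "\<alpha> \<in> H ==> v \<in> vecs m ==> w \<in> vecs m ==> \<alpha> (v + w) = \<alpha> v + \<alpha> w"
begin

abbreviation "V \<equiv> vecs m"

lemma lin: "\<alpha> \<in> H ==> additive_on m \<alpha>"
 by (unfold_locales) (rule addH)

definition invar :: "(nat => int) set => bool" where
 "invar M \<longleftrightarrow> subgrp M \<and> M \<subseteq> V \<and> (\<forall>\<alpha>\<in>H. \<forall>v\<in>M. \<alpha> v \<in> M)"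

lemma H_ne: "H \<noteq> {}" using one by blast

definition eqproj :: "(nat => int) => ((nat => int) => (nat => int)) => int => bool" where
 "eqproj g \<pi> t \<longleftrightarrow> t \<noteq> 0 \<and> additive_on m \<pi> \<and> (\<forall>v\<in>V. \<pi> v \<in> V) \<and> (\<forall>\<alpha>\<in>H. \<forall>v\<in>V. \<pi> (\<alpha> v) = \<alpha> (\<pi> v)) \<and>
  \<pi> g = of_int t * g \<and> (\<forall>U. subgrp U --> (\<forall>\<alpha>\<in>H. \<alpha> g \<in> U) --> (\<forall>v\<in>V. \<pi> v \<in> U))"

text \<open>Up to a nonzero factor \<open>t\<close>, there is an equivariant projection onto the submodule generated by \<open>g\<close>:
 solve for coordinates by Cramer's rule, then average over \<open>H\<close>.\<close>

lemma equivariant_projection: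
 assumes g: "g \<in> V" "g \<noteq> 0"
 shows "\<exists>\<pi> t. eqproj g \<pi> t"
proof -
 define Z :: "((nat => int) => (nat => int)) => nat => int" where "Z \<alpha> c = \<alpha> g c" for \<alpha> c
 obtain d f c where d: "d \<le> m" "\<forall>i<d. f i \<in> H" "\<forall>j<d. c j < m" "minor Z d f c \<noteq> 0"
  and van: "\<And>f c. (\<forall>i\<le>d. f i \<in> H) ==> (\<forall>j\<le>d. c j < m) ==> minor Z (Suc d) f c = 0"
  by (rule max_minor[of m H Z]) blast
 define \<delta> where "\<delta> = minor Z d f c"
 obtain B where B: "\<And>l i. l < d ==> i < d ==> (\<Sum>j<d. Z (f l) (c j) * B j i) = (if l = i then \<delta> else 0)"
 proof -
  have "\<exists>B. \<forall>l<d. \<forall>i<d. (\<Sum>j<d. Z (f l) (c j) * B j i) = (if l = i then \<delta> else 0)"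
   unfolding \<delta>_def minor_def by (rule adjugate)
  then show thesis using that by blast
 qed
 \<comment> \<open>On a translate of \<open>g\<close>, this is \<open>\<delta>\<close> times the
   coefficient at \<open>f i g\<close> in its expansion over the translates selected by the maximal
   minor.\<close>
 define lam where "lam i v = (\<Sum>j<d. v (c j) * B j i)" for i and v :: "nat => int"
 define \<pi>0 where "\<pi>0 v = (\<Sum>i<d. of_int (lam i v) * f i g)" for v
 have gV: "\<alpha> g \<in> V" if "\<alpha> \<in> H" for \<alpha> using clos that g by blast
 have lam_add: "lam i (v + w) = lam i v + lam i w" for i v w
  by (simp add: lam_def distrib_right sum.distrib)
 have \<pi>0_add: "\<pi>0 (v + w) = \<pi>0 v + \<pi>0 w" for v w
  by (simp add: \<pi>0_def lam_add distrib_right sum.distrib)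
 have \<pi>0g: "\<pi>0 (\<alpha> g) = of_int \<delta> * \<alpha> g" if \<alpha>: "\<alpha> \<in> H" for \<alpha>
 proof -
  obtain a where a: "\<forall>e<m. minor Z d f c * Z \<alpha> e = (\<Sum>i<d. a i * Z (f i) e)"
   using minor_cramer[where Z = Z and d = d and R = H and m = m and S = UNIV and r = \<alpha>, OF van d(2,3) is_subring_UNIV _ \<alpha>]
   by auto
  have ae: "\<delta> * \<alpha> g e = (\<Sum>i<d. a i * f i g e)" for e
  proof (cases "e < m")
   case True then show ?thesis using a by (simp add: Z_def \<delta>_def)
  next
   case False
   then have "\<alpha> g e = 0" "\<And>i. i < d ==> f i g e = 0" using gV \<alpha> d(2) by (auto simp: vecs_def)
   then show ?thesis by simp
  qed
  have "\<delta> * lam i (\<alpha> g) = \<delta> * a i" if i: "i < d" for i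
  proof -
   have "\<delta> * lam i (\<alpha> g) = (\<Sum>j<d. (\<delta> * \<alpha> g (c j)) * B j i)" by (simp add: lam_def sum_distrib_left mult.assoc)
   also have "... = (\<Sum>j<d. \<Sum>l<d. a l * (Z (f l) (c j) * B j i))"
    by (simp add: ae Z_def sum_distrib_right mult.assoc)
   also have "... = (\<Sum>l<d. a l * (\<Sum>j<d. Z (f l) (c j) * B j i))"
    by (subst sum.swap) (simp add: sum_distrib_left)
   also have "... = (\<Sum>l<d. if l = i then a i * \<delta> else 0)" by (rule sum.cong) (auto simp: B i)
   also have "... = \<delta> * a i" using i by simp
   finally show ?thesis .
  qed
  then have "lam i (\<alpha> g) = a i" if "i < d" for i using d(4) that by (simp add: \<delta>_def)
  then have "\<pi>0 (\<alpha> g) = (\<Sum>i<d. of_int (a i) * f i g)" by (simp add: \<pi>0_def)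
  also have "... = of_int \<delta> * \<alpha> g" by (rule ext) (simp add: sum_fun_apply of_int_fun_apply ae)
  finally show ?thesis .
 qed
 define iv where "iv \<alpha> = (SOME \<beta>. \<beta> \<in> H \<and> (\<forall>v\<in>V. \<beta> (\<alpha> v) = v \<and> \<alpha> (\<beta> v) = v))" for \<alpha>
 have iv: "iv \<alpha> \<in> H" "\<And>v. v \<in> V ==> iv \<alpha> (\<alpha> v) = v" "\<And>v. v \<in> V ==> \<alpha> (iv \<alpha> v) = v" if "\<alpha> \<in> H" for \<alpha>
 proof -
  have "\<exists>\<beta>. \<beta> \<in> H \<and> (\<forall>v\<in>V. \<beta> (\<alpha> v) = v \<and> \<alpha> (\<beta> v) = v)" using invs[OF that] by blast
  then have "iv \<alpha> \<in> H \<and> (\<forall>v\<in>V. iv \<alpha> (\<alpha> v) = v \<and> \<alpha> (iv \<alpha> v) = v)" unfolding iv_def by (rule someI_ex)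
  then show "iv \<alpha> \<in> H" "\<And>v. v \<in> V ==> iv \<alpha> (\<alpha> v) = v" "\<And>v. v \<in> V ==> \<alpha> (iv \<alpha> v) = v" by blast+
 qed
 \<comment> \<open>The sum of the conjugates of \<open>\<pi>0\<close> under \<open>H\<close>. There
   is no division by the order of \<open>H\<close>, which becomes part of the factor
   \<open>t\<close>.\<close>
 define \<pi> where "\<pi> v = (\<Sum>\<alpha>\<in>H. iv \<alpha> (\<pi>0 (\<alpha> v)))" for v
 have \<pi>0U: "\<pi>0 v \<in> U" if "subgrp U" "\<And>\<alpha>. \<alpha> \<in> H ==> \<alpha> g \<in> U" for U v
  unfolding \<pi>0_def using d(2) that by (intro subgrp_sum subgrp_scale) auto
 have \<pi>0V: "\<pi>0 v \<in> V" for v by (rule \<pi>0U[of V, OF subgrp_vecs]) (rule gV)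
 have \<pi>U: "\<pi> v \<in> U" if U: "subgrp U" "\<And>\<alpha>. \<alpha> \<in> H ==> \<alpha> g \<in> U" for U v
 proof -
  define U' where "U' = {x \<in> V. \<forall>\<alpha>\<in>H. \<alpha> x \<in> U}"
  have sU': "subgrp U'" unfolding subgrp_def
  proof (intro conjI ballI)
   have "\<alpha> 0 \<in> U" if \<alpha>: "\<alpha> \<in> H" for \<alpha>
    unfolding additive_on.zero[OF lin[OF \<alpha>]] by (rule subgrp_zero[OF U(1)])
   then show "0 \<in> U'" unfolding U'_def using subgrp_zero[OF subgrp_vecs] by blast
   fix x y assume "x \<in> U'" "y \<in> U'"
   then have xy: "x \<in> V" "y \<in> V" "\<And>\<alpha>. \<alpha> \<in> H ==> \<alpha> x \<in> U" "\<And>\<alpha>. \<alpha> \<in> H ==> \<alpha> y \<in> U" unfolding U'_def by blast+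
   have "\<alpha> (x - y) \<in> U" if \<alpha>: "\<alpha> \<in> H" for \<alpha>
    unfolding additive_on.diff[OF lin[OF \<alpha>] xy(1,2)] by (rule subgrp_diff[OF U(1) xy(3)[OF \<alpha>] xy(4)[OF \<alpha>]])
   then show "x - y \<in> U'" unfolding U'_def using subgrp_diff[OF subgrp_vecs xy(1,2)] by blast
  qed
  have gU': "\<alpha> g \<in> U'" if \<alpha>: "\<alpha> \<in> H" for \<alpha>
  proof -
   have "\<beta> (\<alpha> g) \<in> U" if \<beta>: "\<beta> \<in> H" for \<beta> using U(2)[OF comp[OF \<beta> \<alpha>]] by simp
   then show ?thesis using gV[OF \<alpha>] by (simp add: U'_def)
  qed
  have "\<pi>0 w \<in> U'" for w by (rule \<pi>0U[of U', OF sU']) (rule gU')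
  then have "iv \<alpha> (\<pi>0 (\<alpha> v)) \<in> U" if "\<alpha> \<in> H" for \<alpha> using iv(1)[OF that] by (simp add: U'_def)
  then show ?thesis unfolding \<pi>_def by (intro subgrp_sum[OF U(1)])
 qed
 have \<pi>V: "\<pi> v \<in> V" for v by (rule \<pi>U[of V, OF subgrp_vecs]) (rule gV)
 have add\<pi>: "additive_on m \<pi>"
 proof
  fix v w assume vw: "v \<in> V" "w \<in> V"
  have "iv \<alpha> (\<pi>0 (\<alpha> (v + w))) = iv \<alpha> (\<pi>0 (\<alpha> v)) + iv \<alpha> (\<pi>0 (\<alpha> w))" if "\<alpha> \<in> H" for \<alpha>
   using addH[OF that vw] addH[OF iv(1)[OF that] \<pi>0V \<pi>0V] by (simp add: \<pi>0_add)
  then show "\<pi> (v + w) = \<pi> v + \<pi> w" by (simp add: \<pi>_def sum.distrib)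
 qed
 have equi: "\<pi> (\<beta> v) = \<beta> (\<pi> v)" if \<beta>: "\<beta> \<in> H" and v: "v \<in> V" for \<beta> v
 proof -
  interpret \<beta>: additive_on m \<beta> by (rule lin[OF \<beta>])
  have inj: "inj_on (%\<alpha>. \<alpha> \<circ> \<beta>) H"
  proof (rule inj_onI, rule ext)
   fix \<alpha> \<alpha>' w assume a: "\<alpha> \<in> H" "\<alpha>' \<in> H" "\<alpha> \<circ> \<beta> = \<alpha>' \<circ> \<beta>"
   show "\<alpha> w = \<alpha>' w"
   proof (cases "w \<in> V")
    case True
    then have "\<alpha> (\<beta> (iv \<beta> w)) = \<alpha>' (\<beta> (iv \<beta> w))" using fun_cong[OF a(3), of "iv \<beta> w"] by simp
    then show ?thesis using iv(3)[OF \<beta> True] by simp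
   qed (simp add: outside a)
  qed
  have img: "(%\<alpha>. \<alpha> \<circ> \<beta>) ` H = H"
   by (rule endo_inj_surj[OF finH _ inj]) (use comp \<beta> in blast)
  have key: "iv \<alpha> y = \<beta> (iv (\<alpha> \<circ> \<beta>) y)" if \<alpha>: "\<alpha> \<in> H" and y: "y \<in> V" for \<alpha> y
  proof -
   define u where "u = iv (\<alpha> \<circ> \<beta>) y"
   have u: "u \<in> V" unfolding u_def using clos[OF iv(1)[OF comp[OF \<alpha> \<beta>]] y] .
   have "\<alpha> (\<beta> u) = y" using iv(3)[OF comp[OF \<alpha> \<beta>] y] by (simp add: u_def)
   then show ?thesis using iv(2)[OF \<alpha> clos[OF \<beta> u]] by (simp add: u_def)
  qed
  have e1: "\<pi> (\<beta> v) = (\<Sum>\<alpha>\<in>H. \<beta> (iv (\<alpha> \<circ> \<beta>) (\<pi>0 ((\<alpha> \<circ> \<beta>) v))))"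
   unfolding \<pi>_def by (rule sum.cong) (simp_all add: key \<pi>0V)
  define \<Theta> where "\<Theta> \<alpha> = \<beta> (iv \<alpha> (\<pi>0 (\<alpha> v)))" for \<alpha>
  have "sum \<Theta> H = sum (\<Theta> \<circ> (%\<alpha>. \<alpha> \<circ> \<beta>)) H"
   using sum.reindex[OF inj, of \<Theta>] by (simp only: img)
  then have e2: "sum \<Theta> H = (\<Sum>\<alpha>\<in>H. \<Theta> (\<alpha> \<circ> \<beta>))" by (simp only: comp_def[of \<Theta>])
  have "\<beta> (\<pi> v) = sum \<Theta> H"
   unfolding \<pi>_def \<Theta>_def
  proof (rule \<beta>.sum)
   fix \<alpha> assume "\<alpha> \<in> H"
   then show "iv \<alpha> (\<pi>0 (\<alpha> v)) \<in> V" by (rule clos[OF iv(1) \<pi>0V])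
  qed
  then show ?thesis using e1 e2 by (simp only: \<Theta>_def)
 qed
 have \<pi>g: "\<pi> g = of_int (int (card H) * \<delta>) * g"
 proof -
  have "iv \<alpha> (\<pi>0 (\<alpha> g)) = of_int \<delta> * g" if \<alpha>: "\<alpha> \<in> H" for \<alpha>
   by (simp only: \<pi>0g[OF \<alpha>] additive_on.scale[OF lin[OF iv(1)[OF \<alpha>]] gV[OF \<alpha>]] iv(2)[OF \<alpha> g(1)])
  then have "\<pi> g = (\<Sum>\<alpha>\<in>H. of_int \<delta> * g)" unfolding \<pi>_def by (intro sum.cong refl)
  then show ?thesis by (simp only: sum_constant of_int_mult of_int_of_nat_eq mult.assoc)
 qed
 have "eqproj g \<pi> (int (card H) * \<delta>)"
  unfolding eqproj_def
 proof (intro conjI ballI allI impI)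
  show "int (card H) * \<delta> \<noteq> 0" using finH H_ne d(4) by (simp add: \<delta>_def)
  show "additive_on m \<pi>" by (rule add\<pi>)
  show "\<pi> g = of_int (int (card H) * \<delta>) * g" by (rule \<pi>g)
  fix v assume v: "v \<in> V"
  show "\<pi> v \<in> V" by (rule \<pi>V)
  show "\<pi> (\<alpha> v) = \<alpha> (\<pi> v)" if "\<alpha> \<in> H" for \<alpha> by (rule equi[OF that v])
  show "\<pi> v \<in> U" if "subgrp U" "\<forall>\<alpha>\<in>H. \<alpha> g \<in> U" for U by (rule \<pi>U[OF that(1)]) (use that(2) in blast)
 qed
 then show ?thesis by blast
qed

section \<open>Ranks of vectors and the exponent\<close>

definition dot :: "(nat => complex) => (nat => int) => complex" where
 "dot w v = (\<Sum>i<m. w i * of_int (v i))"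

text \<open>The matrix with entries \<open>dot w (\<alpha> (unitv c))\<close> has rank less than
  \<open>d\<close>.\<close>

definition low :: "nat => (nat => complex) => bool" where
 "low d w \<longleftrightarrow> (\<forall>f c. (\<forall>i<d. f i \<in> H) --> (\<forall>j<d. c j < m) --> minor (%\<alpha> c. dot w (\<alpha> (unitv c))) d f c = 0)"

text \<open>The lattice elements that vectors of rank less than \<open>d\<close> cannot tell from 0,
  whatever finitely generated ring the vectors are taken from.\<close>

definition Sz :: "nat => (nat => int) set" where
 "Sz d = {g \<in> V. \<forall>Q w. fgring Q --> (\<forall>i<m. w i \<in> Q) --> low d w --> dot w g = 0}"

lemma Sz_top: "Sz (Suc m) \<subseteq> {0}"
proof
 fix g assume g: "g \<in> Sz (Suc m)"
 have "g i = 0" for i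
 proof (cases "i < m")
  case True
  define w :: "nat => complex" where "w c = (if c = i then 1 else 0)" for c
  have "low (Suc m) w" unfolding low_def by (auto intro!: minor_repeat_col[of m])
  moreover have "w c \<in> range of_int" for c unfolding w_def
   by (rule image_eqI[of _ _ "if c = i then 1 else 0"]) auto
  ultimately have "dot w g = 0" using g fgring_int unfolding Sz_def by blast
  also have "dot w g = (\<Sum>c<m. if c = i then of_int (g i) else 0)" unfolding dot_def w_def by (rule sum.cong) auto
  finally show ?thesis using True by simp
 next
  case False then show ?thesis using g by (auto simp: Sz_def vecs_def)
 qed
 then show "g \<in> {0}" by (auto simp: fun_eq_iff)
qed

text \<open>Mind the shift: \<open>low (Suc d)\<close> means rank at most \<open>d\<close>, so
  vectors of rank at most \<open>rdim\<close> separate points, while those of smaller rank do not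
  unless \<open>m = 0\<close>.\<close>

definition rdim :: nat where "rdim = (LEAST d. Sz (Suc d) \<subseteq> {0})"

lemma Sz_Suc_rdim: "Sz (Suc rdim) \<subseteq> {0}"
 unfolding rdim_def by (rule LeastI[of _ m]) (rule Sz_top)

lemma Sz_rdim: assumes "m > 0" shows "\<exists>g\<in>Sz rdim. g \<noteq> 0"
proof (cases rdim)
 case 0
 have "\<not> low 0 w" for w by (simp add: low_def minor_def)
 then have "unitv 0 \<in> Sz rdim" using unitv_in[OF assms] by (simp add: Sz_def 0)
 moreover have "unitv 0 \<noteq> 0" by (auto simp: unitv_def fun_eq_iff)
 ultimately show ?thesis by blast
next
 case (Suc d)
 have "\<not> Sz (Suc d) \<subseteq> {0}" using not_less_Least[of d "%d. Sz (Suc d) \<subseteq> {0}"] Suc unfolding rdim_def by simp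
 then show ?thesis unfolding Suc by blast
qed

lemma dot_expand:
 assumes \<alpha>: "\<alpha> \<in> H" and v: "v \<in> V"
 shows "dot w (\<alpha> v) = (\<Sum>c<m. of_int (v c) * dot w (\<alpha> (unitv c)))"
proof -
 have "dot w (\<alpha> v) = (\<Sum>i<m. \<Sum>c<m. of_int (v c) * (w i * of_int (\<alpha> (unitv c) i)))"
  unfolding dot_def additive_on.expand_apply[OF lin[OF \<alpha>] v] by (simp add: sum_distrib_left mult_ac)
 also have "... = (\<Sum>c<m. of_int (v c) * dot w (\<alpha> (unitv c)))"
  by (subst sum.swap) (simp add: dot_def sum_distrib_left)
 finally show ?thesis .
qed

lemma dot_diff: "dot w (a - b) = dot w a - dot w b"
 by (simp add: dot_def right_diff_distrib sum_subtractf)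

lemma prime_power_order:
 fixes l r :: int
 assumes "r > 0" "\<not> r dvd l"
 shows "\<exists>p e. is_prime p \<and> p ^ e dvd r \<and> \<not> p ^ e dvd l"
proof (rule ccontr)
 assume no: "\<nexists>p e. is_prime p \<and> p ^ e dvd r \<and> \<not> p ^ e dvd l"
 have l: "l \<noteq> 0" using assms by auto
 have "r dvd l"
 proof (rule multiplicity_le_imp_dvd)
  show "r \<noteq> 0" using assms by simp
  fix p :: int assume p: "is_prime p"
  have "p ^ multiplicity p r dvd r" by (rule multiplicity_dvd)
  then have "p ^ multiplicity p r dvd l" using no p by blast
  then show "multiplicity p r \<le> multiplicity p l"
   using p l by (intro multiplicity_geI) (auto simp: prime_elem_not_unit)
 qed
 then show False using assms by blast
qed

text \<open>The conclusion provides points incongruent modulo \<open>M\<close> instead of an index,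
  since such points can be carried directly to distinct cosets of a normal subgroup. The hypothesis
  on \<open>s\<close> expresses that \<open>g\<close> has finite order modulo
  \<open>M\<close>.\<close>

lemma lower:
 assumes m: "m > 0"
 obtains g N where "g \<in> V" "g \<noteq> 0" "N > (0::int)"
  "\<And>M s n. invar M ==> s > 0 ==> of_int s * g \<in> M ==> of_int (Lcm {1..int n}) * g \<notin> M ==>
   \<exists>E. finite E \<and> E \<subseteq> V \<and> (\<forall>a\<in>E. \<forall>b\<in>E. a - b \<in> M --> a = b) \<and> (real n / of_int N) ^ rdim \<le> real (card E)"
proof -
 obtain g where g: "g \<in> Sz rdim" "g \<noteq> 0" using Sz_rdim[OF m] by blast
 have gV: "g \<in> V" using g by (simp add: Sz_def)
 define k where "k = rdim"
 obtain \<pi> t where eq: "eqproj g \<pi> t" using equivariant_projection[OF gV g(2)] by blast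
 have t: "t \<noteq> 0" and \<pi>: "additive_on m \<pi>" "\<And>v. v \<in> V ==> \<pi> v \<in> V"
  "\<And>\<alpha> v. \<alpha> \<in> H ==> v \<in> V ==> \<pi> (\<alpha> v) = \<alpha> (\<pi> v)" and \<pi>g: "\<pi> g = of_int t * g"
  and \<pi>U: "\<And>U v. subgrp U ==> (\<forall>\<alpha>\<in>H. \<alpha> g \<in> U) ==> v \<in> V ==> \<pi> v \<in> U"
  using eq by (simp_all add: eqproj_def)
 define A where "A \<alpha> i c = \<alpha> (unitv c) i" for \<alpha> :: "(nat => int) => nat => int" and i c
 have "\<exists>N>0. \<forall>(p::int) e W. is_prime p --> p ^ e dvd (\<Sum>i<m. W i * g i) - t -->
  (\<exists>f c. (\<forall>i<k. f i \<in> H) \<and> (\<forall>j<k. c j < m) \<and> gcd (minor (%\<alpha> c. \<Sum>i<m. W i * A \<alpha> i c) k f c) (p ^ e) dvd N)"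
 proof (rule nullstellensatz[OF H_ne m t])
  fix Q w assume Q: "fgring Q" "\<forall>i<m. w i \<in> Q"
   and van: "\<And>f c. \<forall>i<k. f i \<in> H ==> \<forall>j<k. c j < m ==> minor (%\<alpha> c. \<Sum>i<m. w i * of_int (A \<alpha> i c)) k f c = 0"
  have "low k w" unfolding low_def dot_def using van unfolding A_def by blast
  then show "(\<Sum>i<m. w i * of_int (g i)) = 0" using g(1) Q unfolding Sz_def k_def dot_def by blast
 qed
 then obtain N where N: "N > 0" and NS: "\<And>(p::int) e W. is_prime p ==> p ^ e dvd (\<Sum>i<m. W i * g i) - t ==>
  \<exists>f c. (\<forall>i<k. f i \<in> H) \<and> (\<forall>j<k. c j < m) \<and> gcd (minor (%\<alpha> c. \<Sum>i<m. W i * A \<alpha> i c) k f c) (p ^ e) dvd N"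
  by blast
 have "\<exists>E. finite E \<and> E \<subseteq> V \<and> (\<forall>a\<in>E. \<forall>b\<in>E. a - b \<in> M --> a = b) \<and> (real n / of_int N) ^ k \<le> real (card E)"
  if M: "invar M" and s: "s > 0" "of_int s * g \<in> M" and l: "of_int (Lcm {1..int n}) * g \<notin> M" for M s n
 proof -
  have sM: "subgrp M" "M \<subseteq> V" and HM: "\<And>\<alpha> v. \<alpha> \<in> H ==> v \<in> M ==> \<alpha> v \<in> M" using M by (auto simp: invar_def)
  define I where "I j \<longleftrightarrow> j > 0 \<and> of_nat j * g \<in> M" for j
  have "I (nat s)" using s by (simp add: I_def)
  then have LI: "I (Least I)" by (rule LeastI)
  define r where "r = int (Least I)"
  have r: "r > 0" "of_int r * g \<in> M" using LI by (auto simp: I_def r_def)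
  have ord: "of_int j * g \<in> M \<longleftrightarrow> r dvd j" for j
  proof
   assume j: "of_int j * g \<in> M"
   show "r dvd j"
   proof (rule ccontr)
    assume nd: "\<not> r dvd j"
    have "of_int (j mod r) * g = of_int j * g - of_int (j div r) * (of_int r * g)"
     by (simp only: minus_mult_div_eq_mod[symmetric] of_int_diff of_int_mult) (simp add: algebra_simps)
    then have "of_int (j mod r) * g \<in> M" using subgrp_diff[OF sM(1) j subgrp_scale[OF sM(1) r(2)]] by simp
    moreover have jr: "j mod r > 0" using nd r(1) pos_mod_sign[OF r(1), of j] by (auto simp: dvd_eq_mod_eq_0)
    ultimately have "I (nat (j mod r))" by (simp add: I_def)
    then have "Least I \<le> nat (j mod r)" by (rule Least_le)
    then have "int (Least I) \<le> j mod r" by (simp only: le_nat_iff[OF less_imp_le[OF jr]])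
    then have "r \<le> j mod r" by (simp only: r_def[symmetric])
    then show False using pos_mod_bound[OF r(1), of j] by simp
   qed
  next
   assume "r dvd j"
   then obtain j' where "j = j' * r" by (metis dvd_def mult.commute)
   then show "of_int j * g \<in> M" using subgrp_scale[OF sM(1) r(2), of j'] by (simp add: mult.assoc)
  qed
  have "\<not> r dvd Lcm {1..int n}" using l ord by blast
  \<comment> \<open>The order \<open>r\<close> of \<open>g\<close> modulo \<open>M\<close> does not
    divide \<open>lcm(1..n)\<close>, so it has a prime power divisor \<open>q\<close>, necessarily
    larger than \<open>n\<close>.\<close>
  then obtain p e where p: "is_prime p" "p ^ e dvd r" "\<not> p ^ e dvd Lcm {1..int n}"
   using prime_power_order[OF r(1)] by blast
  define q where "q = p ^ e"
  have q0: "q > 0" using p(1) by (simp add: q_def prime_gt_0_int)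
  have qn: "q > int n"
  proof (rule ccontr)
   assume "\<not> q > int n"
   then have "q dvd Lcm {1..int n}" using q0 by (intro dvd_Lcm) simp
   then show False using p(3) by (simp add: q_def)
  qed
  have "of_int r * x \<in> M" if x: "x \<in> (%\<alpha>. \<alpha> g) ` H" for x
  proof -
   obtain \<alpha> where \<alpha>: "\<alpha> \<in> H" "x = \<alpha> g" using x by blast
   then show ?thesis using HM[OF \<alpha>(1) r(2)] additive_on.scale[OF lin[OF \<alpha>(1)] gV] by simp
  qed
  \<comment> \<open>A character of exponent \<open>r\<close>, trivial on \<open>M\<close>, defined
    on a subgroup that contains the orbit of \<open>g\<close>, and with value 1 at \<open>g\<close>.
    Composed with \<open>\<pi>\<close>, whose image lies in that subgroup, it is defined on all of
    \<open>V\<close>; \<open>W\<close> lists its values at the unit vectors.\<close>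
  then obtain U W1 where W1: "charac r M U W1" "g \<in> U" "(%\<alpha>. \<alpha> g) ` H \<subseteq> U" "r dvd W1 g - 1"
   using character_exists[OF sM(1) ord r(1), of "(%\<alpha>. \<alpha> g) ` H"] finH by blast
  note DU = characD[OF W1(1)]
  have \<pi>inU: "\<pi> v \<in> U" if v: "v \<in> V" for v
   by (rule \<pi>U[OF DU(1) _ v]) (use W1(3) in blast)
  define W where "W i = W1 (\<pi> (unitv i))" for i
  have W: "r dvd W1 (\<pi> v) - (\<Sum>i<m. W i * v i)" if v: "v \<in> V" for v
  proof -
   have "r dvd W1 (\<Sum>i<m. of_int (v i) * \<pi> (unitv i)) - (\<Sum>i<m. v i * W1 (\<pi> (unitv i)))"
    by (rule charac_sum[OF W1(1)]) (intro \<pi>inU unitv_in, simp)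
   then show ?thesis unfolding additive_on.expand[OF \<pi>(1) v] W_def by (simp add: mult.commute)
  qed
  \<comment> \<open>As \<open>\<pi> g\<close> is \<open>t\<close> times \<open>g\<close>, the vector
    \<open>W\<close> takes the value \<open>t\<close> at \<open>g\<close> modulo \<open>r\<close>, a
    fixed nonzero integer. This is the hypothesis of the Nullstellensatz modulo
    \<open>q\<close>.\<close>
  have "r dvd (\<Sum>i<m. W i * g i) - t"
  proof -
   have 1: "r dvd W1 (of_int t * g) - (\<Sum>i<m. W i * g i)" using W[OF gV] by (simp add: \<pi>g)
   have 2: "r dvd W1 (of_int t * g) - t * W1 g" by (rule charac_scale[OF W1(1,2)])
   have 3: "r dvd t * (W1 g - 1)" using W1(4) by simp
   from dvd_add[OF dvd_diff[OF 2 1] 3] show ?thesis by (simp add: algebra_simps)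
  qed
  then have "p ^ e dvd (\<Sum>i<m. W i * g i) - t" using p(2) dvd_trans by blast
  from NS[OF p(1) this] obtain f c where f: "\<forall>i<k. f i \<in> H" and c: "\<forall>j<k. c j < m"
   and gN: "gcd (minor (%\<alpha> c. \<Sum>i<m. W i * A \<alpha> i c) k f c) q dvd N"
   unfolding q_def by blast
  define Z where "Z \<alpha> c = (\<Sum>i<m. W i * A \<alpha> i c)" for \<alpha> c
  define \<delta> where "\<delta> = minor Z k f c"
  have gN: "gcd \<delta> q dvd N" using gN unfolding \<delta>_def Z_def by simp
  \<comment> \<open>Modulo \<open>q'\<close> the cofactor \<open>\<delta> div gcd \<delta> q\<close>
    is invertible. As the gcd divides \<open>N\<close>, still \<open>q' \<ge> n / N\<close>.\<close>
  define q' where "q' = q div gcd \<delta> q"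
  have g0: "gcd \<delta> q > 0" using q0 by simp
  have qq': "q = q' * gcd \<delta> q" by (simp add: q'_def)
  have q'0: "q' > 0" using q0 g0 qq' by (metis zero_less_mult_pos2)
  have q'n: "real n / of_int N \<le> real (nat q')"
  proof -
   have "gcd \<delta> q \<le> N" using gN N by (rule zdvd_imp_le)
   then have "q \<le> q' * N" using qq' q'0 by (metis mult_left_mono less_imp_le)
   then have "int n \<le> q' * N" using qn by simp
   then have "real n \<le> of_int q' * of_int N" by (metis of_int_le_iff of_int_mult of_int_of_nat_eq)
   then show ?thesis using N q'0 by (simp add: field_simps)
  qed
  obtain B where B: "\<And>l i. l < k ==> i < k ==> (\<Sum>j<k. Z (f l) (c j) * B j i) = (if l = i then \<delta> else 0)"
  proof -
   have "\<exists>B. \<forall>l<k. \<forall>i<k. (\<Sum>j<k. Z (f l) (c j) * B j i) = (if l = i then \<delta> else 0)"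
    unfolding \<delta>_def minor_def by (rule adjugate)
   then show thesis using that by blast
  qed
  \<comment> \<open>With the adjugate \<open>B\<close> inserted, \<open>W\<close> applied to
    \<open>f l (a x)\<close> gives \<open>\<delta> * x l\<close>. If \<open>\<pi> (a x)\<close> and
    \<open>\<pi> (a y)\<close> are congruent modulo \<open>M\<close>, these values agree modulo
    \<open>q\<close>, hence \<open>x\<close> and \<open>y\<close> modulo \<open>q'\<close>: each of
    the \<open>k\<close> coordinates contributes a factor \<open>q'\<close>.\<close>
  define a where "a x = (\<Sum>j<k. of_int (\<Sum>i<k. B j i * x i) * unitv (c j))" for x :: "nat => int"
  have aV: "a x \<in> V" for x unfolding a_def using c by (intro subgrp_sum[OF subgrp_vecs] subgrp_scale[OF subgrp_vecs] unitv_in) auto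
  have a_diff: "a x - a y = a (%i. x i - y i)" for x y
   unfolding a_def by (simp add: right_diff_distrib sum_subtractf left_diff_distrib)
  define X' where "X' = {..<k} \<rightarrow>\<^sub>E {0..<q'}"
  have sep: "x = y" if xy: "x \<in> X'" "y \<in> X'" and M: "\<pi> (a x) - \<pi> (a y) \<in> M" for x y
  proof -
   define z where "z i = x i - y i" for i
   have zM: "\<pi> (a z) \<in> M" using M additive_on.diff[OF \<pi>(1) aV aV, of x y] a_diff[of x y] by (simp add: z_def[abs_def])
   have "q' dvd z l" if l: "l < k" for l
   proof -
    have fl: "f l \<in> H" using f l by blast
    have "r dvd W1 (\<pi> (f l (a z)))" using DU(4)[OF HM[OF fl zM]] \<pi>(3)[OF fl aV] by simp
    from dvd_diff[OF this W[OF clos[OF fl aV[of z]]]] have "r dvd (\<Sum>i<m. W i * f l (a z) i)" by simp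
    also have "(\<Sum>i<m. W i * f l (a z) i) = (\<Sum>i<m. W i * (\<Sum>j<k. (\<Sum>h<k. B j h * z h) * A (f l) i (c j)))"
    proof (rule sum.cong[OF refl])
     fix i
     have "f l (a z) = (\<Sum>j<k. of_int (\<Sum>i<k. B j i * z i) * f l (unitv (c j)))"
      unfolding a_def using c by (intro additive_on.lincomb[OF lin[OF fl]] unitv_in) auto
     then show "W i * f l (a z) i = W i * (\<Sum>j<k. (\<Sum>h<k. B j h * z h) * A (f l) i (c j))"
      by (simp only: sum_fun_apply times_fun_def of_int_fun_apply A_def of_int_eq_id id_apply)
    qed
    also have "... = (\<Sum>i<m. \<Sum>j<k. (\<Sum>h<k. B j h * z h) * (W i * A (f l) i (c j)))"
     by (simp only: sum_distrib_left mult_ac)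
    also have "... = (\<Sum>j<k. (\<Sum>h<k. B j h * z h) * Z (f l) (c j))"
     by (subst sum.swap) (simp only: Z_def sum_distrib_left)
    also have "... = (\<Sum>j<k. \<Sum>h<k. z h * (Z (f l) (c j) * B j h))"
     by (intro sum.cong refl) (simp add: sum_distrib_left sum_distrib_right mult_ac)
    also have "... = (\<Sum>h<k. z h * (\<Sum>j<k. Z (f l) (c j) * B j h))"
     by (subst sum.swap) (simp only: sum_distrib_left)
    also have "... = (\<Sum>h<k. if h = l then z l * \<delta> else 0)" by (rule sum.cong) (auto simp: B l)
    also have "... = z l * \<delta>" using l by simp
    finally have "q dvd z l * \<delta>" using p(2) dvd_trans unfolding q_def by blast
    then have "q' * gcd \<delta> q dvd z l * (\<delta> div gcd \<delta> q) * gcd \<delta> q" by (simp add: qq'[symmetric] mult.assoc)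
    then have "q' dvd z l * (\<delta> div gcd \<delta> q)" using q0 by auto
    moreover have "coprime q' (\<delta> div gcd \<delta> q)"
     unfolding q'_def using div_gcd_coprime[of \<delta> q] q0 by (simp add: coprime_commute)
    ultimately show ?thesis by (simp add: coprime_dvd_mult_left_iff)
   qed
   moreover have "\<bar>z l\<bar> < q'" if "l < k" for l
   proof -
    have "x l \<in> {0..<q'}" by (rule PiE_mem[of x "{..<k}" "%_. {0..<q'}"]) (use xy that in \<open>simp_all add: X'_def\<close>)
    moreover have "y l \<in> {0..<q'}" by (rule PiE_mem[of y "{..<k}" "%_. {0..<q'}"]) (use xy that in \<open>simp_all add: X'_def\<close>)
    ultimately show ?thesis by (auto simp: z_def)
   qed
   ultimately have "z l = 0" if "l < k" for l
    using that by (metis abs_of_pos dvd_imp_le_int linorder_not_less q'0)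
   then show "x = y" using xy unfolding X'_def by (intro PiE_ext[of x _ _ y]) (auto simp: z_def)
  qed
  define E where "E = (%x. \<pi> (a x)) ` X'"
  have fX: "finite X'" unfolding X'_def by (rule finite_PiE) auto
  have inj: "inj_on (%x. \<pi> (a x)) X'" by (rule inj_onI) (rule sep, simp_all add: subgrp_zero[OF sM(1)])
  have "card E = nat q' ^ k" unfolding E_def card_image[OF inj] unfolding X'_def by (simp add: card_PiE)
  then have "(real n / of_int N) ^ k \<le> real (card E)"
   using power_mono[OF q'n, of k] N by simp
  moreover have "E \<subseteq> V" unfolding E_def using \<pi>(2) aV by auto
  moreover have "\<forall>a\<in>E. \<forall>b\<in>E. a - b \<in> M --> a = b" unfolding E_def using sep by auto
  ultimately show ?thesis using fX by (intro exI[of _ E]) (simp add: E_def)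
 qed
 then show thesis using that[OF gV g(2) N] unfolding k_def by blast
qed


text \<open>\<open>F\<close> labels the lattice by lists of residue classes; its fibres lie in
  cosets of \<open>M\<close>, so \<open>M\<close> has index at most \<open>B\<close>. Labels are
  used instead of the index because they combine easily with cosets in the group.\<close>

definition separable :: "(nat => int) => real => bool" where
 "separable g B \<longleftrightarrow> (\<exists>M (F :: (nat => int) => complex set list). invar M \<and> g \<notin> M \<and>
  (\<forall>a\<in>V. \<forall>b\<in>V. F a = F b --> a - b \<in> M) \<and> finite (F ` V) \<and> real (card (F ` V)) \<le> B)"

lemma separable_mono: "separable g B ==> B \<le> B' ==> separable g B'"
 unfolding separable_def by (meson order_trans)

text \<open>\<open>M\<close> consists of the vectors all of whose translates \<open>w\<close> sends
  into \<open>P\<close>. By Cramer's rule, a nonzero minor \<open>\<delta>\<close> of maximal size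
  \<open>d\<close> times any value \<open>dot w (\<alpha> a)\<close> is a combination of
  \<open>d\<close> fixed such values. If \<open>\<delta>\<close>, taken as \<open>z0\<close>, is
  outside \<open>P\<close>, the residues of these \<open>d\<close> values determine the class modulo
  \<open>M\<close>.\<close>

lemma separable_at_prime:
 assumes ring: "nring Q b n" and w: "\<And>i. i < m ==> w i \<in> Q" and lw: "low (Suc rdim) w"
 shows "\<exists>z0. z0 \<in> Q \<and> z0 \<noteq> 0 \<and> (\<forall>g\<in>V. \<forall>P. nring.maxid Q P --> dot w g * z0 \<notin> P -->
  separable g (real (idx Q P) ^ rdim))"
proof -
 interpret N: nring Q b n by (rule ring)
 define Z where "Z \<alpha> c = dot w (\<alpha> (unitv c))" for \<alpha> :: "(nat => int) => nat => int" and c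
 define d where "d = (LEAST d. low (Suc d) w)"
 have lowd: "low (Suc d) w" unfolding d_def by (rule LeastI[of _ rdim]) (rule lw)
 have dr: "d \<le> rdim" unfolding d_def by (rule Least_le) (rule lw)
 have "\<not> low d w"
 proof (cases d)
  case 0 show ?thesis by (simp add: 0 low_def minor_def)
 next
  case (Suc d') then show ?thesis using not_less_Least[of d' "%d. low (Suc d) w"] by (simp add: d_def)
 qed
 then obtain f c where f: "\<forall>i<d. f i \<in> H" and c: "\<forall>j<d. c j < m" and nz: "minor Z d f c \<noteq> 0"
  unfolding low_def Z_def[abs_def] by blast
 define \<delta> where "\<delta> = minor Z d f c"
 have van: "minor Z (Suc d) f c = 0" if "\<forall>i\<le>d. f i \<in> H" "\<forall>j\<le>d. c j < m" for f c
  using lowd that unfolding low_def Z_def[abs_def] less_Suc_eq_le by blast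
 have dotQ: "dot w v \<in> Q" for v
  unfolding dot_def by (intro N.sum_in N.mult w N.of_int_in) simp
 then have ZQ: "Z \<alpha> c \<in> Q" for \<alpha> c by (simp add: Z_def)
 have \<delta>Q: "\<delta> \<in> Q" unfolding \<delta>_def minor_def by (rule det_in_subring[OF N.is_subring_R]) (auto simp: ZQ)
 have cramer: "\<exists>a. (\<forall>i<d. a i \<in> Q) \<and> (\<forall>e<m. \<delta> * Z \<alpha> e = (\<Sum>i<d. a i * Z (f i) e))" if "\<alpha> \<in> H" for \<alpha>
  unfolding \<delta>_def by (rule minor_cramer[where R = H, OF van f c N.is_subring_R ZQ that])
 have "separable g (real (idx Q P) ^ rdim)" if g: "g \<in> V" and P: "N.maxid P" and gP: "dot w g * \<delta> \<notin> P" for g P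
 proof -
  note PD = N.maxidD[OF P]
  define M where "M = {a \<in> V. \<forall>\<alpha>\<in>H. dot w (\<alpha> a) \<in> P}"
  define F where "F a = map (%i. (+) (dot w (f i a)) ` P) [0..<d]" for a
  have \<delta>P: "\<delta> \<notin> P"
  proof
   assume "\<delta> \<in> P"
   then have "dot w g * \<delta> \<in> P" by (rule N.idealD(3)[OF PD(1) dotQ])
   then show False using gP by blast
  qed
  have sM: "subgrp M" unfolding subgrp_def
  proof (intro conjI ballI)
   have "dot w (\<alpha> 0) \<in> P" if \<alpha>: "\<alpha> \<in> H" for \<alpha>
    unfolding additive_on.zero[OF lin[OF \<alpha>]] using subgrp_zero[OF PD(2)] by (simp add: dot_def)
   then show "0 \<in> M" unfolding M_def using subgrp_zero[OF subgrp_vecs] by blast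
   fix x y assume "x \<in> M" "y \<in> M"
   then have xy: "x \<in> V" "y \<in> V" "\<And>\<alpha>. \<alpha> \<in> H ==> dot w (\<alpha> x) \<in> P" "\<And>\<alpha>. \<alpha> \<in> H ==> dot w (\<alpha> y) \<in> P"
    unfolding M_def by blast+
   have "dot w (\<alpha> (x - y)) \<in> P" if \<alpha>: "\<alpha> \<in> H" for \<alpha>
    unfolding additive_on.diff[OF lin[OF \<alpha>] xy(1,2)] dot_diff
    by (rule subgrp_diff[OF PD(2) xy(3)[OF \<alpha>] xy(4)[OF \<alpha>]])
   then show "x - y \<in> M" unfolding M_def using subgrp_diff[OF subgrp_vecs xy(1,2)] by blast
  qed
  have inv: "\<alpha> v \<in> M" if \<alpha>: "\<alpha> \<in> H" and v: "v \<in> M" for \<alpha> v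
  proof -
   have vV: "v \<in> V" and vP: "\<And>\<beta>. \<beta> \<in> H ==> dot w (\<beta> v) \<in> P" using v unfolding M_def by blast+
   have "dot w (\<beta> (\<alpha> v)) \<in> P" if \<beta>: "\<beta> \<in> H" for \<beta> using vP[OF comp[OF \<beta> \<alpha>]] by simp
   then show ?thesis unfolding M_def using clos[OF \<alpha> vV] by blast
  qed
  have iM: "invar M" unfolding invar_def using sM inv by (auto simp: M_def)
  have gM: "g \<notin> M"
  proof
   assume gM: "g \<in> M"
   obtain \<epsilon> where e: "\<epsilon> \<in> H" "\<forall>v\<in>V. \<epsilon> v = v" using one by blast
   then have "dot w g \<in> P" using gM g unfolding M_def by force
   then have "\<delta> * dot w g \<in> P" by (rule N.idealD(3)[OF PD(1) \<delta>Q])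
   then show False using gP by (simp add: mult.commute)
  qed
  have FM: "x - y \<in> M" if xy: "x \<in> V" "y \<in> V" and eq: "F x = F y" for x y
  proof -
   define u where "u = x - y"
   have uV: "u \<in> V" unfolding u_def by (rule subgrp_diff[OF subgrp_vecs xy])
   have fu: "dot w (f i u) \<in> P" if i: "i < d" for i
   proof -
    have fi: "f i \<in> H" using f i by blast
    have "(+) (dot w (f i x)) ` P = (+) (dot w (f i y)) ` P"
     using arg_cong[OF eq, of "%l. l ! i"] i by (simp add: F_def)
    then have "dot w (f i x) - dot w (f i y) \<in> P" by (simp only: coset_eq_iff[OF PD(2)])
    then show ?thesis unfolding u_def additive_on.diff[OF lin[OF fi] xy] dot_diff .
   qed
   have "dot w (\<alpha> u) \<in> P" if \<alpha>: "\<alpha> \<in> H" for \<alpha>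
   proof -
    obtain a where a: "\<forall>i<d. a i \<in> Q" "\<forall>e<m. \<delta> * Z \<alpha> e = (\<Sum>i<d. a i * Z (f i) e)" using cramer[OF \<alpha>] by blast
    have "\<delta> * dot w (\<alpha> u) = (\<Sum>e<m. of_int (u e) * (\<delta> * Z \<alpha> e))"
     unfolding dot_expand[OF \<alpha> uV] Z_def by (simp add: sum_distrib_left mult_ac)
    also have "... = (\<Sum>e<m. \<Sum>i<d. a i * (of_int (u e) * Z (f i) e))"
     using a(2) by (intro sum.cong refl) (simp add: sum_distrib_left mult_ac)
    also have "... = (\<Sum>i<d. a i * (\<Sum>e<m. of_int (u e) * Z (f i) e))"
     by (subst sum.swap) (simp only: sum_distrib_left)
    also have "... = (\<Sum>i<d. a i * dot w (f i u))"
    proof (rule sum.cong[OF refl])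
     fix i assume "i \<in> {..<d}"
     then have "f i \<in> H" using f by blast
     then show "a i * (\<Sum>e<m. of_int (u e) * Z (f i) e) = a i * dot w (f i u)"
      by (simp only: dot_expand[OF _ uV] Z_def)
    qed
    also have "... \<in> P" by (rule subgrp_sum[OF PD(2)]) (rule N.idealD(3)[OF PD(1)], use a(1) fu in simp_all)
    finally show ?thesis by (rule N.maxid_prime[OF P \<delta>Q \<delta>P dotQ])
   qed
   then show ?thesis unfolding M_def u_def[symmetric] using uV by blast
  qed
  have Fsub: "F ` V \<subseteq> {xs. set xs \<subseteq> cosets Q P \<and> length xs = d}"
   unfolding F_def cosets_def using dotQ by auto
  have fin: "finite {xs. set xs \<subseteq> cosets Q P \<and> length xs = d}" by (rule finite_lists_length_eq[OF PD(4)])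
  have "card (F ` V) \<le> idx Q P ^ d"
   using card_mono[OF fin Fsub] card_lists_length_eq[OF PD(4), of d] by (simp add: idx_def)
  also have "... \<le> idx Q P ^ rdim"
   using N.idx_maxid[OF P] dr by (intro power_increasing) auto
  finally have "real (card (F ` V)) \<le> real (idx Q P) ^ rdim" by (simp only: of_nat_power[symmetric] of_nat_le_iff)
  then show ?thesis unfolding separable_def using iM gM FM finite_subset[OF Fsub fin] by blast
 qed
 then show ?thesis using \<delta>Q nz by (intro exI[of _ \<delta>]) (simp add: \<delta>_def)
qed

text \<open>If \<open>z\<close> lay in a chosen ideal above each degree-one prime up to
  \<open>x\<close>, the product of these primes would be at most the index of \<open>z\<close>,
  whose logarithm is \<open>O(ln Y)\<close>. The Chebyshev estimate makes the logarithm of the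
  product at least \<open>c * x\<close>, which is too much already for some \<open>x\<close> of
  order \<open>ln Y\<close>.\<close>

lemma prime_avoiding:
 assumes ring: "nring Q b n"
 shows "\<exists>C>0. \<forall>Y\<ge>2. \<forall>z. nring.bx Q b n (K * Y) z --> z \<noteq> 0 -->
  (\<exists>P. nring.maxid Q P \<and> z \<notin> P \<and> real (idx Q P) \<le> C * ln Y)"
proof -
 interpret N: nring Q b n by (rule ring)
 obtain c N0 where c: "c > 0" and cheb: "\<And>x. x \<ge> N0 ==> (\<Sum>p\<in>{p. p \<le> x \<and> N.deg_one_prime p}. ln (real p)) \<ge> c * real x"
  using N.chebyshev_deg_one by blast
 define L where "L = 2 * (real n * (N.kc * \<bar>K\<bar>)) + 2"
 have L: "L \<ge> 2" using N.kc_ge by (simp add: L_def)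
 define C1 where "C1 = real n * (ln L / ln 2 + 1)"
 have C1: "C1 \<ge> 0" using L by (simp add: C1_def)
 \<comment> \<open>\<open>C1 / c\<close> is the genuine constant; the first summand absorbs the
   threshold \<open>N0\<close> and the rounding of \<open>x\<close>, using
   \<open>ln Y \<ge> ln 2\<close>.\<close>
 define C where "C = (real N0 + 2) / ln 2 + C1 / c"
 have C: "C > 0" using c C1 by (simp add: C_def add_pos_nonneg)
 have "\<exists>P. N.maxid P \<and> z \<notin> P \<and> real (idx Q P) \<le> C * ln Y" if Y: "Y \<ge> 2" and z: "N.bx (K * Y) z" "z \<noteq> 0" for Y z
 proof (rule ccontr)
  assume no: "\<nexists>P. N.maxid P \<and> z \<notin> P \<and> real (idx Q P) \<le> C * ln Y"
  have zQ: "z \<in> Q" using N.bx_in[OF z(1)] .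
  have lnX: "ln Y \<ge> ln 2" "ln Y > 0" using Y by simp_all
  have KX: "K * Y \<le> \<bar>K\<bar> * Y" using Y by (intro mult_right_mono) auto
  have "N.bx (\<bar>K\<bar> * Y) z" by (rule N.bx_mono[OF z(1) KX])
  note fin = N.idx_mul_le(1)[OF z(2) this] and ub = N.idx_mul_le(2)[OF z(2) this]
  have "2 * (real n * (N.kc * (\<bar>K\<bar> * Y))) + 1 \<le> L * Y"
   using Y by (simp add: L_def distrib_right mult.assoc)
  then have "real (idx Q (N.mul z)) \<le> (L * Y) ^ n"
   using ub power_mono[of "2 * (real n * (N.kc * (\<bar>K\<bar> * Y))) + 1" "L * Y" n] N.kc_ge Y by simp
  moreover have idx0: "idx Q (N.mul z) > 0"
  proof -
   have "cosets Q (N.mul z) \<noteq> {}" using zQ by (auto simp: cosets_def)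
   then show ?thesis using fin by (simp add: idx_def card_gt_0_iff)
  qed
  ultimately have "ln (real (idx Q (N.mul z))) \<le> ln ((L * Y) ^ n)" by (intro ln_mono) simp_all
  also have "... = real n * (ln L + ln Y)" using L Y by (simp add: ln_realpow ln_mult)
  also have "... \<le> C1 * ln Y"
  proof -
   have "ln L = (ln L / ln 2) * ln 2" by simp
   also have "... \<le> (ln L / ln 2) * ln Y" using L lnX by (intro mult_left_mono) simp_all
   finally have "ln L + ln Y \<le> (ln L / ln 2 + 1) * ln Y" by (simp add: distrib_right)
   then have "real n * (ln L + ln Y) \<le> real n * ((ln L / ln 2 + 1) * ln Y)" by (rule mult_left_mono) simp
   then show ?thesis by (simp add: C1_def mult.assoc)
  qed
  finally have lnidx: "ln (real (idx Q (N.mul z))) \<le> C1 * ln Y" .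
  define x where "x = N0 + nat \<lceil>C1 * ln Y / c\<rceil> + 1"
  have q0: "C1 * ln Y / c \<ge> 0" using C1 c lnX by simp
  have xr: "real x = real N0 + of_int \<lceil>C1 * ln Y / c\<rceil> + 1" using q0 by (simp add: x_def)
  have xb: "real x > C1 * ln Y / c" "real x \<le> real N0 + 2 + C1 * ln Y / c"
   unfolding xr using ceiling_correct[of "C1 * ln Y / c"] by linarith+
  have xC: "real x \<le> C * ln Y"
  proof -
   have "real N0 + 2 = (real N0 + 2) / ln 2 * ln 2" by simp
   also have "... \<le> (real N0 + 2) / ln 2 * ln Y" using lnX by (intro mult_left_mono) simp_all
   finally show ?thesis using xb(2) by (simp add: C_def distrib_right)
  qed
  define S where "S = {p. p \<le> x \<and> N.deg_one_prime p}"
  have fS: "finite S" unfolding S_def by simp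
  have "\<forall>p\<in>S. \<exists>P. N.maxid P \<and> N.ch P = p \<and> idx Q P = p" unfolding S_def N.deg_one_prime_def by blast
  then obtain PP where PP: "\<And>p. p \<in> S ==> N.maxid (PP p)" "\<And>p. p \<in> S ==> N.ch (PP p) = p" "\<And>p. p \<in> S ==> idx Q (PP p) = p"
   by metis
  have inj: "inj_on PP S" using PP(2) by (metis inj_onI)
  have zP: "z \<in> PP p" if p: "p \<in> S" for p
  proof -
   have "real p \<le> C * ln Y" using p xC by (simp add: S_def)
   then show ?thesis using no PP(1,3)[OF p] by force
  qed
  have "(\<Prod>P\<in>PP ` S. idx Q P) \<le> idx Q (N.mul z)"
  proof (rule N.prod_maxid_le)
   show "finite (PP ` S)" using fS by simp
   show "N.ideal (N.mul z)" by (rule N.ideal_mul[OF zQ])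
   show "finite (cosets Q (N.mul z))" by (rule fin)
   fix P assume "P \<in> PP ` S"
   then obtain p where p: "p \<in> S" "P = PP p" by blast
   have "N.mul z \<subseteq> P"
    unfolding N.mul_def p(2) using N.idealD(4)[OF N.maxidD(1)[OF PP(1)[OF p(1)]] _ zP[OF p(1)]] by blast
   then show "N.maxid P \<and> N.mul z \<subseteq> P" using PP(1)[OF p(1)] p(2) by simp
  qed
  then have le: "(\<Prod>p\<in>S. p) \<le> idx Q (N.mul z)" by (simp add: prod.reindex[OF inj] PP(3))
  have pos: "p > 0" if "p \<in> S" for p using that by (auto simp: S_def N.deg_one_prime_def prime_gt_0_nat)
  have "real p \<noteq> 0" if "p \<in> S" for p using pos[OF that] by simp
  then have "(\<Sum>p\<in>S. ln (real p)) = ln (\<Prod>p\<in>S. real p)"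
   by (rule ln_prod[OF fS, symmetric])
  also have "... \<le> ln (real (idx Q (N.mul z)))"
  proof (rule ln_mono)
   show "(\<Prod>p\<in>S. real p) \<le> real (idx Q (N.mul z))" using le by (simp only: of_nat_prod[symmetric] of_nat_le_iff)
   show "0 < (\<Prod>p\<in>S. real p)" using pos by (intro prod_pos) simp
  qed
  also have "... \<le> C1 * ln Y" by (rule lnidx)
  also have "... < c * real x" using xb(1) c by (simp add: field_simps)
  also have "... \<le> (\<Sum>p\<in>S. ln (real p))" unfolding S_def by (rule cheb) (simp add: x_def)
  finally show False by simp
 qed
 then show ?thesis using C by blast
qed

text \<open>The ideal has to avoid \<open>dot w g\<close> and the minor \<open>z0\<close>. It is
  enough that it avoids their product, a single nonzero element of size \<open>O(Y)\<close>.\<close>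

lemma upper_single:
 assumes Q: "fgring Q" and w: "\<And>i. i < m ==> w i \<in> Q" and lw: "low (Suc rdim) w"
 shows "\<exists>C>0. \<forall>Y\<ge>2. \<forall>g\<in>V. (\<forall>i<m. real_of_int \<bar>g i\<bar> \<le> Y) --> dot w g \<noteq> 0 --> separable g ((C * ln Y) ^ rdim)"
proof -
 obtain b n where ring: "nring Q b n" by (rule fgring_basis[OF Q])
 interpret N: nring Q b n by (rule ring)
 obtain z0 where z0: "z0 \<in> Q" "z0 \<noteq> 0"
  and sep: "\<And>g P. g \<in> V ==> N.maxid P ==> dot w g * z0 \<notin> P ==> separable g (real (idx Q P) ^ rdim)"
  using separable_at_prime[OF ring w lw] by blast
 obtain r0 where r0: "r0 \<ge> 1" "N.bx r0 z0" using N.ex_bx[OF z0(1)] by blast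
 have "\<forall>i. \<exists>r. i < m --> r \<ge> 1 \<and> N.bx r (w i)" using N.ex_bx w by blast
 then obtain r where r: "\<And>i. i < m ==> r i \<ge> 1" "\<And>i. i < m ==> N.bx (r i) (w i)" by metis
 define Rs where "Rs = (\<Sum>i<m. r i)"
 define K where "K = N.kc * Rs * r0"
 obtain C where C: "C > 0" and av: "\<And>Y z. Y \<ge> 2 ==> N.bx (K * Y) z ==> z \<noteq> 0 ==>
   \<exists>P. N.maxid P \<and> z \<notin> P \<and> real (idx Q P) \<le> C * ln Y"
  using prime_avoiding[OF ring, of K] by blast
 have "separable g ((C * ln Y) ^ rdim)"
  if Y: "Y \<ge> 2" and g: "g \<in> V" and gX: "\<forall>i<m. real_of_int \<bar>g i\<bar> \<le> Y" and nz: "dot w g \<noteq> 0" for Y g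
 proof -
  have "N.bx (Y * (\<Sum>i\<in>A. r i)) (\<Sum>i\<in>A. w i * of_int (g i))" if "A \<subseteq> {..<m}" for A
   using finite_subset[OF that finite_lessThan] that
  proof (induction A rule: finite_induct)
   case empty
   then show ?case using N.zero_in by (simp add: N.bx_def N.co_zero)
  next
   case (insert i A)
   then have i: "i < m" by blast
   have "N.bx (Y * r i) (of_int (g i) * w i)" unfolding N.bx_def
   proof (intro conjI allI impI)
    show "of_int (g i) * w i \<in> Q" by (intro N.mult N.of_int_in w i)
    fix j assume j: "j < n"
    have "real_of_int \<bar>g i * N.co (w i) j\<bar> = real_of_int \<bar>g i\<bar> * real_of_int \<bar>N.co (w i) j\<bar>" by (simp add: abs_mult)
    also have "... \<le> Y * r i" using gX i r(2)[OF i] j Y by (intro mult_mono) (auto simp: N.bx_def)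
    finally show "real_of_int \<bar>N.co (of_int (g i) * w i) j\<bar> \<le> Y * r i" by (simp only: N.co_smult[OF w[OF i] j])
   qed
   from N.bx_add[OF this insert.IH] insert.prems insert.hyps show ?case by (simp add: algebra_simps)
  qed
  from this[of "{..<m}"] have "N.bx (Y * Rs) (dot w g)" by (simp add: dot_def Rs_def)
  from N.bx_mult[OF this r0(2)] have "N.bx (K * Y) (dot w g * z0)" by (simp add: K_def mult_ac)
  moreover have "dot w g * z0 \<noteq> 0" using nz z0(2) by simp
  ultimately obtain P where P: "N.maxid P" "dot w g * z0 \<notin> P" "real (idx Q P) \<le> C * ln Y" using av[OF Y] by blast
  show ?thesis by (rule separable_mono[OF sep[OF g P(1,2)]]) (rule power_mono[OF P(3)], simp)
 qed
 then show ?thesis using C by blast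
qed

text \<open>The definition of the exponent involves infinitely many vectors \<open>w\<close> over
  varying rings. A maximal nonvanishing minor of their coordinates selects at most \<open>m\<close>
  of them with the same common kernel, and a sum of finitely many constants serves for all of
  these.\<close>

lemma upper: "\<exists>C>0. \<forall>Y\<ge>2. \<forall>g\<in>V. (\<forall>i<m. real_of_int \<bar>g i\<bar> \<le> Y) --> g \<noteq> 0 --> separable g ((C * ln Y) ^ rdim)"
proof -
 define Adm where "Adm = {w. \<exists>Q. fgring Q \<and> (\<forall>i<m. w i \<in> Q) \<and> low (Suc rdim) w}"
 define Z :: "(nat => complex) => nat => complex" where "Z w c = w c" for w c
 obtain d f c where d: "d \<le> m" "\<forall>i<d. f i \<in> Adm" "\<forall>j<d. c j < m" "minor Z d f c \<noteq> 0"
  and van: "\<And>f c. (\<forall>i\<le>d. f i \<in> Adm) ==> (\<forall>j\<le>d. c j < m) ==> minor Z (Suc d) f c = 0"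
  by (rule max_minor[of m Adm Z]) blast
 have ker: "\<exists>i<d. dot (f i) g \<noteq> 0" if g: "g \<in> V" "g \<noteq> 0" for g
 proof (rule ccontr)
  assume no: "\<not> (\<exists>i<d. dot (f i) g \<noteq> 0)"
  have "dot w g = 0" if w: "w \<in> Adm" for w
  proof -
   obtain a where a: "\<forall>e<m. minor Z d f c * Z w e = (\<Sum>i<d. a i * Z (f i) e)"
    using minor_cramer[where Z = Z and d = d and R = Adm and m = m and S = UNIV and r = w, OF van d(2,3) is_subring_UNIV _ w]
    by auto
   have "minor Z d f c * dot w g = (\<Sum>e<m. (minor Z d f c * Z w e) * of_int (g e))"
    by (simp add: dot_def Z_def sum_distrib_left mult.assoc)
   also have "... = (\<Sum>e<m. \<Sum>i<d. a i * (f i e * of_int (g e)))"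
    using a by (intro sum.cong refl) (simp add: sum_distrib_left sum_distrib_right mult_ac Z_def)
   also have "... = (\<Sum>i<d. a i * dot (f i) g)" by (subst sum.swap) (simp only: sum_distrib_left dot_def)
   also have "... = 0" using no by (intro sum.neutral) auto
   finally show ?thesis using d(4) by simp
  qed
  then have "g \<in> Sz (Suc rdim)" using g(1) unfolding Sz_def Adm_def by blast
  then show False using Sz_Suc_rdim g(2) by blast
 qed
 have "\<forall>i. \<exists>C. i < d --> C > 0 \<and> (\<forall>Y\<ge>2. \<forall>g\<in>V. (\<forall>j<m. real_of_int \<bar>g j\<bar> \<le> Y) --> dot (f i) g \<noteq> 0 --> separable g ((C * ln Y) ^ rdim))"
 proof
  fix i
  show "\<exists>C. i < d --> C > 0 \<and> (\<forall>Y\<ge>2. \<forall>g\<in>V. (\<forall>j<m. real_of_int \<bar>g j\<bar> \<le> Y) --> dot (f i) g \<noteq> 0 --> separable g ((C * ln Y) ^ rdim))"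
  proof (cases "i < d")
   case True
   then obtain Q where "fgring Q" "\<forall>j<m. f i j \<in> Q" "low (Suc rdim) (f i)" using d(2) unfolding Adm_def by blast
   then show ?thesis using upper_single[of Q "f i"] by blast
  qed simp
 qed
 then obtain C where C: "\<And>i. i < d ==> C i > 0" and
  sep: "\<And>i Y g. i < d ==> Y \<ge> 2 ==> g \<in> V ==> (\<forall>j<m. real_of_int \<bar>g j\<bar> \<le> Y) ==> dot (f i) g \<noteq> 0 ==> separable g ((C i * ln Y) ^ rdim)"
  by metis
 define D where "D = 1 + (\<Sum>i<d. C i)"
 have "D > 0" unfolding D_def using C by (intro add_pos_nonneg sum_nonneg) (auto intro: less_imp_le)
 moreover have "separable g ((D * ln Y) ^ rdim)"
  if Y: "Y \<ge> 2" and g: "g \<in> V" "\<forall>j<m. real_of_int \<bar>g j\<bar> \<le> Y" "g \<noteq> 0" for Y g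
 proof -
  obtain i where i: "i < d" "dot (f i) g \<noteq> 0" using ker g by blast
  have "C i \<le> (\<Sum>i<d. C i)" using C i(1) by (intro member_le_sum) (auto intro: less_imp_le)
  then have "C i * ln Y \<le> D * ln Y" using Y by (intro mult_right_mono) (auto simp: D_def)
  moreover have "0 \<le> C i * ln Y" using C[OF i(1)] Y by simp
  ultimately show ?thesis by (intro separable_mono[OF sep[OF i(1) Y g(1,2) i(2)]] power_mono)
 qed
 ultimately show ?thesis by blast
qed

end

section \<open>Virtually abelian groups\<close>

lemma (in group) card_rcosets_le:
 assumes K: "subgroup K G" and fin: "finite (f ` carrier G)"
  and f: "\<And>x y. x \<in> carrier G ==> y \<in> carrier G ==> f x = f y ==> x \<otimes> inv y \<in> K"
 shows "finite (rcosets K)" "card (rcosets K) \<le> card (f ` carrier G)"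
proof -
 define h where "h z = K #> (SOME x. x \<in> carrier G \<and> f x = z)" for z
 have sub: "rcosets K \<subseteq> h ` (f ` carrier G)"
 proof
  fix C assume "C \<in> rcosets K"
  then obtain x where x: "x \<in> carrier G" "C = K #> x" unfolding RCOSETS_def by blast
  define y where "y = (SOME y. y \<in> carrier G \<and> f y = f x)"
  have y: "y \<in> carrier G \<and> f y = f x" unfolding y_def by (rule someI[of _ x]) (use x in simp)
  have k: "x \<otimes> inv y \<in> K" using f x y by simp
  have "x = (x \<otimes> inv y) \<otimes> y" using x y by (simp add: m_assoc)
  then have "x \<in> K #> y" unfolding r_coset_def using k by blast
  then have "K #> y = K #> x" using repr_independence[OF _ _ K] y by blast
  then have "C = h (f x)" using x by (simp add: h_def y_def)
  then show "C \<in> h ` (f ` carrier G)" using x by blast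
 qed
 show "finite (rcosets K)" by (rule finite_subset[OF sub]) (use fin in simp)
 show "card (rcosets K) \<le> card (f ` carrier G)" by (rule surj_card_le[OF fin sub])
qed

locale virt_abelian = group G for G (structure) +
 fixes A and S
 assumes finS: "finite S" and genS: "S \<subseteq> carrier G" "generate G S = carrier G"
  and nA: "A \<lhd> G" and finA: "finite (rcosets A)"
  and comm: "a \<in> A ==> b \<in> A ==> a \<otimes> b = b \<otimes> a"
begin

abbreviation "letters \<equiv> S \<union> m_inv G ` S"

abbreviation "wd w \<equiv> foldr (\<otimes>) w \<one>"

lemma sA: "subgroup A G" using nA by (rule normal_imp_subgroup)

lemma A_carrier: "a \<in> A ==> a \<in> carrier G" using subgroup.mem_carrier[OF sA] .

lemma A_simps: "\<one> \<in> A" "a \<in> A ==> b \<in> A ==> a \<otimes> b \<in> A" "a \<in> A ==> inv a \<in> A"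
 using subgroup.one_closed[OF sA] subgroup.m_closed[OF sA] subgroup.m_inv_closed[OF sA] by auto

lemma A_conj: "x \<in> carrier G ==> a \<in> A ==> x \<otimes> a \<otimes> inv x \<in> A" "x \<in> carrier G ==> a \<in> A ==> inv x \<otimes> a \<otimes> x \<in> A"
 using normal.inv_op_closed2[OF nA] normal.inv_op_closed1[OF nA] by auto

lemma letters_carrier: "letters \<subseteq> carrier G" using genS(1) by auto

lemma wd_closed: "set w \<subseteq> carrier G ==> wd w \<in> carrier G"
 by (induction w) auto

lemma wd_append: "set u \<subseteq> carrier G ==> set w \<subseteq> carrier G ==> wd (u @ w) = wd u \<otimes> wd w"
proof (induction u)
 case (Cons a u)
 then have "wd (u @ w) = wd u \<otimes> wd w" "a \<in> carrier G" "wd u \<in> carrier G" "wd w \<in> carrier G"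
  using wd_closed by auto
 then show ?case by (simp add: m_assoc)
qed (simp add: wd_closed)

lemma word_exists: assumes "x \<in> carrier G" shows "\<exists>w. set w \<subseteq> letters \<and> wd w = x"
proof -
 have "x \<in> generate G S" using assms genS by simp
 then show ?thesis
 proof (induction rule: generate.induct)
  case one show ?case by (intro exI[of _ "[]"]) simp
 next
  case (incl h) then show ?case using genS by (intro exI[of _ "[h]"]) auto
 next
  case (inv h) then show ?case using genS by (intro exI[of _ "[inv h]"]) auto
 next
  case (eng h1 h2)
  then obtain u w where "set u \<subseteq> letters" "wd u = h1" "set w \<subseteq> letters" "wd w = h2" by blast
  then show ?case using wd_append[of u w] letters_carrier by (intro exI[of _ "u @ w"]) auto
 qed
qed

lemma nat_pow_in: "a \<in> A ==> a [^] (n::nat) \<in> A"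
 by (induction n) (simp_all add: A_simps)

lemma int_pow_in: "a \<in> A ==> a [^] (k::int) \<in> A"
 by (cases k rule: int_cases2) (simp_all add: int_pow_int int_pow_neg_int A_carrier nat_pow_in A_simps)

definition hm :: "((nat => int) => 'a) => bool" where
 "hm \<Phi> \<longleftrightarrow> (\<forall>v w. \<Phi> (%i. v i + w i) = \<Phi> v \<otimes> \<Phi> w) \<and> (\<forall>v. \<Phi> v \<in> A)"

text \<open>The last clause lets the map ignore all coordinates from \<open>s\<close> on; the
  induction needs it to evaluate the old map at the new unit vector.\<close>

lemma hm_exists:
 assumes "\<And>x. x < s ==> y x \<in> A"
 shows "\<exists>\<Phi>. hm \<Phi> \<and> (\<forall>x<s. \<Phi> (%i. if i = x then 1 else 0) = y x) \<and> (\<forall>v. (\<forall>x<s. v x = 0) --> \<Phi> v = \<one>)"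
 using assms
proof (induction s)
 case 0
 have "hm (%_. \<one>)" by (simp add: hm_def A_simps)
 then show ?case by (intro exI[of _ "%_. \<one>"]) simp
next
 case (Suc s)
 then obtain \<Phi> where \<Phi>: "hm \<Phi>" "\<forall>x<s. \<Phi> (%i. if i = x then 1 else 0) = y x" "\<forall>v. (\<forall>x<s. v x = 0) --> \<Phi> v = \<one>"
  by force
 define \<Psi> where "\<Psi> v = \<Phi> v \<otimes> y s [^] v s" for v :: "nat => int"
 have yA: "y s [^] (k::int) \<in> A" for k using Suc.prems int_pow_in by simp
 have ys: "y s \<in> carrier G" using Suc.prems A_carrier by simp
 have \<Phi>A: "\<Phi> v \<in> A" for v using \<Phi>(1) by (simp add: hm_def)
 have "\<Psi> (%i. v i + w i) = \<Psi> v \<otimes> \<Psi> w" for v w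
 proof -
  have "\<Psi> (%i. v i + w i) = \<Phi> v \<otimes> \<Phi> w \<otimes> (y s [^] v s \<otimes> y s [^] w s)"
   using \<Phi>(1) by (simp add: \<Psi>_def hm_def int_pow_mult ys)
  also have "... = \<Phi> v \<otimes> (\<Phi> w \<otimes> y s [^] v s) \<otimes> y s [^] w s"
   using \<Phi>A yA by (simp add: m_assoc A_carrier)
  also have "... = \<Phi> v \<otimes> (y s [^] v s \<otimes> \<Phi> w) \<otimes> y s [^] w s"
   by (simp only: comm[OF \<Phi>A yA])
  also have "... = \<Psi> v \<otimes> \<Psi> w" using \<Phi>A yA by (simp add: m_assoc A_carrier \<Psi>_def)
  finally show ?thesis .
 qed
 then have "hm \<Psi>" using \<Phi>A yA by (simp add: hm_def \<Psi>_def A_simps)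
 moreover have "\<Psi> (%i. if i = x then 1 else 0) = y x" if "x < Suc s" for x
 proof (cases "x = s")
  case True
  have "\<Phi> (%i. if i = x then 1 else 0) = \<one>" using \<Phi>(3) True by simp
  then show ?thesis using True ys by (simp add: \<Psi>_def)
 next
  case False
  then have "\<Phi> (%i. if i = x then 1 else 0) = y x" "x < s" using \<Phi>(2) that by simp_all
  then show ?thesis using Suc.prems[of x] by (simp add: \<Psi>_def A_carrier)
 qed
 moreover have "\<Psi> v = \<one>" if "\<forall>x<Suc s. v x = 0" for v using \<Phi>(3) that by (simp add: \<Psi>_def)
 ultimately show ?case by blast
qed

context
 fixes \<Phi> :: "(nat => int) => 'a"
 assumes hm: "hm \<Phi>"
begin

lemma hm_add: "\<Phi> (%i. v i + w i) = \<Phi> v \<otimes> \<Phi> w" using hm by (simp add: hm_def)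

lemma hm_in: "\<Phi> v \<in> A" using hm by (simp add: hm_def)

lemma hm_carrier: "\<Phi> v \<in> carrier G" using hm_in A_carrier by blast

lemma hm_zero: "\<Phi> (%i. 0) = \<one>"
 using hm_add[of "%_. 0" "%_. 0"] hm_carrier[of "%_. 0"] by (simp add: l_cancel_one')

lemma hm_minus: "\<Phi> (%i. - v i) = inv \<Phi> v"
proof (rule inv_equality[symmetric])
 show "\<Phi> (%i. - v i) \<otimes> \<Phi> v = \<one>" using hm_add[of "%i. - v i" v] hm_zero by simp
qed (rule hm_carrier)+

lemma hm_diff: "\<Phi> (%i. v i - w i) = \<Phi> v \<otimes> inv \<Phi> w"
 using hm_add[of v "%i. - w i"] hm_minus[of w] by simp

lemma hm_nat: "\<Phi> (%i. int n * v i) = \<Phi> v [^] n"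
proof (induction n)
 case (Suc n)
 have "\<Phi> (%i. int (Suc n) * v i) = \<Phi> (%i. int n * v i + v i)" by (simp add: algebra_simps)
 also have "... = \<Phi> v [^] n \<otimes> \<Phi> v" by (simp only: hm_add Suc)
 finally show ?case by simp
qed (simp add: hm_zero)

lemma hm_kill: assumes "\<Phi> v = \<one>" shows "\<Phi> (%i. c * v i) = \<one>"
proof (cases c rule: int_cases2)
 case (nonneg n) then show ?thesis using hm_nat[of n v] assms by simp
next
 case (nonpos n)
 then show ?thesis using hm_minus[of "%i. int n * v i"] hm_nat[of n v] assms by simp
qed

lemma hm_sum_kill: "(\<And>x. x \<in> F ==> \<Phi> (f x) = \<one>) ==> \<Phi> (%i. \<Sum>x\<in>F. f x i) = \<one>"
proof (induction F rule: infinite_finite_induct)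
 case (insert x F)
 have "\<Phi> (%i. f x i + (\<Sum>x\<in>F. f x i)) = \<one> \<otimes> \<one>"
  unfolding hm_add using insert.prems insert.IH by simp
 then show ?case using insert.hyps by simp
qed (simp_all add: hm_zero)

end

section \<open>Transversal of \<open>A\<close> and the associated cocycle\<close>

definition tau :: "'a set => 'a" where
 "tau C = (if \<one> \<in> C then \<one> else SOME x. x \<in> C)"

definition tr :: "'a => 'a" where "tr x = tau (A #> x)"

text \<open>The component of \<open>x\<close> in \<open>A\<close>. Since \<open>tau\<close>
  represents the coset \<open>A\<close> by the identity, \<open>cc\<close> fixes \<open>A\<close>
  pointwise.\<close>

definition cc :: "'a => 'a" where "cc x = inv (tr x) \<otimes> x"

lemma tr_in: assumes "x \<in> carrier G" shows "tr x \<in> A #> x"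
proof -
 have "x \<in> A #> x" by (rule rcos_self[OF assms sA])
 then show ?thesis unfolding tr_def tau_def by (auto intro: someI)
qed

lemma trE: assumes "x \<in> carrier G" obtains a where "a \<in> A" "tr x = a \<otimes> x"
 using tr_in[OF assms] unfolding r_coset_def by blast

lemma tr_carrier: assumes "x \<in> carrier G" shows "tr x \<in> carrier G"
proof -
 obtain a where "a \<in> A" "tr x = a \<otimes> x" by (rule trE[OF assms])
 then show ?thesis using assms A_carrier by simp
qed

lemma cc_in: assumes x: "x \<in> carrier G" shows "cc x \<in> A"
proof -
 obtain a where a: "a \<in> A" "tr x = a \<otimes> x" by (rule trE[OF x])
 have "cc x = inv x \<otimes> inv a \<otimes> x" using a x by (simp add: cc_def inv_mult_group A_carrier)
 then show ?thesis using A_conj(2)[OF x A_simps(3)[OF a(1)]] by simp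
qed

lemma cancel_mid: "s \<in> carrier G ==> t \<in> carrier G ==> x \<in> carrier G ==> (s \<otimes> t) \<otimes> (inv t \<otimes> x) = s \<otimes> x"
proof -
 assume h: "s \<in> carrier G" "t \<in> carrier G" "x \<in> carrier G"
 have "(s \<otimes> t) \<otimes> (inv t \<otimes> x) = s \<otimes> ((t \<otimes> inv t) \<otimes> x)" using h by (simp only: m_assoc m_closed inv_closed)
 also have "... = s \<otimes> x" using h by simp
 finally show ?thesis .
qed

lemma tr_cc: "x \<in> carrier G ==> x = tr x \<otimes> cc x"
 using cancel_mid[of \<one> "tr x" x] tr_carrier[of x] by (simp add: cc_def)

text \<open>\<open>s \<otimes> x\<close> and \<open>s \<otimes> tr x\<close> lie in the same coset.
  Prefixing a letter to a word thus multiplies \<open>cc\<close> by a factor that depends only on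
  the letter and the coset, of which there are finitely many.\<close>

lemma cc_mult:
 assumes s: "s \<in> carrier G" and x: "x \<in> carrier G"
 shows "cc (s \<otimes> x) = cc (s \<otimes> tr x) \<otimes> cc x"
proof -
 obtain a where a: "a \<in> A" "tr x = a \<otimes> x" by (rule trE[OF x])
 have aG: "a \<in> carrier G" using a A_carrier by blast
 have "s \<otimes> tr x = (s \<otimes> a \<otimes> inv s) \<otimes> (s \<otimes> x)"
 proof -
  have "(s \<otimes> a \<otimes> inv s) \<otimes> (s \<otimes> x) = (s \<otimes> a) \<otimes> ((inv s \<otimes> s) \<otimes> x)"
   using s x aG by (simp only: m_assoc m_closed inv_closed)
  also have "... = s \<otimes> tr x" using s x aG a(2) by (simp add: m_assoc)
  finally show ?thesis by simp
 qed
 then have "s \<otimes> tr x \<in> A #> (s \<otimes> x)" unfolding r_coset_def using A_conj(1)[OF s a(1)] by blast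
 then have "A #> (s \<otimes> x) = A #> (s \<otimes> tr x)" using repr_independence[OF _ _ sA] s x by blast
 then have eq: "tr (s \<otimes> x) = tr (s \<otimes> tr x)" by (simp add: tr_def)
 have c: "tr x \<in> carrier G" "tr (s \<otimes> tr x) \<in> carrier G" using tr_carrier s x by auto
 have "cc (s \<otimes> tr x) \<otimes> cc x = inv (tr (s \<otimes> tr x)) \<otimes> ((s \<otimes> tr x) \<otimes> (inv (tr x) \<otimes> x))"
  using s x c by (simp only: cc_def m_assoc m_closed inv_closed)
 also have "... = cc (s \<otimes> x)" using cancel_mid[OF s c(1) x] by (simp add: cc_def eq)
 finally show ?thesis by simp
qed

lemma cc_A: assumes "x \<in> A" shows "cc x = x"
proof -
 have "A #> x = A" using sA assms by (rule coset_join2[OF A_carrier[OF assms]])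
 then have "tr x = \<one>" using A_simps(1) by (simp add: tr_def tau_def)
 then show ?thesis using A_carrier[OF assms] by (simp add: cc_def)
qed

text \<open>Reidemeister--Schreier: the cocycle \<open>cc\<close> turns words into exponent vectors of controlled size.\<close>

lemma coordinates:
 "\<exists>\<Phi> (s::nat). hm \<Phi> \<and> (\<forall>w. set w \<subseteq> letters -->
  (\<exists>v. (\<forall>i\<ge>s. v i = 0) \<and> \<Phi> v = cc (wd w) \<and> (\<forall>i. \<bar>v i\<bar> \<le> int (length w))))"
proof -
 define Y where "Y = (%(a,C). cc (a \<otimes> tau C)) ` (letters \<times> rcosets A)"
 have "finite Y" unfolding Y_def using finS finA by simp
 then obtain ys where ys: "set ys = Y" using finite_list by blast
 define s where "s = length ys"
 have tauC: "tau C \<in> carrier G" if "C \<in> rcosets A" for C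
 proof -
  obtain x where "x \<in> carrier G" "C = A #> x" using \<open>C \<in> rcosets A\<close> unfolding RCOSETS_def by blast
  then show ?thesis using tr_carrier by (simp add: tr_def)
 qed
 have "Y \<subseteq> A" unfolding Y_def using tauC letters_carrier cc_in by fastforce
 then have "ys ! x \<in> A" if "x < s" for x using ys that nth_mem by (force simp: s_def)
 then obtain \<Phi> where \<Phi>: "hm \<Phi>" "\<forall>x<s. \<Phi> (%i. if i = x then 1 else 0) = ys ! x"
  using hm_exists[of s "%x. ys ! x"] by blast
 have "\<exists>v. (\<forall>i\<ge>s. v i = 0) \<and> \<Phi> v = cc (wd w) \<and> (\<forall>i. \<bar>v i\<bar> \<le> int (length w))" if w: "set w \<subseteq> letters" for w
  using w
 proof (induction w)
  case Nil
  have "cc \<one> = \<one>" by (rule cc_A[OF A_simps(1)])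
  then show ?case using hm_zero[OF \<Phi>(1)] by (intro exI[of _ "%_. 0"]) simp
 next
  case (Cons a w)
  then obtain v where v: "\<forall>i\<ge>s. v i = 0" "\<Phi> v = cc (wd w)" "\<forall>i. \<bar>v i\<bar> \<le> int (length w)" by auto
  have c: "a \<in> carrier G" "wd w \<in> carrier G" using Cons.prems letters_carrier wd_closed[of w] by auto
  have "A #> wd w \<in> rcosets A" unfolding RCOSETS_def using c by blast
  then have "cc (a \<otimes> tr (wd w)) \<in> Y" unfolding Y_def tr_def using Cons.prems by auto
  then obtain x where x: "x < s" "ys ! x = cc (a \<otimes> tr (wd w))" unfolding ys[symmetric] s_def in_set_conv_nth by blast
  define v' where "v' i = (if i = x then 1 else 0) + v i" for i
  have "\<Phi> v' = ys ! x \<otimes> cc (wd w)"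
   using hm_add[OF \<Phi>(1), of "%i. if i = x then 1 else 0" v] \<Phi>(2) x(1) v(2) by (simp add: v'_def[abs_def])
  then have "\<Phi> v' = cc (wd (a # w))" using cc_mult[OF c] x(2) by simp
  moreover have "\<forall>i\<ge>s. v' i = 0" using x(1) v(1) by (simp add: v'_def)
  moreover have "\<bar>v' i\<bar> \<le> int (length (a # w))" for i
  proof -
   have "\<bar>v' i\<bar> \<le> \<bar>if i = x then 1 else 0\<bar> + \<bar>v i\<bar>" unfolding v'_def by (rule abs_triangle_ineq)
   moreover have "\<bar>if i = x then 1 else 0 :: int\<bar> \<le> 1" by simp
   ultimately show ?thesis using v(3)[rule_format, of i] unfolding list.size by linarith
  qed
  ultimately show ?case by blast
 qed
 then show ?thesis using \<Phi>(1) by blast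
qed

text \<open>A parametrisation of a free abelian normal subgroup of finite index whose coordinates
  are bounded linearly by the length of every word for the element.\<close>

definition lattice_chart :: "nat => ((nat => int) => 'a) => int => bool" where
 "lattice_chart m E K \<longleftrightarrow> hm E \<and> (\<forall>v. (\<forall>i\<ge>m. v i = 0) --> E v = \<one> --> v = (%i. 0)) \<and>
  E ` {v. \<forall>i\<ge>m. v i = 0} \<lhd> G \<and> finite (rcosets (E ` {v. \<forall>i\<ge>m. v i = 0})) \<and>
  (\<forall>w. set w \<subseteq> letters --> wd w \<in> E ` {v. \<forall>i\<ge>m. v i = 0} -->
   (\<exists>v. (\<forall>i\<ge>m. v i = 0) \<and> E v = wd w \<and> (\<forall>i. \<bar>v i\<bar> \<le> K * int (length w))))"

text \<open>\<open>N\<close> is an exponent of the torsion subgroup of \<open>A\<close>; the subgroup of \<open>N\<close>-th powers of \<open>A\<close> is free.\<close>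

lemma lattice_chart_exists: "\<exists>m E K. lattice_chart m E K"
proof -
 obtain \<Phi> and s :: nat where \<Phi>: "hm \<Phi>" and wv: "\<And>w. set w \<subseteq> letters ==>
  \<exists>v. (\<forall>i\<ge>s. v i = 0) \<and> \<Phi> v = cc (wd w) \<and> (\<forall>i. \<bar>v i\<bar> \<le> int (length w))"
  using coordinates by blast
 note H = hm_add[OF \<Phi>] hm_zero[OF \<Phi>] hm_minus[OF \<Phi>] hm_diff[OF \<Phi>]
 \<comment> \<open>Relations up to torsion: admitting a multiplier \<open>j\<close> makes the group
   of relations pure.\<close>
 define Kt where "Kt v \<longleftrightarrow> (\<exists>j::int. j \<noteq> 0 \<and> \<Phi> (%i. j * v i) = \<one>)" for v :: "nat => int"
 have K0: "Kt (%x. 0)" unfolding Kt_def by (intro exI[of _ 1]) (simp add: H)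
 have Kd: "Kt (%x. v x - w x)" if vw: "Kt v" "Kt w" for v w
 proof -
  obtain j where j: "j \<noteq> 0 \<and> \<Phi> (%i. j * v i) = \<one>" using vw(1) unfolding Kt_def by (elim exE)
  obtain k where k: "k \<noteq> 0 \<and> \<Phi> (%i. k * w i) = \<one>" using vw(2) unfolding Kt_def by (elim exE)
  have jk: "j \<noteq> 0" "\<Phi> (%i. j * v i) = \<one>" "k \<noteq> 0" "\<Phi> (%i. k * w i) = \<one>" using j k by simp_all
  have "\<Phi> (%i. k * (j * v i) - j * (k * w i)) = \<one> \<otimes> inv \<one>"
   by (simp only: H hm_kill[OF \<Phi> jk(2)] hm_kill[OF \<Phi> jk(4)])
  moreover have "(%i. k * (j * v i) - j * (k * w i)) = (%i. (j * k) * (v i - w i))" by (simp add: algebra_simps)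
  ultimately have "\<Phi> (%i. (j * k) * (v i - w i)) = \<one>" by simp
  then show ?thesis unfolding Kt_def using jk by (intro exI[of _ "j * k"]) simp
 qed
 have pure: "Kt v" if "c \<noteq> 0" "Kt (%x. c * v x)" for c v
 proof -
  obtain j where "j \<noteq> 0 \<and> \<Phi> (%i. j * (c * v i)) = \<one>" using \<open>Kt (%x. c * v x)\<close> unfolding Kt_def by (elim exE)
  then show ?thesis unfolding Kt_def using \<open>c \<noteq> 0\<close> by (intro exI[of _ "j * c"]) (simp add: mult.assoc)
 qed
 have "\<exists>(n::nat) u. (\<forall>v. (\<forall>x\<ge>s. v x = 0) --> (\<exists>c. Kt (%x. v x - (\<Sum>j<n. c j * u j x)))) \<and>
  (\<forall>c. Kt (%x. \<Sum>j<n. c j * u j x) --> (\<forall>j<n. c j = 0)) \<and> (\<forall>j<n. \<forall>x\<ge>s. u j x = 0)"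
  by (rule lattice_basis[where K = Kt]) (rule K0, erule (1) Kd, erule (1) pure)
 then obtain m :: nat and u where u: "(\<forall>v. (\<forall>x\<ge>s. v x = 0) --> (\<exists>c. Kt (%x. v x - (\<Sum>j<m. c j * u j x)))) \<and>
  (\<forall>c. Kt (%x. \<Sum>j<m. c j * u j x) --> (\<forall>j<m. c j = 0)) \<and> (\<forall>j<m. \<forall>x\<ge>s. u j x = 0)"
  by (elim exE)
 have u1: "\<exists>c. Kt (%x. v x - (\<Sum>j<m. c j * u j x))" if "\<forall>x\<ge>s. v x = 0" for v
  using conjunct1[OF u] that by simp
 have u2: "\<forall>j<m. c j = 0" if "Kt (%x. \<Sum>j<m. c j * u j x)" for c
  using conjunct1[OF conjunct2[OF u]] that by simp
 have u3: "\<forall>j<m. \<forall>x\<ge>s. u j x = 0" using u by simp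
 define \<epsilon> where "\<epsilon> x i = (if i = x then 1 else 0 :: int)" for x i :: nat
 define good where "good x c N \<longleftrightarrow> N \<noteq> 0 \<and> \<Phi> (%i. N * (\<epsilon> x i - (\<Sum>j<m. c j * u j i))) = \<one>" for x c and N :: int
 have "\<exists>c N. good x c N" if "x < s" for x
  using u1[of "\<epsilon> x"] that unfolding Kt_def good_def by (auto simp: \<epsilon>_def)
 then obtain cx Nx where good: "\<And>x. x < s ==> good x (cx x) (Nx x)" by metis
 have Nx: "Nx x \<noteq> 0" and cx: "\<Phi> (%i. Nx x * (\<epsilon> x i - (\<Sum>j<m. cx x j * u j i))) = \<one>" if "x < s" for x
  using good[OF that] by (simp_all add: good_def)
 \<comment> \<open>A common multiple of the \<open>Nx x\<close>: after passing to
   \<open>N\<close>-th powers every generator is expressed exactly by the basis, without a torsion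
   error.\<close>
 define N where "N = (\<Prod>x<s. nat \<bar>Nx x\<bar>)"
 have N0: "N > 0" unfolding N_def using Nx by (intro prod_pos) simp
 have NxN: "Nx x dvd int N" if "x < s" for x
 proof -
  have "nat \<bar>Nx x\<bar> dvd N" unfolding N_def using that by (intro dvd_prodI) simp_all
  then have "int (nat \<bar>Nx x\<bar>) dvd int N" by (simp only: of_nat_dvd_iff)
  then show ?thesis by simp
 qed
 define E where "E c = \<Phi> (%i. int N * (\<Sum>j<m. c j * u j i))" for c :: "nat => int"
 have hE: "hm E"
  unfolding hm_def
 proof (intro conjI allI)
  fix v w :: "nat => int"
  have "(%i. int N * (\<Sum>j<m. (v j + w j) * u j i)) = (%i. int N * (\<Sum>j<m. v j * u j i) + int N * (\<Sum>j<m. w j * u j i))"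
   by (simp add: distrib_right sum.distrib distrib_left)
  then show "E (%i. v i + w i) = E v \<otimes> E w" by (simp only: E_def H)
  show "E v \<in> A" unfolding E_def by (rule hm_in[OF \<Phi>])
 qed
 have injE: "c = (%i. 0)" if c: "\<forall>i\<ge>m. c i = 0" "E c = \<one>" for c
 proof -
  have "Kt (%x. \<Sum>j<m. c j * u j x)" unfolding Kt_def using c(2) N0 by (intro exI[of _ "int N"]) (simp add: E_def)
  from u2[OF this] have "c i = 0" for i using c(1) by (cases "i < m") auto
  then show ?thesis by blast
 qed
 define d where "d v j = (if j < m then \<Sum>x<s. v x * cx x j else 0)" for v :: "nat => int" and j
 have \<Phi>N: "\<Phi> (%i. int N * v i) = E (d v)" if v: "\<forall>i\<ge>s. v i = 0" for v
 proof -
  have "\<Phi> (%i. \<Sum>x<s. (v x * (int N div Nx x)) * (Nx x * (\<epsilon> x i - (\<Sum>j<m. cx x j * u j i)))) = \<one>"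
   by (rule hm_sum_kill[OF \<Phi>], rule hm_kill[OF \<Phi>], rule cx) simp
  also have "(%i. \<Sum>x<s. (v x * (int N div Nx x)) * (Nx x * (\<epsilon> x i - (\<Sum>j<m. cx x j * u j i)))) =
   (%i. int N * v i - int N * (\<Sum>j<m. d v j * u j i))"
  proof
   fix i
   have "(\<Sum>x<s. (v x * (int N div Nx x)) * (Nx x * (\<epsilon> x i - (\<Sum>j<m. cx x j * u j i)))) =
    (\<Sum>x<s. int N * (v x * \<epsilon> x i) - int N * (\<Sum>j<m. v x * cx x j * u j i))"
   proof (rule sum.cong[OF refl])
    fix x assume "x \<in> {..<s}"
    then have "(int N div Nx x) * Nx x = int N" using NxN by simp
    moreover have "(v x * (int N div Nx x)) * (Nx x * (\<epsilon> x i - (\<Sum>j<m. cx x j * u j i))) =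
     ((int N div Nx x) * Nx x) * (v x * (\<epsilon> x i - (\<Sum>j<m. cx x j * u j i)))"
     by (simp only: mult_ac)
    ultimately have "(v x * (int N div Nx x)) * (Nx x * (\<epsilon> x i - (\<Sum>j<m. cx x j * u j i))) =
     int N * (v x * (\<epsilon> x i - (\<Sum>j<m. cx x j * u j i)))"
     by simp
    also have "... = int N * (v x * \<epsilon> x i) - int N * (\<Sum>j<m. v x * cx x j * u j i)"
     by (simp add: right_diff_distrib sum_distrib_left mult.assoc)
    finally show "(v x * (int N div Nx x)) * (Nx x * (\<epsilon> x i - (\<Sum>j<m. cx x j * u j i))) =
     int N * (v x * \<epsilon> x i) - int N * (\<Sum>j<m. v x * cx x j * u j i)" .
   qed
   also have "... = int N * (\<Sum>x<s. v x * \<epsilon> x i) - int N * (\<Sum>x<s. \<Sum>j<m. v x * cx x j * u j i)"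
    by (simp only: sum_subtractf sum_distrib_left)
   also have "(\<Sum>x<s. v x * \<epsilon> x i) = v i"
   proof -
    have "(\<Sum>x<s. v x * \<epsilon> x i) = (\<Sum>x<s. if i = x then v x else 0)" by (rule sum.cong) (auto simp: \<epsilon>_def)
    then show ?thesis using v by simp
   qed
   also have "(\<Sum>x<s. \<Sum>j<m. v x * cx x j * u j i) = (\<Sum>j<m. d v j * u j i)"
    by (subst sum.swap) (simp add: d_def sum_distrib_right)
   finally show "(\<Sum>x<s. (v x * (int N div Nx x)) * (Nx x * (\<epsilon> x i - (\<Sum>j<m. cx x j * u j i)))) =
    int N * v i - int N * (\<Sum>j<m. d v j * u j i)" .
  qed
  finally have "\<Phi> (%i. int N * v i) \<otimes> inv E (d v) = \<one>" by (simp only: H E_def)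
  then show ?thesis using hm_carrier[OF \<Phi>] hm_carrier[OF hE] by (metis inv_solve_right' l_one one_closed)
 qed
 have dm: "\<forall>i\<ge>m. d v i = 0" for v by (simp add: d_def)
 define L where "L = E ` {v. \<forall>i\<ge>m. v i = 0}"
 have surj: "\<exists>v. (\<forall>i\<ge>s. v i = 0) \<and> \<Phi> v = a" if a: "a \<in> A" for a
 proof -
  obtain w where w: "set w \<subseteq> letters" "wd w = a" using word_exists[OF A_carrier[OF a]] by blast
  then show ?thesis using wv[OF w(1)] cc_A[OF a] by auto
 qed
 have powL: "a [^] N \<in> L" if a: "a \<in> A" for a
 proof -
  obtain v where v: "\<forall>i\<ge>s. v i = 0" "\<Phi> v = a" using surj[OF a] by blast
  have "a [^] N = E (d v)" using hm_nat[OF \<Phi>, of N v] \<Phi>N[OF v(1)] v(2) by simp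
  then show ?thesis unfolding L_def using dm by blast
 qed
 have Lpow: "\<exists>a\<in>A. x = a [^] N" if x: "x \<in> L" for x
 proof -
  obtain c where "x = E c" using x unfolding L_def by blast
  then have "x = \<Phi> (%i. \<Sum>j<m. c j * u j i) [^] N" using hm_nat[OF \<Phi>, of N] by (simp add: E_def)
  then show ?thesis using hm_in[OF \<Phi>] by blast
 qed
 have LA: "L \<subseteq> A" unfolding L_def using hm_in[OF hE] by blast
 have sL: "subgroup L G"
 proof (rule subgroupI)
  show "L \<subseteq> carrier G" using LA A_carrier by blast
  show "L \<noteq> {}" unfolding L_def by (auto intro: exI[of _ "%_. 0"])
  fix x assume "x \<in> L"
  then obtain c where c: "\<forall>i\<ge>m. c i = 0" "x = E c" unfolding L_def by blast
  then have "inv x = E (%i. - c i)" using hm_minus[OF hE] by simp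
  moreover have "\<forall>i\<ge>m. - c i = 0" using c by simp
  ultimately show "inv x \<in> L" unfolding L_def by blast
  fix y assume "y \<in> L"
  then obtain c' where c': "\<forall>i\<ge>m. c' i = 0" "y = E c'" unfolding L_def by blast
  have "x \<otimes> y = E (%i. c i + c' i)" using hm_add[OF hE] c c' by simp
  moreover have "\<forall>i\<ge>m. c i + c' i = 0" using c c' by simp
  ultimately show "x \<otimes> y \<in> L" unfolding L_def by blast
 qed
 \<comment> \<open>\<open>L\<close> is the set of \<open>N\<close>-th powers of elements of
   \<open>A\<close>. Conjugation respects powers, so normality of \<open>A\<close> passes to
   \<open>L\<close>.\<close>
 have conj_pow: "x \<otimes> a [^] (n::nat) \<otimes> inv x = (x \<otimes> a \<otimes> inv x) [^] n" if x: "x \<in> carrier G" and a: "a \<in> carrier G" for x a n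
 proof (induction n)
  case (Suc n)
  have "x \<otimes> a [^] Suc n \<otimes> inv x = (x \<otimes> a [^] n) \<otimes> (a \<otimes> inv x)" using x a by (simp add: m_assoc)
  also have "... = ((x \<otimes> a [^] n) \<otimes> inv x) \<otimes> (inv (inv x) \<otimes> (a \<otimes> inv x))"
   using x a by (intro cancel_mid[symmetric]) auto
  also have "... = (x \<otimes> a \<otimes> inv x) [^] n \<otimes> (x \<otimes> a \<otimes> inv x)" using x a Suc by (simp add: m_assoc)
  finally show ?case by simp
 qed (use x in simp)
 have nL: "L \<lhd> G"
  unfolding normal_inv_iff
 proof (intro conjI ballI sL)
  fix x y assume x: "x \<in> carrier G" and y: "y \<in> L"
  obtain a where a: "a \<in> A" "y = a [^] N" using Lpow[OF y] by blast
  have "x \<otimes> y \<otimes> inv x = (x \<otimes> a \<otimes> inv x) [^] N" using conj_pow[OF x A_carrier[OF a(1)]] a(2) by simp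
  then show "x \<otimes> y \<otimes> inv x \<in> L" using powL[OF A_conj(1)[OF x a(1)]] by simp
 qed
 define vv where "vv a = (SOME v. (\<forall>i\<ge>s. v i = 0) \<and> \<Phi> v = a)" for a
 have vv: "(\<forall>i\<ge>s. vv a i = 0) \<and> \<Phi> (vv a) = a" if "a \<in> A" for a
  unfolding vv_def by (rule someI_ex[OF surj[OF that]])
 \<comment> \<open>The coset of \<open>x\<close> modulo \<open>A\<close> together with the
   coordinates of \<open>cc x\<close> modulo \<open>N\<close>: finitely many values, and they
   determine the coset modulo \<open>L\<close>.\<close>
 define f where "f x = (A #> x, \<lambda>i\<in>{..<s}. vv (cc x) i mod int N)" for x
 have "f ` carrier G \<subseteq> (rcosets A) \<times> ({..<s} \<rightarrow>\<^sub>E {0..<int N})"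
  using N0 by (auto simp: f_def RCOSETS_def)
 moreover have "finite ((rcosets A) \<times> ({..<s} \<rightarrow>\<^sub>E {0..<int N}))"
  by (intro finite_cartesian_product finA finite_PiE) auto
 ultimately have ff: "finite (f ` carrier G)" by (rule finite_subset)
 have fL: "x \<otimes> inv y \<in> L" if x: "x \<in> carrier G" and y: "y \<in> carrier G" and eq: "f x = f y" for x y
 proof -
  have t: "tr x = tr y" using eq by (simp add: f_def tr_def)
  have md: "vv (cc x) i mod int N = vv (cc y) i mod int N" if "i < s" for i
   using fun_cong[OF arg_cong[OF eq, of snd], of i] that by (simp add: f_def)
  define z where "z i = (vv (cc x) i - vv (cc y) i) div int N" for i
  have z: "int N * z i = vv (cc x) i - vv (cc y) i" for i
  proof (cases "i < s")
   case True then show ?thesis using md[OF True] by (simp add: z_def mod_eq_dvd_iff)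
  next
   case False then show ?thesis using vv[OF cc_in[OF x]] vv[OF cc_in[OF y]] by (simp add: z_def)
  qed
  have "cc x \<otimes> inv cc y = \<Phi> (%i. int N * z i)"
   unfolding z H using vv[OF cc_in[OF x]] vv[OF cc_in[OF y]] by simp
  also have "... = \<Phi> z [^] N" by (rule hm_nat[OF \<Phi>])
  finally have cL: "cc x \<otimes> inv cc y \<in> L" using powL[OF hm_in[OF \<Phi>]] by simp
  have c: "cc x \<in> carrier G" "cc y \<in> carrier G" "tr x \<in> carrier G" using cc_in A_carrier tr_carrier x y by auto
  have "x \<otimes> inv y = (tr x \<otimes> cc x) \<otimes> inv (tr x \<otimes> cc y)" using tr_cc[OF x] tr_cc[OF y] t by metis
  also have "... = tr x \<otimes> (cc x \<otimes> inv cc y) \<otimes> inv (tr x)" using c by (simp add: inv_mult_group m_assoc)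
  also have "... \<in> L" using cL normal.inv_op_closed2[OF nL c(3)] by blast
  finally show ?thesis .
 qed
 have finL: "finite (rcosets L)" by (rule card_rcosets_le(1)[where f = f, OF sL ff]) (rule fL; assumption)
 define K where "K = (\<Sum>x<s. \<Sum>j<m. \<bar>cx x j\<bar>)"
 have "\<exists>v. (\<forall>i\<ge>m. v i = 0) \<and> E v = wd w \<and> (\<forall>i. \<bar>v i\<bar> \<le> K * int (length w))"
  if w: "set w \<subseteq> letters" and wL: "wd w \<in> L" for w
 proof -
  obtain c where c: "\<forall>i\<ge>m. c i = 0" "wd w = E c" using wL unfolding L_def by blast
  have "cc (wd w) = wd w" using cc_A LA wL by blast
  then obtain v where v: "\<forall>i\<ge>s. v i = 0" "\<Phi> v = wd w" "\<forall>i. \<bar>v i\<bar> \<le> int (length w)" using wv[OF w] by auto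
  \<comment> \<open>Both sides are the \<open>N\<close>-th power of the element. By injectivity
    \<open>N * c\<close> equals \<open>d v\<close>, so \<open>c\<close> inherits the linear bound
    from \<open>v\<close>.\<close>
  have "E (%i. int N * c i) = E (d v)"
   using hm_nat[OF hE, of N c] hm_nat[OF \<Phi>, of N v] \<Phi>N[OF v(1)] v(2) c(2) by simp
  then have "E (%i. int N * c i - d v i) = \<one>" using hm_diff[OF hE] hm_carrier[OF hE] by simp
  then have "(%i. int N * c i - d v i) = (%i. 0)" by (intro injE) (simp_all add: c(1) dm)
  then have Nc: "int N * c i = d v i" for i by (metis eq_iff_diff_eq_0)
  have "\<bar>c i\<bar> \<le> K * int (length w)" for i
  proof (cases "i < m")
   case True
   have h1: "\<bar>c i\<bar> \<le> int N * \<bar>c i\<bar>" using N0 mult_right_mono[of 1 "int N" "\<bar>c i\<bar>"] by simp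
   have "\<bar>int N * c i\<bar> = int N * \<bar>c i\<bar>" by (simp add: abs_mult)
   then have h2: "int N * \<bar>c i\<bar> = \<bar>d v i\<bar>" by (simp only: Nc)
   have h3: "\<bar>d v i\<bar> \<le> (\<Sum>x<s. \<bar>v x * cx x i\<bar>)" using True by (simp add: d_def sum_abs)
   have h4: "(\<Sum>x<s. \<bar>v x * cx x i\<bar>) \<le> (\<Sum>x<s. int (length w) * (\<Sum>j<m. \<bar>cx x j\<bar>))"
   proof (rule sum_mono)
    fix x
    have "\<bar>cx x i\<bar> \<le> (\<Sum>j<m. \<bar>cx x j\<bar>)" using True by (intro member_le_sum) auto
    then show "\<bar>v x * cx x i\<bar> \<le> int (length w) * (\<Sum>j<m. \<bar>cx x j\<bar>)"
     unfolding abs_mult using v(3) by (intro mult_mono) auto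
   qed
   have h5: "(\<Sum>x<s. int (length w) * (\<Sum>j<m. \<bar>cx x j\<bar>)) = K * int (length w)"
    by (simp add: K_def sum_distrib_left[symmetric] mult.commute)
   show ?thesis using h1 h2 h3 h4 h5 by linarith
  next
   case False
   have "0 \<le> K" unfolding K_def by (intro sum_nonneg) simp
   then show ?thesis using False c(1) by simp
  qed
  then show ?thesis using c by auto
 qed
 then have "lattice_chart m E K" unfolding lattice_chart_def L_def[symmetric] using hE injE nL finL by blast
 then show ?thesis by blast
qed

end

text \<open>A prime that divides some \<open>k \<le> n\<close> more than once is at most
  \<open>sqrt n\<close>. So the least common multiple divides the product of all primes up to
  \<open>n\<close> and, for each \<open>q\<close> with \<open>2 \<le> q\<close> and
  \<open>q ^ 2 \<le> n\<close>, the largest power of \<open>q\<close> up to \<open>n\<close>. The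
  logarithms of the two parts are at most \<open>n * ln 4\<close> and \<open>sqrt n * ln n\<close>,
  each at most \<open>2 * n\<close>.\<close>

lemma Lcm_bound: "ln (real_of_int (Lcm {1..int n})) \<le> 4 * real n"
proof (cases "n = 0")
 case False
 define D1 where "D1 = \<Prod>{p::nat. is_prime p \<and> p \<le> n}"
 define Q where "Q = {q::nat. 2 \<le> q \<and> q\<^sup>2 \<le> n}"
 define f where "f q = (GREATEST a. q ^ a \<le> n)" for q :: nat
 have aq: "a \<le> n" if "q ^ a \<le> n" "2 \<le> q" for q a :: nat
 proof -
  have "a < 2 ^ a" by (rule less_exp)
  also have "... \<le> q ^ a" using that by (intro power_mono) auto
  finally show ?thesis using that by simp
 qed
 have f: "q ^ f q \<le> n" if "2 \<le> q" for q
  unfolding f_def by (rule GreatestI_nat[of _ 0 n]) (use aq that False in auto)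
 have fg: "a \<le> f q" if "2 \<le> q" "q ^ a \<le> n" for a q
  unfolding f_def by (rule Greatest_le_nat[of _ a n]) (use aq that in auto)
 define D where "D = D1 * (\<Prod>q\<in>Q. q ^ f q)"
 have fQ: "finite Q" unfolding Q_def by (rule finite_subset[of _ "{..n}"]) (auto simp: power2_eq_square intro: le_trans[OF le_square])
 have D1p: "D1 > 0" unfolding D1_def by (rule prod_pos) (use prime_gt_0_nat in auto)
 have D2p: "(\<Prod>q\<in>Q. q ^ f q) > 0" unfolding Q_def by (rule prod_pos) auto
 have "k dvd D" if k: "k \<in> {1..n}" for k
 proof (rule multiplicity_le_imp_dvd)
  show "k \<noteq> 0" using k by simp
  fix p :: nat assume p: "is_prime p"
  define a where "a = multiplicity p k"
  have pa: "p ^ a dvd k" unfolding a_def by (rule multiplicity_dvd)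
  then have pan: "p ^ a \<le> n" using k dvd_imp_le[OF pa] by auto
  have p2: "2 \<le> p" using p by (rule prime_ge_2_nat)
  have "p ^ a dvd D"
  proof (cases "a \<le> 1")
   case True
   then consider "a = 0" | "a = 1" by linarith
   then show ?thesis
   proof cases
    case 2
    then have "p dvd D1" unfolding D1_def using p pan
     by (intro dvd_prodI[where f = "%x. x"]) auto
    then show ?thesis using 2 by (simp add: D_def)
   qed simp
  next
   case False
   then have "p\<^sup>2 \<le> p ^ a" using p2 by (intro power_increasing) auto
   then have "p\<^sup>2 \<le> n" using pan by (rule order_trans)
   then have "p \<in> Q" using p2 by (simp add: Q_def)
   then have "p ^ f p dvd (\<Prod>q\<in>Q. q ^ f q)" using fQ by (intro dvd_prodI) auto
   moreover have "p ^ a dvd p ^ f p" by (rule le_imp_power_dvd) (rule fg[OF p2 pan])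
   ultimately show ?thesis unfolding D_def by (meson dvd_mult dvd_trans)
  qed
  then show "multiplicity p k \<le> multiplicity p D"
   using p D1p D2p unfolding a_def by (intro multiplicity_geI) (auto simp: D_def)
 qed
 then have "int k dvd int D" if "k \<in> {1..n}" for k using that by (simp only: of_nat_dvd_iff)
 then have "z dvd int D" if "z \<in> {1..int n}" for z
  using that by (metis atLeastAtMost_iff int_nat_eq nat_int nat_le_eq_zle of_nat_1 of_nat_le_iff order_trans zero_le_one)
 then have "Lcm {1..int n} dvd int D" by (intro Lcm_least)
 moreover have "D > 0" unfolding D_def by (rule mult_pos_pos[OF D1p D2p])
 then have D0: "int D > 0" by simp
 ultimately have le: "Lcm {1..int n} \<le> int D" by (rule zdvd_imp_le)
 have L0: "Lcm {1..int n} > 0"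
  using Lcm_0_iff[of "{1..int n}"] by (simp add: order_less_le)
 have "real_of_int (Lcm {1..int n}) \<le> real D" using le by linarith
 then have "ln (real_of_int (Lcm {1..int n})) \<le> ln (real D)" using L0 by (intro ln_mono) auto
 also have "... = ln (real D1) + ln (\<Prod>q\<in>Q. real (q ^ f q))"
 proof -
  have "real D = real D1 * (\<Prod>q\<in>Q. real (q ^ f q))" by (simp add: D_def)
  moreover have "(\<Prod>q\<in>Q. real (q ^ f q)) > 0" by (rule prod_pos) (auto simp: Q_def)
  ultimately show ?thesis using D1p by (simp add: ln_mult)
 qed
 also have "... \<le> real n * ln 4 + real (card Q) * ln (real n)"
 proof (rule add_mono)
  have "real D1 \<le> real (4 ^ n)" unfolding D1_def using primorial_le[of n] by (simp only: of_nat_le_iff)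
  then have "ln (real D1) \<le> ln (4 ^ n)" using D1p by (intro ln_mono) auto
  then show "ln (real D1) \<le> real n * ln 4" by (simp add: ln_realpow)
  have "ln (\<Prod>q\<in>Q. real (q ^ f q)) = (\<Sum>q\<in>Q. ln (real (q ^ f q)))"
   by (rule ln_prod[OF fQ]) (auto simp: Q_def)
  also have "... \<le> (\<Sum>q\<in>Q. ln (real n))"
  proof (rule sum_mono)
   fix q assume "q \<in> Q"
   then have q: "2 \<le> q" by (simp add: Q_def)
   have "real (q ^ f q) \<le> real n" using f[OF q] by (simp only: of_nat_le_iff)
   then show "ln (real (q ^ f q)) \<le> ln (real n)" using q by (intro ln_mono) auto
  qed
  finally show "ln (\<Prod>q\<in>Q. real (q ^ f q)) \<le> real (card Q) * ln (real n)" by simp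
 qed
 also have "... \<le> real n * 2 + 2 * real n"
 proof (rule add_mono)
  have "ln (4::real) \<le> 2"
  proof -
   have "ln (4::real) = 2 * ln 2" using ln_realpow[of 2 2] by simp
   then show ?thesis using ln_le_minus_one[of "2::real"] by simp
  qed
  then show "real n * ln 4 \<le> real n * 2" by (intro mult_left_mono) auto
  have "Q \<subseteq> {1..nat \<lfloor>sqrt (real n)\<rfloor>}"
  proof
   fix q assume q: "q \<in> Q"
   then have "real (q\<^sup>2) \<le> real n" unfolding Q_def by (simp only: mem_Collect_eq of_nat_le_iff)
   then have "real q \<le> sqrt (real n)" by (intro real_le_rsqrt) simp
   then have "int q \<le> \<lfloor>sqrt (real n)\<rfloor>" by (simp add: le_floor_iff)
   then show "q \<in> {1..nat \<lfloor>sqrt (real n)\<rfloor>}" using q by (auto simp: Q_def)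
  qed
  then have "card Q \<le> nat \<lfloor>sqrt (real n)\<rfloor>" using card_mono[OF finite_atLeastAtMost, of Q 1 "nat \<lfloor>sqrt (real n)\<rfloor>"] by simp
  then have "real (card Q) \<le> real (nat \<lfloor>sqrt (real n)\<rfloor>)" by (simp only: of_nat_le_iff)
  also have "... = of_int \<lfloor>sqrt (real n)\<rfloor>" by simp
  also have "... \<le> sqrt (real n)" by (rule of_int_floor_le)
  finally have "real (card Q) \<le> sqrt (real n)" .
  moreover have "ln (real n) \<le> 2 * sqrt (real n)"
  proof -
   have "ln (real n) = 2 * ln (sqrt (real n))" using False by (simp add: ln_sqrt)
   moreover have "ln (sqrt (real n)) \<le> sqrt (real n)" using ln_le_minus_one[of "sqrt (real n)"] False by simp
   ultimately show ?thesis by simp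
  qed
  ultimately have "real (card Q) * ln (real n) \<le> sqrt (real n) * (2 * sqrt (real n))"
   using False by (intro mult_mono) auto
  also have "... = 2 * real n" by simp
  finally show "real (card Q) * ln (real n) \<le> 2 * real n" .
 qed
 finally show ?thesis by simp
qed simp

section \<open>Growth of residual finiteness\<close>

lemma vecs_scale: "(of_int k :: nat => int) * v = (%i. k * v i)"
 by (rule ext) (simp only: times_fun_def of_int_fun_apply of_int_eq_id id_apply)

section \<open>The conjugation action in coordinates\<close>

context virt_abelian
begin

context
 fixes m E K
 assumes chart: "lattice_chart m E K"
begin

definition "L = E ` vecs m"

lemma hE: "hm E" using chart by (simp add: lattice_chart_def)

lemma nL: "L \<lhd> G" and finL: "finite (rcosets L)"
 using chart unfolding lattice_chart_def L_def vecs_def by blast+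

lemma sL: "subgroup L G" using nL by (rule normal_imp_subgroup)

lemma E_add: "E (v + w) = E v \<otimes> E w"
 using hm_add[OF hE, of v w] by (simp only: plus_fun_def)

lemma E_diff: "E (v - w) = E v \<otimes> inv E w"
 using hm_diff[OF hE, of v w] by (simp only: fun_diff_def)

lemma E_zero: "E 0 = \<one>"
 using hm_zero[OF hE] by (simp only: zero_fun_def)

lemma E_carrier: "E v \<in> carrier G" by (rule hm_carrier[OF hE])

lemma E_scale: "E (of_int (int n) * v) = E v [^] n"
 unfolding vecs_scale by (rule hm_nat[OF hE])

lemma E_one: "v \<in> vecs m ==> E v = \<one> ==> v = 0"
 using chart unfolding lattice_chart_def vecs_def zero_fun_def by blast

lemma E_inj: assumes "v \<in> vecs m" "w \<in> vecs m" "E v = E w" shows "v = w"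
proof -
 have "E (v - w) = \<one>" unfolding E_diff assms(3) by (rule r_inv[OF E_carrier])
 then have "v - w = 0" by (rule E_one[OF subgrp_diff[OF subgrp_vecs assms(1,2)]])
 then show ?thesis by (simp only: right_minus_eq)
qed

text \<open>Conjugation by \<open>x\<close>, read in the coordinates of the chart. The value 0
  outside the lattice is the one that the locale \<open>latt\<close> prescribes.\<close>

definition "act x v = (if v \<in> vecs m then (SOME w. w \<in> vecs m \<and> E w = x \<otimes> E v \<otimes> inv x) else 0)"

lemma act: assumes "x \<in> carrier G" "v \<in> vecs m" shows "act x v \<in> vecs m" "E (act x v) = x \<otimes> E v \<otimes> inv x"
proof -
 have "x \<otimes> E v \<otimes> inv x \<in> L" by (rule normal.inv_op_closed2[OF nL assms(1)]) (use assms(2) in \<open>simp add: L_def\<close>)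
 then have "\<exists>w. w \<in> vecs m \<and> E w = x \<otimes> E v \<otimes> inv x" unfolding L_def by force
 then have "(SOME w. w \<in> vecs m \<and> E w = x \<otimes> E v \<otimes> inv x) \<in> vecs m \<and>
   E (SOME w. w \<in> vecs m \<and> E w = x \<otimes> E v \<otimes> inv x) = x \<otimes> E v \<otimes> inv x" by (rule someI_ex)
 then show "act x v \<in> vecs m" "E (act x v) = x \<otimes> E v \<otimes> inv x" using assms(2) by (simp_all add: act_def)
qed

lemma act_outside: "v \<notin> vecs m ==> act x v = 0" by (simp add: act_def)

lemma act_zero: assumes "x \<in> carrier G" shows "act x 0 = 0"
proof (rule E_one)
 have z: "0 \<in> vecs m" by (rule subgrp_zero[OF subgrp_vecs])
 show "act x 0 \<in> vecs m" by (rule act(1)[OF assms z])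
 show "E (act x 0) = \<one>" unfolding act(2)[OF assms z] E_zero using assms by simp
qed

lemma act_mult: assumes x: "x \<in> carrier G" and y: "y \<in> carrier G" shows "act x \<circ> act y = act (x \<otimes> y)"
proof
 fix v
 show "(act x \<circ> act y) v = act (x \<otimes> y) v"
 proof (cases "v \<in> vecs m")
  case True
  have xy: "x \<otimes> y \<in> carrier G" using x y by simp
  have "E (act x (act y v)) = x \<otimes> (y \<otimes> E v \<otimes> inv y) \<otimes> inv x"
   by (simp only: act(2)[OF x act(1)[OF y True]] act(2)[OF y True])
  also have "... = (x \<otimes> y) \<otimes> E v \<otimes> inv (x \<otimes> y)"
   using x y E_carrier[of v] by (simp add: inv_mult_group m_assoc)
  also have "... = E (act (x \<otimes> y) v)" by (simp only: act(2)[OF xy True])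
  finally have "act x (act y v) = act (x \<otimes> y) v"
   by (rule E_inj[OF act(1)[OF x act(1)[OF y True]] act(1)[OF xy True]])
  then show ?thesis by simp
 next
  case False
  then show ?thesis by (simp only: o_apply act_outside act_zero[OF x] not_False_eq_True)
 qed
qed

lemma act_one: assumes "v \<in> vecs m" shows "act \<one> v = v"
proof (rule E_inj[OF act(1)[OF one_closed assms] assms])
 show "E (act \<one> v) = E v" unfolding act(2)[OF one_closed assms] using E_carrier[of v] by simp
qed

lemma act_add: assumes x: "x \<in> carrier G" and v: "v \<in> vecs m" and w: "w \<in> vecs m"
 shows "act x (v + w) = act x v + act x w"
proof (rule E_inj)
 have vw: "v + w \<in> vecs m" by (rule subgrp_add[OF subgrp_vecs v w])
 show "act x (v + w) \<in> vecs m" by (rule act(1)[OF x vw])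
 show "act x v + act x w \<in> vecs m" by (rule subgrp_add[OF subgrp_vecs act(1)[OF x v] act(1)[OF x w]])
 have c: "E v \<in> carrier G" "E w \<in> carrier G" "inv x \<in> carrier G" using E_carrier x by auto
 have "E (act x v + act x w) = (x \<otimes> E v \<otimes> inv x) \<otimes> (inv (inv x) \<otimes> (E w \<otimes> inv x))"
  using x c by (simp add: E_add act(2)[OF x v] act(2)[OF x w] m_assoc)
 also have "... = (x \<otimes> E v) \<otimes> (E w \<otimes> inv x)" using x c by (intro cancel_mid) auto
 also have "... = x \<otimes> E (v + w) \<otimes> inv x" using x c by (simp add: E_add m_assoc)
 finally show "E (act x (v + w)) = E (act x v + act x w)" by (simp only: act(2)[OF x vw])
qed

text \<open>The image of \<open>E\<close> lies in the commutative group \<open>A\<close>, on which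
  \<open>A\<close> acts trivially by conjugation. The action therefore depends only on the coset
  modulo \<open>A\<close>, and the acting group is finite.\<close>

lemma act_tr: assumes x: "x \<in> carrier G" shows "act x = act (tr x)"
proof
 fix v
 show "act x v = act (tr x) v"
 proof (cases "v \<in> vecs m")
  case True
  obtain a where a: "a \<in> A" "tr x = a \<otimes> x" by (rule trE[OF x])
  have aG: "a \<in> carrier G" by (rule A_carrier[OF a(1)])
  define y where "y = x \<otimes> E v \<otimes> inv x"
  have yA: "y \<in> A" unfolding y_def by (rule A_conj(1)[OF x hm_in[OF hE]])
  have yG: "y \<in> carrier G" by (rule A_carrier[OF yA])
  have "E (act (tr x) v) = a \<otimes> y \<otimes> inv a"
   using aG x E_carrier[of v] unfolding act(2)[OF tr_carrier[OF x] True] unfolding a(2) y_def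
   by (simp add: inv_mult_group m_assoc)
  also have "... = y" using comm[OF a(1) yA] aG yG by (simp add: m_assoc)
  also have "... = E (act x v)" by (simp only: act(2)[OF x True] y_def)
  finally show ?thesis using E_inj[OF act(1)[OF tr_carrier[OF x] True] act(1)[OF x True]] by simp
 qed (simp only: act_outside not_False_eq_True)
qed

lemma latt_act: "latt m (act ` carrier G)"
proof
 have "act ` carrier G \<subseteq> (%C. act (tau C)) ` (rcosets A)"
 proof
  fix h assume "h \<in> act ` carrier G"
  then obtain x where x: "x \<in> carrier G" "h = act x" by blast
  have "A #> x \<in> rcosets A" unfolding RCOSETS_def using x by blast
  moreover have "h = act (tau (A #> x))" using act_tr[OF x(1)] x(2) by (simp only: tr_def)
  ultimately show "h \<in> (%C. act (tau C)) ` (rcosets A)" by blast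
 qed
 then show "finite (act ` carrier G)" by (rule finite_subset) (rule finite_imageI[OF finA])
 show "\<exists>\<epsilon>\<in>act ` carrier G. \<forall>v\<in>vecs m. \<epsilon> v = v" using act_one one_closed by blast
next
 fix \<alpha> \<beta> assume "\<alpha> \<in> act ` carrier G" "\<beta> \<in> act ` carrier G"
 then obtain x y where "x \<in> carrier G" "y \<in> carrier G" "\<alpha> = act x" "\<beta> = act y" by blast
 then show "\<alpha> \<circ> \<beta> \<in> act ` carrier G" using act_mult m_closed by simp
next
 fix \<alpha> assume "\<alpha> \<in> act ` carrier G"
 then obtain x where x: "x \<in> carrier G" "\<alpha> = act x" by blast
 have i: "inv x \<in> carrier G" using x by simp
 have "act (inv x) (act x v) = v \<and> act x (act (inv x) v) = v" if "v \<in> vecs m" for v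
  using fun_cong[OF act_mult[OF i x(1)], of v] fun_cong[OF act_mult[OF x(1) i], of v] act_one[OF that] x(1) by simp
 then show "\<exists>\<beta>\<in>act ` carrier G. \<forall>v\<in>vecs m. \<beta> (\<alpha> v) = v \<and> \<alpha> (\<beta> v) = v" using x(2) i by blast
next
 fix \<alpha> v assume "\<alpha> \<in> act ` carrier G" "v \<notin> vecs m"
 then show "\<alpha> v = 0" using act_outside by blast
next
 fix \<alpha> v assume "\<alpha> \<in> act ` carrier G" "v \<in> vecs m"
 then show "\<alpha> v \<in> vecs m" using act(1) by blast
next
 fix \<alpha> v w assume "\<alpha> \<in> act ` carrier G" "v \<in> vecs m" "w \<in> vecs m"
 then show "\<alpha> (v + w) = \<alpha> v + \<alpha> w" using act_add by blast
qed

interpretation latt m "act ` carrier G" by (rule latt_act)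

section \<open>Transfer between invariant sublattices and normal subgroups\<close>

lemma coset_repr:
 assumes N: "subgroup N G" and x: "x \<in> carrier G" and y: "y \<in> carrier G"
 shows "N #> x = N #> y ==> x \<otimes> inv y \<in> N"
proof -
 assume "N #> x = N #> y"
 then have "x \<in> N #> y" using rcos_self[OF x N] by simp
 then obtain a where a: "a \<in> N" "x = a \<otimes> y" unfolding r_coset_def by blast
 then have "x \<otimes> inv y = a" using y subgroup.mem_carrier[OF N] by (simp add: m_assoc)
 then show ?thesis using a by simp
qed

text \<open>\<open>N\<close> is the image of the separating \<open>M\<close>. A group element is
  labelled by its coset modulo \<open>L\<close> and by the \<open>F\<close>-label of its quotient by
  the representative of that coset, which costs only the index of \<open>L\<close> as an additional
  factor.\<close>

lemma separable_index:
 assumes v: "v \<in> vecs m" and sep: "separable v B"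
 shows "\<exists>N \<in> fin_index_normal G. E v \<notin> N \<and> real (card (rcosets N)) \<le> real (card (rcosets L)) * B"
proof -
 obtain M and F :: "(nat => int) => complex set list" where M: "invar M" "v \<notin> M"
  and F: "\<forall>a\<in>vecs m. \<forall>b\<in>vecs m. F a = F b --> a - b \<in> M" "finite (F ` vecs m)" "real (card (F ` vecs m)) \<le> B"
  using sep unfolding separable_def by blast
 have sM: "subgrp M" "M \<subseteq> vecs m" and HM: "\<And>x u. x \<in> carrier G ==> u \<in> M ==> act x u \<in> M"
  using M(1) unfolding invar_def by blast+
 define N where "N = E ` M"
 have sN: "subgroup N G"
 proof (rule subgroupI)
  show "N \<subseteq> carrier G" unfolding N_def using E_carrier by blast
  show "N \<noteq> {}" unfolding N_def using subgrp_zero[OF sM(1)] by blast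
  fix a assume "a \<in> N"
  then obtain u where u: "u \<in> M" "a = E u" unfolding N_def by blast
  have "E (0 - u) = inv a" unfolding E_diff E_zero u(2) using E_carrier[of u] by simp
  then show "inv a \<in> N" unfolding N_def using subgrp_diff[OF sM(1) subgrp_zero[OF sM(1)] u(1)] by (metis imageI)
  fix b assume "b \<in> N"
  then obtain w where w: "w \<in> M" "b = E w" unfolding N_def by blast
  have "E (u + w) = a \<otimes> b" unfolding E_add u(2) w(2) ..
  then show "a \<otimes> b \<in> N" unfolding N_def using subgrp_add[OF sM(1) u(1) w(1)] by (metis imageI)
 qed
 have nN: "N \<lhd> G" unfolding normal_inv_iff
 proof (intro conjI ballI sN)
  fix x y assume x: "x \<in> carrier G" and "y \<in> N"
  then obtain u where u: "u \<in> M" "y = E u" unfolding N_def by blast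
  have "x \<otimes> y \<otimes> inv x = E (act x u)" unfolding u(2) using act(2)[OF x] u(1) sM(2) by auto
  then show "x \<otimes> y \<otimes> inv x \<in> N" unfolding N_def using HM[OF x u(1)] by simp
 qed
 have vN: "E v \<notin> N"
 proof
  assume "E v \<in> N"
  then obtain u where u: "u \<in> M" "E v = E u" unfolding N_def by blast
  then have "v = u" using E_inj[OF v] sM(2) by blast
  then show False using M(2) u(1) by blast
 qed
 define \<rho> where "\<rho> C = (SOME y. y \<in> C)" for C :: "'a set"
 have \<rho>: "\<rho> (L #> x) \<in> L #> x" if "x \<in> carrier G" for x
  unfolding \<rho>_def by (rule someI[of "%y. y \<in> L #> x", OF rcos_self[OF that sL]])
 have \<rho>G: "\<rho> (L #> x) \<in> carrier G" if x: "x \<in> carrier G" for x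
  using \<rho>[OF x] r_coset_subset_G[OF subgroup.subset[OF sL] x] by blast
 define cv where "cv x = (SOME u. u \<in> vecs m \<and> E u = x \<otimes> inv \<rho> (L #> x))" for x
 have cv: "cv x \<in> vecs m \<and> E (cv x) = x \<otimes> inv \<rho> (L #> x)" if x: "x \<in> carrier G" for x
 proof -
  have "L #> x = L #> \<rho> (L #> x)" by (rule repr_independence[OF \<rho>[OF x] x sL])
  then have "x \<otimes> inv \<rho> (L #> x) \<in> L" by (rule coset_repr[OF sL x \<rho>G[OF x]])
  then have "\<exists>u. u \<in> vecs m \<and> E u = x \<otimes> inv \<rho> (L #> x)" unfolding L_def by force
  then show ?thesis unfolding cv_def by (rule someI_ex)
 qed
 define f where "f x = (L #> x, F (cv x))" for x
 have sub: "f ` carrier G \<subseteq> (rcosets L) \<times> F ` vecs m"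
  unfolding f_def RCOSETS_def using cv by blast
 have fin: "finite ((rcosets L) \<times> F ` vecs m)" by (intro finite_cartesian_product finL F(2))
 have ff: "finite (f ` carrier G)" by (rule finite_subset[OF sub fin])
 have fN: "x \<otimes> inv y \<in> N" if x: "x \<in> carrier G" and y: "y \<in> carrier G" and eq: "f x = f y" for x y
 proof -
  have Lxy: "L #> x = L #> y" and Fxy: "F (cv x) = F (cv y)" using eq by (simp_all add: f_def)
  define z where "z = \<rho> (L #> x)"
  have z: "z \<in> carrier G" unfolding z_def by (rule \<rho>G[OF x])
  have ex: "E (cv x) = x \<otimes> inv z" and ey: "E (cv y) = y \<otimes> inv z" using cv[OF x] cv[OF y] by (simp_all add: z_def Lxy)
  have "cv x - cv y \<in> M" using F(1) cv[OF x] cv[OF y] Fxy by blast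
  moreover have "E (cv x - cv y) = x \<otimes> inv y"
  proof -
   have "E (cv x - cv y) = (x \<otimes> inv z) \<otimes> (inv (inv z) \<otimes> inv y)"
    unfolding E_diff ex ey using y z by (simp add: inv_mult_group)
   also have "... = x \<otimes> inv y" using x y z by (intro cancel_mid) auto
   finally show ?thesis .
  qed
  ultimately show ?thesis unfolding N_def by (metis imageI)
 qed
 have cr: "finite (rcosets N)" "card (rcosets N) \<le> card (f ` carrier G)"
  by (rule card_rcosets_le[where f = f, OF sN ff], rule fN; assumption)+
 have "card (rcosets N) \<le> card (rcosets L) * card (F ` vecs m)"
  using order_trans[OF cr(2) card_mono[OF fin sub]] by (simp only: card_cartesian_product)
 then have le1: "real (card (rcosets N)) \<le> real (card (rcosets L)) * real (card (F ` vecs m))"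
  by (simp only: of_nat_mult[symmetric] of_nat_le_iff)
 have "real (card (rcosets L)) * real (card (F ` vecs m)) \<le> real (card (rcosets L)) * B"
  using F(3) by (intro mult_left_mono) simp_all
 with le1 have "real (card (rcosets N)) \<le> real (card (rcosets L)) * B" by (rule order_trans)
 then show ?thesis using nN cr(1) vN unfolding fin_index_normal_def by blast
qed

lemma power_in_finite_index:
 assumes N: "N \<lhd> G" "finite (rcosets N)" and x: "x \<in> carrier G"
 shows "\<exists>n>0. x [^] (n::nat) \<in> N"
proof -
 have sN: "subgroup N G" by (rule normal_imp_subgroup[OF N(1)])
 have "range (%i::nat. N #> x [^] i) \<subseteq> rcosets N" unfolding RCOSETS_def using x by blast
 then have "finite (range (%i::nat. N #> x [^] i))" using N(2) by (rule finite_subset)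
 then have "\<not> inj (%i::nat. N #> x [^] i)" using finite_imageD infinite_UNIV_nat by blast
 then obtain i j :: nat where ij: "i \<noteq> j" "N #> x [^] i = N #> x [^] j" unfolding inj_def by blast
 have *: "\<exists>n>0. x [^] (n::nat) \<in> N" if ij: "i < j" "N #> x [^] j = N #> x [^] i" for i j :: nat
 proof -
  have "x [^] j = x [^] (j - i) \<otimes> x [^] i" using ij(1) x by (simp add: nat_pow_mult)
  then have "x [^] j \<otimes> inv (x [^] i) = x [^] (j - i)" using x by (simp add: m_assoc)
  moreover have "x [^] j \<otimes> inv (x [^] i) \<in> N" by (rule coset_repr[OF sN _ _ ij(2)]) (use x in simp_all)
  ultimately show ?thesis using ij(1) by (intro exI[of _ "j - i"]) simp
 qed
 show ?thesis using *[of i j] *[of j i] ij by (cases "i < j") auto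
qed

text \<open>The vectors mapped into \<open>N\<close> form an invariant subgroup because
  \<open>N\<close> is normal; vectors incongruent modulo it lie in distinct cosets of
  \<open>N\<close>. A power of \<open>E g\<close> falls into \<open>N\<close> as the index is
  finite.\<close>

lemma lower_index:
 assumes m: "m > 0"
 obtains g B where "g \<in> vecs m" "g \<noteq> 0" "B > (0::real)"
  "\<And>N n. N \<in> fin_index_normal G ==> E (of_int (Lcm {1..int n}) * g) \<notin> N ==> (real n / B) ^ rdim \<le> real (card (rcosets N))"
proof -
 obtain g N0 where g: "g \<in> vecs m" "g \<noteq> 0" and N0: "N0 > (0::int)"
  and low: "\<And>M s n. invar M ==> s > 0 ==> of_int s * g \<in> M ==> of_int (Lcm {1..int n}) * g \<notin> M ==>
   \<exists>E'. finite E' \<and> E' \<subseteq> vecs m \<and> (\<forall>a\<in>E'. \<forall>b\<in>E'. a - b \<in> M --> a = b) \<and> (real n / of_int N0) ^ rdim \<le> real (card E')"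
  by (rule lower[OF m]) (rule that; assumption)
 have "(real n / of_int N0) ^ rdim \<le> real (card (rcosets N))"
  if N: "N \<in> fin_index_normal G" and nN: "E (of_int (Lcm {1..int n}) * g) \<notin> N" for N n
 proof -
  have nm: "N \<lhd> G" "finite (rcosets N)" using N by (simp_all add: fin_index_normal_def)
  have sN: "subgroup N G" by (rule normal_imp_subgroup[OF nm(1)])
  define M where "M = {v \<in> vecs m. E v \<in> N}"
  have "subgrp M" unfolding subgrp_def
  proof (intro conjI ballI)
   show "0 \<in> M" unfolding M_def using subgrp_zero[OF subgrp_vecs] subgroup.one_closed[OF sN] E_zero by auto
   fix a b assume "a \<in> M" "b \<in> M"
   then have ab: "a \<in> vecs m" "b \<in> vecs m" "E a \<in> N" "E b \<in> N" unfolding M_def by blast+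
   have "E (a - b) \<in> N" unfolding E_diff by (rule subgroup.m_closed[OF sN ab(3) subgroup.m_inv_closed[OF sN ab(4)]])
   then show "a - b \<in> M" unfolding M_def using subgrp_diff[OF subgrp_vecs ab(1,2)] by blast
  qed
  moreover have "act x v \<in> M" if x: "x \<in> carrier G" and v: "v \<in> M" for x v
  proof -
   have v': "v \<in> vecs m" "E v \<in> N" using v unfolding M_def by blast+
   show ?thesis unfolding M_def using act[OF x v'(1)] normal.inv_op_closed2[OF nm(1) x v'(2)] by simp
  qed
  ultimately have inv: "invar M" unfolding invar_def by (auto simp: M_def)
  obtain s :: nat where s: "s > 0" "E g [^] s \<in> N" using power_in_finite_index[OF nm E_carrier[of g]] by blast
  have sM: "of_int (int s) * g \<in> M"
   unfolding M_def using s(2) E_scale[of s g] subgrp_scale[OF subgrp_vecs g(1), of "int s"] by simp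
  have "of_int (Lcm {1..int n}) * g \<notin> M" using nN unfolding M_def by blast
  from low[OF inv _ sM this] s(1) obtain E' where E': "finite E'" "E' \<subseteq> vecs m" "\<forall>a\<in>E'. \<forall>b\<in>E'. a - b \<in> M --> a = b"
   "(real n / of_int N0) ^ rdim \<le> real (card E')" by auto
  have "inj_on (%v. N #> E v) E'"
  proof (rule inj_onI)
   fix a b assume ab: "a \<in> E'" "b \<in> E'" "N #> E a = N #> E b"
   have "E (a - b) \<in> N" unfolding E_diff by (rule coset_repr[OF sN E_carrier E_carrier ab(3)])
   moreover have "a - b \<in> vecs m" using subgrp_diff[OF subgrp_vecs] ab(1,2) E'(2) by blast
   ultimately have "a - b \<in> M" unfolding M_def by blast
   then show "a = b" using E'(3) ab(1,2) by blast
  qed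
  moreover have "(%v. N #> E v) ` E' \<subseteq> rcosets N" unfolding RCOSETS_def using E_carrier by blast
  ultimately have "card E' \<le> card (rcosets N)" by (rule card_inj_on_le[OF _ _ nm(2)])
  then have "real (card E') \<le> real (card (rcosets N))" by (simp only: of_nat_le_iff)
  then show ?thesis using E'(4) by linarith
 qed
 then show thesis using that[OF g, of "of_int N0"] N0 by simp
qed

lemma upper_index:
 "\<exists>B>0. \<exists>D\<ge>1. \<forall>w r. set w \<subseteq> letters --> wd w \<noteq> \<one> --> r \<ge> 1 --> real (length w) \<le> r -->
  (\<exists>N\<in>fin_index_normal G. wd w \<notin> N \<and> real (card (rcosets N)) \<le> B * (ln (D * r)) ^ rdim) \<and> 1 \<le> B * (ln (D * r)) ^ rdim"
proof -
 obtain C0 where C0: "C0 > 0" and up: "\<And>Y g. Y \<ge> 2 ==> g \<in> vecs m ==> (\<forall>i<m. real_of_int \<bar>g i\<bar> \<le> Y) ==> g \<noteq> 0 ==>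
   separable g ((C0 * ln Y) ^ rdim)"
  using upper by blast
 \<comment> \<open>The summand 3 makes \<open>D * r\<close> at least \<open>exp 1\<close>, so that
   its logarithm is at least 1; the other makes \<open>D * r\<close> a bound for the coordinates of
   words of length at most \<open>r\<close>.\<close>
 define D where "D = 3 + real_of_int \<bar>K\<bar>"
 \<comment> \<open>The summand 1 keeps \<open>C * ln Y\<close> at least 1. The bound then also
   covers the index of \<open>L\<close>, which is the separating subgroup for elements outside
   \<open>L\<close>.\<close>
 define C where "C = 1 + C0"
 define I0 where "I0 = real (card (rcosets L))"
 have "L #> \<one> \<in> rcosets L" unfolding RCOSETS_def by blast
 then have "card (rcosets L) > 0" using finL card_gt_0_iff by blast
 then have I0: "I0 \<ge> 1" by (simp add: I0_def)
 define B where "B = I0 * C ^ rdim"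
 have B: "B > 0" using I0 C0 by (simp add: B_def C_def)
 have "(\<exists>N\<in>fin_index_normal G. wd w \<notin> N \<and> real (card (rcosets N)) \<le> B * (ln (D * r)) ^ rdim) \<and> 1 \<le> B * (ln (D * r)) ^ rdim"
  if w: "set w \<subseteq> letters" "wd w \<noteq> \<one>" and r: "r \<ge> 1" "real (length w) \<le> r" for w r
 proof -
  define Y where "Y = D * r"
  have D3: "D \<ge> 3" by (simp add: D_def)
  have "D * 1 \<le> D * r" using r(1) D3 by (intro mult_left_mono) auto
  then have "D \<le> D * r" by (simp only: mult_1_right)
  with D3 have "3 \<le> D * r" by (rule order_trans)
  then have Y: "Y \<ge> 3" by (simp only: Y_def)
  have "exp 1 \<le> Y" using exp_le Y by linarith
  then have lnY: "1 \<le> ln Y" using Y by (simp add: ln_ge_iff)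
  have Bl: "B * ln Y ^ rdim = I0 * (C * ln Y) ^ rdim" by (simp add: B_def power_mult_distrib mult.assoc)
  have "1 * 1 \<le> C * ln Y" using lnY C0 by (intro mult_mono) (auto simp: C_def)
  then have p1: "1 \<le> (C * ln Y) ^ rdim" by (intro one_le_power) simp
  then have I1: "I0 \<le> I0 * (C * ln Y) ^ rdim" using I0 by simp
  have "\<exists>N\<in>fin_index_normal G. wd w \<notin> N \<and> real (card (rcosets N)) \<le> I0 * (C * ln Y) ^ rdim"
  proof (cases "wd w \<in> L")
   case False
   then show ?thesis using nL finL I1 unfolding fin_index_normal_def I0_def by blast
  next
   case True
   then obtain v where v: "\<forall>i\<ge>m. v i = 0" "E v = wd w" "\<forall>i. \<bar>v i\<bar> \<le> K * int (length w)"
    using chart w(1) unfolding lattice_chart_def L_def vecs_def by blast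
   have vV: "v \<in> vecs m" using v(1) by (simp add: vecs_def)
   have "real_of_int \<bar>v i\<bar> \<le> Y" for i
   proof -
    have "real_of_int \<bar>v i\<bar> \<le> real_of_int (K * int (length w))" using v(3) by (simp only: of_int_le_iff)
    moreover have "real_of_int K * real (length w) \<le> real_of_int \<bar>K\<bar> * r" using r by (intro mult_mono) auto
    moreover have "real_of_int \<bar>K\<bar> * r \<le> Y" using r(1) by (simp add: Y_def D_def distrib_right)
    ultimately show ?thesis by simp
   qed
   moreover have "v \<noteq> 0" using w(2) v(2) E_zero by metis
   ultimately have "separable v ((C0 * ln Y) ^ rdim)" using up[OF _ vV] Y by simp
   moreover have "(C0 * ln Y) ^ rdim \<le> (C * ln Y) ^ rdim"
    using C0 lnY by (intro power_mono mult_right_mono) (auto simp: C_def)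
   ultimately have "separable v ((C * ln Y) ^ rdim)" by (rule separable_mono)
   from separable_index[OF vV this] show ?thesis unfolding v(2) I0_def .
  qed
  moreover have "1 \<le> I0 * (C * ln Y) ^ rdim" using I1 I0 by linarith
  ultimately show ?thesis unfolding Y_def[symmetric] Bl by blast
 qed
 moreover have "D \<ge> 1" by (simp add: D_def)
 ultimately show ?thesis using B by blast
qed

lemma wd_power: "set w \<subseteq> carrier G ==> wd (concat (replicate n w)) = wd w [^] n"
proof (induction n)
 case (Suc n)
 have "set (concat (replicate n w)) \<subseteq> carrier G" using Suc.prems by (auto split: if_splits)
 then have "wd (concat (replicate (Suc n) w)) = wd w \<otimes> wd w [^] n"
  using wd_append[OF Suc.prems, of "concat (replicate n w)"] Suc by simp
 also have "... = wd w [^] Suc n" using wd_closed[OF Suc.prems] by (simp only: nat_pow_Suc2)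
 finally show ?case .
qed simp

section \<open>From the divisibility of elements to the growth function\<close>

lemma word_ball_iff: "x \<in> word_ball G S r \<longleftrightarrow> (\<exists>w. x = wd w \<and> set w \<subseteq> letters \<and> real (length w) \<le> r)"
 unfolding word_ball_def by blast

lemma finite_word_ball: "finite (word_ball G S r)"
proof (rule finite_subset)
 show "word_ball G S r \<subseteq> (%w. wd w) ` {w. set w \<subseteq> letters \<and> length w \<le> nat \<lfloor>r\<rfloor>}"
 proof
  fix x assume "x \<in> word_ball G S r"
  then obtain w where w: "x = wd w" "set w \<subseteq> letters" "real (length w) \<le> r" unfolding word_ball_iff by blast
  have "int (length w) \<le> \<lfloor>r\<rfloor>" using w(3) by (simp add: le_floor_iff)
  then have "length w \<le> nat \<lfloor>r\<rfloor>" by linarith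
  then show "x \<in> (%w. wd w) ` {w. set w \<subseteq> letters \<and> length w \<le> nat \<lfloor>r\<rfloor>}" using w by blast
 qed
 show "finite ((%w. wd w) ` {w. set w \<subseteq> letters \<and> length w \<le> nat \<lfloor>r\<rfloor>})"
  by (intro finite_imageI finite_lists_length_le) (use finS in simp)
qed

lemma divisibility_le: "N \<in> fin_index_normal G ==> x \<notin> N ==> divisibility G x \<le> card (rcosets N)"
 unfolding divisibility_def by (intro cInf_lower) auto

text \<open>Residual finiteness is a by-product of the upper bound, applied to any word for
  \<open>x\<close>; it turns the infimum into a minimum.\<close>

lemma divisibility_attained:
 assumes x: "x \<in> carrier G" "x \<noteq> \<one>"
 shows "\<exists>N \<in> fin_index_normal G. x \<notin> N \<and> divisibility G x = card (rcosets N) \<and> divisibility G x \<ge> 1"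
proof -
 obtain w where w: "set w \<subseteq> letters" "wd w = x" using word_exists[OF x(1)] by blast
 obtain N where "N \<in> fin_index_normal G" "x \<notin> N"
  using upper_index w x(2) by (metis max.cobounded1 max.cobounded2)
 then have "{card (rcosets N) | N. N \<in> fin_index_normal G \<and> x \<notin> N} \<noteq> {}" by blast
 from Inf_nat_def1[OF this] obtain N where N: "N \<in> fin_index_normal G" "x \<notin> N" "divisibility G x = card (rcosets N)"
  unfolding divisibility_def by auto
 have "N #> \<one> \<in> rcosets N" unfolding RCOSETS_def by blast
 moreover have "finite (rcosets N)" using N(1) by (simp add: fin_index_normal_def)
 ultimately have "card (rcosets N) > 0" using card_gt_0_iff by blast
 then show ?thesis using N by auto
qed

lemma RF_ge: "x \<in> word_ball G S r ==> x \<noteq> \<one> ==> real (divisibility G x) \<le> RF G S r"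
proof -
 assume x: "x \<in> word_ball G S r" "x \<noteq> \<one>"
 then have "divisibility G x \<le> Max (divisibility G ` (word_ball G S r - {\<one>}))"
  using finite_word_ball by (intro Max_ge) auto
 moreover have "word_ball G S r - {\<one>} \<noteq> {}" using x by blast
 ultimately show ?thesis unfolding RF_def by simp
qed

lemma word_ball_carrier: "x \<in> word_ball G S r ==> x \<in> carrier G"
 unfolding word_ball_iff using wd_closed letters_carrier by blast

lemma RF_ge_1: "RF G S r \<ge> 1"
proof (cases "word_ball G S r - {\<one>} = {}")
 case True then show ?thesis by (simp add: RF_def)
next
 case False
 then obtain x where x: "x \<in> word_ball G S r" "x \<noteq> \<one>" by blast
 have "divisibility G x \<ge> 1" using divisibility_attained[OF word_ball_carrier[OF x(1)] x(2)] by blast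
 then show ?thesis using RF_ge[OF x] by linarith
qed

lemma RF_le:
 assumes "1 \<le> B" "\<And>x. x \<in> word_ball G S r ==> x \<noteq> \<one> ==> real (divisibility G x) \<le> B"
 shows "RF G S r \<le> B"
proof (cases "word_ball G S r - {\<one>} = {}")
 case True then show ?thesis using assms(1) by (simp add: RF_def)
next
 case False
 have "Max (divisibility G ` (word_ball G S r - {\<one>})) \<in> divisibility G ` (word_ball G S r - {\<one>})"
  using False finite_word_ball by (intro Max_in) auto
 then show ?thesis using False assms(2) unfolding RF_def by auto
qed

lemma growth_upper: "growth_le (RF G S) (%r. ln r ^ rdim)"
proof -
 obtain B D where B: "B > 0" and D: "D \<ge> 1" and up: "\<And>w r. set w \<subseteq> letters ==> wd w \<noteq> \<one> ==> r \<ge> 1 ==> real (length w) \<le> r ==>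
  (\<exists>N\<in>fin_index_normal G. wd w \<notin> N \<and> real (card (rcosets N)) \<le> B * (ln (D * r)) ^ rdim) \<and> 1 \<le> B * (ln (D * r)) ^ rdim"
  using upper_index by blast
 \<comment> \<open>The factor 3 gives \<open>C * r \<ge> 3\<close>, so the logarithm is at least 1
   and the bound also covers the value 1 that \<open>RF\<close> has on a ball containing only the
   identity.\<close>
 define C where "C = max (max B 1) (3 * D)"
 have C: "C \<ge> B" "C \<ge> 1" "C \<ge> 3 * D" "C > 0" by (auto simp: C_def)
 have "RF G S r \<le> C * ln (C * r) ^ rdim" if r: "r \<ge> 1" for r
 proof (rule RF_le)
  have Dr: "D * r \<ge> 1" using mult_mono[of 1 D 1 r] D r by simp
  have CDr: "3 * (D * r) \<le> C * r" using C(3) r mult_right_mono[of "3 * D" C r] by (simp add: mult.assoc)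
  have le: "B * (ln (D * r)) ^ rdim \<le> C * ln (C * r) ^ rdim"
  proof (rule mult_mono)
   have "ln (D * r) \<le> ln (C * r)" by (intro ln_mono) (use CDr Dr in linarith)+
   then show "ln (D * r) ^ rdim \<le> ln (C * r) ^ rdim" using Dr by (intro power_mono) simp_all
   show "0 \<le> ln (D * r) ^ rdim" using Dr by simp
  qed (use C B in auto)
  have "exp 1 \<le> C * r" using exp_le CDr Dr by linarith
  then have "1 \<le> ln (C * r)" using CDr Dr by (subst ln_ge_iff) linarith+
  then show "1 \<le> C * ln (C * r) ^ rdim"
   using C(2) one_le_power[of "ln (C * r)" rdim] mult_mono[of 1 C 1 "ln (C * r) ^ rdim"] by simp
  fix x assume x: "x \<in> word_ball G S r" "x \<noteq> \<one>"
  then obtain w where w: "x = wd w" "set w \<subseteq> letters" "real (length w) \<le> r" unfolding word_ball_iff by blast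
  then obtain N where N: "N \<in> fin_index_normal G" "wd w \<notin> N" "real (card (rcosets N)) \<le> B * (ln (D * r)) ^ rdim"
   using up[OF w(2) _ r w(3)] x(2) by blast
  have "divisibility G x \<le> card (rcosets N)" using divisibility_le[OF N(1)] N(2) w(1) by simp
  then show "real (divisibility G x) \<le> C * ln (C * r) ^ rdim" using N(3) le by linarith
 qed
 then show ?thesis unfolding growth_le_def using C(4) by (intro exI[of _ C]) simp
qed

lemma growth_lower: "growth_le (%r. ln r ^ rdim) (RF G S)"
proof (cases "m = 0")
 \<comment> \<open>A chart of dimension 0 means that \<open>G\<close> is finite; the exponent is
   then 0, and \<open>RF\<close> is at least 1.\<close>
 case True
 have "rdim = 0" unfolding rdim_def by (rule Least_equality) (use Sz_top True in simp_all)
 then show ?thesis unfolding growth_le_def using RF_ge_1 by (intro exI[of _ 1]) simp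
next
 case False
 then have m: "m > 0" by simp
 obtain g B where g: "g \<in> vecs m" "g \<noteq> 0" and B: "B > 0"
  and low: "\<And>N n. N \<in> fin_index_normal G ==> E (of_int (Lcm {1..int n}) * g) \<notin> N ==> (real n / B) ^ rdim \<le> real (card (rcosets N))"
  by (rule lower_index[OF m]) blast
 obtain u where u: "set u \<subseteq> letters" "wd u = E g" using word_exists[OF E_carrier] by blast
 \<comment> \<open>The second entry accommodates the length of the word built below, the third the
   constant lost in passing from \<open>ln r\<close> to \<open>n / B\<close>.\<close>
 define C where "C = max (max 1 (real (length u) * exp 4)) ((4 * B) ^ rdim)"
 have C: "C \<ge> 1" "C \<ge> real (length u) * exp 4" "C \<ge> (4 * B) ^ rdim" "C > 0" by (auto simp: C_def)
 have "ln r ^ rdim \<le> C * RF G S (C * r)" if r: "r \<ge> 1" for r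
 proof -
  \<comment> \<open>Chosen so that \<open>ln r \<le> 4 * n \<le> ln r + 4\<close>. The logarithm of
    \<open>lcm(1..n)\<close> is at most \<open>4 * n\<close>, so this multiple is at most
    \<open>r * exp 4\<close>, and the corresponding power of \<open>E g\<close> has word length
    \<open>O(r)\<close>.\<close>
  define n where "n = nat \<lfloor>ln r / 4\<rfloor> + 1"
  have lr: "ln r \<ge> 0" using r by simp
  then have nr: "real n = of_int \<lfloor>ln r / 4\<rfloor> + 1" by (simp add: n_def)
  have "ln r / 4 \<le> real n" using real_of_int_floor_add_one_gt[of "ln r / 4"] by (simp only: nr less_imp_le)
  then have n: "ln r \<le> 4 * real n" by simp
  have "real n \<le> ln r / 4 + 1" unfolding nr by (rule add_right_mono[OF of_int_floor_le])
  then have n': "4 * real n \<le> ln r + 4" by simp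
  define l where "l = nat (Lcm {1..int n})"
  have L0: "Lcm {1..int n} > 0" using Lcm_0_iff[of "{1..int n}"] by (simp add: order_less_le)
  then have l: "int l = Lcm {1..int n}" "l > 0" by (simp_all add: l_def)
  have "ln (real l) \<le> ln r + 4" using Lcm_bound[of n] n' l(1) by (metis of_int_of_nat_eq order_trans)
  then have "exp (ln (real l)) \<le> exp (ln r + 4)" by simp
  then have lr4: "real l \<le> r * exp 4" using l(2) r by (simp add: exp_add)
  define x where "x = E (of_int (Lcm {1..int n}) * g)"
  have xpow: "x = E g [^] l" unfolding x_def l(1)[symmetric] by (rule E_scale)
  have x1: "x \<noteq> \<one>"
  proof
   assume "x = \<one>"
   then have z: "of_int (Lcm {1..int n}) * g = 0" unfolding x_def by (rule E_one[OF subgrp_scale[OF subgrp_vecs g(1)]])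
   have "g i = 0" for i
    using fun_cong[OF z, of i] L0 unfolding vecs_scale by (simp add: zero_fun_def)
   then show False using g(2) by (simp add: fun_eq_iff zero_fun_def)
  qed
  define w where "w = concat (replicate l u)"
  have sw: "set w \<subseteq> letters" unfolding w_def using u(1) by (auto split: if_splits)
  have "wd w = x" unfolding w_def xpow u(2)[symmetric] by (rule wd_power) (use u(1) letters_carrier in blast)
  moreover have "real (length w) \<le> C * r"
  proof -
   have "length w = l * length u" by (simp add: w_def length_concat sum_list_replicate)
   then have "real (length w) = real l * real (length u)" by simp
   moreover have "real l * real (length u) \<le> (r * exp 4) * real (length u)" using lr4 by (intro mult_right_mono) simp_all
   moreover have "(real (length u) * exp 4) * r \<le> C * r" using C(2) r by (intro mult_right_mono) simp_all
   ultimately show ?thesis by (simp add: mult_ac)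
  qed
  ultimately have xb: "x \<in> word_ball G S (C * r)" unfolding word_ball_iff using sw by blast
  obtain N where N: "N \<in> fin_index_normal G" "x \<notin> N" "divisibility G x = card (rcosets N)"
   using divisibility_attained[OF word_ball_carrier[OF xb] x1] by blast
  have "ln r ^ rdim \<le> (4 * real n) ^ rdim" using n lr by (intro power_mono)
  moreover have "(4 * real n) ^ rdim = (4 * B) ^ rdim * (real n / B) ^ rdim" by (subst power_mult_distrib[symmetric]) (use B in simp)
  moreover have "(4 * B) ^ rdim * (real n / B) ^ rdim \<le> C * RF G S (C * r)"
  proof (rule mult_mono[OF C(3)])
   have "(real n / B) ^ rdim \<le> real (divisibility G x)" using low[OF N(1)] N(2,3) by (simp add: x_def)
   then show "(real n / B) ^ rdim \<le> RF G S (C * r)" using RF_ge[OF xb x1] by linarith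
  qed (use C B in auto)
  ultimately show ?thesis by linarith
 qed
 then show ?thesis unfolding growth_le_def using C(4) by (intro exI[of _ C]) simp
qed

lemma growth_log: "\<exists>k. growth_eq (RF G S) (%r. ln r ^ k)"
 unfolding growth_eq_def using growth_upper growth_lower by blast

end

end

theorem theorem1p1:
  fixes G (structure)
  assumes "group G"
    and "finitely_generated G"
    and "virtually_abelian G"
  shows "\<exists>k::nat. RF_equals G (\<lambda>r. (ln r) ^ k)"
proof -
 interpret group G by fact
 obtain S where S: "finite S" "S \<subseteq> carrier G" "generate G S = carrier G"
  using assms(2) unfolding finitely_generated_def generates_def by blast
 obtain A where A: "A \<lhd> G" "finite (rcosets A)" "comm_group (G\<lparr>carrier := A\<rparr>)"
  using assms(3) unfolding virtually_abelian_def fin_index_normal_def by blast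
 have "virt_abelian_axioms G A S"
 proof (rule virt_abelian_axioms.intro)
  fix a b assume "a \<in> A" "b \<in> A"
  then show "a \<otimes> b = b \<otimes> a"
   using comm_monoid.m_comm[OF comm_group.axioms(1)[OF A(3)], of a b] by simp
 qed (fact S A)+
 then interpret virt_abelian G A S by (rule virt_abelian.intro[OF assms(1)])
 obtain m E K where "lattice_chart m E K" using lattice_chart_exists by blast
 then obtain k where "growth_eq (RF G S) (%r. ln r ^ k)" using growth_log by blast
 then show ?thesis unfolding RF_equals_def generates_def using S by blast
qed

end
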